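(* Let $S$ be a finite hyperbolic non-compact Riemann surface and $\rho:\pi_1(S,z_0)\to GL(2,\mathbb C)$ an injective representation onto a Schottky group. Then there are sections $s^+$ and $s^-$ of largest expansion and of largest contraction, respectively, for the foliated geodesic flow of the associated bundle, which are defined and continuous on a subset of $T^1S$ of full Liouville measure.
   Context: A finite hyperbolic Riemann surface is a Riemann surface conformally equivalent to $\bar S\setminus\{p_1,\dots,p_r\}$ with $\bar S$ compact of genus $g$, where $g>1$, or $g=1,r\ge1$, or $g=0,r\ge3$; it carries the complete hyperbolic metric induced from $\mathbb H^+$, $T^1S$ its unit tangent bundle, $\varphi$ the geodesic flow and $dLiouv$ the normalized Liouville measure. A Schottky group of rank $m$ is a group $\Gamma$ of Möbius transformations of $\mathbb CP^1$ (elements of $PSL(2,\mathbb C)$) having $2m$ disjoint circles $C_1,C_1',\dots,C_m,C_m'$ bounding a domain $D\subset\mathbb CP^1$ and a generating system $g_1,\dots,g_m$ with $g_i(C_i')=C_i$ and $g_i(D)\cap D=\emptyset$. $E_\rho\to S$ is the flat bundle $(\mathbb H^+\times\mathbb C^2)/\pi_1(S,z_0)$ with $\gamma\cdot(z,w)=(\rho_{can}(\gamma)z,\rho(\gamma)w)$, $\rho_{can}$ the deck group action; $E=q^*E_\rho\to T^1S$ with $q:T^1S\to S$; the foliated geodesic flow $\tilde\Phi$ on $E$ sends $w\in E_v$ to its flat parallel transport $\tilde\Phi(w,t)\in E_{\varphi(v,t)}$ along the geodesic $s\mapsto\varphi(v,s)$. Fix a continuous Hermitian metric $|\cdot|$ on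 $E_\rho$ (pulled back to $E$). Section of largest expansion: a $\varphi$-invariant set $\mathcal A\subset T^1S$ of full Liouville measure and a measurable $\tilde\Phi$-invariant splitting $E_v=F_v\oplus G_v$ ($v\in\mathcal A$) with $\dim F_v=1$ such that for every $v\in\mathcal A$, compact $K\subset T^1S$ and sequence $t_n\to+\infty$ with $\varphi(v,t_n)\in K$, $|\tilde\Phi(w_1,t_n)|/|\tilde\Phi(w_2,t_n)|\to\infty$ for all nonzero $w_1\in F_v,w_2\in G_v$; the section is $v\mapsto[F_v]\in Proj(E_v)$. Section of largest contraction: the same with $t_n\to-\infty$. *)

theory Defs
  imports "HOL-Analysis.Analysis"
begin

definition H_plane :: "complex set" where
  "H_plane = {z. Im z > 0}"

text \<open>Unit tangent bundle of the upper half plane: a point z with a tangent vector u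
  of hyperbolic length 1, i.e. Euclidean length Im z.\<close>
definition T1H :: "(complex \<times> complex) set" where
  "T1H = {(z, u). Im z > 0 \<and> cmod u = Im z}"

definition SL2R :: "(real^2^2) set" where
  "SL2R = {g. det g = 1}"

definition mobR :: "real^2^2 \<Rightarrow> complex \<Rightarrow> complex" where
  "mobR g z = (complex_of_real (g$1$1) * z + complex_of_real (g$1$2)) /
              (complex_of_real (g$2$1) * z + complex_of_real (g$2$2))"

text \<open>Action of SL(2,R) on T1H by the derivative of the Moebius map.\<close>
definition actT :: "real^2^2 \<Rightarrow> complex \<times> complex \<Rightarrow> complex \<times> complex" where
  "actT g v = (mobR g (fst v),
               snd v / (complex_of_real (g$2$1) * fst v + complex_of_real (g$2$2))^2)"

text \<open>Geodesic flow on T1H: the unit vector (i, i) flows along the imaginary axis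
  to (i e^t, i e^t); all other orbits are obtained by isometries.\<close>
definition geoflow :: "complex \<times> complex \<Rightarrow> real \<Rightarrow> complex \<times> complex" where
  "geoflow v t = actT (SOME g. g \<in> SL2R \<and> actT g (\<i>, \<i>) = v)
                      (complex_of_real (exp t) * \<i>, complex_of_real (exp t) * \<i>)"

text \<open>Deck group of a finite hyperbolic Riemann surface S = H / \<Gamma>: a subgroup of SL(2,R)
  (a lift of the Fuchsian group), discrete, acting freely on H, of finite covolume.\<close>
definition finite_hyperbolic_group :: "(real^2^2) set \<Rightarrow> bool" where
  "finite_hyperbolic_group \<Gamma> \<longleftrightarrow>
     \<Gamma> \<subseteq> SL2R \<and> mat 1 \<in> \<Gamma> \<and>
     (\<forall>g\<in>\<Gamma>. \<forall>h\<in>\<Gamma>. g ** h \<in> \<Gamma>) \<and>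
     (\<forall>g\<in>\<Gamma>. \<exists>h\<in>\<Gamma>. g ** h = mat 1) \<and>
     (\<exists>\<epsilon>>0. \<forall>g\<in>\<Gamma>. g \<noteq> mat 1 \<longrightarrow> \<epsilon> \<le> norm (g - mat 1)) \<and>
     (\<forall>g\<in>\<Gamma>. g \<noteq> mat 1 \<longrightarrow> (\<forall>z\<in>H_plane. mobR g z \<noteq> z)) \<and>
     (\<exists>D \<in> sets (lborel :: complex measure). D \<subseteq> H_plane \<and>
        (\<Union>g\<in>\<Gamma>. mobR g ` D) = H_plane \<and>
        set_nn_integral lborel D (\<lambda>z. ennreal (1 / (Im z)^2)) < \<infinity>)"

definition cocompact :: "(real^2^2) set \<Rightarrow> bool" where
  "cocompact \<Gamma> \<longleftrightarrow> (\<exists>K. compact K \<and> K \<subseteq> H_plane \<and> (\<Union>g\<in>\<Gamma>. mobR g ` K) = H_plane)"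

definition coordT :: "real \<times> real \<times> real \<Rightarrow> complex \<times> complex" where
  "coordT p = (case p of (x, y, \<theta>) \<Rightarrow> (Complex x y, complex_of_real y * cis \<theta>))"

text \<open>A (\<Gamma>-invariant) subset A of T1H has full Liouville measure iff its complement is a
  null set of the measure dx dy d\<theta> / y^2, i.e. a Lebesgue null set in coordinates.\<close>
definition liouville_full :: "(complex \<times> complex) set \<Rightarrow> bool" where
  "liouville_full A \<longleftrightarrow>
     (\<exists>N \<in> null_sets (lborel :: (real \<times> real \<times> real) measure).
        {p. fst (snd p) > 0 \<and> coordT p \<notin> A} \<subseteq> N)"

definition representation :: "(real^2^2) set \<Rightarrow> (real^2^2 \<Rightarrow> complex^2^2) \<Rightarrow> bool" where
  "representation \<Gamma> \<rho> \<longleftrightarrow>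
     (\<forall>g\<in>\<Gamma>. invertible (\<rho> g)) \<and> (\<forall>g\<in>\<Gamma>. \<forall>h\<in>\<Gamma>. \<rho> (g ** h) = \<rho> g ** \<rho> h)"

text \<open>CP^1 as complex option (None = \<infinity>) and Moebius action.\<close>
definition moebC :: "complex^2^2 \<Rightarrow> complex option \<Rightarrow> complex option" where
  "moebC A p = (case p of
       None \<Rightarrow> (if A$2$1 = 0 then None else Some (A$1$1 / A$2$1))
     | Some z \<Rightarrow> (if A$2$1 * z + A$2$2 = 0 then None
                  else Some ((A$1$1 * z + A$1$2) / (A$2$1 * z + A$2$2))))"

text \<open>Generalised circles/discs on CP^1 with parameters (a,b,c), a,c real, b complex,
  |b|^2 > a c: the circle a|z|^2 + 2 Re(conj b z) + c = 0 and the closed disc where \<le> 0.\<close>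
definition gpar_ok :: "real \<times> complex \<times> real \<Rightarrow> bool" where
  "gpar_ok P = (case P of (a, b, c) \<Rightarrow> (cmod b)^2 > a * c)"

definition gcircle :: "real \<times> complex \<times> real \<Rightarrow> complex option set" where
  "gcircle P = (case P of (a, b, c) \<Rightarrow>
     Some ` {z. a * (cmod z)^2 + 2 * Re (cnj b * z) + c = 0} \<union> (if a = 0 then {None} else {}))"

definition gdisc :: "real \<times> complex \<times> real \<Rightarrow> complex option set" where
  "gdisc P = (case P of (a, b, c) \<Rightarrow>
     Some ` {z. a * (cmod z)^2 + 2 * Re (cnj b * z) + c \<le> 0} \<union> (if a \<le> 0 then {None} else {}))"

inductive_set gen_group :: "('a \<Rightarrow> 'a) set \<Rightarrow> ('a \<Rightarrow> 'a) set" for F where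
  gen_id: "id \<in> gen_group F"
| gen_l: "f \<in> F \<Longrightarrow> h \<in> gen_group F \<Longrightarrow> f \<circ> h \<in> gen_group F"
| gen_linv: "f \<in> F \<Longrightarrow> h \<in> gen_group F \<Longrightarrow> inv f \<circ> h \<in> gen_group F"

text \<open>A group G of (matrices representing) Moebius transformations is Schottky of rank m:
  2m pairwise disjoint closed discs (sides of the circles C_i, C_i' not containing D),
  D the complement of their union, generators g_i with g_i(C_i') = C_i, g_i(D) \<inter> D = {},
  generating the group of Moebius transformations induced by G.\<close>
definition schottky :: "(complex^2^2) set \<Rightarrow> bool" where
  "schottky G \<longleftrightarrow> (\<forall>A\<in>G. invertible A) \<and>
    (\<exists>(m::nat) (gs :: nat \<Rightarrow> complex^2^2) (P :: nat \<Rightarrow> real \<times> complex \<times> real)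
        (P' :: nat \<Rightarrow> real \<times> complex \<times> real).
       (\<forall>i<m. gs i \<in> G \<and> gpar_ok (P i) \<and> gpar_ok (P' i)) \<and>
       (\<forall>i<m. \<forall>j<m. gdisc (P i) \<inter> gdisc (P' j) = {} \<and>
          (i \<noteq> j \<longrightarrow> gdisc (P i) \<inter> gdisc (P j) = {} \<and> gdisc (P' i) \<inter> gdisc (P' j) = {})) \<and>
       (let D = UNIV - (\<Union>i<m. gdisc (P i) \<union> gdisc (P' i)) in
          \<forall>i<m. moebC (gs i) ` gcircle (P' i) = gcircle (P i) \<and>
                moebC (gs i) ` D \<inter> D = {}) \<and>
       moebC ` G = gen_group ((\<lambda>i. moebC (gs i)) ` {..<m}))"

definition hnorm :: "complex^2^2 \<Rightarrow> complex^2 \<Rightarrow> real" where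
  "hnorm M w = sqrt (Re (\<Sum>i\<in>UNIV. \<Sum>j\<in>UNIV. cnj (w$i) * M$i$j * w$j))"

text \<open>A continuous Hermitian metric on E_rho, lifted to H x C^2: a continuous family of
  positive definite Hermitian matrices, equivariant under (z,w) \<mapsto> (\<gamma> z, \<rho>(\<gamma>) w).\<close>
definition hermitian_metric ::
  "(real^2^2) set \<Rightarrow> (real^2^2 \<Rightarrow> complex^2^2) \<Rightarrow> (complex \<Rightarrow> complex^2^2) \<Rightarrow> bool" where
  "hermitian_metric \<Gamma> \<rho> Hf \<longleftrightarrow>
     continuous_on H_plane Hf \<and>
     (\<forall>z\<in>H_plane. (\<forall>i j. Hf z $ i $ j = cnj (Hf z $ j $ i)) \<and>
        (\<forall>w. w \<noteq> 0 \<longrightarrow> Re (\<Sum>i\<in>UNIV. \<Sum>j\<in>UNIV. cnj (w$i) * Hf z $i$j * w$j) > 0)) \<and>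
     (\<forall>g\<in>\<Gamma>. \<forall>z\<in>H_plane. \<forall>w. hnorm (Hf (mobR g z)) (\<rho> g *v w) = hnorm (Hf z) w)"

definition cline :: "complex^2 \<Rightarrow> (complex^2) set" where
  "cline w = range (\<lambda>c::complex. c *s w)"

text \<open>Section of largest expansion (F = at_top) / contraction (F = at_bot), lifted to the
  universal cover T1H: A is the lift of the full-measure \<phi>-invariant set, the lines
  F_v = cline (f v), G_v = cline (g v) form a measurable, flow-invariant (flat transport is
  trivial on the cover), \<rho>-equivariant splitting, and compact sets of T^1S are images of
  compact subsets of T1H.\<close>
definition largest_section ::
  "(real^2^2) set \<Rightarrow> (real^2^2 \<Rightarrow> complex^2^2) \<Rightarrow> (complex \<Rightarrow> complex^2^2) \<Rightarrow>
   (complex \<times> complex) set \<Rightarrow> (complex \<times> complex \<Rightarrow> complex^2) \<Rightarrow>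
   (complex \<times> complex \<Rightarrow> complex^2) \<Rightarrow> real filter \<Rightarrow> bool" where
  "largest_section \<Gamma> \<rho> Hf A f g F \<longleftrightarrow>
     A \<subseteq> T1H \<and> liouville_full A \<and>
     (\<forall>v\<in>A. \<forall>t. geoflow v t \<in> A) \<and>
     (\<forall>\<gamma>\<in>\<Gamma>. \<forall>v\<in>T1H. actT \<gamma> v \<in> A \<longleftrightarrow> v \<in> A) \<and>
     (\<forall>v\<in>A. f v \<noteq> 0 \<and> g v \<noteq> 0 \<and> cline (f v) \<inter> cline (g v) = {0}) \<and>
     (\<lambda>p. f (coordT p)) \<in> borel_measurable (lebesgue :: (real \<times> real \<times> real) measure) \<and>
     (\<lambda>p. g (coordT p)) \<in> borel_measurable (lebesgue :: (real \<times> real \<times> real) measure) \<and>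
     (\<forall>v\<in>A. \<forall>t. cline (f (geoflow v t)) = cline (f v) \<and> cline (g (geoflow v t)) = cline (g v)) \<and>
     (\<forall>\<gamma>\<in>\<Gamma>. \<forall>v\<in>A. cline (f (actT \<gamma> v)) = (\<lambda>w. \<rho> \<gamma> *v w) ` cline (f v) \<and>
                     cline (g (actT \<gamma> v)) = (\<lambda>w. \<rho> \<gamma> *v w) ` cline (g v)) \<and>
     (\<forall>v\<in>A. \<forall>K. compact K \<and> K \<subseteq> T1H \<longrightarrow>
        (\<forall>t :: nat \<Rightarrow> real. filterlim t F sequentially \<and>
             (\<forall>n. \<exists>\<gamma>\<in>\<Gamma>. actT \<gamma> (geoflow v (t n)) \<in> K) \<longrightarrow>
           (\<forall>w1 \<in> cline (f v) - {0}. \<forall>w2 \<in> cline (g v) - {0}.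
              filterlim (\<lambda>n. hnorm (Hf (fst (geoflow v (t n)))) w1 /
                             hnorm (Hf (fst (geoflow v (t n)))) w2) at_top sequentially)))"

text \<open>Continuity on A of v \<mapsto> [F_v] in CP^1 (locally given by a continuous nonvanishing
  spanning vector field).\<close>
definition section_continuous ::
  "(complex \<times> complex) set \<Rightarrow> (complex \<times> complex \<Rightarrow> complex^2) \<Rightarrow> bool" where
  "section_continuous A f \<longleftrightarrow>
     (\<forall>v0\<in>A. \<exists>U. open U \<and> v0 \<in> U \<and>
        (\<exists>h. continuous_on (A \<inter> U) h \<and> (\<forall>v\<in>A \<inter> U. h v \<noteq> 0 \<and> cline (h v) = cline (f v))))"

end

theory Submission imports Defs begin

text \<open>The Schottky discs turn \<open>\<Gamma>\<close> into a free group acting by ping-pong, so every infinite reduced word determines a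
  line in \<open>\<complex>\<^sup>2\<close> that is exponentially contracted by the inverses of its prefixes. Finite area gives a cover of the
  plane by translates of finitely many horoballs and compact pieces, by Zassenhaus' commutator argument. The half
  planes shrinking to an end of a geodesic that is not a cusp meet only translates whose reduced words agree on
  longer and longer prefixes; hence almost every geodesic has a word at either end. The lines of these two words
  are the splitting. They depend continuously on the geodesic because finitely many letters are read off from a
  half plane. When the geodesic returns to a compact set, the element that brings it back is a long prefix of the
  word of the end, up to a bounded error, since otherwise the geodesic would visit far-away cusps of one and the
  same translate before and after the return; this gives the expansion.\<close>

section \<open>The hyperbolic plane\<close>

text \<open>Flow time does not control growth here: a deep excursion into a cusp multiplies the
  group element by a high power of a parabolic, whose reduced word may be arbitrarily long.
  Everything is therefore phrased through words instead of rates in time, and norms are compared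
  only when the geodesic is back in a compact set.

  A second obstacle is the infinite stabiliser of a horoball. A point of it lies in the translates
  by all powers of the parabolic, so infinitely many elements are seen from one point. Only data
  unchanged by a single step between overlapping pieces can be read off. The first letters of a long
  word are such data, and the finitely many short words are the exceptions; a set is useful once it
  avoids the pieces that belong to them. Half planes serve as neighbourhoods of an end because they
  are connected and vary well with the geodesic.

  No ergodic theorem enters. The exceptional geodesics are those with an end in a cusp, and there
  are countably many cusps, so a countable union of explicit null sets is discarded.\<close>

lemma mult2: "((A::'a::semiring_1^2^2) ** B)$i$j = A$i$1*B$1$j + A$i$2*B$2$j"
  by (simp add: matrix_matrix_mult_def sum_2)

lemma mulv2: "((A::'a::semiring_1^2^2) *v w)$i = A$i$1*w$1 + A$i$2*w$2"
  by (simp add: matrix_vector_mult_def sum_2)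

lemma mat1_2 [simp]: "(mat 1::'a::semiring_1^2^2)$1$1 = 1" "(mat 1::'a::semiring_1^2^2)$1$2 = 0"
  "(mat 1::'a::semiring_1^2^2)$2$1 = 0" "(mat 1::'a::semiring_1^2^2)$2$2 = 1"
  by (simp_all add: mat_def)

lemma mat2_eq: "(A::'a^2^2) = B \<longleftrightarrow> A$1$1=B$1$1 \<and> A$1$2=B$1$2 \<and> A$2$1=B$2$1 \<and> A$2$2=B$2$2"
  by (auto simp: vec_eq_iff forall_2)

lemma vec2_eq: "(v::'a^2) = w \<longleftrightarrow> v$1=w$1 \<and> v$2=w$2"
  by (auto simp: vec_eq_iff forall_2)

definition mk2 :: "'a::zero \<Rightarrow> 'a \<Rightarrow> 'a \<Rightarrow> 'a \<Rightarrow> 'a^2^2" where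
  "mk2 a b c d = vector [vector [a,b], vector [c,d]]"

lemma mk2_sel [simp]: "mk2 a b c d $1$1 = a" "mk2 a b c d $1$2 = b" "mk2 a b c d $2$1 = c" "mk2 a b c d $2$2 = d"
  by (simp_all add: mk2_def)

text \<open>On \<open>SL2R\<close> this is the inverse. The polynomial form reverses products and
  keeps the norm without any condition on the determinant.\<close>

definition adj2 :: "'a::ab_group_add^2^2 \<Rightarrow> 'a^2^2" where
  "adj2 g = mk2 (g$2$2) (- (g$1$2)) (- (g$2$1)) (g$1$1)"

lemma adj2_sel [simp]: "adj2 g $1$1 = g$2$2" "adj2 g $1$2 = - (g$1$2)" "adj2 g $2$1 = - (g$2$1)" "adj2 g $2$2 = g$1$1"
  by (simp_all add: adj2_def)

lemma SL2R_iff: "g \<in> SL2R \<longleftrightarrow> g$1$1 * g$2$2 - g$1$2 * g$2$1 = 1"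
  by (simp add: SL2R_def det_2)

lemma SL2R_mult: "g \<in> SL2R \<Longrightarrow> h \<in> SL2R \<Longrightarrow> g ** h \<in> SL2R"
  by (simp add: SL2R_def det_mul)

lemma SL2R_adj: "g \<in> SL2R \<Longrightarrow> adj2 g \<in> SL2R"
  by (simp add: SL2R_iff mult.commute)

lemma adj2_left: "g \<in> SL2R \<Longrightarrow> adj2 g ** g = mat 1"
  by (simp add: SL2R_iff mat2_eq mult2 algebra_simps)

lemma adj2_right: "g \<in> SL2R \<Longrightarrow> g ** adj2 g = mat 1"
  by (simp add: SL2R_iff mat2_eq mult2 algebra_simps)

lemma adj2_adj2 [simp]: "adj2 (adj2 g) = g" by (simp add: mat2_eq)

lemma adj2_mult: "adj2 (g ** h) = adj2 h ** adj2 (g::real^2^2)"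
  by (simp add: mat2_eq mult2 algebra_simps)

lemma adj2_one [simp]: "adj2 (mat 1 :: real^2^2) = mat 1"
  by (simp add: mat2_eq)

lemma norm_2x2_sq: "(norm (A::real^2^2))\<^sup>2 = (A$1$1)\<^sup>2 + (A$1$2)\<^sup>2 + (A$2$1)\<^sup>2 + (A$2$2)\<^sup>2"
  by (simp add: norm_vec_def L2_set_def sum_2)

lemma normv2_sq: "(norm (v::real^2))\<^sup>2 = (v$1)\<^sup>2 + (v$2)\<^sup>2"
  by (simp add: norm_vec_def L2_set_def sum_2)

lemma cauchy2: "((a::real)*x + b*y)\<^sup>2 \<le> (a\<^sup>2+b\<^sup>2)*(x\<^sup>2+y\<^sup>2)"
proof -
  have "(a\<^sup>2+b\<^sup>2)*(x\<^sup>2+y\<^sup>2) - (a*x+b*y)\<^sup>2 = (a*y - b*x)\<^sup>2" by (simp add: power2_eq_square algebra_simps)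
  then show ?thesis by (metis diff_ge_0_iff_ge zero_le_power2)
qed

lemma norm_mult2: "norm ((A::real^2^2) ** (B::real^2^2)) \<le> norm A * norm B"
proof -
  have "(norm (A ** B))\<^sup>2 \<le> (norm A * norm B)\<^sup>2"
    unfolding power_mult_distrib norm_2x2_sq mult2
    using cauchy2[of "A$1$1" "B$1$1" "A$1$2" "B$2$1"] cauchy2[of "A$1$1" "B$1$2" "A$1$2" "B$2$2"]
      cauchy2[of "A$2$1" "B$1$1" "A$2$2" "B$2$1"] cauchy2[of "A$2$1" "B$1$2" "A$2$2" "B$2$2"]
    by (simp add: algebra_simps)
  then show ?thesis by (rule power2_le_imp_le) simp
qed

lemma norm_adj2 [simp]: "norm (adj2 (A::real^2^2)) = norm A"
proof -
  have "(norm (adj2 A))\<^sup>2 = (norm A)\<^sup>2" by (simp add: norm_2x2_sq)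
  then show ?thesis by simp
qed

section \<open>Moebius maps, automorphy factors and the base point\<close>

definition den :: "real^2^2 \<Rightarrow> complex \<Rightarrow> complex" where
  "den g z = complex_of_real (g$2$1) * z + complex_of_real (g$2$2)"
definition num :: "real^2^2 \<Rightarrow> complex \<Rightarrow> complex" where
  "num g z = complex_of_real (g$1$1) * z + complex_of_real (g$1$2)"

lemma mobR_nd: "mobR g z = num g z / den g z"
  by (simp add: mobR_def num_def den_def)

lemma den_nonzero: assumes "g \<in> SL2R" "Im z > 0" shows "den g z \<noteq> 0"
proof
  assume "den g z = 0"
  then have "g$2$1 * Im z = 0" "g$2$1 * Re z + g$2$2 = 0"
    by (auto simp: den_def complex_eq_iff)
  then have "g$2$1 = 0" "g$2$2 = 0" using assms(2) by auto
  then show False using assms(1) by (simp add: SL2R_iff)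
qed

lemma of_real_det: assumes "g \<in> SL2R"
  shows "complex_of_real (g$1$1) * complex_of_real (g$2$2) - complex_of_real (g$1$2) * complex_of_real (g$2$1) = 1"
  using assms by (simp add: SL2R_iff flip: of_real_mult of_real_diff)

lemma Im_mobR: assumes "g \<in> SL2R"
  shows "Im (mobR g z) = Im z / (cmod (den g z))\<^sup>2"
proof -
  have "mobR g z = num g z * cnj (den g z) / of_real ((cmod (den g z))\<^sup>2)"
    unfolding mobR_nd by (subst complex_div_cnj) simp
  then have "Im (mobR g z) = Im (num g z * cnj (den g z)) / (cmod (den g z))\<^sup>2"
    by (simp only: Im_divide_of_real)
  also have "Im (num g z * cnj (den g z)) = (g$1$1 * g$2$2 - g$1$2 * g$2$1) * Im z"
    by (simp add: num_def den_def algebra_simps)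
  finally show ?thesis using assms by (simp add: SL2R_iff)
qed

lemma Im_mobR_pos: "g \<in> SL2R \<Longrightarrow> Im z > 0 \<Longrightarrow> Im (mobR g z) > 0"
  using den_nonzero by (simp add: Im_mobR)

text \<open>The cocycle rule of the automorphy factor, to which the action laws on points and on
  tangent vectors reduce.\<close>

lemma den_mult: assumes "h \<in> SL2R" "Im z > 0"
  shows "den (g ** h) z = den g (mobR h z) * den h z"
  using den_nonzero[OF assms] by (simp add: mobR_nd den_def num_def mult2 field_simps)

lemma num_mult: assumes "h \<in> SL2R" "Im z > 0"
  shows "num (g ** h) z = num g (mobR h z) * den h z"
  using den_nonzero[OF assms] by (simp add: mobR_nd den_def num_def mult2 field_simps)

lemma mobR_mult: assumes "h \<in> SL2R" "Im z > 0"
  shows "mobR (g ** h) z = mobR g (mobR h z)"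
  using den_nonzero[OF assms] by (simp add: mobR_nd[of "g**h"] mobR_nd[of g] den_mult[OF assms] num_mult[OF assms])

lemma mobR_one [simp]: "mobR (mat 1) z = z" by (simp add: mobR_def)

lemma mobR_adj_cancel: "g \<in> SL2R \<Longrightarrow> Im z > 0 \<Longrightarrow> mobR (adj2 g) (mobR g z) = z"
  "g \<in> SL2R \<Longrightarrow> Im z > 0 \<Longrightarrow> mobR g (mobR (adj2 g) z) = z"
  by (metis adj2_left mobR_mult mobR_one) (metis adj2_right SL2R_adj mobR_mult mobR_one)

text \<open>The value is \<open>2 cosh d(i, z)\<close> for the hyperbolic distance \<open>d\<close>.\<close>
definition hb :: "complex \<Rightarrow> real" where "hb z = (1 + (cmod z)\<^sup>2) / Im z"

text \<open>The upper triangular matrix that moves \<open>i\<close> to \<open>z\<close>.\<close>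
definition hm :: "complex \<Rightarrow> real^2^2" where
  "hm z = mk2 (sqrt (Im z)) (Re z / sqrt (Im z)) 0 (1 / sqrt (Im z))"

lemma hm_SL2R: "Im z > 0 \<Longrightarrow> hm z \<in> SL2R" by (simp add: SL2R_iff hm_def)

lemma mobR_hm: assumes "Im z > 0" shows "mobR (hm z) \<i> = z"
proof -
  define s where "s = sqrt (Im z)"
  have s: "s \<noteq> 0" "s * s = Im z" using assms by (auto simp: s_def)
  have "mobR (hm z) \<i> = (of_real s * \<i> + of_real (Re z / s)) / of_real (1 / s)"
    by (simp add: mobR_def hm_def s_def)
  also have "\<dots> = (of_real s * \<i> + of_real (Re z / s)) * of_real s" by simp
  also have "\<dots> = z" using s by (simp add: complex_eq_iff)
  finally show ?thesis .
qed

text \<open>Since \<open>Im (g i) = 1 / |den|^2\<close>, both sides equal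
  \<open>|num|^2 + |den|^2\<close> at \<open>i\<close>. Distances from the base point become
  Euclidean matrix norms, and submultiplicativity takes the place of the triangle inequality of the
  hyperbolic metric.\<close>

lemma norm_sq_hb: assumes "g \<in> SL2R" shows "(norm g)\<^sup>2 = hb (mobR g \<i>)"
proof -
  have i: "Im \<i> > 0" by simp
  have d: "(cmod (den g \<i>))\<^sup>2 = (g$2$1)\<^sup>2 + (g$2$2)\<^sup>2" by (simp add: den_def cmod_power2)
  have n: "(cmod (num g \<i>))\<^sup>2 = (g$1$1)\<^sup>2 + (g$1$2)\<^sup>2" by (simp add: num_def cmod_power2)
  have "(cmod (den g \<i>))\<^sup>2 > 0" using den_nonzero[OF assms i] by simp
  moreover have "(cmod (mobR g \<i>))\<^sup>2 = (cmod (num g \<i>))\<^sup>2 / (cmod (den g \<i>))\<^sup>2"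
    by (simp add: mobR_nd norm_divide power_divide)
  ultimately have "hb (mobR g \<i>) = (cmod (den g \<i>))\<^sup>2 + (cmod (num g \<i>))\<^sup>2"
    unfolding hb_def Im_mobR[OF assms] by (simp add: field_simps)
  then show ?thesis by (simp add: d n norm_2x2_sq)
qed

lemma hb_pos: "Im z > 0 \<Longrightarrow> hb z > 0" by (simp add: hb_def add_pos_nonneg)

lemma hb_mob: assumes "g \<in> SL2R" "Im z > 0" shows "hb (mobR g z) \<le> (norm g)\<^sup>2 * hb z"
proof -
  have h: "hm z \<in> SL2R" using assms hm_SL2R by auto
  have "hb (mobR g z) = (norm (g ** hm z))\<^sup>2"
    using norm_sq_hb[OF SL2R_mult[OF assms(1) h]] mobR_mult[OF h, of \<i> g] mobR_hm[OF assms(2)] by simp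
  also have "\<dots> \<le> (norm g * norm (hm z))\<^sup>2" by (intro power_mono norm_mult2) simp
  also have "\<dots> = (norm g)\<^sup>2 * hb z" using norm_sq_hb[OF h] mobR_hm[OF assms(2)] by (simp add: power_mult_distrib)
  finally show ?thesis .
qed

text \<open>A vector represents a horocycle based at \<open>w$1 / w$2\<close>: \<open>eta w\<close> is small deep inside the horoball, and
  \<open>SL(2,R)\<close> acts compatibly on vectors and points.\<close>
definition eta :: "real^2 \<Rightarrow> complex \<Rightarrow> real" where
  "eta w z = (cmod (of_real (w$1) - of_real (w$2) * z))\<^sup>2 / Im z"

text \<open>The linear form is divided by \<open>den g z\<close> and the imaginary part by its
  squared modulus, so the factors cancel in the quotient.\<close>

lemma eta_equiv: assumes "g \<in> SL2R" "Im z > 0" shows "eta (g *v w) (mobR g z) = eta w z"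
proof -
  have d: "den g z \<noteq> 0" using den_nonzero assms by auto
  have "(of_real ((g *v w)$1) - of_real ((g *v w)$2) * mobR g z) * den g z =
     of_real ((g *v w)$1) * den g z - of_real ((g *v w)$2) * num g z"
    using d by (simp add: mobR_nd field_simps)
  also have "\<dots> = (complex_of_real (g$1$1) * complex_of_real (g$2$2) - complex_of_real (g$1$2) * complex_of_real (g$2$1))
       * (of_real (w$1) - of_real (w$2) * z)"
    by (simp add: mulv2 num_def den_def algebra_simps)
  finally have "(of_real ((g *v w)$1) - of_real ((g *v w)$2) * mobR g z) * den g z = of_real (w$1) - of_real (w$2) * z"
    by (simp add: of_real_det[OF assms(1)])
  then have "cmod (of_real ((g *v w)$1) - of_real ((g *v w)$2) * mobR g z) * cmod (den g z) = cmod (of_real (w$1) - of_real (w$2) * z)"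
    by (metis norm_mult)
  then have "cmod (of_real (w$1) - of_real (w$2) * z)^2 = cmod (of_real ((g *v w)$1) - of_real ((g *v w)$2) * mobR g z)^2 * (cmod (den g z))^2"
    by (metis power_mult_distrib)
  then show ?thesis using d unfolding eta_def Im_mobR[OF assms(1)] by simp
qed

lemma eta_nonneg: "Im z > 0 \<Longrightarrow> eta w z \<ge> 0" by (simp add: eta_def)

text \<open>The second component of \<open>w\<close> is the one that grows with \<open>t\<close>: if
  it is nonzero, the vertical geodesic leaves the horoball for good. This is why \<open>good\<close>
  tests that component.\<close>

lemma eta_geo: "eta w (of_real (exp t) * \<i>) = exp (-t) * (w$1)\<^sup>2 + exp t * (w$2)\<^sup>2"
proof -
  have "(cmod (of_real (w$1) - of_real (w$2) * (of_real (exp t) * \<i>)))\<^sup>2 = (w$1)\<^sup>2 + (w$2 * exp t)\<^sup>2"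
    by (simp add: cmod_power2)
  then show ?thesis by (simp add: eta_def exp_minus field_simps power2_eq_square)
qed

lemma eta_le_hb: assumes "Im z > 0" shows "eta w z \<le> hb z * (norm w)\<^sup>2"
proof -
  have "(cmod (of_real (w$1) - of_real (w$2) * z))\<^sup>2 \<le> (\<bar>w$1\<bar> + \<bar>w$2\<bar> * cmod z)\<^sup>2"
    by (rule power_mono) (use norm_triangle_ineq4[of "of_real (w$1)" "of_real (w$2) * z"] in \<open>simp_all add: norm_mult\<close>)
  also have "\<dots> \<le> (\<bar>w$1\<bar>\<^sup>2 + \<bar>w$2\<bar>\<^sup>2) * (1\<^sup>2 + (cmod z)\<^sup>2)"
    using cauchy2[of "\<bar>w$1\<bar>" 1 "\<bar>w$2\<bar>" "cmod z"] by simp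
  finally have "(cmod (of_real (w$1) - of_real (w$2) * z))\<^sup>2 \<le> (norm w)\<^sup>2 * (1 + (cmod z)\<^sup>2)"
    by (simp add: normv2_sq)
  then show ?thesis using assms by (simp add: eta_def hb_def field_simps)
qed

lemma hb_eta_basis: "hb z = eta (axis 1 1) z + eta (axis 2 1) z"
  by (simp add: hb_def eta_def axis_def add_divide_distrib)

lemma eta_add_le: assumes "Im z > 0" shows "eta (u + v) z \<le> 2 * eta u z + 2 * eta v z"
proof -
  let ?a = "of_real (u$1) - of_real (u$2) * z" and ?b = "of_real (v$1) - of_real (v$2) * z"
  have A: "of_real ((u+v)$1) - of_real ((u+v)$2) * z = ?a + ?b" by (simp add: algebra_simps)
  have B: "(cmod (?a + ?b))\<^sup>2 \<le> 2 * (cmod ?a)\<^sup>2 + 2 * (cmod ?b)\<^sup>2"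
  proof -
    have "(cmod (?a + ?b))\<^sup>2 \<le> (cmod ?a + cmod ?b)\<^sup>2" by (intro power_mono norm_triangle_ineq) simp
    also have "\<dots> \<le> 2 * (cmod ?a)\<^sup>2 + 2 * (cmod ?b)\<^sup>2" 
      using cauchy2[of 1 "cmod ?a" 1 "cmod ?b"] by simp
    finally show ?thesis .
  qed
  have "(cmod (?a + ?b))\<^sup>2 / Im z \<le> (2 * (cmod ?a)\<^sup>2 + 2 * (cmod ?b)\<^sup>2) / Im z"
    using B assms by (intro divide_right_mono) auto
  then show ?thesis unfolding eta_def A by (simp add: add_divide_distrib)
qed

lemma eta_scale: "eta (c *\<^sub>R w) z = c\<^sup>2 * eta w z"
proof -
  have "of_real ((c *\<^sub>R w)$1) - of_real ((c *\<^sub>R w)$2) * z = of_real c * (of_real (w$1) - of_real (w$2) * z)"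
    by (simp add: algebra_simps)
  then show ?thesis by (simp add: eta_def norm_mult power_mult_distrib)
qed

definition wdg :: "real^2 \<Rightarrow> real^2 \<Rightarrow> real" where "wdg u v = u$1 * v$2 - u$2 * v$1"

lemma wdg_SL2R: "g \<in> SL2R \<Longrightarrow> wdg (g *v u) (g *v v) = wdg u v"
proof -
  have "wdg (g *v u) (g *v v) = (g$1$1 * g$2$2 - g$1$2 * g$2$1) * wdg u v"
    by (simp add: wdg_def mulv2 algebra_simps)
  then show "g \<in> SL2R \<Longrightarrow> wdg (g *v u) (g *v v) = wdg u v" by (simp add: SL2R_iff)
qed

text \<open>Horoballs with different centres meet in a bounded region. By Cramer's rule the standard
  basis is a combination of \<open>u\<close> and \<open>v\<close>, and \<open>hb\<close> is the sum
  of the values of \<open>eta\<close> on that basis.\<close>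

lemma hb_le_of_eta: assumes "Im z > 0" "eta u z \<le> C" "eta v z \<le> C" "wdg u v \<noteq> 0"
  shows "hb z \<le> 2 * C * ((norm u)\<^sup>2 + (norm v)\<^sup>2) / (wdg u v)\<^sup>2"
proof -
  let ?d = "wdg u v"
  have e: "eta x z \<le> 2 * a\<^sup>2 * C + 2 * b\<^sup>2 * C" if "x = a *\<^sub>R u + b *\<^sub>R v" for x a b
  proof -
    have "eta x z \<le> 2 * (a\<^sup>2 * eta u z) + 2 * (b\<^sup>2 * eta v z)"
      using eta_add_le[OF assms(1), of "a *\<^sub>R u" "b *\<^sub>R v"] that by (simp add: eta_scale)
    also have "\<dots> \<le> 2 * (a\<^sup>2 * C) + 2 * (b\<^sup>2 * C)"
      using assms by (intro add_mono mult_left_mono) auto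
    finally show ?thesis by simp
  qed
  have a: "(u$1 * v$2 - u$2 * v$1) / ?d = 1" using assms(4) by (simp add: wdg_def)
  have 1: "axis 1 1 = (v$2 / ?d) *\<^sub>R u + (- (u$2) / ?d) *\<^sub>R v"
    using a by (simp add: vec2_eq axis_def diff_divide_distrib mult.commute)
  have 2: "axis 2 1 = (- (v$1) / ?d) *\<^sub>R u + (u$1 / ?d) *\<^sub>R v"
    using a by (simp add: vec2_eq axis_def diff_divide_distrib mult.commute)
  have "hb z \<le> 2 * C * ((v$2/?d)\<^sup>2 + (-(u$2)/?d)\<^sup>2 + (-(v$1)/?d)\<^sup>2 + (u$1/?d)\<^sup>2)"
    unfolding hb_eta_basis using e[OF 1] e[OF 2] by (simp add: algebra_simps)
  also have "\<dots> = 2 * C * ((norm u)\<^sup>2 + (norm v)\<^sup>2) / ?d\<^sup>2"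
    by (simp add: normv2_sq power_divide add_divide_distrib algebra_simps)
  finally show ?thesis .
qed

text \<open>Its zeros are the fixed points of \<open>m\<close>, and its coefficients are the
  traceless part of \<open>m\<close>.\<close>

definition qf :: "real^2^2 \<Rightarrow> complex \<Rightarrow> complex" where
  "qf m z = of_real (m$2$1) * z\<^sup>2 + of_real (m$2$2 - m$1$1) * z - of_real (m$1$2)"

definition tr2 :: "real^2^2 \<Rightarrow> real" where "tr2 m = m$1$1 + m$2$2"

text \<open>Twice the hyperbolic sine of half the displacement of \<open>z\<close> under \<open>m\<close>.\<close>
definition Dsp :: "real^2^2 \<Rightarrow> complex \<Rightarrow> real" where "Dsp m z = cmod (qf m z) / Im z"

text \<open>Distance of \<open>m\<close> from the identity as seen from the base point \<open>z\<close>.\<close>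
definition Nn :: "real^2^2 \<Rightarrow> complex \<Rightarrow> real" where
  "Nn m z = norm (adj2 (hm z) ** m ** hm z - mat 1)"

lemma Dsp_equiv: assumes "g \<in> SL2R" "Im z > 0"
  shows "Dsp (g ** m ** adj2 g) (mobR g z) = Dsp m z"
proof -
  have d: "den g z \<noteq> 0" using den_nonzero assms by auto
  let ?a = "complex_of_real (g$1$1)" and ?b = "complex_of_real (g$1$2)" and ?c = "complex_of_real (g$2$1)" and ?d = "complex_of_real (g$2$2)"
  have D: "?a * ?d - ?b * ?c = 1" by (rule of_real_det[OF assms(1)])
  have "qf (g ** m ** adj2 g) (mobR g z) * (den g z)\<^sup>2 =
     of_real ((g ** m ** adj2 g)$2$1) * (num g z)\<^sup>2 + of_real ((g ** m ** adj2 g)$2$2 - (g ** m ** adj2 g)$1$1) * num g z * den g z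
       - of_real ((g ** m ** adj2 g)$1$2) * (den g z)\<^sup>2"
    using d by (simp add: qf_def mobR_nd field_simps power2_eq_square)
  also have "\<dots> = (?a * ?d - ?b * ?c)^2 * qf m z"
    by (simp add: mult2 num_def den_def qf_def algebra_simps power2_eq_square)
  finally have "qf (g ** m ** adj2 g) (mobR g z) * (den g z)\<^sup>2 = qf m z" using D by simp
  then have "cmod (qf m z) = cmod (qf (g ** m ** adj2 g) (mobR g z)) * (cmod (den g z))\<^sup>2"
    by (metis norm_mult norm_power)
  then show ?thesis using d unfolding Dsp_def Im_mobR[OF assms(1)] by simp
qed

lemma tr2_conj: assumes "g \<in> SL2R" shows "tr2 (g ** m ** adj2 g) = tr2 m"
proof -
  have "tr2 (g ** m ** adj2 g) = (g$1$1 * g$2$2 - g$1$2 * g$2$1) * tr2 m"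
    by (simp add: tr2_def mult2 algebra_simps)
  then show ?thesis using assms by (simp add: SL2R_iff)
qed

text \<open>Conjugation by \<open>hm z\<close> reduces the claim to an identity between squares of
  entries that uses determinant 1. The right hand side is invariant under simultaneous conjugation
  and translation, which is not visible for \<open>Nn\<close> because of the choice of
  \<open>hm z\<close>.\<close>

lemma Nn_sq: assumes "m \<in> SL2R" "Im z > 0" shows "(Nn m z)\<^sup>2 = (Dsp m z)\<^sup>2 + 4 - 2 * tr2 m"
proof -
  define x y where "x = Re z" and "y = Im z"
  define s where "s = sqrt y"
  have y: "y > 0" using assms y_def by auto
  have s: "s > 0" "s * s = y" using y by (auto simp: s_def)
  define P where "P = adj2 (hm z) ** m ** hm z"
  have hmz: "hm z = mk2 s (x/s) 0 (1/s)" by (simp add: hm_def s_def x_def y_def)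
  have z: "z = Complex x y" by (simp add: x_def y_def)
  have p: "P$1$1 = m$1$1 - x * m$2$1" "P$1$2 = (m$1$2 + x * (m$1$1 - m$2$2) - x\<^sup>2 * m$2$1) / y"
    "P$2$1 = y * m$2$1" "P$2$2 = m$2$2 + x * m$2$1"
    unfolding P_def hmz s(2)[symmetric] using s(1) by (simp_all add: mult2 field_simps power2_eq_square)
  have det: "m$1$1 * m$2$2 - m$1$2 * m$2$1 = 1" using assms SL2R_iff by auto
  have "Re (qf m z) = m$2$1 * (x\<^sup>2 - y\<^sup>2) + (m$2$2 - m$1$1) * x - m$1$2"
    "Im (qf m z) = 2 * m$2$1 * x * y + (m$2$2 - m$1$1) * y"
    unfolding z by (simp_all add: qf_def power2_eq_square algebra_simps)
  then have q: "(cmod (qf m z))\<^sup>2 = (m$2$1 * (x\<^sup>2 - y\<^sup>2) + (m$2$2 - m$1$1) * x - m$1$2)\<^sup>2 + (2 * m$2$1 * x * y + (m$2$2 - m$1$1) * y)\<^sup>2"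
    by (simp add: cmod_power2)
  have "(Nn m z)\<^sup>2 = (P$1$1 - 1)\<^sup>2 + (P$1$2)\<^sup>2 + (P$2$1)\<^sup>2 + (P$2$2 - 1)\<^sup>2"
    by (simp add: Nn_def P_def norm_2x2_sq)
  moreover have "(Dsp m z)\<^sup>2 = (P$2$1 + P$1$2)\<^sup>2 + (P$2$2 - P$1$1)\<^sup>2"
  proof -
    have yn: "y \<noteq> 0" using y by simp
    define B where "B = m$1$2 + x * (m$1$1 - m$2$2) - x\<^sup>2 * m$2$1"
    have "(cmod (qf m z))\<^sup>2 = (m$2$1 * y\<^sup>2 + B)\<^sup>2 + y\<^sup>2 * (2 * m$2$1 * x + (m$2$2 - m$1$1))\<^sup>2"
      unfolding q B_def by (simp add: power2_eq_square algebra_simps)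
    then have "(Dsp m z)\<^sup>2 = (m$2$1 * y + B / y)\<^sup>2 + (2 * m$2$1 * x + (m$2$2 - m$1$1))\<^sup>2"
      using yn by (simp add: Dsp_def power_divide y_def[symmetric] field_simps power2_eq_square)
    moreover have "P$1$2 = B / y" using p B_def by simp
    moreover have "P$2$2 - P$1$1 = 2 * m$2$1 * x + (m$2$2 - m$1$1)" "P$2$1 = m$2$1 * y" using p by simp_all
    ultimately show "(Dsp m z)\<^sup>2 = (P$2$1 + P$1$2)\<^sup>2 + (P$2$2 - P$1$1)\<^sup>2"
      by simp
  qed
  moreover have "P \<in> SL2R" unfolding P_def using assms by (intro SL2R_mult SL2R_adj hm_SL2R)
  then have "P$1$1 * P$2$2 - P$1$2 * P$2$1 = 1" by (simp add: SL2R_iff)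
  moreover have "tr2 m = P$1$1 + P$2$2" using p by (simp add: tr2_def)
  ultimately show ?thesis by (simp add: power2_eq_square algebra_simps)
qed

lemma SL2R_conj: "g \<in> SL2R \<Longrightarrow> m \<in> SL2R \<Longrightarrow> g ** m ** adj2 g \<in> SL2R"
  by (intro SL2R_mult SL2R_adj)

lemma Nn_equiv: assumes "g \<in> SL2R" "m \<in> SL2R" "Im z > 0"
  shows "Nn (g ** m ** adj2 g) (mobR g z) = Nn m z"
proof -
  have "(Nn (g ** m ** adj2 g) (mobR g z))\<^sup>2 = (Nn m z)\<^sup>2"
    using assms by (simp add: Nn_sq SL2R_conj Im_mobR_pos Dsp_equiv tr2_conj)
  then show ?thesis by (simp add: Nn_def)
qed

section \<open>Hyperbolic area\<close>

definition harea :: "complex set \<Rightarrow> ennreal" where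
  "harea E = set_nn_integral lborel E (\<lambda>z. ennreal (1 / (Im z)\<^sup>2))"

text \<open>The change of variables in \<open>harea_mob\<close> takes place in
  \<open>real^2\<close>; these two maps carry Lebesgue measure across.\<close>

definition r2c :: "real^2 \<Rightarrow> complex" where "r2c p = Complex (p$1) (p$2)"
definition c2r :: "complex \<Rightarrow> real^2" where "c2r z = vector [Re z, Im z]"

lemma r2c_c2r [simp]: "r2c (c2r z) = z" and c2r_r2c [simp]: "c2r (r2c p) = p"
  by (simp_all add: r2c_def c2r_def vec2_eq)

lemma linear_r2c: "linear r2c"
  by (rule linearI) (simp_all add: r2c_def complex_eq_iff)

lemma linear_c2r: "linear c2r"
  by (rule linearI) (simp_all add: c2r_def vec2_eq)

lemma r2c_measurable [measurable]: "r2c \<in> borel_measurable borel"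
  by (intro borel_measurable_continuous_onI linear_continuous_on linear_conv_bounded_linear[THEN iffD1] linear_r2c)

lemma Basis_real2: "(Basis :: (real^2) set) = {axis 1 1, axis 2 1}"
  by (auto simp: Basis_vec_def UNIV_2)

lemma axis_neq2: "axis 1 1 \<noteq> (axis 2 1 :: real^2)" by (simp add: axis_eq_axis)

lemma distr_r2c: "distr lborel borel r2c = (lborel :: complex measure)"
proof (rule lborel_eqI[symmetric])
  fix l u :: complex assume le: "\<And>b. b \<in> Basis \<Longrightarrow> l \<bullet> b \<le> u \<bullet> b"
  have v: "r2c -` box l u = box (c2r l) (c2r u)"
    by (auto simp: box_def Basis_real2 Basis_complex_def inner_axis r2c_def c2r_def inner_complex_def)
  have "emeasure (distr lborel borel r2c) (box l u) = emeasure lborel (box (c2r l) (c2r u))"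
    by (subst emeasure_distr) (auto simp: v)
  also have "\<dots> = (\<Prod>b\<in>Basis. (c2r u - c2r l) \<bullet> b)"
    using le[of 1] le[of \<i>] 
    by (intro emeasure_lborel_box) (auto simp: Basis_real2 Basis_complex_def inner_axis c2r_def)
  also have "\<dots> = (\<Prod>b\<in>Basis. (u - l) \<bullet> b)"
    using axis_neq2 by (simp add: Basis_real2 Basis_complex_def inner_axis c2r_def inner_complex_def)
  finally show "emeasure (distr lborel borel r2c) (box l u) = ennreal (\<Prod>b\<in>Basis. (u - l) \<bullet> b)" by simp
qed simp

lemma harea_r2c: assumes [measurable]: "E \<in> sets borel"
  shows "harea E = set_nn_integral lborel (r2c -` E) (\<lambda>p. ennreal (1 / (p$2)\<^sup>2))"
proof -
  have "harea E = (\<integral>\<^sup>+z. ennreal (1 / (Im z)\<^sup>2) * indicator E z \<partial>distr lborel borel r2c)"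
    by (simp add: harea_def distr_r2c)
  also have "\<dots> = (\<integral>\<^sup>+p. ennreal (1 / (Im (r2c p))\<^sup>2) * indicator E (r2c p) \<partial>lborel)"
    by (rule nn_integral_distr) auto
  also have "\<dots> = set_nn_integral lborel (r2c -` E) (\<lambda>p. ennreal (1 / (p$2)\<^sup>2))"
    by (intro nn_integral_cong) (auto simp: r2c_def indicator_def)
  finally show ?thesis .
qed

lemma mobR_image_preimage: assumes "g \<in> SL2R" "E \<subseteq> H_plane"
  shows "mobR g ` E = H_plane \<inter> mobR (adj2 g) -` E"
proof (intro set_eqI iffI)
  fix w assume "w \<in> mobR g ` E"
  then obtain z where w: "w = mobR g z" "z \<in> E" by auto
  then have z: "Im z > 0" using assms by (auto simp: H_plane_def)
  show "w \<in> H_plane \<inter> mobR (adj2 g) -` E"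
    using Im_mobR_pos[OF assms(1) z] mobR_adj_cancel[OF assms(1) z] w by (simp add: H_plane_def)
next
  fix z assume "z \<in> H_plane \<inter> mobR (adj2 g) -` E"
  then show "z \<in> mobR g ` E" using mobR_adj_cancel(2)[OF assms(1)] by (force simp: H_plane_def)
qed

lemma open_H_plane: "open H_plane" unfolding H_plane_def by (simp add: open_halfspace_Im_gt)

lemma continuous_on_mobR: assumes "g \<in> SL2R" shows "continuous_on H_plane (mobR g)"
proof -
  have "continuous_on H_plane (\<lambda>z. num g z / den g z)"
    using den_nonzero[OF assms] unfolding num_def den_def H_plane_def by (intro continuous_intros) auto
  then show ?thesis by (simp add: mobR_nd[abs_def])
qed

lemma mobR_image_borel: assumes "g \<in> SL2R" "E \<subseteq> H_plane" "E \<in> sets borel"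
  shows "mobR g ` E \<in> sets borel"
proof -
  have H: "H_plane \<in> sets borel" using open_H_plane by simp
  have "mobR (adj2 g) \<in> borel_measurable (restrict_space borel H_plane)"
    by (rule borel_measurable_continuous_on_restrict[OF continuous_on_mobR[OF SL2R_adj[OF assms(1)]]])
  from measurable_sets[OF this assms(3)]
  have "mobR (adj2 g) -` E \<inter> H_plane \<in> sets (restrict_space borel H_plane)"
    by (simp add: space_restrict_space)
  then have "mobR (adj2 g) -` E \<inter> H_plane \<in> sets borel"
    using H by (subst (asm) sets_restrict_space_iff) auto
  then show ?thesis by (simp add: mobR_image_preimage[OF assms(1,2)] Int_commute)
qed

lemma mobR_deriv: assumes "g \<in> SL2R" "Im z > 0"
  shows "(mobR g has_field_derivative 1 / (den g z)\<^sup>2) (at z)"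
proof -
  have d: "den g z \<noteq> 0" using den_nonzero assms by auto
  have "((\<lambda>z. num g z / den g z) has_field_derivative
     (of_real (g$1$1) * den g z - num g z * of_real (g$2$1)) / (den g z * den g z)) (at z)"
    by (rule DERIV_divide) (use d in \<open>auto simp: num_def den_def intro!: derivative_eq_intros\<close>)
  moreover have "of_real (g$1$1) * den g z - num g z * of_real (g$2$1) = 1"
    using of_real_det[OF assms(1)] by (simp add: num_def den_def algebra_simps)
  ultimately show ?thesis by (simp add: mobR_nd[abs_def] power2_eq_square)
qed

text \<open>The Jacobian of a Moebius map is \<open>|den|^-4\<close>, and the density
  \<open>1 / Im^2\<close> picks up the inverse factor. Finite area makes the density integrable, as
  the change of variables formula requires.\<close>

lemma harea_mob: assumes g: "g \<in> SL2R" and EH: "E \<subseteq> H_plane" and Em [measurable]: "E \<in> sets borel" and fin: "harea E < \<infinity>"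
  shows "harea (mobR g ` E) = harea E"
proof -
  define S where "S = r2c -` E"
  define G where "G = (\<lambda>p. c2r (mobR g (r2c p)))"
  define G' where "G' = (\<lambda>p v. c2r (r2c v / (den g (r2c p))\<^sup>2))"
  define f where "f = (\<lambda>p::real^2. 1 / (p$2)\<^sup>2)"
  have Sm[measurable]: "S \<in> sets borel" unfolding S_def by (rule measurable_sets_borel[OF r2c_measurable Em])
  have Spos: "p$2 > 0" "Im (r2c p) > 0" if "p \<in> S" for p
    using that EH by (auto simp: S_def H_plane_def r2c_def)
  have im: "mobR g ` E \<in> sets borel" using mobR_image_borel[OF g EH Em] .
  have GS: "G ` S = r2c -` (mobR g ` E)"
  proof (intro set_eqI iffI)
    fix q assume "q \<in> G ` S" then show "q \<in> r2c -` (mobR g ` E)" by (auto simp: S_def G_def)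
  next
    fix p assume "p \<in> r2c -` (mobR g ` E)"
    then obtain z where "r2c p = mobR g z" "z \<in> E" by auto
    then have "p = G (c2r z)" "c2r z \<in> S" by (auto simp: G_def S_def) (metis c2r_r2c)
    then show "p \<in> G ` S" by auto
  qed
  have inj: "inj_on G S"
  proof (rule inj_onI)
    fix x y assume "x \<in> S" "y \<in> S" "G x = G y"
    then have "mobR g (r2c x) = mobR g (r2c y)" by (metis G_def r2c_c2r)
    then have "r2c x = r2c y" using mobR_adj_cancel(1)[OF g] Spos \<open>x \<in> S\<close> \<open>y \<in> S\<close> by metis
    then show "x = y" by (metis c2r_r2c)
  qed
  have der: "(G has_derivative G' x) (at x within S)" if "x \<in> S" for x
  proof -
    have 1: "(mobR g has_derivative (\<lambda>h. h / (den g (r2c x))\<^sup>2)) (at (r2c x))"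
      using mobR_deriv[OF g Spos(2)[OF that]] unfolding has_field_derivative_def
      by (rule has_derivative_eq_rhs) (auto simp: fun_eq_iff)
    have 2: "(r2c has_derivative r2c) (at x within S)" using linear_r2c
      by (simp add: linear_imp_has_derivative)
    have 3: "(c2r has_derivative c2r) (at y)" for y using linear_c2r
      by (simp add: linear_imp_has_derivative)
    show ?thesis
      using has_derivative_compose[OF has_derivative_compose[OF 2 1] 3]
      by (simp add: G_def G'_def)
  qed
  have det: "\<bar>det (matrix (G' x))\<bar> * f (G x) = f x" if "x \<in> S" for x
  proof -
    let ?z = "r2c x"
    have d: "den g ?z \<noteq> 0" using den_nonzero[OF g Spos(2)[OF that]] .
    define c where "c = 1 / (den g ?z)\<^sup>2"
    have "G' x v = c2r (c * r2c v)" for v by (simp add: G'_def c_def)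
    then have "det (matrix (G' x)) = (Re c)\<^sup>2 + (Im c)\<^sup>2"
      by (simp add: det_2 matrix_def axis_def r2c_def c2r_def power2_eq_square)
    then have 1: "\<bar>det (matrix (G' x))\<bar> = 1 / (cmod (den g ?z))^4"
      by (simp add: cmod_power2[symmetric] c_def norm_divide norm_power power_divide flip: power_mult)
    have "G x $ 2 = x$2 / (cmod (den g ?z))\<^sup>2"
      using Im_mobR[OF g, of ?z] by (simp add: G_def c2r_def) (simp add: r2c_def)
    then have "f (G x) = (cmod (den g ?z))^4 / (x$2)\<^sup>2"
      by (simp add: f_def power_divide flip: power_mult)
    then show ?thesis using 1 d by (simp add: f_def)
  qed
  have fb[measurable]: "f \<in> borel_measurable borel" unfolding f_def by measurable
  have fin': "(\<integral>\<^sup>+p\<in>S. ennreal (f p) \<partial>lborel) < \<infinity>"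
    using fin harea_r2c[OF Em] by (simp add: S_def f_def)
  have "set_integrable lborel S f"
    unfolding set_integrable_def
  proof (rule integrableI_nonneg)
    have "(\<integral>\<^sup>+p. ennreal (indicator S p *\<^sub>R f p) \<partial>lborel) = (\<integral>\<^sup>+p\<in>S. ennreal (f p) \<partial>lborel)"
      by (intro nn_integral_cong) (auto simp: indicator_def)
    then show "(\<integral>\<^sup>+p. ennreal (indicator S p *\<^sub>R f p) \<partial>lborel) < \<infinity>" using fin' by simp
  qed (auto simp: f_def)
  then have fint: "f integrable_on S" using set_borel_integral_eq_integral by blast
  have f0: "f p \<ge> 0" for p by (simp add: f_def)
  have fa: "f absolutely_integrable_on S" by (rule nonnegative_absolutely_integrable_1[OF fint f0])
  \<comment> \<open>The formula is stated for vector valued functions, so the density is read as a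
    map into \<open>real^1\<close>.\<close>
  define F where "F = (\<lambda>p. vec (f p) :: real^1)"
  have Fe: "(\<bar>det (matrix (G' x))\<bar> *\<^sub>R F (G x)) = F x" if "x \<in> S" for x
    using det[OF that] by (simp add: F_def vec_eq_iff)
  have Fa: "F absolutely_integrable_on S" using fa by (simp add: F_def absolutely_integrable_on_1_iff)
  have Fi: "integral S F = vec (integral S f)" by (simp add: integral_on_1_eq F_def)
  have A: "(\<lambda>x. \<bar>det (matrix (G' x))\<bar> *\<^sub>R F (G x)) absolutely_integrable_on S"
    using Fa by (rule set_integrable_cong[THEN iffD2, rotated -1]) (auto simp: Fe)
  have B: "integral S (\<lambda>x. \<bar>det (matrix (G' x))\<bar> *\<^sub>R F (G x)) = vec (integral S f)"
    unfolding Fi[symmetric] by (rule integral_cong) (rule Fe)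
  have "F absolutely_integrable_on (G ` S) \<and> integral (G ` S) F = vec (integral S f)"
    using has_absolute_integral_change_of_variables[OF _ der inj, of F "vec (integral S f)"] A B Sm by auto
  then have "f absolutely_integrable_on (G ` S)" "integral (G ` S) f = integral S f"
    by (auto simp: F_def absolutely_integrable_on_1_iff integral_on_1_eq vec_eq_iff)
  then have I: "(f has_integral (integral S f)) (G ` S)"
    by (metis has_integral_integrable_integral set_lebesgue_integral_eq_integral(1))
  have "(\<integral>\<^sup>+p\<in>G ` S. ennreal (f p) \<partial>lborel) = ennreal (integral S f)"
    by (rule nn_integral_has_integral_lebesgue'[OF f0 I])
  moreover have "(\<integral>\<^sup>+p\<in>S. ennreal (f p) \<partial>lborel) = ennreal (integral S f)"
    by (rule nn_integral_has_integral_lebesgue'[OF f0]) (use fint in blast)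
  ultimately show ?thesis unfolding harea_r2c[OF Em] harea_r2c[OF im] GS[symmetric] S_def[symmetric] by (simp add: f_def)
qed

section \<open>Cocompactness of the thick part\<close>

lemma matrix_sub_rdistrib: "((A::real^2^2) - B) ** (C::real^2^2) = A ** C - B ** C"
  unfolding mat2_eq by (simp add: mult2 left_diff_distrib)

text \<open>Pigeonhole: finitely many balls of radius \<delta>/2 cover the compact ball, and each
  contains at most one point of the set. The bound depends on \<delta> and the radius alone, which
  makes \<open>multiplicity\<close> uniform.\<close>

lemma separated_card:
  fixes C :: real assumes "\<delta> > 0"
  shows "\<exists>N. \<forall>X::'a::euclidean_space set. X \<subseteq> cball 0 C \<longrightarrow> (\<forall>x\<in>X. \<forall>y\<in>X. x \<noteq> y \<longrightarrow> \<delta> \<le> dist x y) \<longrightarrow> finite X \<and> card X \<le> N"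
proof -
  have "compact (cball (0::'a) C)" by simp
  then obtain k :: "'a set" where k: "finite k" "cball 0 C \<subseteq> (\<Union>x\<in>k. ball x (\<delta>/2))"
    by (rule compactE_image[of _ "cball 0 C" "\<lambda>x. ball x (\<delta>/2)"]) (use assms in auto)
  show ?thesis
  proof (intro exI[of _ "card k"] allI impI)
    fix X :: "'a set" assume X: "X \<subseteq> cball 0 C" "\<forall>x\<in>X. \<forall>y\<in>X. x \<noteq> y \<longrightarrow> \<delta> \<le> dist x y"
    have "\<forall>x\<in>X. \<exists>y\<in>k. dist y x < \<delta>/2" using X k by (fastforce simp: ball_def)
    then obtain f where f: "\<forall>x\<in>X. f x \<in> k \<and> dist (f x) x < \<delta>/2" by metis
    have "inj_on f X"
    proof (rule inj_onI, rule ccontr)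
      fix x y assume xy: "x \<in> X" "y \<in> X" "f x = f y" "x \<noteq> y"
      then have "dist x y < \<delta>" using f[rule_format, of x] f[rule_format, of y] dist_triangle3[of x y "f x"] by simp
      then show False using X xy by fastforce
    qed
    moreover have "f ` X \<subseteq> k" using f by auto
    ultimately show "finite X \<and> card X \<le> card k"
      using k card_inj_on_le[of f X k] inj_on_finite by blast
  qed
qed

section \<open>Discreteness and proper discontinuity of the deck group\<close>

locale fuchsian =
  fixes \<Gamma> :: "(real^2^2) set"
  assumes fhg: "finite_hyperbolic_group \<Gamma>"
begin

lemma sub: "\<gamma> \<in> \<Gamma> \<Longrightarrow> \<gamma> \<in> SL2R" using fhg by (auto simp: finite_hyperbolic_group_def)
lemma one: "mat 1 \<in> \<Gamma>" using fhg by (auto simp: finite_hyperbolic_group_def)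
lemma mult: "g \<in> \<Gamma> \<Longrightarrow> h \<in> \<Gamma> \<Longrightarrow> g ** h \<in> \<Gamma>" using fhg by (auto simp: finite_hyperbolic_group_def)
lemma adj: assumes "g \<in> \<Gamma>" shows "adj2 g \<in> \<Gamma>"
proof -
  obtain h where h: "h \<in> \<Gamma>" "g ** h = mat 1" using fhg assms by (auto simp: finite_hyperbolic_group_def)
  have "adj2 g = adj2 g ** (g ** h)" using h by simp
  also have "\<dots> = h" using adj2_left[OF sub[OF assms]] by (simp add: matrix_mul_assoc)
  finally show ?thesis using h by simp
qed
lemma free: "\<gamma> \<in> \<Gamma> \<Longrightarrow> \<gamma> \<noteq> mat 1 \<Longrightarrow> Im z > 0 \<Longrightarrow> mobR \<gamma> z \<noteq> z"
  using fhg by (auto simp: finite_hyperbolic_group_def H_plane_def)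
lemma discrete: "\<exists>\<epsilon>>0. \<forall>g\<in>\<Gamma>. g \<noteq> mat 1 \<longrightarrow> \<epsilon> \<le> norm (g - mat 1)"
  using fhg by (auto simp: finite_hyperbolic_group_def)

text \<open>The gap at the identity spreads by translation:
  \<open>x y^-1 - 1 = (x - y) y^-1\<close>, so distinct elements of bounded norm are uniformly
  separated.\<close>

lemma finite_norm: "finite {\<gamma> \<in> \<Gamma>. norm \<gamma> \<le> C}"
proof -
  obtain \<epsilon> where e: "\<epsilon> > 0" "\<And>g. g \<in> \<Gamma> \<Longrightarrow> g \<noteq> mat 1 \<Longrightarrow> \<epsilon> \<le> norm (g - mat 1)" using discrete by auto
  define C' where "C' = \<bar>C\<bar> + 1"
  have C': "C' > 0" by (simp add: C'_def)
  obtain N where N: "\<And>X::(real^2^2) set. X \<subseteq> cball 0 C' \<Longrightarrow> (\<forall>x\<in>X. \<forall>y\<in>X. x \<noteq> y \<longrightarrow> \<epsilon>/C' \<le> dist x y) \<Longrightarrow> finite X \<and> card X \<le> N"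
    using separated_card[of "\<epsilon>/C'" C'] e C' by (metis divide_pos_pos)
  have "finite {\<gamma> \<in> \<Gamma>. norm \<gamma> \<le> C} \<and> card {\<gamma> \<in> \<Gamma>. norm \<gamma> \<le> C} \<le> N"
  proof (rule N)
    show "{\<gamma> \<in> \<Gamma>. norm \<gamma> \<le> C} \<subseteq> cball 0 C'" by (auto simp: C'_def)
    show "\<forall>x\<in>{\<gamma> \<in> \<Gamma>. norm \<gamma> \<le> C}. \<forall>y\<in>{\<gamma> \<in> \<Gamma>. norm \<gamma> \<le> C}. x \<noteq> y \<longrightarrow> \<epsilon>/C' \<le> dist x y"
    proof (intro ballI impI)
      fix x y assume x: "x \<in> {\<gamma> \<in> \<Gamma>. norm \<gamma> \<le> C}" and y: "y \<in> {\<gamma> \<in> \<Gamma>. norm \<gamma> \<le> C}" and "x \<noteq> y"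
      have yy: "y ** adj2 y = mat 1" "adj2 y ** y = mat 1" using adj2_right adj2_left sub y by auto
      have ne: "x ** adj2 y \<noteq> mat 1"
      proof
        assume "x ** adj2 y = mat 1"
        then have "x ** adj2 y ** y = y" by simp
        then show False using yy \<open>x \<noteq> y\<close> by (simp add: matrix_mul_assoc[symmetric])
      qed
      have "x ** adj2 y \<in> \<Gamma>" using x y mult adj by auto
      then have "\<epsilon> \<le> norm (x ** adj2 y - mat 1)" using e ne by auto
      also have "x ** adj2 y - mat 1 = (x - y) ** adj2 y"
        using yy(1) by (simp add: matrix_sub_rdistrib)
      also have "norm \<dots> \<le> norm (x - y) * norm (adj2 y)" by (rule norm_mult2)
      also have "\<dots> \<le> norm (x - y) * C'" using y by (intro mult_left_mono) (auto simp: C'_def)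
      finally show "\<epsilon>/C' \<le> dist x y" using C' by (simp add: dist_norm field_simps)
    qed
  qed
  then show ?thesis by simp
qed

text \<open>Proper discontinuity. Both \<gamma> times \<open>hm z\<close> and \<open>hm z\<close>
  have norm at most the root of \<open>C\<close>, and \<gamma> is the first times the inverse of the
  second.\<close>

lemma finite_hb: "finite {\<gamma> \<in> \<Gamma>. \<exists>z. Im z > 0 \<and> hb z \<le> C \<and> hb (mobR \<gamma> z) \<le> C}"
proof (rule finite_subset[OF _ finite_norm[of "C"]], safe)
  fix \<gamma> z assume g: "\<gamma> \<in> \<Gamma>" and z: "Im z > 0" "hb z \<le> C" "hb (mobR \<gamma> z) \<le> C"
  let ?h = "hm z"
  have h: "?h \<in> SL2R" using z hm_SL2R by auto
  have C: "C > 0" using hb_pos[OF z(1)] z by linarith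
  have nh: "norm ?h \<le> sqrt C" using norm_sq_hb[OF h] mobR_hm[OF z(1)] z by (simp add: real_le_rsqrt)
  have "mobR (\<gamma> ** ?h) \<i> = mobR \<gamma> z" using mobR_mult[OF h] mobR_hm[OF z(1)] by simp
  then have ng: "norm (\<gamma> ** ?h) \<le> sqrt C" using norm_sq_hb[OF SL2R_mult[OF sub[OF g] h]] z by (simp add: real_le_rsqrt)
  have "\<gamma> = (\<gamma> ** ?h) ** adj2 ?h" using adj2_right[OF h] by (simp add: matrix_mul_assoc[symmetric])
  then have "norm \<gamma> \<le> norm (\<gamma> ** ?h) * norm (adj2 ?h)" by (metis norm_mult2)
  also have "\<dots> \<le> sqrt C * sqrt C" using nh ng C by (intro mult_mono) auto
  finally show "norm \<gamma> \<le> C" using C by simp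
qed

lemma countable_Gamma: "countable \<Gamma>"
proof -
  have "\<Gamma> = (\<Union>n::nat. {\<gamma> \<in> \<Gamma>. norm \<gamma> \<le> real n})"
    using real_arch_simple by (auto simp: set_eq_iff)
  moreover have "countable (\<Union>n::nat. {\<gamma> \<in> \<Gamma>. norm \<gamma> \<le> real n})"
    by (rule countable_UN) (auto intro: countable_finite finite_norm)
  ultimately show ?thesis by simp
qed

text \<open>Smallness is measured in \<open>SL2R\<close> and not by displacement: an element near
  minus the identity counts as large although it moves \<open>z\<close> little.\<close>

definition thick :: "real \<Rightarrow> complex \<Rightarrow> bool" where
  "thick \<epsilon> z \<longleftrightarrow> Im z > 0 \<and> (\<forall>\<gamma>\<in>\<Gamma>. \<gamma> \<noteq> mat 1 \<longrightarrow> \<epsilon> \<le> Nn \<gamma> z)"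

text \<open>A hyperbolic disc about \<open>i\<close>. The bound 3 only has to exceed 2, the minimum
  of \<open>hb\<close>.\<close>

definition B0 :: "complex set" where "B0 = {z. Im z > 0 \<and> hb z < 3}"
definition Bt :: "complex \<Rightarrow> complex set" where "Bt z = mobR (hm z) ` B0"

lemma in_Bt: assumes "Im z > 0" "Im w > 0" shows "w \<in> Bt z \<longleftrightarrow> (norm (adj2 (hm z) ** hm w))\<^sup>2 < 3"
proof -
  let ?h = "hm z"
  have h: "?h \<in> SL2R" using assms hm_SL2R by auto
  have "w \<in> Bt z \<longleftrightarrow> mobR (adj2 ?h) w \<in> B0"
    unfolding Bt_def using mobR_image_preimage[OF h, of B0] assms by (auto simp: B0_def H_plane_def)
  also have "\<dots> \<longleftrightarrow> hb (mobR (adj2 ?h) w) < 3"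
    using Im_mobR_pos[OF SL2R_adj[OF h] assms(2)] by (simp add: B0_def)
  also have "hb (mobR (adj2 ?h) w) = (norm (adj2 ?h ** hm w))\<^sup>2"
    using norm_sq_hb[OF SL2R_mult[OF SL2R_adj[OF h] hm_SL2R[OF assms(2)]]]
      mobR_mult[OF hm_SL2R[OF assms(2)], of \<i>] mobR_hm[OF assms(2)] by simp
  finally show ?thesis .
qed

lemma Bt_sub: "Im z > 0 \<Longrightarrow> Bt z \<subseteq> H_plane"
  by (auto simp: Bt_def H_plane_def B0_def intro!: Im_mobR_pos hm_SL2R)

lemma hb_bounds: assumes "Im z > 0" "hb z \<le> C" shows "1 \<le> C * Im z" "cmod z \<le> C"
proof -
  have *: "1 + (cmod z)\<^sup>2 \<le> C * Im z" using assms by (simp add: hb_def field_simps)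
  then show 1: "1 \<le> C * Im z" using zero_le_power2[of "cmod z"] by linarith
  have C: "C > 0" using 1 assms by (metis less_le_not_le mult_nonpos_nonneg not_le order.trans zero_less_one less_eq_real_def)
  have "C * Im z \<le> C * cmod z" using C abs_Im_le_cmod[of z] by (intro mult_left_mono) auto
  then have "(cmod z)\<^sup>2 \<le> C * cmod z" using * by linarith
  then show "cmod z \<le> C" using C by (cases "cmod z = 0") (auto simp: power2_eq_square)
qed

lemma continuous_on_hb: "continuous_on H_plane hb"
  unfolding hb_def[abs_def] H_plane_def by (intro continuous_intros) auto

lemma B0_open: "open B0"
proof -
  have "B0 = H_plane \<inter> hb -` {..<3}" by (auto simp: B0_def H_plane_def)
  then show ?thesis using continuous_open_preimage[OF continuous_on_hb open_H_plane, of "{..<3}"] by simp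
qed

lemma B0_sub: "B0 \<subseteq> H_plane" by (auto simp: B0_def H_plane_def)

lemma harea_B0: "harea B0 < \<infinity>" "harea B0 > 0"
proof -
  have "harea B0 \<le> (\<integral>\<^sup>+z. 9 * indicator (cball (0::complex) 3) z \<partial>lborel)"
    unfolding harea_def
  proof (intro nn_integral_mono)
    fix z
    show "ennreal (1 / (Im z)\<^sup>2) * indicator B0 z \<le> 9 * indicator (cball 0 3) z"
    proof (cases "z \<in> B0")
      case True
      then have z: "Im z > 0" "hb z \<le> 3" by (auto simp: B0_def)
      have "cmod z \<le> 3" using hb_bounds[OF z] by simp
      have "1 / (Im z)\<^sup>2 \<le> 9" using one_le_power[OF hb_bounds(1)[OF z], of 2] z
        by (simp add: field_simps power_mult_distrib)
      then have "ennreal (1 / (Im z)\<^sup>2) \<le> ennreal 9" by (intro ennreal_leI)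
      then show ?thesis using True \<open>cmod z \<le> 3\<close> by simp
    qed simp
  qed
  also have "\<dots> < \<infinity>"
  proof -
    have "emeasure lborel (cball (0::complex) 3) \<noteq> top"
      using emeasure_lborel_cball_finite[of "0::complex" 3] by (simp add: less_top)
    then show ?thesis by (subst nn_integral_cmult_indicator) (auto simp: ennreal_mult_eq_top_iff less_top[symmetric])
  qed
  finally show "harea B0 < \<infinity>" .
  have "harea B0 \<noteq> 0"
  proof
    assume "harea B0 = 0"
    then have "AE z in lborel. ennreal (1 / (Im z)\<^sup>2) * indicator B0 z = 0"
      unfolding harea_def using B0_open by (subst (asm) nn_integral_0_iff_AE) auto
    then have "AE z in lborel. z \<notin> B0"
      by eventually_elim (auto simp: indicator_def B0_def split: if_splits)
    then have "emeasure lborel B0 = 0" using B0_open by (subst (asm) AE_iff_measurable[OF _ refl]) auto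
    moreover have "\<i> \<in> B0" by (simp add: B0_def hb_def)
    ultimately show False using open_not_negligible[OF B0_open] B0_open by (auto simp: null_sets_def negligible_iff_null_sets)
  qed
  then show "harea B0 > 0" by (simp add: zero_less_iff_neq_zero)
qed

text \<open>Seen in the frames at \<open>z\<close> and \<open>w\<close>, the elements in question
  become matrices of norm below 2. Two of them differ by a non-trivial element that is not small at
  the thick point \<open>z\<close>, so they are uniformly separated and their number is
  bounded.\<close>

lemma multiplicity:
  assumes "\<epsilon> > 0"
  shows "\<exists>N::nat. \<forall>z w. thick \<epsilon> z \<longrightarrow> Im w > 0 \<longrightarrow> finite {\<gamma>\<in>\<Gamma>. mobR \<gamma> w \<in> Bt z} \<and> card {\<gamma>\<in>\<Gamma>. mobR \<gamma> w \<in> Bt z} \<le> N"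
proof -
  obtain N where N: "\<And>X::(real^2^2) set. X \<subseteq> cball 0 2 \<Longrightarrow> (\<forall>x\<in>X. \<forall>y\<in>X. x \<noteq> y \<longrightarrow> \<epsilon>/2 \<le> dist x y) \<Longrightarrow> finite X \<and> card X \<le> N"
    using separated_card[of "\<epsilon>/2" 2] assms by (metis half_gt_zero)
  show ?thesis
  proof (intro exI[of _ N] allI impI)
    fix z w assume z: "thick \<epsilon> z" and w: "Im w > 0"
    let ?h = "hm z" and ?k = "hm w"
    have z0: "Im z > 0" using z by (simp add: thick_def)
    have h: "?h \<in> SL2R" "?k \<in> SL2R" using z0 w hm_SL2R by auto
    define X where "X = {\<gamma>\<in>\<Gamma>. mobR \<gamma> w \<in> Bt z}"
    define F where "F = (\<lambda>\<gamma>. adj2 ?h ** \<gamma> ** ?k)"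
    have FS: "F \<gamma> \<in> SL2R" if "\<gamma> \<in> \<Gamma>" for \<gamma> using that h sub unfolding F_def by (intro SL2R_mult SL2R_adj)
    have Fn: "norm (F \<gamma>) < 2" if "\<gamma> \<in> X" for \<gamma>
    proof -
      have g: "\<gamma> \<in> \<Gamma>" "mobR \<gamma> w \<in> Bt z" using that by (auto simp: X_def)
      have "mobR (F \<gamma>) \<i> = mobR (adj2 ?h) (mobR \<gamma> w)"
        unfolding F_def using mobR_mult[OF h(2), of \<i>] mobR_mult[OF sub[OF g(1)] w] mobR_hm[OF w] by simp
      moreover have "mobR (adj2 ?h) (mobR \<gamma> w) \<in> B0"
        using g(2) mobR_adj_cancel(1)[OF h(1)] by (auto simp: Bt_def B0_def)
      ultimately have "(norm (F \<gamma>))\<^sup>2 < 3" using norm_sq_hb[OF FS[OF g(1)]] by (simp add: B0_def)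
      then have "(norm (F \<gamma>))\<^sup>2 < 2\<^sup>2" by simp
      then show ?thesis by (rule power_less_imp_less_base) simp
    qed
    have sep: "\<epsilon>/2 \<le> dist (F x) (F y)" if "x \<in> X" "y \<in> X" "x \<noteq> y" for x y
    proof -
      have g: "x \<in> \<Gamma>" "y \<in> \<Gamma>" using that by (auto simp: X_def)
      have yy: "y ** adj2 y = mat 1" "adj2 y ** y = mat 1" using adj2_right adj2_left sub g by auto
      define m where "m = x ** adj2 y"
      have ne: "m \<noteq> mat 1"
      proof
        assume "m = mat 1"
        then have "x ** adj2 y ** y = y" by (simp add: m_def)
        then show False using yy \<open>x \<noteq> y\<close> by (simp add: matrix_mul_assoc[symmetric])
      qed
      have "m \<in> \<Gamma>" using g mult adj by (simp add: m_def)
      then have "\<epsilon> \<le> Nn m z" using z ne by (auto simp: thick_def)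
      also have "adj2 ?h ** m ** ?h - mat 1 = (F x - F y) ** adj2 (F y)"
      proof -
        have "F y ** adj2 (F y) = mat 1" using adj2_right FS g by blast
        moreover have "F x ** adj2 (F y) = adj2 ?h ** x ** (?k ** adj2 ?k) ** adj2 y ** ?h"
          by (simp add: F_def adj2_mult matrix_mul_assoc)
        then have "F x ** adj2 (F y) = adj2 ?h ** m ** ?h"
          by (simp add: adj2_right[OF h(2)] m_def matrix_mul_assoc)
        ultimately show ?thesis by (simp add: matrix_sub_rdistrib)
      qed
      then have "Nn m z = norm ((F x - F y) ** adj2 (F y))" by (simp add: Nn_def)
      also have "\<dots> \<le> norm (F x - F y) * norm (adj2 (F y))" by (rule norm_mult2)
      also have "\<dots> \<le> norm (F x - F y) * 2" using Fn[OF that(2)] by (intro mult_left_mono) auto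
      finally show ?thesis by (simp add: dist_norm)
    qed
    have inj: "inj_on F X" using sep assms by (fastforce simp: inj_on_def)
    have "finite (F ` X) \<and> card (F ` X) \<le> N"
      by (rule N) (use Fn sep in \<open>force+\<close>)
    then show "finite X \<and> card X \<le> N" using inj by (simp add: card_image finite_image_iff)
  qed
qed

text \<open>An area count. Each disc is cut up and moved back into the set \<open>D\<close> of
  finite area. By disjointness of the orbits and by \<open>multiplicity\<close> a point of
  \<open>D\<close> is hit at most \<open>N\<close> times, so \<open>card Z\<close> times the area of
  a disc is at most \<open>N\<close> times the area of \<open>D\<close>.\<close>

lemma packing:
  assumes "\<epsilon> > 0"
  shows "\<exists>M::nat. \<forall>Z. finite Z \<longrightarrow> (\<forall>z\<in>Z. thick \<epsilon> z) \<longrightarrow>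
     (\<forall>z\<in>Z. \<forall>z'\<in>Z. \<forall>\<gamma>\<in>\<Gamma>. z \<noteq> z' \<longrightarrow> mobR \<gamma> ` Bt z \<inter> Bt z' = {}) \<longrightarrow> card Z \<le> M"
proof -
  obtain N :: nat where N: "\<And>z w. thick \<epsilon> z \<Longrightarrow> Im w > 0 \<Longrightarrow> finite {\<gamma>\<in>\<Gamma>. mobR \<gamma> w \<in> Bt z} \<and> card {\<gamma>\<in>\<Gamma>. mobR \<gamma> w \<in> Bt z} \<le> N"
    using multiplicity[OF assms] by blast
  obtain D where D: "D \<in> sets borel" "D \<subseteq> H_plane" "(\<Union>g\<in>\<Gamma>. mobR g ` D) = H_plane" "harea D < \<infinity>"
    using fhg by (auto simp: finite_hyperbolic_group_def harea_def)
  define \<mu> where "\<mu> = density lborel (\<lambda>z::complex. ennreal (1 / (Im z)\<^sup>2))"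
  have mu: "emeasure \<mu> E = harea E" if "E \<in> sets borel" for E
    unfolding \<mu>_def harea_def using that by (subst emeasure_density) auto
  have smu: "sets \<mu> = sets borel" by (simp add: \<mu>_def)
  define I where "I = to_nat_on \<Gamma> ` \<Gamma>"
  define e where "e = from_nat_into \<Gamma>"
  have e: "e n \<in> \<Gamma>" for n using one unfolding e_def by (metis from_nat_into empty_iff)
  have einj: "inj_on e I" using countable_Gamma unfolding I_def e_def by (auto intro!: inj_onI)
  have eI: "e ` I = \<Gamma>" using countable_Gamma by (force simp: I_def e_def image_image)
  \<comment> \<open>The part of \<open>D\<close> that the \<open>n\<close>-th element carries into
    the disc. Outside \<open>I\<close> the enumeration repeats elements, so those indices get the
    empty set and nothing is counted twice.\<close>
  define F where "F = (\<lambda>z n. if n \<in> I then D \<inter> mobR (e n) -` Bt z else {})"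
  have Bm: "Bt z \<in> sets borel" "harea (Bt z) = harea B0" if "Im z > 0" for z
    using mobR_image_borel[OF hm_SL2R[OF that] B0_sub] harea_mob[OF hm_SL2R[OF that] B0_sub] B0_open harea_B0
    by (auto simp: Bt_def)
  have F1: "F z n \<in> sets borel" "F z n \<subseteq> D" if z: "Im z > 0" for z n
  proof -
    have "Bt z \<subseteq> H_plane" by (rule Bt_sub[OF z])
    then have "mobR (adj2 (e n)) ` Bt z \<in> sets borel"
      using mobR_image_borel[OF SL2R_adj[OF sub[OF e]]] Bm[OF z] by blast
    moreover have "D \<inter> mobR (e n) -` Bt z = D \<inter> mobR (adj2 (e n)) ` Bt z"
      using D mobR_image_preimage[OF SL2R_adj[OF sub[OF e]] \<open>Bt z \<subseteq> H_plane\<close>, of n] by auto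
    ultimately show "F z n \<in> sets borel" using D by (simp add: F_def)
    show "F z n \<subseteq> D" by (auto simp: F_def)
  qed
  have F2: "harea (Bt z) \<le> (\<Sum>n. harea (F z n))" if z: "Im z > 0" for z
  proof -
    have FH: "F z n \<subseteq> H_plane" for n using F1(2)[OF z] D by blast
    have im: "mobR (e n) ` F z n \<in> sets borel" for n
      using mobR_image_borel[OF sub[OF e] FH F1(1)[OF z]] .
    have fin: "harea (F z n) < \<infinity>" for n
    proof -
      have "harea (F z n) \<le> harea D" using F1[OF z] D mu emeasure_mono[of "F z n" D \<mu>] by (metis smu)
      then show ?thesis using D by (simp add: order_le_less_trans)
    qed
    have "Bt z \<subseteq> (\<Union>n. mobR (e n) ` F z n)"
    proof
      fix w assume w: "w \<in> Bt z"
      then have "w \<in> H_plane" using Bt_sub[OF z] by auto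
      then obtain g d where "g \<in> \<Gamma>" "d \<in> D" "w = mobR g d" using D(3) by blast
      then obtain n where "n \<in> I" "g = e n" using eI by blast
      then show "w \<in> (\<Union>n. mobR (e n) ` F z n)"
        using \<open>d \<in> D\<close> \<open>w = mobR g d\<close> w by (auto simp: F_def)
    qed
    then have "emeasure \<mu> (Bt z) \<le> emeasure \<mu> (\<Union>n. mobR (e n) ` F z n)"
      using im smu by (intro emeasure_mono) auto
    also have "\<dots> \<le> (\<Sum>n. emeasure \<mu> (mobR (e n) ` F z n))"
      using im smu by (intro emeasure_subadditive_countably) auto
    also have "\<dots> = (\<Sum>n. harea (F z n))"
      using mu im harea_mob[OF sub[OF e] FH F1(1)[OF z] fin] by simp
    finally show ?thesis using mu Bm[OF z] by simp
  qed
  have key: "of_nat (card Z) * harea B0 \<le> of_nat N * harea D"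
    if Z: "finite Z" "\<forall>z\<in>Z. thick \<epsilon> z" "\<forall>z\<in>Z. \<forall>z'\<in>Z. \<forall>\<gamma>\<in>\<Gamma>. z \<noteq> z' \<longrightarrow> mobR \<gamma> ` Bt z \<inter> Bt z' = {}" for Z
  proof -
    have Zp: "Im z > 0" if "z \<in> Z" for z using that Z by (auto simp: thick_def)
    have "of_nat (card Z) * harea B0 = (\<Sum>z\<in>Z. harea (Bt z))" using Bm(2)[OF Zp] by simp
    also have "\<dots> \<le> (\<Sum>z\<in>Z. \<Sum>n. harea (F z n))" using F2 Zp by (intro sum_mono) auto
    also have "\<dots> = (\<Sum>z\<in>Z. \<Sum>n. \<integral>\<^sup>+w. indicator (F z n) w \<partial>\<mu>)"
      using F1 Zp smu mu by (intro sum.cong refl suminf_cong) (auto simp: nn_integral_indicator)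
    also have "\<dots> = (\<Sum>z\<in>Z. \<integral>\<^sup>+w. (\<Sum>n. indicator (F z n) w) \<partial>\<mu>)"
      using F1 Zp smu by (intro sum.cong refl nn_integral_suminf[symmetric]) auto
    also have "\<dots> = (\<integral>\<^sup>+w. (\<Sum>z\<in>Z. \<Sum>n. indicator (F z n) w) \<partial>\<mu>)"
      using F1 Zp smu by (intro nn_integral_sum[symmetric]) auto
    also have "\<dots> \<le> (\<integral>\<^sup>+w. of_nat N * indicator D w \<partial>\<mu>)"
    proof (rule nn_integral_mono)
      fix w
      show "(\<Sum>z\<in>Z. \<Sum>n. indicator (F z n) w) \<le> of_nat N * (indicator D w :: ennreal)"
      proof (cases "\<exists>z\<in>Z. \<exists>n. w \<in> F z n")
        case False
        then have "(\<Sum>z\<in>Z. \<Sum>n. indicator (F z n) w) = (0::ennreal)" by (intro sum.neutral) auto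
        then show ?thesis by simp
      next
        case True
        then obtain z n where zn: "z \<in> Z" "w \<in> F z n" by auto
        then have wD: "w \<in> D" using F1(2)[OF Zp] by blast
        have w0: "Im w > 0" using wD D by (auto simp: H_plane_def)
        \<comment> \<open>Two centres hit from the same point \<open>w\<close> would have translated
          discs with a common point.\<close>
        have other: "z' = z" if z': "z' \<in> Z" "w \<in> F z' n'" for z' n'
        proof (rule ccontr)
          assume "z' \<noteq> z"
          have a: "mobR (e n) w \<in> Bt z" "mobR (e n') w \<in> Bt z'" using zn z' by (auto simp: F_def split: if_splits)
          have "mobR (e n ** adj2 (e n')) (mobR (e n') w) = mobR (e n) w"
            using mobR_mult[OF SL2R_adj[OF sub[OF e]] Im_mobR_pos[OF sub[OF e] w0]] mobR_adj_cancel(1)[OF sub[OF e] w0] by metis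
          then have "mobR (e n) w \<in> mobR (e n ** adj2 (e n')) ` Bt z' \<inter> Bt z" using a by (metis IntI imageI)
          moreover have "e n ** adj2 (e n') \<in> \<Gamma>" using e mult adj by blast
          ultimately show False using Z(3) z'(1) zn(1) \<open>z' \<noteq> z\<close> by blast
        qed
        have "(\<Sum>z'\<in>Z. \<Sum>n. indicator (F z' n) w) = (\<Sum>z'\<in>{z}. \<Sum>n. indicator (F z' n) w :: ennreal)"
        proof (rule sum.mono_neutral_right[OF Z(1)])
          show "{z} \<subseteq> Z" using zn by simp
          show "\<forall>i\<in>Z - {z}. (\<Sum>n. indicator (F i n) w) = (0::ennreal)"
          proof
            fix i assume "i \<in> Z - {z}"
            then have "w \<notin> F i n" for n using other[of i n] by blast
            then have "(\<lambda>n. indicator (F i n) w) = (\<lambda>n. 0::ennreal)" by (simp add: fun_eq_iff)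
            then show "(\<Sum>n. indicator (F i n) w) = (0::ennreal)" by (simp only: suminf_zero)
          qed
        qed
        also have "\<dots> = (\<Sum>n. indicator (F z n) w)" by simp
        also have "\<dots> \<le> of_nat N"
        proof -
          define J where "J = {n. w \<in> F z n}"
          have J: "J \<subseteq> I" "e ` J \<subseteq> {\<gamma>\<in>\<Gamma>. mobR \<gamma> w \<in> Bt z}" using e by (auto simp: J_def F_def split: if_splits)
          have injJ: "inj_on e J" by (rule inj_on_subset[OF einj J(1)])
          have fc: "finite {\<gamma>\<in>\<Gamma>. mobR \<gamma> w \<in> Bt z}" "card {\<gamma>\<in>\<Gamma>. mobR \<gamma> w \<in> Bt z} \<le> N"
            using N[OF Z(2)[rule_format, OF zn(1)] w0] by blast+
          have Jf: "finite J" by (rule inj_on_finite[OF injJ J(2) fc(1)])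
          have "card J \<le> N" using card_inj_on_le[OF injJ J(2) fc(1)] fc(2) by simp
          moreover have "(\<Sum>n. indicator (F z n) w :: ennreal) = (\<Sum>n\<in>J. indicator (F z n) w)"
            by (rule suminf_finite[OF Jf]) (auto simp: J_def)
          moreover have "\<dots> = of_nat (card J)" by (simp add: J_def)
          ultimately show ?thesis by (simp add: of_nat_mono)
        qed
        finally show ?thesis using wD by simp
      qed
    qed
    also have "\<dots> = of_nat N * harea D" using D smu mu by (subst nn_integral_cmult_indicator) auto
    finally show ?thesis .
  qed
  obtain d where d: "harea D = ennreal d" "d \<ge> 0" using D(4) by (cases "harea D") auto
  obtain b where b: "harea B0 = ennreal b" "b > 0" using harea_B0 by (cases "harea B0") auto
  show ?thesis
  proof (intro exI[of _ "nat \<lceil>N * d / b\<rceil>"] allI impI)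
    fix Z assume "finite Z" "\<forall>z\<in>Z. thick \<epsilon> z" "\<forall>z\<in>Z. \<forall>z'\<in>Z. \<forall>\<gamma>\<in>\<Gamma>. z \<noteq> z' \<longrightarrow> mobR \<gamma> ` Bt z \<inter> Bt z' = {}"
    from key[OF this] have "ennreal (card Z * b) \<le> ennreal (N * d)"
      using b d by (simp add: ennreal_mult ennreal_of_nat_eq_real_of_nat)
    then have "card Z * b \<le> N * d" using d by (subst (asm) ennreal_le_iff) auto
    then have "real (card Z) \<le> N * d / b" using b by (simp add: field_simps)
    then show "card Z \<le> nat \<lceil>N * d / b\<rceil>" by linarith
  qed
qed

text \<open>\<open>packing\<close> allows a family of disjoint discs of maximal cardinality. The
  disc of any further thick point must meet a translate of one of them, which puts that point at
  bounded distance.\<close>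

lemma thick_cocompact:
  assumes "\<epsilon> > 0"
  shows "\<exists>C. \<forall>z. thick \<epsilon> z \<longrightarrow> (\<exists>\<gamma>\<in>\<Gamma>. hb (mobR \<gamma> z) < C)"
proof -
  define P where "P = (\<lambda>Z. finite Z \<and> (\<forall>z\<in>Z. thick \<epsilon> z) \<and>
     (\<forall>z\<in>Z. \<forall>z'\<in>Z. \<forall>\<gamma>\<in>\<Gamma>. z \<noteq> z' \<longrightarrow> mobR \<gamma> ` Bt z \<inter> Bt z' = {}))"
  from packing[OF assms] obtain M :: nat where M0: "\<forall>Z. finite Z \<longrightarrow> (\<forall>z\<in>Z. thick \<epsilon> z) \<longrightarrow>
     (\<forall>z\<in>Z. \<forall>z'\<in>Z. \<forall>\<gamma>\<in>\<Gamma>. z \<noteq> z' \<longrightarrow> mobR \<gamma> ` Bt z \<inter> Bt z' = {}) \<longrightarrow> card Z \<le> M" ..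
  have M: "card Z \<le> M" if "P Z" for Z using M0[THEN spec, of Z] that unfolding P_def by (elim conjE) (rule mp[OF mp[OF mp]])
  have "P {}" by (simp add: P_def)
  then obtain Z where Z: "P Z" "\<And>Z'. P Z' \<Longrightarrow> card Z' \<le> card Z"
    using ex_has_greatest_nat[of P "{}" card "Suc M"] M le_imp_less_Suc by blast
  have Zf: "finite Z" and Zt: "\<And>z. z \<in> Z \<Longrightarrow> thick \<epsilon> z" using Z by (auto simp: P_def)
  \<comment> \<open>The 9 is the product of two bounds 3 for squared norms: from \<open>z\<close> to
    the common point, and from there to the centre in \<open>Z\<close>.\<close>
  define C where "C = 1 + 9 * (\<Sum>z\<in>Z. hb z)"
  have hbZ: "hb z \<le> (\<Sum>z\<in>Z. hb z)" if "z \<in> Z" for z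
    using that Zf Zt by (intro member_le_sum) (auto simp: thick_def intro!: less_imp_le hb_pos)
  show ?thesis
  proof (intro exI[of _ C] allI impI)
    fix z assume z: "thick \<epsilon> z"
    have z0: "Im z > 0" using z by (simp add: thick_def)
    show "\<exists>\<gamma>\<in>\<Gamma>. hb (mobR \<gamma> z) < C"
    proof (cases "z \<in> Z")
      case True
      have "hb z > 0" using hb_pos z0 by auto
      then show ?thesis using hbZ[OF True] one by (intro bexI[of _ "mat 1"]) (auto simp: C_def)
    next
      case False
      then have "\<not> P (insert z Z)" using Z(2)[of "insert z Z"] Zf by auto
      then obtain z' \<gamma> where z': "z' \<in> Z" "\<gamma> \<in> \<Gamma>" and "mobR \<gamma> ` Bt z \<inter> Bt z' \<noteq> {} \<or> mobR \<gamma> ` Bt z' \<inter> Bt z \<noteq> {}"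
      proof -
        from \<open>\<not> P (insert z Z)\<close> have "\<exists>a\<in>insert z Z. \<exists>b\<in>insert z Z. \<exists>\<gamma>\<in>\<Gamma>. a \<noteq> b \<and> mobR \<gamma> ` Bt a \<inter> Bt b \<noteq> {}"
          unfolding P_def using Zf Zt z by (metis finite_insert insert_iff)
        then obtain a b \<gamma> where ab: "a \<in> insert z Z" "b \<in> insert z Z" "\<gamma> \<in> \<Gamma>" "a \<noteq> b" "mobR \<gamma> ` Bt a \<inter> Bt b \<noteq> {}" by blast
        have "\<not> (a \<in> Z \<and> b \<in> Z)" using Z(1) ab unfolding P_def by metis
        then show thesis using that ab by blast
      qed
      have z'0: "Im z' > 0" using Zt[OF z'(1)] by (simp add: thick_def)
      have "\<exists>\<gamma>\<in>\<Gamma>. mobR \<gamma> ` Bt z \<inter> Bt z' \<noteq> {}"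
        using \<open>_ \<or> _\<close>
      proof
        assume "mobR \<gamma> ` Bt z' \<inter> Bt z \<noteq> {}"
        then obtain w where w: "w \<in> Bt z'" "mobR \<gamma> w \<in> Bt z" by auto
        then have "Im w > 0" using Bt_sub[OF z'0] by (auto simp: H_plane_def)
        then have "mobR (adj2 \<gamma>) (mobR \<gamma> w) = w" using mobR_adj_cancel(1) sub z' by blast
        then show ?thesis using w adj[OF z'(2)] by (intro bexI[of _ "adj2 \<gamma>"]) force+
      qed (use z' in blast)
      then obtain \<gamma> w where g: "\<gamma> \<in> \<Gamma>" and w: "w \<in> Bt z" "mobR \<gamma> w \<in> Bt z'" by auto
      have w0: "Im w > 0" using w Bt_sub[OF z0] by (auto simp: H_plane_def)
      let ?h = "hm z" and ?k = "hm w" and ?h' = "hm z'"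
      have S: "?h \<in> SL2R" "?k \<in> SL2R" "?h' \<in> SL2R" using hm_SL2R z0 w0 z'0 by auto
      have n1: "(norm (adj2 ?h ** ?k))\<^sup>2 < 3" using w(1) in_Bt[OF z0 w0] by simp
      have n2: "(norm (adj2 ?h' ** (\<gamma> ** ?k)))\<^sup>2 < 3"
      proof -
        have "(norm (adj2 ?h' ** (\<gamma> ** ?k)))\<^sup>2 = hb (mobR (adj2 ?h') (mobR \<gamma> w))"
          using norm_sq_hb[OF SL2R_mult[OF SL2R_adj[OF S(3)] SL2R_mult[OF sub[OF g] S(2)]]]
            mobR_mult[OF SL2R_mult[OF sub[OF g] S(2)], of \<i> "adj2 ?h'"] mobR_mult[OF S(2), of \<i> \<gamma>] mobR_hm[OF w0] by simp
        moreover have "mobR (adj2 ?h') (mobR \<gamma> w) \<in> B0"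
          using w(2) mobR_adj_cancel(1)[OF S(3)] by (auto simp: Bt_def B0_def)
        ultimately show ?thesis by (simp add: B0_def)
      qed
      have eq: "\<gamma> ** ?h = ?h' ** ((adj2 ?h' ** (\<gamma> ** ?k)) ** adj2 (adj2 ?h ** ?k))"
      proof -
        have "?h' ** ((adj2 ?h' ** (\<gamma> ** ?k)) ** adj2 (adj2 ?h ** ?k)) = (?h' ** adj2 ?h') ** \<gamma> ** (?k ** adj2 ?k) ** ?h"
          by (simp add: adj2_mult matrix_mul_assoc)
        then show ?thesis by (simp add: adj2_right[OF S(3)] adj2_right[OF S(2)])
      qed
      have "norm (\<gamma> ** ?h) \<le> norm ?h' * (norm (adj2 ?h' ** (\<gamma> ** ?k)) * norm (adj2 ?h ** ?k))"
      proof -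
        have "norm (\<gamma> ** ?h) = norm (?h' ** ((adj2 ?h' ** (\<gamma> ** ?k)) ** adj2 (adj2 ?h ** ?k)))"
          using eq by (rule arg_cong)
        also have "\<dots> \<le> norm ?h' * norm ((adj2 ?h' ** (\<gamma> ** ?k)) ** adj2 (adj2 ?h ** ?k))" by (rule norm_mult2)
        also have "norm ((adj2 ?h' ** (\<gamma> ** ?k)) ** adj2 (adj2 ?h ** ?k)) \<le> norm (adj2 ?h' ** (\<gamma> ** ?k)) * norm (adj2 ?h ** ?k)"
          using norm_mult2[of "adj2 ?h' ** (\<gamma> ** ?k)" "adj2 (adj2 ?h ** ?k)"] by simp
        finally show ?thesis by (simp add: mult_left_mono)
      qed
      then have "(norm (\<gamma> ** ?h))\<^sup>2 \<le> (norm ?h' * (norm (adj2 ?h' ** (\<gamma> ** ?k)) * norm (adj2 ?h ** ?k)))\<^sup>2"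
        by (intro power_mono) auto
      also have "\<dots> = (norm ?h')\<^sup>2 * ((norm (adj2 ?h' ** (\<gamma> ** ?k)))\<^sup>2 * (norm (adj2 ?h ** ?k))\<^sup>2)"
        by (simp add: power_mult_distrib)
      also have "\<dots> \<le> (norm ?h')\<^sup>2 * (3 * 3)"
        using n1 n2 by (intro mult_left_mono mult_mono) auto
      also have "(norm ?h')\<^sup>2 = hb z'" using norm_sq_hb[OF S(3)] mobR_hm[OF z'0] by simp
      also have "(norm (\<gamma> ** ?h))\<^sup>2 = hb (mobR \<gamma> z)"
        using norm_sq_hb[OF SL2R_mult[OF sub[OF g] S(1)]] mobR_mult[OF S(1), of \<i> \<gamma>] mobR_hm[OF z0] by simp
      finally have "hb (mobR \<gamma> z) < C" using hbZ[OF z'(1)] by (simp add: C_def)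
      then show ?thesis using g by blast
    qed
  qed
qed

end

section \<open>Commuting elements and the Zassenhaus lemma\<close>

lemma assoc2: "(A::real^2^2) ** (B::real^2^2) ** (C::real^2^2) = A ** (B ** C)"
  by (simp add: matrix_mul_assoc)

definition comm :: "real^2^2 \<Rightarrow> real^2^2 \<Rightarrow> bool" where "comm a b \<longleftrightarrow> a ** b = b ** a"

lemma comm_sym: "comm a b \<longleftrightarrow> comm b a" by (auto simp: comm_def)
lemma comm_refl: "comm a a" by (simp add: comm_def)

definition is_scalar :: "real^2^2 \<Rightarrow> bool" where "is_scalar a \<longleftrightarrow> a$1$2 = 0 \<and> a$2$1 = 0 \<and> a$1$1 = a$2$2"

text \<open>Equality of the traceless parts up to the factor \<open>l\<close>; two non-scalar matrices commute iff this holds for some \<open>l\<close>.\<close>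
definition tfr :: "real \<Rightarrow> real^2^2 \<Rightarrow> real^2^2 \<Rightarrow> bool" where
  "tfr l a b \<longleftrightarrow> a$1$2 = l * b$1$2 \<and> a$2$1 = l * b$2$1 \<and> a$1$1 - a$2$2 = l * (b$1$1 - b$2$2)"

lemma tfr_trans: "tfr k a c \<Longrightarrow> tfr l c d \<Longrightarrow> tfr (k * l) a d"
  by (simp add: tfr_def mult.assoc)

lemma comm_iff: "comm a b \<longleftrightarrow> a$1$2 * b$2$1 = b$1$2 * a$2$1 \<and>
   a$1$2 * (b$1$1 - b$2$2) = b$1$2 * (a$1$1 - a$2$2) \<and> a$2$1 * (b$1$1 - b$2$2) = b$2$1 * (a$1$1 - a$2$2)"
  unfolding comm_def mat2_eq by (simp add: mult2 algebra_simps) argo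

lemma tfr_comm: "tfr l a b \<Longrightarrow> comm a b"
  by (simp add: comm_iff tfr_def mult_ac)

lemma comm_tfr: assumes "comm a b" "\<not> is_scalar b" shows "\<exists>l. tfr l a b"
proof -
  have c: "a$1$2 * b$2$1 = b$1$2 * a$2$1" "a$1$2 * (b$1$1 - b$2$2) = b$1$2 * (a$1$1 - a$2$2)"
   "a$2$1 * (b$1$1 - b$2$2) = b$2$1 * (a$1$1 - a$2$2)" using assms comm_iff by auto
  consider "b$1$2 \<noteq> 0" | "b$2$1 \<noteq> 0" | "b$1$1 - b$2$2 \<noteq> 0" using assms(2) by (auto simp: is_scalar_def)
  then show ?thesis
  proof cases
    case 1 then have "tfr (a$1$2 / b$1$2) a b" using c by (simp add: tfr_def field_simps)
    then show ?thesis ..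
  next
    case 2 then have "tfr (a$2$1 / b$2$1) a b" using c by (simp add: tfr_def field_simps)
    then show ?thesis ..
  next
    case 3 then have "tfr ((a$1$1 - a$2$2) / (b$1$1 - b$2$2)) a b" using c by (simp add: tfr_def nonzero_eq_divide_eq)
    then show ?thesis ..
  qed
qed

text \<open>The matrices commuting with a non-scalar \<open>b\<close> have traceless part
  proportional to that of \<open>b\<close>, and such matrices commute with one another.\<close>

lemma comm_trans: assumes "comm a b" "comm b c" "\<not> is_scalar b" shows "comm a c"
proof -
  obtain l where l: "tfr l a b" using comm_tfr assms by blast
  obtain k where k: "tfr k c b" using comm_tfr[of c b] assms comm_sym by blast
  show ?thesis using l k by (simp add: comm_iff tfr_def mult_ac)
qed

text \<open>The discriminant of \<open>qf a\<close>: on \<open>SL2R\<close> it is negative for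
  elliptic, zero for parabolic or scalar and positive for hyperbolic matrices.\<close>

definition Dlt :: "real^2^2 \<Rightarrow> real" where "Dlt a = (a$1$1 - a$2$2)\<^sup>2 + 4 * a$1$2 * a$2$1"

lemma Dlt_tr: "a \<in> SL2R \<Longrightarrow> Dlt a = (tr2 a)\<^sup>2 - 4"
  by (simp add: Dlt_def tr2_def SL2R_iff power2_eq_square algebra_simps)

lemma Dlt_tfr: "tfr l a b \<Longrightarrow> Dlt a = l\<^sup>2 * Dlt b"
  by (simp add: Dlt_def tfr_def power2_eq_square distrib_left mult_ac)

lemma Dsp_tfr: assumes "tfr l a b" shows "Dsp a z = \<bar>l\<bar> * Dsp b z"
proof -
  have "a$2$2 - a$1$1 = l * (b$2$2 - b$1$1)" using assms by (simp add: tfr_def algebra_simps)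
  then have "qf a z = of_real (l * b$2$1) * z\<^sup>2 + of_real (l * (b$2$2 - b$1$1)) * z - of_real (l * b$1$2)"
    using assms by (simp only: qf_def tfr_def)
  then have "qf a z = of_real l * qf b z" by (simp add: qf_def algebra_simps)
  then show ?thesis by (simp add: Dsp_def norm_mult)
qed

lemma conj_cancel: assumes "h \<in> SL2R" shows "adj2 h ** (h ** a) = a" "h ** (adj2 h ** a) = (a::real^2^2)"
  using assms by (simp_all add: matrix_mul_assoc adj2_left adj2_right)

lemma conj_mult: assumes "h \<in> SL2R" shows "(adj2 h ** a ** h) ** (adj2 h ** b ** h) = adj2 h ** (a ** b) ** (h::real^2^2)"
  using assms by (simp add: assoc2 conj_cancel)

lemma conj_adj: "adj2 (adj2 h ** a ** h) = adj2 h ** adj2 a ** (h::real^2^2)"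
  by (simp add: adj2_mult assoc2)

lemma norm_mat1: "norm (mat 1 :: real^2^2) \<le> 3/2"
proof -
  have "(norm (mat 1 :: real^2^2))\<^sup>2 \<le> (3/2)\<^sup>2" by (subst norm_2x2_sq) (simp add: power2_eq_square)
  then show ?thesis by (rule power2_le_imp_le) simp
qed

text \<open>With \<open>X = A - 1\<close> and \<open>Y = B - 1\<close>, the commutator minus 1 is
  \<open>X Y - Y X\<close> times the two inverses, hence quadratically small. The inverses have norm
  at most 2 each, so 1/16 gives the factor \<open>2 * 4 / 16 = 1/2\<close>.\<close>

lemma commutator_contract:
  assumes A: "A \<in> SL2R" "norm (A - mat 1) \<le> 1/16" and B: "B \<in> SL2R" "norm (B - mat 1) \<le> 1/16"
  shows "norm (A ** B ** adj2 A ** adj2 B - mat 1) \<le> norm (B - mat 1) / 2"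
proof -
  have nA: "norm A \<le> 2" using norm_triangle_sub[of A "mat 1"] norm_mat1 A by linarith
  have nB: "norm B \<le> 2" using norm_triangle_sub[of B "mat 1"] norm_mat1 B by linarith
  define X where "X = A - mat 1" define Y where "Y = B - mat 1"
  have 1: "A ** B - B ** A = X ** Y - Y ** X"
    unfolding mat2_eq X_def Y_def by (simp add: mult2 algebra_simps)
  have "(B ** A) ** (adj2 A ** adj2 B) = mat 1"
    using A B by (simp add: assoc2 conj_cancel adj2_right)
  then have "A ** B ** adj2 A ** adj2 B - mat 1 = (A ** B - B ** A) ** (adj2 A ** adj2 B)"
    by (simp add: matrix_sub_rdistrib assoc2)
  then have "norm (A ** B ** adj2 A ** adj2 B - mat 1) \<le> norm (X ** Y - Y ** X) * norm (adj2 A ** adj2 B)"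
    using norm_mult2 1 by metis
  also have "\<dots> \<le> (norm X * norm Y + norm X * norm Y) * (2 * 2)"
  proof (rule mult_mono)
    show "norm (X ** Y - Y ** X) \<le> norm X * norm Y + norm X * norm Y"
      using norm_triangle_ineq4[of "X ** Y" "Y ** X"] norm_mult2[of X Y] norm_mult2[of Y X] by (simp add: mult.commute)
    show "norm (adj2 A ** adj2 B) \<le> 2 * 2"
      using norm_mult2[of "adj2 A" "adj2 B"] mult_mono[OF nA nB] by simp
  qed auto
  also have "\<dots> = 8 * norm X * norm Y" by simp
  also have "\<dots> \<le> 8 * (1/16) * norm Y" using A by (intro mult_right_mono mult_left_mono) (auto simp: X_def)
  finally show ?thesis by (simp add: Y_def)
qed

text \<open>For \<open>p\<close> in \<open>SL2R\<close> this is the cyclic group of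
  \<open>p\<close>, built by steps from the right, the form in which \<open>conn_const\<close> walks
  along it.\<close>

inductive_set cyc :: "real^2^2 \<Rightarrow> (real^2^2) set" for p where
  c1: "mat 1 \<in> cyc p"
| cp: "x \<in> cyc p \<Longrightarrow> x ** p \<in> cyc p"
| cm: "x \<in> cyc p \<Longrightarrow> x ** adj2 p \<in> cyc p"

section \<open>Discreteness turns smallness into commutation\<close>

context fuchsian begin

text \<open>Scalar matrices fix every point, so freeness rules out minus the identity as well. Hence
  commuting is transitive on non-trivial elements.\<close>

lemma nonscal: assumes "\<gamma> \<in> \<Gamma>" "\<gamma> \<noteq> mat 1" shows "\<not> is_scalar \<gamma>"
proof
  assume s: "is_scalar \<gamma>"
  then have "\<gamma>$1$1 * \<gamma>$1$1 = 1" using sub[OF assms(1)] by (simp add: is_scalar_def SL2R_iff)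
  then have "\<gamma>$1$1 \<noteq> 0" by auto
  then have "mobR \<gamma> \<i> = \<i>" using s by (simp add: mobR_def is_scalar_def)
  then show False using free[OF assms, of \<i>] by simp
qed

text \<open>A negative discriminant would put a root of \<open>qf b\<close>, that is a fixed point
  of \<open>b\<close>, into the upper half plane.\<close>

lemma trace_ge: assumes "b \<in> \<Gamma>" "b \<noteq> mat 1" shows "Dlt b \<ge> 0"
proof (rule ccontr)
  assume neg: "\<not> Dlt b \<ge> 0"
  then have c: "b$2$1 \<noteq> 0" by (auto simp: Dlt_def)
  define x where "x = (b$1$1 - b$2$2) / (2 * b$2$1)"
  define y where "y = sqrt (- Dlt b) / (2 * \<bar>b$2$1\<bar>)"
  have y: "y > 0" using neg c by (simp add: y_def)
  have y2: "y\<^sup>2 = - Dlt b / (4 * (b$2$1)\<^sup>2)" using neg by (simp add: y_def power_divide power_mult_distrib)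
  let ?z = "Complex x y"
  have q0: "qf b ?z = 0"
  proof -
    have re: "Re (qf b ?z) = b$2$1 * (x\<^sup>2 - y\<^sup>2) + (b$2$2 - b$1$1) * x - b$1$2"
      and im: "Im (qf b ?z) = y * (2 * b$2$1 * x + (b$2$2 - b$1$1))"
      by (simp_all add: qf_def power2_eq_square algebra_simps)
    have x1: "2 * b$2$1 * x = b$1$1 - b$2$2" using c by (simp add: x_def)
    have "4 * (b$2$1)\<^sup>2 * y\<^sup>2 = - Dlt b" using y2 c by (simp add: field_simps)
    moreover have "4 * b$2$1 * (b$2$1 * (x\<^sup>2 - y\<^sup>2) + (b$2$2 - b$1$1) * x - b$1$2)
      = (2 * b$2$1 * x)\<^sup>2 - 4 * (b$2$1)\<^sup>2 * y\<^sup>2 + 2 * (b$2$2 - b$1$1) * (2 * b$2$1 * x) - 4 * b$2$1 * b$1$2"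
      by (simp add: power2_eq_square algebra_simps)
    ultimately have "4 * b$2$1 * Re (qf b ?z) = 0"
      unfolding re x1 by (simp add: Dlt_def power2_eq_square algebra_simps)
    then show ?thesis using c im x1 by (simp add: complex_eq_iff)
  qed
  have d: "den b ?z \<noteq> 0" using den_nonzero[OF sub[OF assms(1)]] y by simp
  have "num b ?z - ?z * den b ?z = - qf b ?z" by (simp add: num_def den_def qf_def power2_eq_square algebra_simps)
  then have "mobR b ?z = ?z" using q0 d by (simp add: mobR_nd field_simps)
  then show False using free[OF assms, of ?z] y by simp
qed

lemma trace_nonzero: assumes "b \<in> \<Gamma>" shows "tr2 b \<noteq> 0"
proof (cases "b = mat 1")
  case True then show ?thesis by (simp add: tr2_def)
next
  case False
  then show ?thesis using trace_ge[OF assms] Dlt_tr[OF sub[OF assms]] by auto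
qed

lemma Zassenhaus_aux:
  assumes a: "a \<in> \<Gamma>" "Nn a z \<le> 1/16" and b: "b \<in> \<Gamma>" "Nn b z \<le> 1/16" and z: "Im z > 0"
  defines "s \<equiv> rec_nat b (\<lambda>_ x. a ** x ** adj2 a ** adj2 x)"
  shows "s n \<in> \<Gamma> \<and> Nn (s n) z \<le> (1/16) * (1/2)^n"
proof (induction n)
  case 0 then show ?case using b by (simp add: s_def)
next
  case (Suc n)
  have h: "hm z \<in> SL2R" using z hm_SL2R by auto
  let ?x = "s n"
  have S: "s (Suc n) = a ** ?x ** adj2 a ** adj2 ?x" by (simp add: s_def)
  have x: "?x \<in> \<Gamma>" using Suc by simp
  let ?c = "\<lambda>m. adj2 (hm z) ** m ** hm z"
  have "?c (s (Suc n)) = ?c a ** ?c ?x ** adj2 (?c a) ** adj2 (?c ?x)"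
    unfolding S by (simp add: conj_adj conj_mult[OF h])
  moreover have "norm (?c a ** ?c ?x ** adj2 (?c a) ** adj2 (?c ?x) - mat 1) \<le> norm (?c ?x - mat 1) / 2"
  proof (rule commutator_contract)
    show "?c a \<in> SL2R" "?c ?x \<in> SL2R" using h sub a x by (auto intro!: SL2R_mult SL2R_adj)
    show "norm (?c a - mat 1) \<le> 1/16" using a by (simp add: Nn_def)
    have "(1/2::real)^n \<le> 1" by (simp add: power_le_one)
    then show "norm (?c ?x - mat 1) \<le> 1/16" using Suc by (simp add: Nn_def)
  qed
  ultimately have "Nn (s (Suc n)) z \<le> Nn ?x z / 2" by (simp add: Nn_def)
  moreover have "s (Suc n) \<in> \<Gamma>" unfolding S using x a mult adj by blast
  ultimately show ?case using Suc by simp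
qed

lemma norm_le_Nn: assumes "Im z > 0" shows "norm (m - mat 1) \<le> hb z * Nn m z"
proof -
  have h: "hm z \<in> SL2R" using assms hm_SL2R by auto
  let ?N = "adj2 (hm z) ** m ** hm z - mat 1"
  have "hm z ** (?N ** adj2 (hm z)) = hm z ** ((adj2 (hm z) ** m ** hm z) ** adj2 (hm z) - adj2 (hm z))"
    by (simp add: matrix_sub_rdistrib)
  also have "\<dots> = m - mat 1"
  proof -
    have "hm z ** (X - Y) = hm z ** X - hm z ** Y" for X Y :: "real^2^2"
      unfolding mat2_eq by (simp add: mult2 algebra_simps)
    then show ?thesis by (simp add: assoc2 conj_cancel[OF h] adj2_right[OF h])
  qed
  finally have "norm (m - mat 1) \<le> norm (hm z) * (norm ?N * norm (hm z))"
    using norm_mult2[of "hm z" "?N ** adj2 (hm z)"] norm_mult2[of ?N "adj2 (hm z)"]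
      mult_left_mono[OF norm_mult2[of ?N "adj2 (hm z)"], of "norm (hm z)"] by simp
  also have "\<dots> = hb z * Nn m z"
    using norm_sq_hb[OF h] mobR_hm[OF assms] by (simp add: Nn_def power2_eq_square)
  finally show ?thesis .
qed

lemma conj_in: "a \<in> \<Gamma> \<Longrightarrow> b \<in> \<Gamma> \<Longrightarrow> b ** a ** adj2 b \<in> \<Gamma>" using mult adj by blast

lemma conj_nonempty: assumes "b \<in> \<Gamma>" "a \<noteq> mat 1" shows "b ** a ** adj2 b \<noteq> mat 1"
proof
  assume "b ** a ** adj2 b = mat 1"
  then have "adj2 b ** (b ** a ** adj2 b) ** b = adj2 b ** mat 1 ** b" by simp
  then have "a = mat 1" using sub[OF assms(1)] by (simp add: assoc2 conj_cancel adj2_left)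
  then show False using assms by simp
qed

text \<open>Repeated conjugation by \<open>b\<close> would shrink the nilpotent part of a parabolic
  element geometrically and produce non-trivial elements arbitrarily close to the identity. For
  \<beta> = 0 the conjugate itself would be scalar.\<close>

lemma shrink_contra:
  assumes a: "a \<in> \<Gamma>" "a \<noteq> mat 1" "Dlt a = 0" and b: "b \<in> \<Gamma>" and t: "tfr \<beta> (b ** a ** adj2 b) a" and \<beta>: "\<bar>\<beta>\<bar> < 1"
  shows False
proof -
  define t where "t = tr2 a"
  have t2: "t\<^sup>2 = 4" using Dlt_tr[OF sub[OF a(1)]] a(3) by (simp add: t_def)
  define X where "X = mk2 ((a$1$1 - a$2$2)/2) (a$1$2) (a$2$1) ((a$2$2 - a$1$1)/2)"
  have aX: "a = mk2 (t/2) 0 0 (t/2) + X" by (simp add: mat2_eq X_def t_def tr2_def field_simps)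
  have bSL: "b \<in> SL2R" using sub b by simp
  have bXb: "b ** X ** adj2 b = \<beta> *\<^sub>R X"
  proof -
    have tr: "tr2 (b ** a ** adj2 b) = tr2 a" by (rule tr2_conj[OF bSL])
    define c where "c = b ** a ** adj2 b"
    have "c = mk2 (t/2) 0 0 (t/2) + b ** X ** adj2 b"
    proof -
      have "c = b ** mk2 (t/2) 0 0 (t/2) ** adj2 b + b ** X ** adj2 b"
        unfolding c_def mat2_eq by (subst (1 2 3 4) aX) (simp add: mult2 algebra_simps)
      moreover have "b ** mk2 (t/2) 0 0 (t/2) ** adj2 b = mk2 (t/2) 0 0 (t/2)"
      proof -
        have "b$1$1 * b$2$2 - b$1$2 * b$2$1 = 1" using bSL by (simp add: SL2R_iff)
        then have "(t/2) * (b$1$1 * b$2$2 - b$1$2 * b$2$1) = t/2" by simp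
        then show ?thesis unfolding mat2_eq by (simp add: mult2 algebra_simps)
      qed
      ultimately show ?thesis by simp
    qed
    moreover have "c$1$2 = \<beta> * a$1$2" "c$2$1 = \<beta> * a$2$1" "c$1$1 - c$2$2 = \<beta> * (a$1$1 - a$2$2)" "c$1$1 + c$2$2 = t"
      using t tr by (auto simp: tfr_def c_def t_def tr2_def)
    ultimately show ?thesis unfolding mat2_eq by (simp add: X_def algebra_simps)
  qed
  \<comment> \<open>The trace of \<open>a\<close> may be -2. The square is always of the form
    \<open>1 + t X\<close> with \<open>X\<close> the traceless part, so it tends to the identity
    when \<open>X\<close> is scaled down.\<close>
  define s where "s = rec_nat (a ** a) (\<lambda>_ x. b ** x ** adj2 b)"
  have XX: "a ** a - mat 1 = t *\<^sub>R X"
  proof -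
    have d: "(a$1$1 - a$2$2)\<^sup>2 + 4 * a$1$2 * a$2$1 = 0" using a(3) by (simp add: Dlt_def)
    have e: "a$1$1 * a$2$2 - a$1$2 * a$2$1 = 1" using sub[OF a(1)] by (simp add: SL2R_iff)
    have f: "a$1$1 + a$2$2 = t" by (simp add: t_def tr2_def)
    show ?thesis unfolding mat2_eq using d e f t2
      by (simp add: mult2 X_def) (auto simp: power2_eq_square algebra_simps f[symmetric])
  qed
  have sn: "s n \<in> \<Gamma> \<and> s n - mat 1 = (\<beta>^n * t) *\<^sub>R X" for n
  proof (induction n)
    case 0 then show ?case using XX a mult by (simp add: s_def)
  next
    case (Suc n)
    have e: "s (Suc n) = b ** s n ** adj2 b" by (simp add: s_def)
    have "s n = mat 1 + (\<beta>^n * t) *\<^sub>R X" using Suc by (simp add: algebra_simps)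
    then have "s (Suc n) = b ** (mat 1 + (\<beta>^n * t) *\<^sub>R X) ** adj2 b" using e by simp
    also have "\<dots> = b ** adj2 b + (\<beta>^n * t) *\<^sub>R (b ** X ** adj2 b)"
      unfolding mat2_eq by (simp add: mult2 algebra_simps)
    also have "\<dots> = mat 1 + (\<beta>^Suc n * t) *\<^sub>R X" using bXb adj2_right[OF bSL] by (simp add: algebra_simps)
    finally have "s (Suc n) - mat 1 = (\<beta>^Suc n * t) *\<^sub>R X" by simp
    moreover have "s (Suc n) \<in> \<Gamma>" unfolding e using Suc b conj_in by blast
    ultimately show ?case by blast
  qed
  have X0: "X \<noteq> 0"
  proof
    assume "X = 0"
    then have "X$1$2 = 0" "X$2$1 = 0" "X$1$1 = 0" by (simp_all only: zero_index)
    then have "is_scalar a" unfolding X_def by (simp add: is_scalar_def)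
    then show False using nonscal[OF a(1,2)] by blast
  qed
  obtain \<epsilon> where e: "\<epsilon> > 0" "\<And>g. g \<in> \<Gamma> \<Longrightarrow> g \<noteq> mat 1 \<Longrightarrow> \<epsilon> \<le> norm (g - mat 1)" using discrete by auto
  have "(\<lambda>n. \<bar>\<beta>\<bar>^n * (\<bar>t\<bar> * norm X)) \<longlonglongrightarrow> 0"
    using \<beta> by (intro tendsto_mult_left_zero LIMSEQ_power_zero) auto
  then have "eventually (\<lambda>n. \<bar>\<beta>\<bar>^n * (\<bar>t\<bar> * norm X) < \<epsilon>) sequentially"
    using e(1) by (rule order_tendstoD)
  then obtain n where n: "\<bar>\<beta>\<bar>^n * (\<bar>t\<bar> * norm X) < \<epsilon>" by (auto simp: eventually_sequentially)
  have nn: "norm (s n - mat 1) = \<bar>\<beta>\<bar>^n * (\<bar>t\<bar> * norm X)"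
    using sn[of n] by (simp add: abs_mult power_abs)
  show False
  proof (cases "\<beta> = 0")
    case True
    then have "is_scalar (b ** a ** adj2 b)" using t by (simp add: tfr_def is_scalar_def)
    then show False using nonscal[OF conj_in[OF a(1) b] conj_nonempty[OF b a(2)]] by simp
  next
    case False
    then have "norm (s n - mat 1) \<noteq> 0" using nn X0 t2 by auto
    then have "s n \<noteq> mat 1" by auto
    then have "\<epsilon> \<le> norm (s n - mat 1)" using e(2) sn by blast
    then show False using n nn by linarith
  qed
qed

text \<open>Conjugation by \<open>b\<close> multiplies the traceless part of \<open>a\<close> by
  some \<beta> and keeps the discriminant, so \<beta> is 1 or -1 or \<open>a\<close> is parabolic.
  The value -1 forces trace 0 for \<open>b\<close>, which would be elliptic; in the parabolic case
  \<open>shrink_contra\<close> excludes a modulus other than 1, for \<open>b\<close> or for its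
  inverse.\<close>

lemma malnormal:
  assumes a: "a \<in> \<Gamma>" "a \<noteq> mat 1" and b: "b \<in> \<Gamma>" and c: "comm (b ** a ** adj2 b) a"
  shows "comm a b"
proof -
  have ns: "\<not> is_scalar a" using nonscal a by blast
  obtain \<beta> where t: "tfr \<beta> (b ** a ** adj2 b) a" using comm_tfr[OF c ns] by blast
  define a' where "a' = b ** a ** adj2 b"
  have bSL: "b \<in> SL2R" using sub b by simp
  have tr: "tr2 a' = tr2 a" using tr2_conj[OF bSL] by (simp add: a'_def)
  have a'G: "a' \<in> \<Gamma>" using conj_in a b by (simp add: a'_def)
  have eqD: "\<beta>\<^sup>2 * Dlt a = Dlt a"
    using Dlt_tfr[OF t] Dlt_tr[OF sub[OF a'G]] Dlt_tr[OF sub[OF a(1)]] tr by (simp add: a'_def)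
  have ba: "b ** a = a' ** b" using adj2_left[OF bSL] by (simp add: a'_def assoc2)
  have "\<beta> = 1"
  proof (rule ccontr)
    assume "\<beta> \<noteq> 1"
    show False
    proof (cases "\<beta> = -1")
      case True
      have a': "a'$1$2 = - a$1$2" "a'$2$1 = - a$2$1" "a'$1$1 - a'$2$2 = - (a$1$1 - a$2$2)" "a'$1$1 + a'$2$2 = a$1$1 + a$2$2"
        using t True tr by (auto simp: tfr_def a'_def tr2_def)
      then have a'': "a'$1$1 = a$2$2" "a'$2$2 = a$1$1" by linarith+
      have "b$1$1 * a$1$2 + b$1$2 * a$2$2 = a$2$2 * b$1$2 - a$1$2 * b$2$2"
        "b$2$1 * a$1$1 + b$2$2 * a$2$1 = - a$2$1 * b$1$1 + a$1$1 * b$2$1"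
        "b$1$1 * a$1$1 + b$1$2 * a$2$1 = a$2$2 * b$1$1 - a$1$2 * b$2$1"
        "b$2$1 * a$1$2 + b$2$2 * a$2$2 = - a$2$1 * b$1$2 + a$1$1 * b$2$2"
        using ba a' a'' unfolding mat2_eq by (simp_all add: mult2)
      then have "tr2 b * a$1$2 = 0" "tr2 b * a$2$1 = 0" "tr2 b * (a$1$1 - a$2$2) = 0"
        by (simp_all add: tr2_def algebra_simps)
      then show False using trace_nonzero[OF b] ns by (auto simp: is_scalar_def)
    next
      case False
      have "\<beta>\<^sup>2 \<noteq> 1" using False \<open>\<beta> \<noteq> 1\<close> by (simp add: power2_eq_1_iff)
      then have D: "Dlt a = 0" using eqD by auto
      have "\<not> \<bar>\<beta>\<bar> < 1" using shrink_contra[OF a D b t] by blast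
      then have b1: "\<bar>\<beta>\<bar> > 1" using False \<open>\<beta> \<noteq> 1\<close> by auto
      \<comment> \<open>For a factor of modulus above 1 the inverse of \<open>b\<close> is used.
        That its factor is 1/\<beta> follows by conjugating back.\<close>
      have "tfr (1/\<beta>) (adj2 b ** a ** adj2 (adj2 b)) a"
      proof -
        define e where "e = adj2 b ** a ** b"
        have "b ** e = a ** b" using conj_cancel[OF bSL] by (simp add: e_def assoc2)
        have 1: "comm e a"
        proof -
          have "comm (adj2 b ** (a' ** b)) (adj2 b ** (a ** b))"
          proof -
            have "a' ** a = a ** a'" using c by (simp add: comm_def a'_def)
            then have "a' ** (a ** b) = a ** (a' ** b)" by (simp add: matrix_mul_assoc)
            then show ?thesis by (simp add: comm_def assoc2 conj_cancel[OF bSL])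
          qed
          moreover have "adj2 b ** (a' ** b) = a" unfolding ba[symmetric] by (simp add: conj_cancel[OF bSL])
          ultimately show ?thesis by (simp add: e_def comm_sym assoc2)
        qed
        obtain \<kappa> where k: "tfr \<kappa> e a" using comm_tfr[OF 1 ns] by blast
        have lin: "tfr \<kappa> (b ** e ** adj2 b) (b ** a ** adj2 b)"
        proof -
          define u where "u = (tr2 a / 2) * (1 - \<kappa>)"
          have "tr2 e = tr2 a" using tr2_conj[OF SL2R_adj[OF bSL], of a] by (simp add: e_def)
          then have ee: "e = mk2 u 0 0 u + \<kappa> *\<^sub>R a"
            using k unfolding mat2_eq tfr_def by (simp add: u_def tr2_def field_simps)
          have "b ** e ** adj2 b = b ** mk2 u 0 0 u ** adj2 b + \<kappa> *\<^sub>R (b ** a ** adj2 b)"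
            unfolding mat2_eq by (subst (1 2 3 4) ee) (simp add: mult2 algebra_simps)
          moreover have "b ** mk2 u 0 0 u ** adj2 b = mk2 u 0 0 u"
          proof -
            have "b$1$1 * b$2$2 - b$1$2 * b$2$1 = 1" using bSL by (simp add: SL2R_iff)
            then have "u * (b$1$1 * b$2$2 - b$1$2 * b$2$1) = u" by simp
            then show ?thesis unfolding mat2_eq by (simp add: mult2 algebra_simps)
          qed
          ultimately show ?thesis by (simp add: tfr_def algebra_simps)
        qed
        have "b ** e ** adj2 b = a" using \<open>b ** e = a ** b\<close> adj2_right[OF bSL] by (simp add: assoc2)
        then have "tfr \<kappa> a (b ** a ** adj2 b)" using lin by simp
        then have "tfr (\<kappa> * \<beta>) a a" using t by (rule tfr_trans)
        then have "\<kappa> * \<beta> = 1" using ns by (auto simp: tfr_def is_scalar_def)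
        then have "\<kappa> = 1 / \<beta>" using b1 by (auto simp: field_simps)
        then show ?thesis using k by (simp add: e_def)
      qed
      moreover have "\<bar>1/\<beta>\<bar> < 1" using b1 by (simp add: field_simps)
      ultimately show False using shrink_contra[OF a D adj[OF b]] by blast
    qed
  qed
  then have "a' = a" using t tr unfolding mat2_eq tfr_def a'_def tr2_def by auto
  then show ?thesis using ba by (simp add: comm_def)
qed

text \<open>Iterated commutators with \<open>a\<close> tend to the identity, so by discreteness one
  of them is trivial. \<open>malnormal\<close> then lets commutation with \<open>a\<close> descend
  to \<open>b\<close> itself, which is stronger than nilpotence of the generated group.\<close>

lemma Zassenhaus:
  assumes a: "a \<in> \<Gamma>" "a \<noteq> mat 1" "Nn a z \<le> 1/16" and b: "b \<in> \<Gamma>" "Nn b z \<le> 1/16" and z: "Im z > 0"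
  shows "comm a b"
proof -
  define s where "s = rec_nat b (\<lambda>_ x. a ** x ** adj2 a ** adj2 x)"
  have s: "s n \<in> \<Gamma> \<and> Nn (s n) z \<le> (1/16) * (1/2)^n" for n
    unfolding s_def by (rule Zassenhaus_aux[OF a(1,3) b z])
  obtain \<epsilon> where e: "\<epsilon> > 0" "\<And>g. g \<in> \<Gamma> \<Longrightarrow> g \<noteq> mat 1 \<Longrightarrow> \<epsilon> \<le> norm (g - mat 1)" using discrete by auto
  have hp: "hb z > 0" using hb_pos z by auto
  have "(\<lambda>n. (1/2)^n * (hb z * (1/16))) \<longlonglongrightarrow> 0"
    by (intro tendsto_mult_left_zero LIMSEQ_power_zero) auto
  then have "eventually (\<lambda>n. (1/2)^n * (hb z * (1/16)) < \<epsilon>) sequentially"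
    using e(1) by (rule order_tendstoD)
  then obtain n where n: "(1/2)^n * (hb z * (1/16)) < \<epsilon>" by (auto simp: eventually_sequentially)
  have "norm (s n - mat 1) \<le> hb z * Nn (s n) z" by (rule norm_le_Nn[OF z])
  also have "\<dots> \<le> hb z * ((1/16) * (1/2)^n)" using s hp by (intro mult_left_mono) auto
  finally have "norm (s n - mat 1) < \<epsilon>" using n by (simp add: algebra_simps)
  then have "s n = mat 1" using e(2) s by fastforce
  then have "comm a (s n)" by (simp add: comm_def)
  \<comment> \<open>Descent: if \<open>a\<close> commutes with its commutator with \<open>x\<close>,
    it commutes with its conjugate by \<open>x\<close>, and \<open>malnormal\<close> gives
    commutation with \<open>x\<close>.\<close>
  then have "comm a (s 0)"
  proof (induction n)
    case (Suc n)
    let ?x = "s n"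
    have xG: "?x \<in> \<Gamma>" using s by simp
    have S: "s (Suc n) = a ** (?x ** adj2 a ** adj2 ?x)" by (simp add: s_def assoc2)
    define y where "y = ?x ** adj2 a ** adj2 ?x"
    have yS: "y \<in> SL2R" using xG a sub unfolding y_def by (intro SL2R_mult SL2R_adj) auto
    have aS: "a \<in> SL2R" using sub a by simp
    have "a ** (a ** y) = a ** (y ** a)" using Suc.prems unfolding comm_def S y_def[symmetric] by (simp add: assoc2)
    then have "adj2 a ** (a ** (a ** y)) = adj2 a ** (a ** (y ** a))" by simp
    then have ay: "a ** y = y ** a" by (simp add: conj_cancel[OF aS])
    have "comm (adj2 y) a"
    proof -
      have "adj2 y ** (a ** y) ** adj2 y = adj2 y ** (y ** a) ** adj2 y" using ay by simp
      then have "adj2 y ** a = a ** adj2 y" using yS by (simp add: assoc2 conj_cancel adj2_right)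
      then show ?thesis by (simp add: comm_def)
    qed
    moreover have "adj2 y = ?x ** a ** adj2 ?x" by (simp add: y_def adj2_mult assoc2)
    ultimately have "comm (?x ** a ** adj2 ?x) a" by simp
    then have "comm a ?x" by (rule malnormal[OF a(1,2) xG])
    then show ?case by (rule Suc.IH)
  qed
  then show ?thesis by (simp add: s_def)
qed

end

section \<open>Cusps\<close>

text \<open>The plane is covered by the translates of finitely many open sets \<open>V i\<close>, each contained in a horoball and
  stabilised up to a finite set by a cyclic group. Relatively compact pieces of the thick part
  are included, with trivial stabiliser.\<close>
locale cusp_cover =
  fixes \<Gamma> :: "(real^2^2) set" and I :: "'i set" and V :: "'i \<Rightarrow> complex set" and p :: "'i \<Rightarrow> real^2^2"
    and w :: "'i \<Rightarrow> real^2" and S :: "(real^2^2) set" and \<rho> c :: real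
  assumes sub: "\<gamma> \<in> \<Gamma> \<Longrightarrow> \<gamma> \<in> SL2R"
    and one: "mat 1 \<in> \<Gamma>"
    and mult: "g \<in> \<Gamma> \<Longrightarrow> h \<in> \<Gamma> \<Longrightarrow> g ** h \<in> \<Gamma>"
    and adj: "g \<in> \<Gamma> \<Longrightarrow> adj2 g \<in> \<Gamma>"
    and finite_hb: "finite {\<gamma> \<in> \<Gamma>. \<exists>z. Im z > 0 \<and> hb z \<le> C \<and> hb (mobR \<gamma> z) \<le> C}"
    and centre: "\<gamma> \<in> \<Gamma> \<Longrightarrow> (\<And>h. h \<in> \<Gamma> \<Longrightarrow> comm \<gamma> h) \<Longrightarrow> \<gamma> = mat 1"
    and finI: "finite I"
    and Vopen: "i \<in> I \<Longrightarrow> open (V i)"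
    and VH: "i \<in> I \<Longrightarrow> z \<in> V i \<Longrightarrow> Im z > 0"
    and pG: "i \<in> I \<Longrightarrow> p i \<in> \<Gamma>"
    and pV: "i \<in> I \<Longrightarrow> z \<in> V i \<Longrightarrow> mobR (p i) z \<in> V i"
    and pV': "i \<in> I \<Longrightarrow> z \<in> V i \<Longrightarrow> mobR (adj2 (p i)) z \<in> V i"
    and cover: "Im z > 0 \<Longrightarrow> \<exists>\<gamma>\<in>\<Gamma>. \<exists>i\<in>I. mobR \<gamma> z \<in> V i"
    and finS: "finite S" and SG: "S \<subseteq> \<Gamma>"
    and overlap: "\<gamma> \<in> \<Gamma> \<Longrightarrow> i \<in> I \<Longrightarrow> j \<in> I \<Longrightarrow> z \<in> V j \<Longrightarrow> mobR \<gamma> z \<in> V i \<Longrightarrow>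
       \<exists>m\<in>cyc (p i). \<exists>m'\<in>cyc (p j). \<exists>s\<in>S. \<gamma> = m ** s ** m'"
    and wV: "i \<in> I \<Longrightarrow> z \<in> V i \<Longrightarrow> eta (w i) z < \<rho>"
    and cpos: "c > 0" and cw: "\<gamma> \<in> \<Gamma> \<Longrightarrow> i \<in> I \<Longrightarrow> c \<le> norm (\<gamma> *v w i)"

lemma tfr_mult: assumes "tfr l m a" "tfr k q a"
  shows "tfr ((l * tr2 q + k * tr2 m) / 2) (m ** q) a"
proof -
  define d where "d = a$1$1 - a$2$2"
  have m: "m$1$2 = l * a$1$2" "m$2$1 = l * a$2$1" "m$1$1 = m$2$2 + l * d"
    and q: "q$1$2 = k * a$1$2" "q$2$1 = k * a$2$1" "q$1$1 = q$2$2 + k * d"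
    using assms by (auto simp: tfr_def d_def)
  show ?thesis unfolding tfr_def d_def[symmetric]
    by (simp add: mult2 tr2_def m q field_simps)
qed

lemma tfr_adj2: "tfr l m a \<Longrightarrow> tfr (-l) (adj2 m) a"
  by (simp add: tfr_def algebra_simps)

lemma tr2_adj2 [simp]: "tr2 (adj2 m) = tr2 m" by (simp add: tr2_def)

lemma comm_conj: assumes "comm a b" "g \<in> SL2R" shows "comm (g ** a ** adj2 g) (g ** b ** adj2 g)"
proof -
  have "(g ** x ** adj2 g) ** (g ** y ** adj2 g) = g ** (x ** y) ** adj2 g" for x y
    using assms(2) by (simp add: assoc2 conj_cancel)
  then show ?thesis using assms(1) by (simp add: comm_def)
qed

lemma comm_adj2: "comm a b \<Longrightarrow> comm (adj2 a) b"
  unfolding comm_iff by (simp add: algebra_simps)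

lemma continuous_on_Dsp: "continuous_on H_plane (Dsp m)"
  unfolding Dsp_def[abs_def] qf_def H_plane_def by (intro continuous_intros) auto

lemma Dsp_nonneg: "Im z > 0 \<Longrightarrow> Dsp m z \<ge> 0" by (simp add: Dsp_def)

text \<open>A matrix within 1/16 of the identity has trace at most 2 + 2/16, and
  \<open>Nn_sq\<close> then keeps the displacement below 1.\<close>

lemma Dsp_lt1: assumes m: "m \<in> SL2R" "Im z > 0" "Nn m z < 1/16" shows "Dsp m z < 1"
proof -
  define H where "H = adj2 (hm z) ** m ** hm z"
  have h: "hm z \<in> SL2R" using m hm_SL2R by auto
  have n: "norm (H - mat 1) < 1/16" using m by (simp add: Nn_def H_def)
  have "tr2 H = tr2 m" using tr2_conj[OF SL2R_adj[OF h], of m] by (simp add: H_def)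
  moreover have "\<bar>(H - mat 1)$i$i\<bar> \<le> norm (H - mat 1)" for i
    using component_le_norm_cart[of "(H - mat 1)$i" i] Finite_Cartesian_Product.norm_nth_le[of "H - mat 1" i] by linarith
  from this[of 1] this[of 2] have "H$1$1 + H$2$2 \<le> 2 + 2/16" using n by (simp add: abs_le_iff)
  ultimately have t: "tr2 m \<le> 2 + 2/16" by (simp add: tr2_def)
  have "(Nn m z)\<^sup>2 < (1/16)\<^sup>2" using m(3) by (intro power_strict_mono) (auto simp: Nn_def)
  then have "(Dsp m z)\<^sup>2 < 1\<^sup>2" using Nn_sq[OF m(1,2)] t by (simp add: power2_eq_square)
  then show ?thesis by (rule power_less_imp_less_base) simp
qed

text \<open>With discriminant 0 the form \<open>qf a\<close> is, up to sign, the square of a linear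
  form. The square roots of its coefficients give the horocycle vector, so displacement and
  horocycle height are the same function.\<close>

lemma parabolic_vector: assumes "Dlt a = 0" "\<not> is_scalar a"
  shows "\<exists>v. v \<noteq> 0 \<and> (\<forall>z. Dsp a z = eta v z)"
proof (cases "a$2$1 = 0")
  case True
  then have d: "a$1$1 = a$2$2" using assms by (simp add: Dlt_def)
  then have b: "a$1$2 \<noteq> 0" using assms True by (simp add: is_scalar_def)
  define v :: "real^2" where "v = vector [sqrt \<bar>a$1$2\<bar>, 0]"
  have "Dsp a z = eta v z" for z using True d by (simp add: Dsp_def eta_def qf_def v_def)
  moreover have "v \<noteq> 0" using b by (auto simp: v_def vec2_eq)
  ultimately show ?thesis by blast
next
  case False
  define k where "k = sqrt \<bar>a$2$1\<bar>"
  define r where "r = (a$1$1 - a$2$2) / (2 * a$2$1)"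
  have k: "k > 0" "k\<^sup>2 = \<bar>a$2$1\<bar>" using False by (auto simp: k_def)
  define v :: "real^2" where "v = vector [k * r, k]"
  have "Dsp a z = eta v z" for z
  proof -
    have 1: "2 * a$2$1 * r = a$1$1 - a$2$2" using False by (simp add: r_def)
    have 3: "A * r\<^sup>2 = - B" if "(2 * A * r)\<^sup>2 + 4 * B * A = 0" "A \<noteq> 0" for A B :: real
    proof -
      have "A * (4 * (A * r\<^sup>2 + B)) = 0" using that(1) by (simp add: power2_eq_square algebra_simps)
      then show ?thesis using that(2) by simp
    qed
    have 2: "a$2$1 * r\<^sup>2 = - a$1$2"
      using assms(1) False by (intro 3) (simp_all add: 1 Dlt_def)
    have "qf a z = of_real (a$2$1) * z\<^sup>2 - of_real (2 * a$2$1 * r) * z + of_real (a$2$1 * r\<^sup>2)"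
      unfolding 1 2 qf_def by (simp add: algebra_simps)
    also have "\<dots> = of_real (a$2$1) * (of_real r - z)\<^sup>2" by (simp add: power2_eq_square algebra_simps)
    finally have "cmod (qf a z) = \<bar>a$2$1\<bar> * (cmod (of_real r - z))\<^sup>2" by (simp add: norm_mult norm_power)
    also have "\<dots> = (cmod (of_real (v$1) - of_real (v$2) * z))\<^sup>2"
    proof -
      have "of_real (v$1) - of_real (v$2) * z = of_real k * (of_real r - z)" by (simp add: v_def algebra_simps)
      then show ?thesis using k by (simp add: norm_mult power_mult_distrib)
    qed
    finally show ?thesis by (simp add: Dsp_def eta_def)
  qed
  moreover have "v \<noteq> 0" using k by (auto simp: v_def vec2_eq)
  ultimately show ?thesis by blast
qed

lemma hyperbolic_eigen: assumes "a \<in> SL2R" "Dlt a > 0"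
  shows "\<exists>u v \<mu>. \<mu>\<^sup>2 > 1 \<and> wdg u v \<noteq> 0 \<and> a *v u = \<mu> *\<^sub>R u \<and> a *v v = (1/\<mu>) *\<^sub>R v"
proof -
  define t where "t = tr2 a" define s where "s = sqrt (Dlt a)"
  have s: "s > 0" "s\<^sup>2 = t\<^sup>2 - 4" using assms Dlt_tr by (auto simp: s_def t_def)
  define m1 where "m1 = (t + s)/2" define m2 where "m2 = (t - s)/2"
  have e: "2 * m1 = t + s" "2 * m2 = t - s" by (simp_all add: m1_def m2_def)
  have "4 * (m1 * m2) = (2 * m1) * (2 * m2)" by simp
  also have "\<dots> = t\<^sup>2 - s\<^sup>2" unfolding e by (simp add: power2_eq_square algebra_simps)
  finally have "4 * (m1 * m2) = t\<^sup>2 - s\<^sup>2" .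
  then have m: "m1 * m2 = 1" "m1 + m2 = t" "m1 \<noteq> m2" using s by (simp_all add: m1_def m2_def flip: add_divide_distrib)
  \<comment> \<open>Stated for either order of the eigenvalues, because only afterwards is it
    decided which one has square above 1.\<close>
  have eval: "\<exists>u v. wdg u v \<noteq> 0 \<and> a *v u = m1 *\<^sub>R u \<and> a *v v = m2 *\<^sub>R v"
    if m: "m1 * m2 = 1" "m1 + m2 = t" "m1 \<noteq> m2" for m1 m2
  proof -
    have t: "a$1$1 + a$2$2 = m1 + m2" using m by (simp add: t_def tr2_def)
    have d: "a$1$1 * a$2$2 - a$1$2 * a$2$1 = m1 * m2" using assms m by (simp add: SL2R_iff)
    have a11: "a$1$1 = m1 + m2 - a$2$2" using t by simp
    consider "a$2$1 \<noteq> 0" | "a$1$2 \<noteq> 0" | "a$2$1 = 0" "a$1$2 = 0" by blast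
    then show ?thesis
    proof cases
      case 1
      define u v :: "real^2" where "u = vector [m1 - a$2$2, a$2$1]" and "v = vector [m2 - a$2$2, a$2$1]"
      have "a$1$2 * a$2$1 = (m1 + m2 - a$2$2) * a$2$2 - m1 * m2" using d a11 by simp
      then have "a *v u = m1 *\<^sub>R u" "a *v v = m2 *\<^sub>R v" 
        by (simp_all add: vec2_eq mulv2 u_def v_def a11 algebra_simps)
      moreover have "wdg u v = a$2$1 * (m1 - m2)" by (simp add: wdg_def u_def v_def algebra_simps)
      ultimately show ?thesis using 1 m(3) by (metis mult_eq_0_iff right_minus_eq)
    next
      case 2
      define u v :: "real^2" where "u = vector [a$1$2, m1 - a$1$1]" and "v = vector [a$1$2, m2 - a$1$1]"
      have "a$1$2 * a$2$1 = (m1 + m2 - a$2$2) * a$2$2 - m1 * m2" using d a11 by simp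
      then have "a *v u = m1 *\<^sub>R u" "a *v v = m2 *\<^sub>R v" 
        by (simp_all add: vec2_eq mulv2 u_def v_def a11 algebra_simps)
      moreover have "wdg u v = a$1$2 * (m2 - m1)" by (simp add: wdg_def u_def v_def algebra_simps)
      ultimately show ?thesis using 2 m(3) by (metis mult_eq_0_iff right_minus_eq)
    next
      case 3
      have "(m1 - a$1$1) * (m1 - a$2$2) = m1 * m1 - m1 * (a$1$1 + a$2$2) + a$1$1 * a$2$2" by (simp add: algebra_simps)
      also have "a$1$1 * a$2$2 = m1 * m2" using d 3 by simp
      finally have "(m1 - a$1$1) * (m1 - a$2$2) = 0" unfolding t by (simp add: algebra_simps)
      then have "(m1 = a$1$1 \<and> m2 = a$2$2) \<or> (m1 = a$2$2 \<and> m2 = a$1$1)" using t by auto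
      then show ?thesis
      proof
        assume "m1 = a$1$1 \<and> m2 = a$2$2"
        then have "a *v (axis 1 1) = m1 *\<^sub>R axis 1 1" "a *v (axis 2 1) = m2 *\<^sub>R axis 2 1" "wdg (axis 1 1) (axis 2 1) \<noteq> 0"
          using 3 by (simp_all add: vec2_eq mulv2 axis_def wdg_def)
        then show ?thesis by blast
      next
        assume "m1 = a$2$2 \<and> m2 = a$1$1"
        then have "a *v (axis 2 1) = m1 *\<^sub>R axis 2 1" "a *v (axis 1 1) = m2 *\<^sub>R axis 1 1" "wdg (axis 2 1) (axis 1 1) \<noteq> 0"
          using 3 by (simp_all add: vec2_eq mulv2 axis_def wdg_def)
        then show ?thesis by blast
      qed
    qed
  qed
  have nz: "m1 \<noteq> 0" "m2 \<noteq> 0" using m by auto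
  have i: "m2 = 1/m1" "m1 = 1/m2" using m nz by (simp_all add: field_simps)
  have sq: "m1\<^sup>2 * m2\<^sup>2 = 1" using m(1) by (simp add: power_mult_distrib[symmetric])
  have "m1\<^sup>2 \<noteq> 1"
  proof
    assume "m1\<^sup>2 = 1"
    then have "m1 = 1 \<or> m1 = -1" by (simp add: power2_eq_1_iff)
    then show False using m(1,3) by auto
  qed
  then consider "m1\<^sup>2 > 1" | "m2\<^sup>2 > 1"
  proof -
    have "m2\<^sup>2 > 1" if "m1\<^sup>2 < 1"
    proof (rule ccontr)
      assume "\<not> m2\<^sup>2 > 1"
      then have "m1\<^sup>2 * m2\<^sup>2 \<le> m1\<^sup>2 * 1" by (intro mult_left_mono) auto
      then show False using sq that by simp
    qed
    then show thesis using that \<open>m1\<^sup>2 \<noteq> 1\<close> by linarith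
  qed
  then show ?thesis
  proof cases
    case 1
    from eval[OF m] obtain u v where "wdg u v \<noteq> 0" "a *v u = m1 *\<^sub>R u" "a *v v = m2 *\<^sub>R v" by blast
    then have "m1\<^sup>2 > 1 \<and> wdg u v \<noteq> 0 \<and> a *v u = m1 *\<^sub>R u \<and> a *v v = (1/m1) *\<^sub>R v" using 1 i(1) by simp
    then show ?thesis by blast
  next
    case 2
    have "m2 * m1 = 1" "m2 + m1 = t" "m2 \<noteq> m1" using m by (auto simp: algebra_simps)
    from eval[OF this] obtain u v where "wdg u v \<noteq> 0" "a *v u = m2 *\<^sub>R u" "a *v v = m1 *\<^sub>R v" by blast
    then have "m2\<^sup>2 > 1 \<and> wdg u v \<noteq> 0 \<and> a *v u = m2 *\<^sub>R u \<and> a *v v = (1/m2) *\<^sub>R v" using 2 i(2) by simp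
    then show ?thesis by blast
  qed
qed

text \<open>\<open>qf a\<close> vanishes at the two fixed points and hence is a multiple of the
  product of the linear forms of the eigenvectors. The displacement thereby becomes a product of two
  horocycle heights.\<close>

lemma eigen_Dsp:
  assumes "a *v u = \<mu> *\<^sub>R u" "a *v v = (1/\<mu>) *\<^sub>R v" "\<mu> \<noteq> 0"
  shows "of_real (wdg u v) * qf a z = of_real (\<mu> - 1/\<mu>) * ((of_real (u$1) - of_real (u$2) * z) * (of_real (v$1) - of_real (v$2) * z))"
proof -
  have e: "a$1$1 * u$1 + a$1$2 * u$2 = \<mu> * u$1" "a$2$1 * u$1 + a$2$2 * u$2 = \<mu> * u$2"
    "a$1$1 * v$1 + a$1$2 * v$2 = (1/\<mu>) * v$1" "a$2$1 * v$1 + a$2$2 * v$2 = (1/\<mu>) * v$2"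
    using assms by (simp_all add: vec2_eq mulv2)
  define n where "n = 1/\<mu>"
  note e' = e[folded n_def]
  have 1: "wdg u v * a$2$1 = (\<mu> - n) * (u$2 * v$2)"
  proof -
    have "wdg u v * a$2$1 = v$2 * (a$2$1 * u$1 + a$2$2 * u$2) - u$2 * (a$2$1 * v$1 + a$2$2 * v$2)" by (simp add: wdg_def algebra_simps)
    then show ?thesis unfolding e' by (simp add: algebra_simps)
  qed
  have 2: "wdg u v * a$1$2 = - (\<mu> - n) * (u$1 * v$1)"
  proof -
    have "wdg u v * a$1$2 = u$1 * (a$1$1 * v$1 + a$1$2 * v$2) - v$1 * (a$1$1 * u$1 + a$1$2 * u$2)" by (simp add: wdg_def algebra_simps)
    then show ?thesis unfolding e' by (simp add: algebra_simps)
  qed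
  have 3: "wdg u v * (a$2$2 - a$1$1) = - (\<mu> - n) * (u$1 * v$2 + u$2 * v$1)"
  proof -
    have "wdg u v * (a$2$2 - a$1$1) = u$1 * (a$2$1 * v$1 + a$2$2 * v$2) - v$1 * (a$2$1 * u$1 + a$2$2 * u$2)
       - (v$2 * (a$1$1 * u$1 + a$1$2 * u$2) - u$2 * (a$1$1 * v$1 + a$1$2 * v$2))" by (simp add: wdg_def algebra_simps)
    then show ?thesis unfolding e' by (simp add: algebra_simps)
  qed
  have "of_real (wdg u v) * qf a z = of_real (wdg u v * a$2$1) * z\<^sup>2 + of_real (wdg u v * (a$2$2 - a$1$1)) * z - of_real (wdg u v * a$1$2)"
    by (simp add: qf_def algebra_simps)
  also have "\<dots> = of_real (\<mu> - n) * ((of_real (u$1) - of_real (u$2) * z) * (of_real (v$1) - of_real (v$2) * z))"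
    unfolding 1 2 3 by (simp add: power2_eq_square algebra_simps)
  finally show ?thesis by (simp add: n_def)
qed

text \<open>The interval from 1 to \<open>M\<close> is a fundamental domain for multiplication by
  \<open>M\<close>. It moves a point along the axis of a hyperbolic element into a bounded
  piece.\<close>

lemma power_window: assumes "(M::real) > 1" "x > 0"
  shows "(\<exists>n. 1 \<le> x / M^n \<and> x / M^n \<le> M) \<or> (\<exists>n. 1 \<le> x * M^n \<and> x * M^n \<le> M)"
proof -
  have *: "\<exists>n. M^n \<le> y \<and> y < M^Suc n" if y1: "y \<ge> 1" for y
  proof -
    obtain k where k: "y < M^k" using real_arch_pow[OF assms(1)] by blast
    define n where "n = (LEAST k. y < M^k)"
    have n: "y < M^n" unfolding n_def using k by (rule LeastI)
    then obtain n' where n': "n = Suc n'" using y1 by (cases n) auto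
    have "\<not> y < M^n'" using not_less_Least[of n' "\<lambda>k. y < M^k"] n' by (simp add: n_def)
    then show ?thesis using n n' by (auto simp: not_less)
  qed
  show ?thesis
  proof (cases "x \<ge> 1")
    case True
    then obtain n where "M^n \<le> x" "x < M^Suc n" using * by blast
    then have "1 \<le> x / M^n \<and> x / M^n \<le> M" using assms by (simp add: field_simps)
    then show ?thesis by blast
  next
    case False
    then have "1/x \<ge> 1" using assms by simp
    then obtain n where "M^n \<le> 1/x" "1/x < M^Suc n" using * by blast
    then have "1 \<le> x * M^Suc n \<and> x * M^Suc n \<le> M" using assms by (simp add: field_simps)
    then show ?thesis by blast
  qed
qed

section \<open>Cyclic maximal abelian subgroups and thin parts\<close>

context fuchsian begin

lemma lam_nonzero: assumes "m \<in> \<Gamma>" "m \<noteq> mat 1" "tfr l m a" shows "l \<noteq> 0"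
  using nonscal[OF assms(1,2)] assms(3) by (auto simp: tfr_def is_scalar_def)

text \<open>The factor bounds the traceless part, and through the discriminant also the trace, so
  the norm is bounded.\<close>

lemma finite_lam: "finite {m \<in> \<Gamma>. \<exists>l. tfr l m a \<and> \<bar>l\<bar> \<le> L}"
proof -
  define T where "T = sqrt (4 + L\<^sup>2 * \<bar>Dlt a\<bar>)"
  define K where "K = T + \<bar>L\<bar> * \<bar>a$1$1 - a$2$2\<bar> + \<bar>L\<bar> * \<bar>a$1$2\<bar> + \<bar>L\<bar> * \<bar>a$2$1\<bar>"
  show ?thesis
  proof (rule finite_subset[OF _ finite_norm[of K]], safe)
    fix m l assume m: "m \<in> \<Gamma>" "tfr l m a" "\<bar>l\<bar> \<le> L"
    have l2: "l\<^sup>2 \<le> L\<^sup>2" using m(3) by (metis abs_ge_zero power2_abs power_mono)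
    have "(tr2 m)\<^sup>2 = 4 + l\<^sup>2 * Dlt a" using Dlt_tr[OF sub[OF m(1)]] Dlt_tfr[OF m(2)] by simp
    also have "\<dots> \<le> 4 + L\<^sup>2 * \<bar>Dlt a\<bar>"
    proof -
      have "l\<^sup>2 * Dlt a \<le> l\<^sup>2 * \<bar>Dlt a\<bar>" by (intro mult_left_mono) auto
      also have "\<dots> \<le> L\<^sup>2 * \<bar>Dlt a\<bar>" using l2 by (intro mult_right_mono) auto
      finally show ?thesis by simp
    qed
    finally have t: "\<bar>tr2 m\<bar> \<le> T" unfolding T_def by (simp add: real_le_rsqrt)
    have e: "\<bar>m$1$2\<bar> \<le> \<bar>L\<bar> * \<bar>a$1$2\<bar>" "\<bar>m$2$1\<bar> \<le> \<bar>L\<bar> * \<bar>a$2$1\<bar>" "\<bar>m$1$1 - m$2$2\<bar> \<le> \<bar>L\<bar> * \<bar>a$1$1 - a$2$2\<bar>"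
      using m(2,3) by (auto simp: tfr_def abs_mult intro!: mult_right_mono)
    have "\<bar>m$1$1\<bar> + \<bar>m$2$2\<bar> \<le> \<bar>m$1$1 - m$2$2\<bar> + \<bar>tr2 m\<bar>" by (simp add: tr2_def)
    moreover have "norm m \<le> \<bar>m$1$1\<bar> + \<bar>m$2$2\<bar> + \<bar>m$1$2\<bar> + \<bar>m$2$1\<bar>"
    proof -
      have "norm m \<le> (\<Sum>i\<in>UNIV. norm (m$i))" unfolding norm_vec_def by (rule L2_set_le_sum) auto
      also have "\<dots> \<le> (\<Sum>i\<in>UNIV. \<Sum>j\<in>UNIV. \<bar>m$i$j\<bar>)" by (intro sum_mono norm_le_l1_cart)
      finally show ?thesis by (simp add: sum_2)
    qed
    ultimately show "norm m \<le> K" using t e unfolding K_def by linarith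
  qed
qed

lemma tfr_refl: "tfr 1 a a" by (simp add: tfr_def)

lemma tfr_unique: "\<not> is_scalar a \<Longrightarrow> tfr l m a \<Longrightarrow> tfr k m a \<Longrightarrow> l = k"
  by (auto simp: tfr_def is_scalar_def)

lemma min_lam: assumes a: "a \<in> \<Gamma>" "a \<noteq> mat 1"
  shows "\<exists>p\<in>\<Gamma>. \<exists>l0. p \<noteq> mat 1 \<and> tfr l0 p a \<and> (\<forall>m\<in>\<Gamma>. m \<noteq> mat 1 \<longrightarrow> (\<forall>l. tfr l m a \<longrightarrow> \<bar>l0\<bar> \<le> \<bar>l\<bar>))"
proof -
  have ns: "\<not> is_scalar a" using nonscal a by blast
  \<comment> \<open>Factors of modulus at most 1 suffice, since \<open>a\<close> itself has factor
    1; this makes the search for a minimum finite.\<close>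
  define X where "X = {m \<in> \<Gamma>. \<exists>l. tfr l m a \<and> \<bar>l\<bar> \<le> 1} - {mat 1}"
  define L where "L = (\<lambda>m. THE l. tfr l m a)"
  have L: "L m = l" if "tfr l m a" for l m
    unfolding L_def using that tfr_unique[OF ns] by blast
  have X: "finite X" unfolding X_def using finite_lam by auto
  have "tfr 1 a a \<and> \<bar>1::real\<bar> \<le> 1" by (simp add: tfr_refl)
  then have aX: "a \<in> X" using a unfolding X_def by blast
  define p where "p = arg_min_on (\<lambda>m. \<bar>L m\<bar>) X"
  have pX: "p \<in> X" unfolding p_def using arg_min_if_finite(1)[OF X] aX by blast
  have pmin: "\<bar>L p\<bar> \<le> \<bar>L m\<bar>" if "m \<in> X" for m
    using arg_min_if_finite(2)[OF X, of "\<lambda>m. \<bar>L m\<bar>"] aX that unfolding p_def by force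
  obtain l0 where l0: "tfr l0 p a" "\<bar>l0\<bar> \<le> 1" "p \<in> \<Gamma>" "p \<noteq> mat 1" using pX unfolding X_def by auto
  have "\<bar>l0\<bar> \<le> \<bar>l\<bar>" if "m \<in> \<Gamma>" "m \<noteq> mat 1" "tfr l m a" for m l
  proof (cases "\<bar>l\<bar> \<le> 1")
    case True
    then have "m \<in> X" unfolding X_def using that by auto
    then show ?thesis using pmin L[OF l0(1)] L[OF that(3)] by metis
  qed (use l0 in auto)
  then show ?thesis using l0 by blast
qed

text \<open>A Euclidean algorithm on the factors. If \<open>m\<close> has factor \<open>l\<close>
  and \<open>p\<close> the minimal factor \<open>k\<close>, the factors of \<open>m p\<close> and
  \<open>m p^-1\<close> have product \<open>l^2 - k^2\<close>, so one of them is smaller than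
  \<open>l\<close> in modulus. For hyperbolic elements this is the identity
  \<open>sinh(s+t) sinh(s-t) = sinh^2 s - sinh^2 t\<close>.\<close>

lemma cyclic: assumes a: "a \<in> \<Gamma>" "a \<noteq> mat 1"
  shows "\<exists>p\<in>\<Gamma>. comm p a \<and> (\<forall>m\<in>\<Gamma>. comm m a \<longrightarrow> m \<in> cyc p)"
proof -
  have ns: "\<not> is_scalar a" using nonscal a by blast
  obtain p k where p: "p \<in> \<Gamma>" "p \<noteq> mat 1" "tfr k p a" and pm: "\<And>m l. m \<in> \<Gamma> \<Longrightarrow> m \<noteq> mat 1 \<Longrightarrow> tfr l m a \<Longrightarrow> \<bar>k\<bar> \<le> \<bar>l\<bar>"
    using min_lam[OF a] by blast
  have k0: "k \<noteq> 0" using lam_nonzero p by blast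
  \<comment> \<open>Counting the elements with smaller factor turns the descent of a real number
    into induction on a natural number.\<close>
  define N where "N = (\<lambda>l. card {m \<in> \<Gamma>. \<exists>l'. tfr l' m a \<and> \<bar>l'\<bar> < \<bar>l\<bar>})"
  have fin: "finite {m \<in> \<Gamma>. \<exists>l'. tfr l' m a \<and> \<bar>l'\<bar> < \<bar>l\<bar>}" for l
    by (rule finite_subset[OF _ finite_lam[of a "\<bar>l\<bar>"]]) (auto intro: less_imp_le)
  have "m \<in> \<Gamma> \<Longrightarrow> tfr l m a \<Longrightarrow> m \<in> cyc p" for m l
  proof (induction "N l" arbitrary: m l rule: less_induct)
    case less
    show ?case
    proof (cases "m = mat 1")
      case True then show ?thesis using cyc.c1 by simp
    next
      case False
      then have kl: "\<bar>k\<bar> \<le> \<bar>l\<bar>" using pm less.prems by blast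
      define x where "x = (l * tr2 p + k * tr2 m) / 2"
      define y where "y = (l * tr2 p + (-k) * tr2 m) / 2"
      have tx: "tfr x (m ** p) a" unfolding x_def by (rule tfr_mult[OF less.prems(2) p(3)])
      have ty: "tfr y (m ** adj2 p) a" unfolding y_def using tfr_mult[OF less.prems(2) tfr_adj2[OF p(3)]] by simp
      have G: "m ** p \<in> \<Gamma>" "m ** adj2 p \<in> \<Gamma>" using mult adj p less.prems by auto
      have t1: "(tr2 p)\<^sup>2 = 4 + k\<^sup>2 * Dlt a" using Dlt_tr[OF sub[OF p(1)]] Dlt_tfr[OF p(3)] by simp
      have t2: "(tr2 m)\<^sup>2 = 4 + l\<^sup>2 * Dlt a" using Dlt_tr[OF sub[OF less.prems(1)]] Dlt_tfr[OF less.prems(2)] by simp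
      have e: "2 * x = l * tr2 p + k * tr2 m" "2 * y = l * tr2 p - k * tr2 m" by (simp_all add: x_def y_def)
      have "4 * (x * y) = (2 * x) * (2 * y)" by simp
      also have "\<dots> = l\<^sup>2 * (tr2 p)\<^sup>2 - k\<^sup>2 * (tr2 m)\<^sup>2" unfolding e by (simp add: power2_eq_square algebra_simps)
      also have "\<dots> = 4 * (l\<^sup>2 - k\<^sup>2)" unfolding t1 t2 by (simp add: algebra_simps)
      finally have xy: "x * y = l\<^sup>2 - k\<^sup>2" by simp
      have "k\<^sup>2 \<le> l\<^sup>2" using kl by (metis abs_ge_zero power2_abs power_mono)
      then have "\<bar>x * y\<bar> < l\<^sup>2" using xy k0 by simp
      then have letter: "\<bar>x\<bar> < \<bar>l\<bar> \<or> \<bar>y\<bar> < \<bar>l\<bar>"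
      proof (rule contrapos_pp)
        assume "\<not> (\<bar>x\<bar> < \<bar>l\<bar> \<or> \<bar>y\<bar> < \<bar>l\<bar>)"
        then have "\<bar>l\<bar> * \<bar>l\<bar> \<le> \<bar>x\<bar> * \<bar>y\<bar>" by (intro mult_mono) auto
        then show "\<not> \<bar>x * y\<bar> < l\<^sup>2" by (simp add: abs_mult power2_eq_square)
      qed
      have dec: "N l' < N l" if "\<bar>l'\<bar> < \<bar>l\<bar>" "m' \<in> \<Gamma>" "tfr l' m' a" for l' m'
        unfolding N_def
      proof (rule psubset_card_mono[OF fin])
        have "m' \<notin> {m \<in> \<Gamma>. \<exists>l''. tfr l'' m a \<and> \<bar>l''\<bar> < \<bar>l'\<bar>}" using tfr_unique[OF ns that(3)] by auto
        moreover have "m' \<in> {m \<in> \<Gamma>. \<exists>l'. tfr l' m a \<and> \<bar>l'\<bar> < \<bar>l\<bar>}" using that by auto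
        moreover have "{m \<in> \<Gamma>. \<exists>l''. tfr l'' m a \<and> \<bar>l''\<bar> < \<bar>l'\<bar>} \<subseteq> {m \<in> \<Gamma>. \<exists>l'. tfr l' m a \<and> \<bar>l'\<bar> < \<bar>l\<bar>}"
          using that by (auto intro: less_trans)
        ultimately show "{m \<in> \<Gamma>. \<exists>l''. tfr l'' m a \<and> \<bar>l''\<bar> < \<bar>l'\<bar>} \<subset> {m \<in> \<Gamma>. \<exists>l'. tfr l' m a \<and> \<bar>l'\<bar> < \<bar>l\<bar>}" by blast
      qed
      have pS: "p \<in> SL2R" using sub p by simp
      from letter show ?thesis
      proof
        assume "\<bar>x\<bar> < \<bar>l\<bar>"
        then have "m ** p \<in> cyc p" using less.hyps[OF dec[OF _ G(1) tx] G(1) tx] by simp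
        then have "m ** p ** adj2 p \<in> cyc p" by (rule cyc.cm)
        then show ?thesis by (simp add: assoc2 adj2_right[OF pS])
      next
        assume "\<bar>y\<bar> < \<bar>l\<bar>"
        then have "m ** adj2 p \<in> cyc p" using less.hyps[OF dec[OF _ G(2) ty] G(2) ty] by simp
        then have "m ** adj2 p ** p \<in> cyc p" by (rule cyc.cp)
        then show ?thesis by (simp add: assoc2 adj2_left[OF pS])
      qed
    qed
  qed
  moreover have "comm p a" using tfr_comm p by blast
  ultimately show ?thesis using p comm_tfr[OF _ ns] by blast
qed

text \<open>The thin part belonging to the maximal abelian subgroup of \<open>a\<close>.\<close>
definition thin_part :: "real^2^2 \<Rightarrow> complex set" where
  "thin_part a = {z. Im z > 0 \<and> (\<exists>m\<in>\<Gamma>. m \<noteq> mat 1 \<and> comm m a \<and> Nn m z < 1/16)}"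

lemma thin_part_open: "open (thin_part a)"
proof -
  have "open {z. Im z > 0 \<and> Nn m z < 1/16}" if "m \<in> \<Gamma>" for m
  proof -
    have "Nn m z < 1/16 \<longleftrightarrow> (Dsp m z)\<^sup>2 + 4 - 2 * tr2 m < 1/256" if "Im z > 0" for z
    proof -
      have "Nn m z < 1/16 \<longleftrightarrow> (Nn m z)\<^sup>2 < (1/16)\<^sup>2"
        using power2_less_imp_less[of "Nn m z" "1/16"] power_strict_mono[of "Nn m z" "1/16" 2] by (auto simp: Nn_def)
      then show ?thesis using Nn_sq[OF sub[OF \<open>m \<in> \<Gamma>\<close>] that] by (simp add: power2_eq_square)
    qed
    then have "{z. Im z > 0 \<and> Nn m z < 1/16} = H_plane \<inter> (\<lambda>z. (Dsp m z)\<^sup>2 + 4 - 2 * tr2 m) -` {..<1/256}"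
      by (auto simp: H_plane_def)
    moreover have "open \<dots>"
      by (intro continuous_open_preimage continuous_intros continuous_on_Dsp open_H_plane)
    ultimately show ?thesis by simp
  qed
  moreover have "thin_part a = (\<Union>m\<in>{m\<in>\<Gamma>. m \<noteq> mat 1 \<and> comm m a}. {z. Im z > 0 \<and> Nn m z < 1/16})"
    by (auto simp: thin_part_def)
  ultimately show ?thesis by auto
qed

lemma thin_part_eq: assumes "a \<in> \<Gamma>" "a \<noteq> mat 1" "b \<in> \<Gamma>" "b \<noteq> mat 1" "comm a b" shows "thin_part a = thin_part b"
proof -
  have "comm m a \<longleftrightarrow> comm m b" for m
    using comm_trans[of m a b] comm_trans[of m b a] assms nonscal comm_sym[of a b] by blast
  then show ?thesis by (simp add: thin_part_def)
qed

text \<open>Two elements that are small at the same point commute by \<open>Zassenhaus\<close>, and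
  commutation passes on through non-scalar elements.\<close>

lemma thin_part_disj: assumes "a \<in> \<Gamma>" "a \<noteq> mat 1" "b \<in> \<Gamma>" "b \<noteq> mat 1" "z \<in> thin_part a" "z \<in> thin_part b" shows "comm a b"
proof -
  obtain m where m: "m \<in> \<Gamma>" "m \<noteq> mat 1" "comm m a" "Nn m z < 1/16" "Im z > 0" using assms unfolding thin_part_def by blast
  obtain k where k: "k \<in> \<Gamma>" "k \<noteq> mat 1" "comm k b" "Nn k z < 1/16" using assms unfolding thin_part_def by blast
  have "comm m k" using Zassenhaus[OF m(1,2) _ k(1) _ m(5)] m(4) k(4) by simp
  then have "comm a k" using comm_trans[of a m k] m nonscal comm_sym by blast
  then show ?thesis using comm_trans[of a k b] k nonscal by blast
qed

lemma thin_part_equiv: assumes "\<gamma> \<in> \<Gamma>" "z \<in> thin_part a" shows "mobR \<gamma> z \<in> thin_part (\<gamma> ** a ** adj2 \<gamma>)"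
proof -
  obtain m where m: "m \<in> \<Gamma>" "m \<noteq> mat 1" "comm m a" "Nn m z < 1/16" "Im z > 0" using assms unfolding thin_part_def by blast
  have g: "\<gamma> \<in> SL2R" using sub assms by simp
  have "Nn (\<gamma> ** m ** adj2 \<gamma>) (mobR \<gamma> z) < 1/16" using Nn_equiv[OF g sub[OF m(1)] m(5)] m by simp
  then show ?thesis unfolding thin_part_def
    using conj_in[OF m(1) assms(1)] conj_nonempty[OF assms(1) m(2)] comm_conj[OF m(3) g] Im_mobR_pos[OF g m(5)] by blast
qed

lemma thin_part_H: "z \<in> thin_part a \<Longrightarrow> Im z > 0" by (simp add: thin_part_def)

text \<open>The element that is small at \<open>z\<close> has displacement below 1, and its factor
  is at least the minimal one in modulus. For parabolic \<open>a\<close> this puts the thin part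
  into a horoball, for hyperbolic \<open>a\<close> into a tube about the axis.\<close>

lemma thin_part_Dsp: assumes a: "a \<in> \<Gamma>" "a \<noteq> mat 1" shows "\<exists>r>0. \<forall>z\<in>thin_part a. Dsp a z < r"
proof -
  have ns: "\<not> is_scalar a" using nonscal a by blast
  obtain p k where p: "p \<in> \<Gamma>" "p \<noteq> mat 1" "tfr k p a" and pm: "\<And>m l. m \<in> \<Gamma> \<Longrightarrow> m \<noteq> mat 1 \<Longrightarrow> tfr l m a \<Longrightarrow> \<bar>k\<bar> \<le> \<bar>l\<bar>"
    using min_lam[OF a] by blast
  have k0: "\<bar>k\<bar> > 0" using lam_nonzero p by simp
  have "Dsp a z < 1 / \<bar>k\<bar>" if zO: "z \<in> thin_part a" for z
  proof -
    obtain m where m: "m \<in> \<Gamma>" "m \<noteq> mat 1" "comm m a" "Nn m z < 1/16" "Im z > 0" using zO unfolding thin_part_def by blast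
    obtain l where l: "tfr l m a" using comm_tfr[OF m(3) ns] by blast
    have "\<bar>k\<bar> * Dsp a z \<le> \<bar>l\<bar> * Dsp a z" using pm[OF m(1,2) l] Dsp_nonneg[OF m(5)] by (intro mult_right_mono) auto
    also have "\<dots> = Dsp m z" by (rule Dsp_tfr[OF l, symmetric])
    also have "\<dots> < 1" using Dsp_lt1[OF sub[OF m(1)] m(5,4)] .
    finally show ?thesis using k0 by (simp add: field_simps)
  qed
  then show ?thesis using k0 by (intro exI[of _ "1/\<bar>k\<bar>"]) auto
qed

text \<open>A power of \<open>a\<close> brings the height over one fixed point into the window from
  1 to \<open>M\<close>. The product of the two heights is a multiple of the squared displacement,
  hence bounded, so both heights are bounded and \<open>hb_le_of_eta\<close> applies.\<close>

lemma hyperbolic_cocompact: assumes a: "a \<in> \<Gamma>" "Dlt a > 0"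
  shows "\<exists>C. \<forall>z. Im z > 0 \<longrightarrow> Dsp a z < r \<longrightarrow> (\<exists>\<gamma>\<in>\<Gamma>. hb (mobR \<gamma> z) \<le> C)"
proof -
  have aS: "a \<in> SL2R" using sub a by simp
  obtain u v \<mu> where uv: "\<mu>\<^sup>2 > 1" "wdg u v \<noteq> 0" "a *v u = \<mu> *\<^sub>R u" "a *v v = (1/\<mu>) *\<^sub>R v"
    using hyperbolic_eigen[OF aS a(2)] by blast
  have mu0: "\<mu> \<noteq> 0" using uv by auto
  have mu1: "\<mu> - 1/\<mu> \<noteq> 0"
  proof
    assume "\<mu> - 1/\<mu> = 0" then have "\<mu>\<^sup>2 = 1" using mu0 by (simp add: field_simps power2_eq_square)
    then show False using uv by simp
  qed
  define M where "M = \<mu>\<^sup>2"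
  have M: "M > 1" using uv by (simp add: M_def)
  have step: "eta u (mobR a z) = eta u z / M" "eta v (mobR a z) = eta v z * M"
    "eta u (mobR (adj2 a) z) = eta u z * M" "eta v (mobR (adj2 a) z) = eta v z / M" if "Im z > 0" for z
  proof -
    have gen: "eta u (mobR a z) = eta u z / M" "eta v (mobR a z) = eta v z * M" if "Im z > 0" for z
    proof -
      have "M * eta u (mobR a z) = eta u z" using eta_equiv[OF aS that, of u] uv by (simp add: eta_scale M_def)
      then show "eta u (mobR a z) = eta u z / M" using M by (simp add: field_simps)
      have "eta v (mobR a z) / M = eta v z" using eta_equiv[OF aS that, of v] uv by (simp add: eta_scale M_def power_divide)
      then show "eta v (mobR a z) = eta v z * M" using M by (simp add: field_simps)
    qed
    show "eta u (mobR a z) = eta u z / M" "eta v (mobR a z) = eta v z * M" using gen that by auto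
    have z': "Im (mobR (adj2 a) z) > 0" using Im_mobR_pos[OF SL2R_adj[OF aS] that] .
    show "eta u (mobR (adj2 a) z) = eta u z * M" "eta v (mobR (adj2 a) z) = eta v z / M"
      using gen[OF z'] mobR_adj_cancel(2)[OF aS that] M by (simp_all add: field_simps)
  qed
  have pw1: "\<exists>\<gamma>\<in>\<Gamma>. \<forall>z. Im z > 0 \<longrightarrow> eta u (mobR \<gamma> z) = eta u z / M^n \<and> eta v (mobR \<gamma> z) = eta v z * M^n" for n
  proof (induction n)
    case 0 then show ?case using one by (intro bexI[of _ "mat 1"]) auto
  next
    case (Suc n)
    then obtain g where g: "g \<in> \<Gamma>" "\<And>z. Im z > 0 \<Longrightarrow> eta u (mobR g z) = eta u z / M^n \<and> eta v (mobR g z) = eta v z * M^n" by blast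
    show ?case
    proof (intro bexI[of _ "a ** g"] allI impI)
      fix z assume z: "Im z > 0"
      show "eta u (mobR (a ** g) z) = eta u z / M^Suc n \<and> eta v (mobR (a ** g) z) = eta v z * M^Suc n"
        using mobR_mult[OF sub[OF g(1)] z, of a] step[OF Im_mobR_pos[OF sub[OF g(1)] z]] g(2)[OF z] by simp
    qed (use g a mult in auto)
  qed
  have pw2: "\<exists>\<gamma>\<in>\<Gamma>. \<forall>z. Im z > 0 \<longrightarrow> eta u (mobR \<gamma> z) = eta u z * M^n \<and> eta v (mobR \<gamma> z) = eta v z / M^n" for n
  proof (induction n)
    case 0 then show ?case using one by (intro bexI[of _ "mat 1"]) auto
  next
    case (Suc n)
    then obtain g where g: "g \<in> \<Gamma>" "\<And>z. Im z > 0 \<Longrightarrow> eta u (mobR g z) = eta u z * M^n \<and> eta v (mobR g z) = eta v z / M^n" by blast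
    show ?case
    proof (intro bexI[of _ "adj2 a ** g"] allI impI)
      fix z assume z: "Im z > 0"
      show "eta u (mobR (adj2 a ** g) z) = eta u z * M^Suc n \<and> eta v (mobR (adj2 a ** g) z) = eta v z / M^Suc n"
        using mobR_mult[OF sub[OF g(1)] z, of "adj2 a"] step[OF Im_mobR_pos[OF sub[OF g(1)] z]] g(2)[OF z] by simp
    qed (use g a mult adj in auto)
  qed
  define K where "K = (wdg u v)\<^sup>2 / (\<mu> - 1/\<mu>)\<^sup>2"
  have K: "K > 0" using uv mu1 by (simp add: K_def)
  have prod: "eta u z * eta v z = K * (Dsp a z)\<^sup>2" if "Im z > 0" for z
  proof -
    let ?l = "of_real (u$1) - of_real (u$2) * z" and ?k = "of_real (v$1) - of_real (v$2) * z"
    have "cmod (of_real (wdg u v) * qf a z) = cmod (of_real (\<mu> - 1/\<mu>) * (?l * ?k))"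
      using eigen_Dsp[OF uv(3,4) mu0, of z] by simp
    then have "\<bar>wdg u v\<bar> * cmod (qf a z) = \<bar>\<mu> - 1/\<mu>\<bar> * (cmod ?l * cmod ?k)"
      unfolding norm_mult norm_of_real .
    then have "(wdg u v)\<^sup>2 * (cmod (qf a z))\<^sup>2 = (\<mu> - 1/\<mu>)\<^sup>2 * ((cmod ?l)\<^sup>2 * (cmod ?k)\<^sup>2)"
      by (metis power2_abs power_mult_distrib)
    then have "(cmod ?l)\<^sup>2 * (cmod ?k)\<^sup>2 = K * (cmod (qf a z))\<^sup>2" using mu1 by (simp add: K_def nonzero_eq_divide_eq mult.commute)
    then show ?thesis by (simp add: eta_def Dsp_def power_divide power2_eq_square)
  qed
  define B where "B = max M (K * r\<^sup>2)"
  show ?thesis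
  proof (intro exI allI impI)
    fix z assume z: "Im z > 0" "Dsp a z < r"
    have e0: "eta u z \<ge> 0" "eta v z \<ge> 0" using eta_nonneg z by auto
    have eu: "eta u z > 0"
    proof -
      have "eta u z \<noteq> 0"
      proof
        assume "eta u z = 0"
        then have "of_real (u$1) - of_real (u$2) * z = 0" using z by (simp add: eta_def)
        then have "u$1 - u$2 * Re z = 0" "u$2 * Im z = 0" by (auto simp: complex_eq_iff)
        then have "u = 0" using z by (auto simp: vec2_eq)
        then show False using uv(2) by (simp add: wdg_def)
      qed
      then show ?thesis using e0 by simp
    qed
    obtain g where g: "g \<in> \<Gamma>" "1 \<le> eta u (mobR g z)" "eta u (mobR g z) \<le> M" "eta u (mobR g z) * eta v (mobR g z) = eta u z * eta v z"
    proof -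
      from power_window[OF M eu] show thesis
      proof
        assume "\<exists>n. 1 \<le> eta u z / M^n \<and> eta u z / M^n \<le> M"
        then obtain n where n: "1 \<le> eta u z / M^n" "eta u z / M^n \<le> M" by blast
        obtain g where "g \<in> \<Gamma>" "eta u (mobR g z) = eta u z / M^n" "eta v (mobR g z) = eta v z * M^n" using pw1 z by blast
        then show thesis using that[of g] n M by simp
      next
        assume "\<exists>n. 1 \<le> eta u z * M^n \<and> eta u z * M^n \<le> M"
        then obtain n where n: "1 \<le> eta u z * M^n" "eta u z * M^n \<le> M" by blast
        obtain g where "g \<in> \<Gamma>" "eta u (mobR g z) = eta u z * M^n" "eta v (mobR g z) = eta v z / M^n" using pw2 z by blast
        then show thesis using that[of g] n M by simp
      qed
    qed
    have z': "Im (mobR g z) > 0" using Im_mobR_pos sub g z by blast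
    have "eta v (mobR g z) \<le> eta u (mobR g z) * eta v (mobR g z)"
      using g(2) eta_nonneg[OF z', of v] by (simp add: mult_le_cancel_right1)
    also have "\<dots> = K * (Dsp a z)\<^sup>2" using g(4) prod z by simp
    also have "\<dots> \<le> K * r\<^sup>2" using z Dsp_nonneg[OF z(1), of a] K by (intro mult_left_mono power_mono) auto
    finally have "eta v (mobR g z) \<le> B" by (simp add: B_def)
    moreover have "eta u (mobR g z) \<le> B" using g by (simp add: B_def)
    ultimately have "hb (mobR g z) \<le> 2 * B * ((norm u)\<^sup>2 + (norm v)\<^sup>2) / (wdg u v)\<^sup>2"
      using hb_le_of_eta[OF z' _ _ uv(2)] by blast
    then show "\<exists>\<gamma>\<in>\<Gamma>. hb (mobR \<gamma> z) \<le> 2 * B * ((norm u)\<^sup>2 + (norm v)\<^sup>2) / (wdg u v)\<^sup>2" using g by blast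
  qed
qed

lemma finite_Nn: "finite {f\<in>\<Gamma>. \<exists>z. Im z > 0 \<and> hb z \<le> C \<and> Nn f z < 1/16}"
proof (rule finite_subset[OF _ finite_norm[of "3/2 + C/16"]], safe)
  fix f z assume f: "f \<in> \<Gamma>" and z: "Im z > 0" "hb z \<le> C" "Nn f z < 1/16"
  have "hb z > 0" using hb_pos z by simp
  have "norm (f - mat 1) \<le> hb z * Nn f z" by (rule norm_le_Nn[OF z(1)])
  also have "\<dots> \<le> C * (1/16)" using z \<open>hb z > 0\<close> by (intro mult_mono) (auto simp: Nn_def)
  finally show "norm f \<le> 3/2 + C/16" using norm_triangle_sub[of f "mat 1"] norm_mat1 by simp
qed

text \<open>The plane is connected, and the open set \<open>thin_part m\<close> together with the
  open set \<open>W\<close> covers it, so they meet. They cannot meet in another thin part, so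
  \<open>thin_part m\<close> reaches a translate of the bounded region. Only finitely many elements
  are small there, which leaves finitely many thin parts up to translation.\<close>

lemma thin_classes:
  assumes C: "C > 2" "\<And>z. thick (1/16) z \<Longrightarrow> \<exists>\<gamma>\<in>\<Gamma>. hb (mobR \<gamma> z) < C" and m: "m \<in> \<Gamma>" "m \<noteq> mat 1" "thin_part m \<noteq> {}"
  shows "\<exists>\<gamma>\<in>\<Gamma>. \<exists>f\<in>\<Gamma>. f \<noteq> mat 1 \<and> (\<exists>z. Im z > 0 \<and> hb z < C \<and> Nn f z < 1/16) \<and> comm (\<gamma> ** f ** adj2 \<gamma>) m"
proof -
  define W where "W = (\<Union>\<gamma>\<in>\<Gamma>. {z. Im z > 0 \<and> hb (mobR \<gamma> z) < C}) \<union> (\<Union>b\<in>{b\<in>\<Gamma>. b \<noteq> mat 1 \<and> \<not> comm b m}. thin_part b)"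
  have Wo: "open W"
  proof -
    have "open {z. Im z > 0 \<and> hb (mobR \<gamma> z) < C}" if "\<gamma> \<in> \<Gamma>" for \<gamma>
    proof -
      have "continuous_on H_plane (\<lambda>z. hb (mobR \<gamma> z))"
        using continuous_on_mobR[OF sub[OF that]] continuous_on_compose2[OF continuous_on_hb]
          Im_mobR_pos[OF sub[OF that]] by (force simp: H_plane_def)
      from continuous_open_preimage[OF this open_H_plane, of "{..<C}"]
      have "open (H_plane \<inter> (\<lambda>z. hb (mobR \<gamma> z)) -` {..<C})" by simp
      moreover have "H_plane \<inter> (\<lambda>z. hb (mobR \<gamma> z)) -` {..<C} = {z. Im z > 0 \<and> hb (mobR \<gamma> z) < C}" by (auto simp: H_plane_def)
      ultimately show ?thesis by simp
    qed
    then show ?thesis unfolding W_def using thin_part_open by auto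
  qed
  have HW: "H_plane \<subseteq> thin_part m \<union> W"
  proof
    fix z assume "z \<in> H_plane"
    then have z: "Im z > 0" by (simp add: H_plane_def)
    show "z \<in> thin_part m \<union> W"
    proof (cases "thick (1/16) z")
      case True then show ?thesis using C(2)[OF True] z unfolding W_def by blast
    next
      case False
      then obtain k where k: "k \<in> \<Gamma>" "k \<noteq> mat 1" "Nn k z < 1/16" using z unfolding thick_def by force
      have zk: "z \<in> thin_part k" unfolding thin_part_def using k z comm_refl by blast
      show ?thesis
      proof (cases "comm k m")
        case True then show ?thesis using zk thin_part_eq[OF k(1,2) m(1,2)] by simp
      next
        case False then show ?thesis using zk k unfolding W_def by blast
      qed
    qed
  qed
  have "convex H_plane" unfolding H_plane_def by (rule convex_halfspace_Im_gt)
  then have conn: "connected H_plane" by (rule convex_connected)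
  \<comment> \<open>Here \<open>C > 2\<close> is used: \<open>hb\<close> takes the value 2 at
    \<open>i\<close>.\<close>
  have "\<i> \<in> W" unfolding W_def using one C(1) by (auto simp: hb_def intro!: bexI[of _ "mat 1"])
  moreover have "\<i> \<in> H_plane" by (simp add: H_plane_def)
  ultimately have "H_plane \<inter> W \<noteq> {}" by blast
  moreover have "H_plane \<inter> thin_part m \<noteq> {}" using m(3) thin_part_H by (auto simp: H_plane_def)
  ultimately have "thin_part m \<inter> W \<inter> H_plane \<noteq> {}"
    using conn HW Wo thin_part_open unfolding connected_def by blast
  then obtain z where z: "z \<in> thin_part m" "z \<in> W" by blast
  have "z \<notin> thin_part b" if "b \<in> \<Gamma>" "b \<noteq> mat 1" "\<not> comm b m" for b
    using thin_part_disj[OF that(1,2) m(1,2) _ z(1)] that by blast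
  then obtain g where g: "g \<in> \<Gamma>" "hb (mobR g z) < C" "Im z > 0" using z(2) unfolding W_def by blast
  obtain k where k: "k \<in> \<Gamma>" "k \<noteq> mat 1" "comm k m" "Nn k z < 1/16" using z unfolding thin_part_def by blast
  have gS: "g \<in> SL2R" using sub g by simp
  define f where "f = g ** k ** adj2 g"
  have "Nn f (mobR g z) < 1/16" using Nn_equiv[OF gS sub[OF k(1)] g(3)] k by (simp add: f_def)
  moreover have "adj2 g ** f ** adj2 (adj2 g) = k" using gS by (simp add: f_def assoc2 conj_cancel adj2_left)
  moreover have "f \<in> \<Gamma>" "f \<noteq> mat 1" using conj_in[OF k(1) g(1)] conj_nonempty[OF g(1) k(2)] by (auto simp: f_def)
  ultimately show ?thesis using adj[OF g(1)] k(3) g(2) Im_mobR_pos[OF gS g(3)] by metis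
qed

end

lemma compact_hb: "compact {z. Im z > 0 \<and> hb z \<le> C}"
proof (cases "C > 0")
  case False
  have "{z. Im z > 0 \<and> hb z \<le> C} = {}" using hb_pos False by force
  then show ?thesis by (simp only: compact_empty)
next
  case True
  have eq: "{z. Im z > 0 \<and> hb z \<le> C} = {z. 1 + (cmod z)\<^sup>2 \<le> C * Im z}"
  proof (intro set_eqI iffI; clarsimp)
    fix z assume "0 < Im z" "hb z \<le> C" then show "1 + (cmod z)\<^sup>2 \<le> C * Im z" by (simp add: hb_def field_simps)
  next
    fix z assume *: "1 + (cmod z)\<^sup>2 \<le> C * Im z"
    then have "C * Im z > 0" by (smt (verit) zero_le_power2)
    then have "Im z > 0" using True by (simp add: zero_less_mult_iff)
    then show "0 < Im z \<and> hb z \<le> C" using * by (simp add: hb_def field_simps)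
  qed
  have "closed {z. 1 + (cmod z)\<^sup>2 \<le> C * Im z}" by (intro closed_Collect_le continuous_intros)
  moreover have "bounded {z. Im z > 0 \<and> hb z \<le> C}"
  proof (rule boundedI)
    fix z assume "z \<in> {z. Im z > 0 \<and> hb z \<le> C}"
    then have z: "Im z > 0" "1 + (cmod z)\<^sup>2 \<le> C * Im z" using eq by auto
    have "C * Im z \<le> C * cmod z" using True abs_Im_le_cmod[of z] by (intro mult_left_mono) auto
    then have "(cmod z)\<^sup>2 \<le> C * cmod z" using z by linarith
    then show "norm z \<le> C" using True by (cases "cmod z = 0") (auto simp: power2_eq_square)
  qed
  ultimately show ?thesis using eq by (simp add: compact_eq_bounded_closed)
qed

section \<open>Overlaps of translates and the finite list of cusps\<close>

context fuchsian begin

text \<open>After conjugation by the inverse of \<open>t\<close>, the element carries a member of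
  the abelian group of \<open>f\<close> to one that commutes with it, and \<open>malnormal\<close>
  places the element in that group.\<close>

lemma coset: assumes m: "m \<in> \<Gamma>" "m \<noteq> mat 1" "comm m f" and k: "k \<in> \<Gamma>" "k \<noteq> mat 1" "comm k f"
  and f: "f \<in> \<Gamma>" "f \<noteq> mat 1" and g: "\<gamma> \<in> \<Gamma>" and t: "t \<in> \<Gamma>"
  and c: "comm (\<gamma> ** m ** adj2 \<gamma>) (t ** k ** adj2 t)"
  shows "comm (adj2 t ** \<gamma>) f"
proof -
  define \<delta> where "\<delta> = adj2 t ** \<gamma>"
  have d: "\<delta> \<in> \<Gamma>" using g t mult adj by (simp add: \<delta>_def)
  have tS: "t \<in> SL2R" using sub t by simp
  have "comm (adj2 t ** (\<gamma> ** m ** adj2 \<gamma>) ** adj2 (adj2 t)) (adj2 t ** (t ** k ** adj2 t) ** adj2 (adj2 t))"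
    by (rule comm_conj[OF c SL2R_adj[OF tS]])
  moreover have "adj2 t ** (\<gamma> ** m ** adj2 \<gamma>) ** adj2 (adj2 t) = \<delta> ** m ** adj2 \<delta>"
    by (simp add: \<delta>_def adj2_mult assoc2)
  moreover have "adj2 t ** (t ** k ** adj2 t) ** adj2 (adj2 t) = k"
    using tS by (simp add: assoc2 conj_cancel adj2_left)
  ultimately have 1: "comm (\<delta> ** m ** adj2 \<delta>) k" by simp
  have "comm k m" using comm_trans[OF k(3), of m] comm_sym m(3) nonscal[OF f] by blast
  then have "comm (\<delta> ** m ** adj2 \<delta>) m" using comm_trans[OF 1 _ nonscal[OF k(1,2)]] by blast
  then have "comm m \<delta>" by (rule malnormal[OF m(1,2) d])
  then have "comm \<delta> f" using comm_trans[of \<delta> m f] comm_sym m(3) nonscal[OF m(1,2)] by blast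
  then show ?thesis by (simp add: \<delta>_def)
qed

text \<open>An element carrying a thin point into the bounded region conjugates a small element to
  one of the finitely many elements of \<Phi>. One representative per value suffices, since by
  \<open>coset\<close> two elements with the same value differ by the stabiliser.\<close>

lemma overlap_ball:
  assumes f: "f \<in> \<Gamma>" "f \<noteq> mat 1"
  shows "\<exists>T. finite T \<and> T \<subseteq> \<Gamma> \<and> (\<forall>\<gamma>\<in>\<Gamma>. \<forall>z\<in>thin_part f. hb (mobR \<gamma> z) \<le> C \<longrightarrow> (\<exists>t\<in>T. \<exists>\<delta>\<in>\<Gamma>. comm \<delta> f \<and> \<gamma> = t ** \<delta>))"
proof -
  define \<Phi> where "\<Phi> = {\<phi>\<in>\<Gamma>. \<exists>z. Im z > 0 \<and> hb z \<le> C \<and> Nn \<phi> z < 1/16}"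
  define P where "P = (\<lambda>\<phi> \<gamma>. \<gamma> \<in> \<Gamma> \<and> (\<exists>m\<in>\<Gamma>. m \<noteq> mat 1 \<and> comm m f \<and> \<gamma> ** m ** adj2 \<gamma> = \<phi>))"
  define T where "T = (\<lambda>\<phi>. SOME \<gamma>. P \<phi> \<gamma>) ` {\<phi>\<in>\<Phi>. \<exists>\<gamma>. P \<phi> \<gamma>}"
  have G: "P \<phi> (SOME \<gamma>. P \<phi> \<gamma>)" if "\<exists>\<gamma>. P \<phi> \<gamma>" for \<phi> using that by (rule someI_ex)
  have "finite \<Phi>" unfolding \<Phi>_def by (rule finite_Nn)
  then have "finite {\<phi>\<in>\<Phi>. \<exists>\<gamma>. P \<phi> \<gamma>}" by (rule rev_finite_subset) blast
  then have T1: "finite T" unfolding T_def by (rule finite_imageI)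
  have T2: "T \<subseteq> \<Gamma>"
  proof
    fix t assume "t \<in> T"
    then obtain \<phi> where "\<exists>\<gamma>. P \<phi> \<gamma>" "t = (SOME \<gamma>. P \<phi> \<gamma>)" unfolding T_def by blast
    then have "P \<phi> t" using G by simp
    then show "t \<in> \<Gamma>" by (simp add: P_def)
  qed
  have T3: "\<exists>t\<in>T. \<exists>\<delta>\<in>\<Gamma>. comm \<delta> f \<and> \<gamma> = t ** \<delta>" if g: "\<gamma> \<in> \<Gamma>" and z: "z \<in> thin_part f" "hb (mobR \<gamma> z) \<le> C" for \<gamma> z
  proof -
    obtain m where m: "m \<in> \<Gamma>" "m \<noteq> mat 1" "comm m f" "Nn m z < 1/16" "Im z > 0" using z(1) unfolding thin_part_def by blast
    define \<phi> where "\<phi> = \<gamma> ** m ** adj2 \<gamma>"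
    have gS: "\<gamma> \<in> SL2R" using sub g by simp
    have P: "P \<phi> \<gamma>" unfolding P_def \<phi>_def using g m by blast
    have "Nn \<phi> (mobR \<gamma> z) < 1/16" using Nn_equiv[OF gS sub[OF m(1)] m(5)] m by (simp add: \<phi>_def)
    moreover have "\<phi> \<in> \<Gamma>" using conj_in[OF m(1) g] by (simp add: \<phi>_def)
    ultimately have "\<phi> \<in> \<Phi>" unfolding \<Phi>_def using z(2) Im_mobR_pos[OF gS m(5)] by blast
    define t where "t = (SOME \<gamma>. P \<phi> \<gamma>)"
    have tT: "t \<in> T" unfolding T_def t_def using \<open>\<phi> \<in> \<Phi>\<close> P by blast
    have "P \<phi> t" unfolding t_def using G P by blast
    then obtain k where t: "t \<in> \<Gamma>" "k \<in> \<Gamma>" "k \<noteq> mat 1" "comm k f" "t ** k ** adj2 t = \<phi>" unfolding P_def by blast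
    have "comm (\<gamma> ** m ** adj2 \<gamma>) (t ** k ** adj2 t)" unfolding t(5) \<phi>_def by (rule comm_refl)
    then have "comm (adj2 t ** \<gamma>) f" by (rule coset[OF m(1-3) t(2-4) f g t(1)])
    moreover have "\<gamma> = t ** (adj2 t ** \<gamma>)" using conj_cancel sub t by simp
    moreover have "adj2 t ** \<gamma> \<in> \<Gamma>" using mult adj t g by blast
    ultimately show ?thesis using tT by blast
  qed
  show ?thesis
  proof (intro exI[of _ T] conjI ballI impI)
    fix \<gamma> z assume "\<gamma> \<in> \<Gamma>" "z \<in> thin_part f" "hb (mobR \<gamma> z) \<le> C"
    then show "\<exists>t\<in>T. \<exists>\<delta>\<in>\<Gamma>. comm \<delta> f \<and> \<gamma> = t ** \<delta>" by (rule T3)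
  qed (rule T1 T2)+
qed

text \<open>Overlapping thin parts belong to commuting elements, so all elements realising an
  overlap lie in one coset of the stabiliser and a single representative is enough.\<close>

lemma overlap_thin_part:
  assumes f: "f \<in> \<Gamma>" "f \<noteq> mat 1" and e: "e \<in> \<Gamma>" "e \<noteq> mat 1"
  shows "\<exists>T. finite T \<and> T \<subseteq> \<Gamma> \<and> (\<forall>\<gamma>\<in>\<Gamma>. \<forall>z\<in>thin_part f. mobR \<gamma> z \<in> thin_part e \<longrightarrow> (\<exists>t\<in>T. \<exists>\<delta>\<in>\<Gamma>. comm \<delta> f \<and> \<gamma> = t ** \<delta>))"
proof (cases "\<exists>t\<in>\<Gamma>. \<exists>z\<in>thin_part f. mobR t z \<in> thin_part e")
  case False
  then show ?thesis by (intro exI[of _ "{}"]) blast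
next
  case True
  have *: "comm (\<gamma> ** f ** adj2 \<gamma>) e" if "\<gamma> \<in> \<Gamma>" "z \<in> thin_part f" "mobR \<gamma> z \<in> thin_part e" for \<gamma> z
    using thin_part_disj[OF conj_in[OF f(1) that(1)] conj_nonempty[OF that(1) f(2)] e] thin_part_equiv[OF that(1,2)] that(3) by blast
  obtain t z where t: "t \<in> \<Gamma>" "z \<in> thin_part f" "mobR t z \<in> thin_part e" using True by blast
  have "\<exists>\<delta>\<in>\<Gamma>. comm \<delta> f \<and> \<gamma> = t ** \<delta>" if g: "\<gamma> \<in> \<Gamma>" "z \<in> thin_part f" "mobR \<gamma> z \<in> thin_part e" for \<gamma> z
  proof -
    have "comm (\<gamma> ** f ** adj2 \<gamma>) (t ** f ** adj2 t)"
      using comm_trans[of "\<gamma> ** f ** adj2 \<gamma>" e "t ** f ** adj2 t"] *[OF g] *[OF t] comm_sym nonscal[OF e] by blast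
    then have "comm (adj2 t ** \<gamma>) f" by (rule coset[OF f comm_refl f comm_refl f g(1) t(1)])
    moreover have "\<gamma> = t ** (adj2 t ** \<gamma>)" using conj_cancel sub t by simp
    moreover have "adj2 t ** \<gamma> \<in> \<Gamma>" using mult adj t g by blast
    ultimately show ?thesis by blast
  qed
  then show ?thesis using t(1) by (intro exI[of _ "{t}"]) blast
qed

text \<open>At \<open>i\<close> the squared norm of the vector is the displacement of
  \<open>f\<close>, which discreteness bounds below. For trace -2 the square of \<open>f\<close> is
  used instead; its displacement is twice as large, whence \<epsilon>/2. Conjugates of
  \<open>f\<close> are covered too, so the bound holds for all translates of cusp vectors.\<close>

lemma cusp_vector_lower:
  "\<exists>c>0. \<forall>f\<in>\<Gamma>. f \<noteq> mat 1 \<longrightarrow> Dlt f = 0 \<longrightarrow> (\<forall>v. (\<forall>z. Dsp f z = eta v z) \<longrightarrow> c \<le> norm v)"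
proof -
  obtain \<epsilon> where e: "\<epsilon> > 0" "\<And>g. g \<in> \<Gamma> \<Longrightarrow> g \<noteq> mat 1 \<Longrightarrow> \<epsilon> \<le> norm (g - mat 1)" using discrete by auto
  have i: "Im \<i> > 0" by simp
  have "hm \<i> = mat 1" by (simp add: hm_def mat2_eq)
  then have Nni: "Nn g \<i> = norm (g - mat 1)" for g by (simp add: Nn_def)
  have D: "\<epsilon> / 2 \<le> Dsp f \<i>" if f: "f \<in> \<Gamma>" "f \<noteq> mat 1" "Dlt f = 0" for f
  proof -
    have fS: "f \<in> SL2R" using sub f by simp
    have "(tr2 f)\<^sup>2 = 4" using Dlt_tr[OF fS] f(3) by simp
    then have "(tr2 f - 2) * (tr2 f + 2) = 0" by (simp add: power2_eq_square algebra_simps)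
    then consider "tr2 f = 2" | "tr2 f = -2" by auto
    then show ?thesis
    proof cases
      case 1
      have "(Nn f \<i>)\<^sup>2 = (Dsp f \<i>)\<^sup>2" using Nn_sq[OF fS i] 1 by simp
      then have "Nn f \<i> = Dsp f \<i>" using Dsp_nonneg[OF i, of f] by (simp add: Nn_def)
      then show ?thesis using e(2)[OF f(1,2)] e(1) Nni by simp
    next
      case 2
      have t: "tfr (-2) (f ** f) f" using tfr_mult[OF tfr_refl tfr_refl, of f] 2 by simp
      have G: "f ** f \<in> \<Gamma>" using mult f by blast
      have ne: "f ** f \<noteq> mat 1"
      proof
        assume "f ** f = mat 1"
        then have "is_scalar f" using t by (simp add: tfr_def is_scalar_def)
        then show False using nonscal f by blast
      qed
      have "tr2 (f ** f) = (tr2 f)\<^sup>2 - 2"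
        using fS by (simp add: tr2_def mult2 SL2R_iff power2_eq_square algebra_simps)
      then have tr: "tr2 (f ** f) = 2" using 2 by simp
      have "(Nn (f ** f) \<i>)\<^sup>2 = (Dsp (f ** f) \<i>)\<^sup>2" using Nn_sq[OF sub[OF G] i] tr by simp
      then have "Nn (f ** f) \<i> = Dsp (f ** f) \<i>" using Dsp_nonneg[OF i, of "f ** f"] by (simp add: Nn_def)
      also have "\<dots> = 2 * Dsp f \<i>" using Dsp_tfr[OF t] by simp
      finally show ?thesis using e(2)[OF G ne] Nni by simp
    qed
  qed
  have "sqrt (\<epsilon>/2) \<le> norm v" if "f \<in> \<Gamma>" "f \<noteq> mat 1" "Dlt f = 0" "\<forall>z. Dsp f z = eta v z" for f v
  proof -
    have "eta v \<i> = (norm v)\<^sup>2" using eta_geo[of v 0] by (simp add: normv2_sq)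
    then have "\<epsilon>/2 \<le> (norm v)\<^sup>2" using D[OF that(1-3)] that(4) by simp
    then show ?thesis by (intro real_le_lsqrt) auto
  qed
  then show ?thesis using e(1) by (intro exI[of _ "sqrt (\<epsilon>/2)"]) auto
qed

lemma eta_unbounded: assumes "v \<noteq> 0" shows "\<exists>z. Im z > 0 \<and> eta v z > B"
proof -
  define k where "k = (v$1)\<^sup>2 + (v$2)\<^sup>2"
  have "k > 0" using assms by (auto simp: k_def vec2_eq sum_power2_gt_zero_iff)
  define L where "L = ln (2 * (\<bar>B\<bar> + 1) / k)"
  have L: "exp L * k = 2 * (\<bar>B\<bar> + 1)" using \<open>k > 0\<close> by (simp add: L_def)
  have L': "exp L * (k/2) = \<bar>B\<bar> + 1" using L by simp
  have LB: "B < \<bar>B\<bar> + 1" by simp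
  have "(v$1)\<^sup>2 \<ge> k/2 \<or> (v$2)\<^sup>2 \<ge> k/2"
  proof (rule ccontr)
    assume "\<not> ((v$1)\<^sup>2 \<ge> k/2 \<or> (v$2)\<^sup>2 \<ge> k/2)"
    then have "(v$1)\<^sup>2 + (v$2)\<^sup>2 < k" by simp
    then show False by (simp add: k_def)
  qed
  then consider "(v$1)\<^sup>2 \<ge> k/2" | "(v$2)\<^sup>2 \<ge> k/2" by blast
  then show ?thesis
  proof cases
    case 1
    have "exp L * (k/2) \<le> exp L * (v$1)\<^sup>2" using 1 by (intro mult_left_mono) auto
    moreover have "0 \<le> exp (-L) * (v$2)\<^sup>2" by simp
    ultimately have "eta v (of_real (exp (-L)) * \<i>) > B" unfolding eta_geo minus_minus using L' LB by linarith
    then show ?thesis by (intro exI[of _ "of_real (exp (-L)) * \<i>"]) simp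
  next
    case 2
    have "exp L * (k/2) \<le> exp L * (v$2)\<^sup>2" using 2 by (intro mult_left_mono) auto
    moreover have "0 \<le> exp (-L) * (v$1)\<^sup>2" by simp
    ultimately have "eta v (of_real (exp L) * \<i>) > B" unfolding eta_geo minus_minus using L' LB by linarith
    then show ?thesis by (intro exI[of _ "of_real (exp L) * \<i>"]) simp
  qed
qed

text \<open>Hyperbolic thin parts lie in tubes that are compact modulo \<Gamma> and are absorbed by
  the bounded piece \<open>None\<close>; parabolic thin parts lie in horoballs and become the pieces
  \<open>Some f\<close>. Without a parabolic class the bounded piece alone would cover the plane
  modulo \<Gamma>, contrary to \<open>nc\<close>.\<close>

theorem cusp_cover_exists:
  assumes nc: "\<not> cocompact \<Gamma>"
  shows "\<exists>I (V :: (real^2^2) option \<Rightarrow> complex set) p w S \<rho> c. cusp_cover \<Gamma> I V p w S \<rho> c"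
proof -
  obtain C0 where C0: "\<And>z. thick (1/16) z \<Longrightarrow> \<exists>\<gamma>\<in>\<Gamma>. hb (mobR \<gamma> z) < C0"
    using thick_cocompact[of "1/16"] by auto
  define C where "C = max C0 3"
  have C: "C > 2" and Ct: "\<And>z. thick (1/16) z \<Longrightarrow> \<exists>\<gamma>\<in>\<Gamma>. hb (mobR \<gamma> z) < C"
    using C0 by (auto simp: C_def) (meson less_max_iff_disj)
  define Fin where "Fin = {f\<in>\<Gamma>. f \<noteq> mat 1 \<and> (\<exists>z. Im z > 0 \<and> hb z < C \<and> Nn f z < 1/16)}"
  have Fin: "finite Fin" unfolding Fin_def by (rule finite_subset[OF _ finite_Nn[of C]]) (auto intro: less_imp_le)
  have FG: "f \<in> \<Gamma>" "f \<noteq> mat 1" if "f \<in> Fin" for f using that by (auto simp: Fin_def)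
  have "\<forall>f\<in>Fin. \<exists>r>0. \<forall>z\<in>thin_part f. Dsp f z < r" using thin_part_Dsp FG by blast
  then obtain r where r: "\<And>f. f \<in> Fin \<Longrightarrow> r f > 0" "\<And>f z. f \<in> Fin \<Longrightarrow> z \<in> thin_part f \<Longrightarrow> Dsp f z < r f" by metis
  have "\<forall>f\<in>{f\<in>Fin. Dlt f > 0}. \<exists>C. \<forall>z. Im z > 0 \<longrightarrow> Dsp f z < r f \<longrightarrow> (\<exists>\<gamma>\<in>\<Gamma>. hb (mobR \<gamma> z) \<le> C)"
    using hyperbolic_cocompact FG by blast
  then obtain Ch where Ch: "\<And>f z. f \<in> Fin \<Longrightarrow> Dlt f > 0 \<Longrightarrow> Im z > 0 \<Longrightarrow> Dsp f z < r f \<Longrightarrow> \<exists>\<gamma>\<in>\<Gamma>. hb (mobR \<gamma> z) \<le> Ch f"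
    by (auto simp: bchoice_iff) 
  \<comment> \<open>Large enough for the bounded piece to contain a translate of every point in a
    hyperbolic thin part from the list.\<close>
  define C' where "C' = C + (\<Sum>f\<in>Fin. \<bar>Ch f\<bar>)"
  have C'1: "C \<le> C'" by (simp add: C'_def sum_nonneg)
  have C'2: "Ch f < C'" if "f \<in> Fin" for f
    using member_le_sum[OF that, of "\<lambda>f. \<bar>Ch f\<bar>"] Fin C by (simp add: C'_def)
  define FP where "FP = {f\<in>Fin. Dlt f = 0}"
  have cov: "(\<exists>\<gamma>\<in>\<Gamma>. hb (mobR \<gamma> z) < C') \<or> (\<exists>\<gamma>\<in>\<Gamma>. \<exists>f\<in>FP. mobR \<gamma> z \<in> thin_part f)" if z: "Im z > 0" for z
  proof (cases "thick (1/16) z")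
    case True
    then obtain \<gamma> where "\<gamma> \<in> \<Gamma>" "hb (mobR \<gamma> z) < C" using Ct by blast
    then have "hb (mobR \<gamma> z) < C'" using C'1 by simp
    then show ?thesis using \<open>\<gamma> \<in> \<Gamma>\<close> by blast
  next
    case False
    then obtain k where k: "k \<in> \<Gamma>" "k \<noteq> mat 1" "Nn k z < 1/16" using z unfolding thick_def by force
    have zk: "z \<in> thin_part k" unfolding thin_part_def using k z comm_refl by blast
    obtain g f where gf: "g \<in> \<Gamma>" "f \<in> \<Gamma>" "f \<noteq> mat 1" "\<exists>z. Im z > 0 \<and> hb z < C \<and> Nn f z < 1/16" "comm (g ** f ** adj2 g) k"
      using thin_classes[OF C Ct k(1,2)] zk by blast
    have fF: "f \<in> Fin" unfolding Fin_def using gf by blast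
    have gS: "g \<in> SL2R" using sub gf by simp
    have "z \<in> thin_part (g ** f ** adj2 g)"
      using thin_part_eq[OF conj_in[OF gf(2,1)] conj_nonempty[OF gf(1,3)] k(1,2) gf(5)] zk by simp
    then have "mobR (adj2 g) z \<in> thin_part (adj2 g ** (g ** f ** adj2 g) ** adj2 (adj2 g))"
      by (rule thin_part_equiv[OF adj[OF gf(1)]])
    moreover have "adj2 g ** (g ** f ** adj2 g) ** adj2 (adj2 g) = f" using gS by (simp add: assoc2 conj_cancel adj2_left)
    ultimately have zf: "mobR (adj2 g) z \<in> thin_part f" by simp
    show ?thesis
    proof (cases "Dlt f = 0")
      case True then show ?thesis using zf fF adj[OF gf(1)] unfolding FP_def by blast
    next
      case False
      then have "Dlt f > 0" using trace_ge[OF gf(2,3)] by simp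
      then obtain h where h: "h \<in> \<Gamma>" "hb (mobR h (mobR (adj2 g) z)) \<le> Ch f"
        using Ch[OF fF _ thin_part_H[OF zf] r(2)[OF fF zf]] by blast
      have "mobR (h ** adj2 g) z = mobR h (mobR (adj2 g) z)" using mobR_mult[OF SL2R_adj[OF gS] z] .
      then have "hb (mobR (h ** adj2 g) z) < C'" using h(2) C'2[OF fF] by simp
      then show ?thesis using mult[OF h(1) adj[OF gf(1)]] by blast
    qed
  qed
  have "FP \<noteq> {}"
  proof
    assume "FP = {}"
    have "cocompact \<Gamma>"
      unfolding cocompact_def
    proof (intro exI conjI)
      show "compact {z. Im z > 0 \<and> hb z \<le> C'}" by (rule compact_hb)
      show "{z. Im z > 0 \<and> hb z \<le> C'} \<subseteq> H_plane" by (auto simp: H_plane_def)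
      show "(\<Union>g\<in>\<Gamma>. mobR g ` {z. Im z > 0 \<and> hb z \<le> C'}) = H_plane"
      proof (intro set_eqI iffI)
        fix z assume "z \<in> (\<Union>g\<in>\<Gamma>. mobR g ` {z. Im z > 0 \<and> hb z \<le> C'})"
        then show "z \<in> H_plane" using Im_mobR_pos sub by (auto simp: H_plane_def)
      next
        fix z assume "z \<in> H_plane"
        then have z: "Im z > 0" by (simp add: H_plane_def)
        then obtain g where g: "g \<in> \<Gamma>" "hb (mobR g z) < C'" using cov \<open>FP = {}\<close> by blast
        have "z = mobR (adj2 g) (mobR g z)" using mobR_adj_cancel(1)[OF sub[OF g(1)] z] by simp
        moreover have "mobR g z \<in> {z. Im z > 0 \<and> hb z \<le> C'}" using g Im_mobR_pos[OF sub[OF g(1)] z] by simp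
        ultimately show "z \<in> (\<Union>g\<in>\<Gamma>. mobR g ` {z. Im z > 0 \<and> hb z \<le> C'})" using adj[OF g(1)] by blast
      qed
    qed
    then show False using nc by simp
  qed
  then obtain f0 where f0: "f0 \<in> FP" by blast
  have FPG: "f \<in> \<Gamma>" "f \<noteq> mat 1" "f \<in> Fin" "Dlt f = 0" if "f \<in> FP" for f using that FG unfolding FP_def by auto
  have "\<forall>f\<in>FP. \<exists>v. v \<noteq> 0 \<and> (\<forall>z. Dsp f z = eta v z)" using parabolic_vector nonscal FPG by blast
  then obtain vv where vv: "\<And>f. f \<in> FP \<Longrightarrow> vv f \<noteq> 0" "\<And>f z. f \<in> FP \<Longrightarrow> Dsp f z = eta (vv f) z" by metis
  have "\<forall>f\<in>FP. \<exists>q\<in>\<Gamma>. comm q f \<and> (\<forall>m\<in>\<Gamma>. comm m f \<longrightarrow> m \<in> cyc q)" using cyclic FPG by blast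
  then obtain q where q: "\<And>f. f \<in> FP \<Longrightarrow> q f \<in> \<Gamma>" "\<And>f. f \<in> FP \<Longrightarrow> comm (q f) f"
     "\<And>f m. f \<in> FP \<Longrightarrow> m \<in> \<Gamma> \<Longrightarrow> comm m f \<Longrightarrow> m \<in> cyc (q f)" by metis
  define I where "I = insert None (Some ` FP)"
  define V where "V = (\<lambda>i. case i of None \<Rightarrow> {z. Im z > 0 \<and> hb z < C'} | Some f \<Rightarrow> thin_part f)"
  define p where "p = (\<lambda>i. case i of None \<Rightarrow> mat 1 | Some f \<Rightarrow> q f)"
  \<comment> \<open>The bounded piece needs a vector as well. That of any cusp serves, since a
    region of bounded \<open>hb\<close> lies in a sufficiently large horoball at each cusp; hence
    the first summand of \<rho>.\<close>
  define w where "w = (\<lambda>i. case i of None \<Rightarrow> vv f0 | Some f \<Rightarrow> vv f)"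
  define \<rho> where "\<rho> = C' * (norm (vv f0))\<^sup>2 + (\<Sum>f\<in>FP. r f)"
  have FPf: "finite FP" using Fin by (simp add: FP_def)
  have rpos: "r f > 0" if "f \<in> FP" for f using r FPG that by blast
  have C'pos: "C' > 0" using C C'1 by simp
  have wV: "eta (w i) z < \<rho>" if "i \<in> I" "z \<in> V i" for i z
  proof (cases i)
    case None
    then have z: "Im z > 0" "hb z < C'" using that by (auto simp: V_def)
    have "(norm (vv f0))\<^sup>2 > 0" using vv f0 by simp
    then have "hb z * (norm (vv f0))\<^sup>2 < C' * (norm (vv f0))\<^sup>2" using z by simp
    moreover have "(\<Sum>f\<in>FP. r f) \<ge> 0" using rpos by (intro sum_nonneg) (auto intro: less_imp_le)
    ultimately show ?thesis using eta_le_hb[OF z(1), of "vv f0"] None by (simp add: w_def \<rho>_def)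
  next
    case (Some f)
    then have f: "f \<in> FP" and z: "z \<in> thin_part f" using that by (auto simp: I_def V_def)
    have "eta (vv f) z < r f" using r(2)[OF FPG(3)[OF f] z] vv(2)[OF f] by simp
    also have "r f \<le> (\<Sum>f\<in>FP. r f)" using rpos FPf f by (intro member_le_sum) (auto intro: less_imp_le)
    finally show ?thesis using Some C'pos by (simp add: w_def \<rho>_def add_strict_increasing2)
  qed
  have wvv: "\<exists>f\<in>FP. w i = vv f" if "i \<in> I" for i using that f0 by (auto simp: I_def w_def)
  obtain c where c: "c > 0" "\<And>f v. f \<in> \<Gamma> \<Longrightarrow> f \<noteq> mat 1 \<Longrightarrow> Dlt f = 0 \<Longrightarrow> (\<forall>z. Dsp f z = eta v z) \<Longrightarrow> c \<le> norm v"
    using cusp_vector_lower by blast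
  have cw: "c \<le> norm (\<gamma> *v w i)" if g: "\<gamma> \<in> \<Gamma>" and i: "i \<in> I" for \<gamma> i
  proof -
    obtain f where f: "f \<in> FP" "w i = vv f" using wvv i by blast
    define e where "e = \<gamma> ** f ** adj2 \<gamma>"
    have gS: "\<gamma> \<in> SL2R" using sub g by simp
    have eG: "e \<in> \<Gamma>" "e \<noteq> mat 1" using conj_in[OF FPG(1)[OF f(1)] g] conj_nonempty[OF g FPG(2)[OF f(1)]] by (auto simp: e_def)
    have "Dlt e = Dlt f" using Dlt_tr[OF sub[OF eG(1)]] Dlt_tr[OF sub[OF FPG(1)[OF f(1)]]] tr2_conj[OF gS] by (simp add: e_def)
    then have D: "Dlt e = 0" using FPG(4) f by simp
    obtain v where v: "\<And>z. Dsp e z = eta v z" using parabolic_vector[OF D nonscal[OF eG]] by blast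
    have "eta (\<gamma> *v vv f) z = eta v z" if z: "Im z > 0" for z
    proof -
      have z': "Im (mobR (adj2 \<gamma>) z) > 0" using Im_mobR_pos[OF SL2R_adj[OF gS] z] .
      show ?thesis using Dsp_equiv[OF gS z', of f] eta_equiv[OF gS z', of "vv f"] mobR_adj_cancel(2)[OF gS z] vv(2)[OF f(1)] v
        by (simp add: e_def)
    qed
    from this[of \<i>] have "(norm (\<gamma> *v vv f))\<^sup>2 = (norm v)\<^sup>2"
      using eta_geo[of v 0] eta_geo[of "\<gamma> *v vv f" 0] by (simp add: normv2_sq)
    then have "norm (\<gamma> *v vv f) = norm v" by simp
    then show ?thesis using c(2)[OF eG D] v f(2) by simp
  qed
  have ov: "\<exists>T. finite T \<and> T \<subseteq> \<Gamma> \<and> (\<forall>\<gamma>\<in>\<Gamma>. \<forall>z\<in>V j. mobR \<gamma> z \<in> V i \<longrightarrow>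
      (\<exists>m\<in>cyc (p i). \<exists>m'\<in>cyc (p j). \<exists>s\<in>T. \<gamma> = m ** s ** m'))" if ij: "i \<in> I" "j \<in> I" for i j
  proof (cases j)
    case None
    note j = None
    show ?thesis
    proof (cases i)
      case None
      define T where "T = {\<gamma> \<in> \<Gamma>. \<exists>z. Im z > 0 \<and> hb z \<le> C' \<and> hb (mobR \<gamma> z) \<le> C'}"
      have T1: "finite T" unfolding T_def by (rule finite_hb)
      have T3: "\<exists>m\<in>cyc (p i). \<exists>m'\<in>cyc (p j). \<exists>s\<in>T. \<gamma> = m ** s ** m'"
        if "\<gamma> \<in> \<Gamma>" "z \<in> V j" "mobR \<gamma> z \<in> V i" for \<gamma> z
      proof (intro bexI)
        show "\<gamma> = mat 1 ** \<gamma> ** mat 1" by simp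
        show "\<gamma> \<in> T" using that None j unfolding T_def by (auto simp: V_def intro: less_imp_le)
      qed (rule cyc.c1)+
      have T2: "T \<subseteq> \<Gamma>" by (auto simp: T_def)
      show ?thesis by (intro exI[of _ T] conjI ballI impI T1 T2 T3)
    next
      case (Some f)
      then have f: "f \<in> FP" using ij by (auto simp: I_def)
      from overlap_ball[OF FPG(1,2)[OF f], of C'] obtain T where T0: "finite T" "T \<subseteq> \<Gamma>"
         "\<forall>\<gamma>\<in>\<Gamma>. \<forall>z\<in>thin_part f. hb (mobR \<gamma> z) \<le> C' \<longrightarrow> (\<exists>t\<in>T. \<exists>\<delta>\<in>\<Gamma>. comm \<delta> f \<and> \<gamma> = t ** \<delta>)"
        by (elim exE conjE)
      note T = T0(1,2) T0(3)[rule_format]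
      \<comment> \<open>\<open>overlap_ball\<close> treats passages from the thin part to the
        bounded piece. The opposite direction is obtained from inverses.\<close>
      have T3: "\<exists>m\<in>cyc (p i). \<exists>m'\<in>cyc (p j). \<exists>s\<in>adj2 ` T. \<gamma> = m ** s ** m'"
        if g: "\<gamma> \<in> \<Gamma>" and z: "z \<in> V j" "mobR \<gamma> z \<in> V i" for \<gamma> z
      proof -
        have z0: "Im z > 0" "hb z < C'" using z j by (auto simp: V_def)
        have "hb (mobR (adj2 \<gamma>) (mobR \<gamma> z)) \<le> C'" using mobR_adj_cancel(1)[OF sub[OF g] z0(1)] z0 by simp
        moreover have "mobR \<gamma> z \<in> thin_part f" using z Some by (simp add: V_def)
        ultimately obtain t \<delta> where t: "t \<in> T" "\<delta> \<in> \<Gamma>" "comm \<delta> f" "adj2 \<gamma> = t ** \<delta>" using T(3)[OF adj[OF g]] by blast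
        have "\<gamma> = adj2 (adj2 \<gamma>)" by simp
        also have "\<dots> = adj2 \<delta> ** adj2 t ** mat 1" unfolding t(4) by (simp add: adj2_mult)
        finally have "\<gamma> = adj2 \<delta> ** adj2 t ** mat 1" .
        moreover have "adj2 \<delta> \<in> cyc (p i)" using q(3)[OF f adj[OF t(2)] comm_adj2[OF t(3)]] Some by (simp add: p_def)
        ultimately show ?thesis using t(1) cyc.c1 by blast
      qed
      have T2: "adj2 ` T \<subseteq> \<Gamma>" using T(2) adj by blast
      have T1: "finite (adj2 ` T)" using T(1) by simp
      show ?thesis by (intro exI[of _ "adj2 ` T"] conjI ballI impI T1 T2 T3)
    qed
  next
    case (Some f)
    then have f: "f \<in> FP" using ij by (auto simp: I_def)
    have "\<exists>T. finite T \<and> T \<subseteq> \<Gamma> \<and> (\<forall>\<gamma>\<in>\<Gamma>. \<forall>z\<in>thin_part f. mobR \<gamma> z \<in> V i \<longrightarrow> (\<exists>t\<in>T. \<exists>\<delta>\<in>\<Gamma>. comm \<delta> f \<and> \<gamma> = t ** \<delta>))"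
    proof (cases i)
      case None
      from overlap_ball[OF FPG(1,2)[OF f], of C'] obtain T where T0: "finite T" "T \<subseteq> \<Gamma>"
         "\<forall>\<gamma>\<in>\<Gamma>. \<forall>z\<in>thin_part f. hb (mobR \<gamma> z) \<le> C' \<longrightarrow> (\<exists>t\<in>T. \<exists>\<delta>\<in>\<Gamma>. comm \<delta> f \<and> \<gamma> = t ** \<delta>)"
        by (elim exE conjE)
      have "hb u \<le> C'" if "u \<in> V i" for u using that None by (simp add: V_def)
      then show ?thesis by (intro exI[of _ T] conjI ballI impI T0(1,2) T0(3)[rule_format])
    next
      case (Some e)
      then have e: "e \<in> FP" using ij by (auto simp: I_def)
      then show ?thesis using overlap_thin_part[OF FPG(1,2)[OF f] FPG(1,2)[OF e]] Some by (simp add: V_def)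
    qed
    then obtain T where T0: "finite T" "T \<subseteq> \<Gamma>"
         "\<forall>\<gamma>\<in>\<Gamma>. \<forall>z\<in>thin_part f. mobR \<gamma> z \<in> V i \<longrightarrow> (\<exists>t\<in>T. \<exists>\<delta>\<in>\<Gamma>. comm \<delta> f \<and> \<gamma> = t ** \<delta>)"
      by (elim exE conjE)
    note T = T0(1,2) T0(3)[rule_format]
    have T3: "\<exists>m\<in>cyc (p i). \<exists>m'\<in>cyc (p j). \<exists>s\<in>T. \<gamma> = m ** s ** m'"
      if g: "\<gamma> \<in> \<Gamma>" and z: "z \<in> V j" "mobR \<gamma> z \<in> V i" for \<gamma> z
    proof -
      have "z \<in> thin_part f" using z Some by (simp add: V_def)
      then obtain t \<delta> where t: "t \<in> T" "\<delta> \<in> \<Gamma>" "comm \<delta> f" "\<gamma> = t ** \<delta>" using T(3)[OF g _ z(2)] by blast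
      have "\<gamma> = mat 1 ** t ** \<delta>" using t(4) by simp
      moreover have "\<delta> \<in> cyc (p j)" using q(3)[OF f t(2,3)] Some by (simp add: p_def)
      ultimately show ?thesis using t(1) cyc.c1 by blast
    qed
    show ?thesis by (intro exI[of _ T] conjI ballI impI T(1,2) T3)
  qed
  then have "\<forall>ij\<in>I \<times> I. \<exists>T. finite T \<and> T \<subseteq> \<Gamma> \<and> (\<forall>\<gamma>\<in>\<Gamma>. \<forall>z\<in>V (snd ij). mobR \<gamma> z \<in> V (fst ij) \<longrightarrow>
      (\<exists>m\<in>cyc (p (fst ij)). \<exists>m'\<in>cyc (p (snd ij)). \<exists>s\<in>T. \<gamma> = m ** s ** m'))" by auto
  from bchoice[OF this] obtain T where T: "\<forall>ij\<in>I \<times> I. finite (T ij) \<and> T ij \<subseteq> \<Gamma> \<and> (\<forall>\<gamma>\<in>\<Gamma>. \<forall>z\<in>V (snd ij). mobR \<gamma> z \<in> V (fst ij) \<longrightarrow>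
      (\<exists>m\<in>cyc (p (fst ij)). \<exists>m'\<in>cyc (p (snd ij)). \<exists>s\<in>T ij. \<gamma> = m ** s ** m'))" by blast
  define S where "S = (\<Union>ij\<in>I \<times> I. T ij)"
  have Ifin: "finite I" using FPf by (simp add: I_def)
  \<comment> \<open>A central element has traceless part proportional to that of each parabolic
    \<open>f\<close>. Its displacement is then bounded on every piece, and by centrality on the
    whole plane, whereas on the other hand it is a nonzero multiple of the unbounded function
    \<open>eta\<close>.\<close>
  have centre: "\<gamma> = mat 1" if g: "\<gamma> \<in> \<Gamma>" and cen: "\<And>h. h \<in> \<Gamma> \<Longrightarrow> comm \<gamma> h" for \<gamma>
  proof (rule ccontr)
    assume ne: "\<gamma> \<noteq> mat 1"
    have "\<exists>l. tfr l \<gamma> f" if "f \<in> FP" for f using comm_tfr[OF cen nonscal] FPG that by blast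
    then obtain l where l: "\<And>f. f \<in> FP \<Longrightarrow> tfr (l f) \<gamma> f" by metis
    define B where "B = (\<Sum>f\<in>FP. \<bar>l f\<bar>) * \<rho>"
    have rho: "\<rho> > 0" using wV[of None "\<i>"] C C'1 eta_nonneg[of "\<i>" "w None"] by (simp add: I_def V_def hb_def)
    have lb: "\<bar>l f\<bar> \<le> (\<Sum>f\<in>FP. \<bar>l f\<bar>)" if "f \<in> FP" for f using that FPf by (intro member_le_sum) auto
    have onV: "Dsp \<gamma> z \<le> B" if "i \<in> I" "z \<in> V i" for i z
    proof -
      obtain f where f: "f \<in> FP" "w i = vv f" using wvv \<open>i \<in> I\<close> by blast
      have z0: "Im z > 0" using that by (cases i) (auto simp: V_def thin_part_H)
      have "Dsp \<gamma> z = \<bar>l f\<bar> * eta (w i) z" using Dsp_tfr[OF l[OF f(1)]] vv(2)[OF f(1)] f(2) by simp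
      also have "\<dots> \<le> (\<Sum>f\<in>FP. \<bar>l f\<bar>) * \<rho>"
        using lb[OF f(1)] wV[OF that] eta_nonneg[OF z0] by (intro mult_mono sum_nonneg) (auto intro: less_imp_le)
      finally show ?thesis by (simp add: B_def)
    qed
    have all: "Dsp \<gamma> z \<le> B" if z: "Im z > 0" for z
    proof -
      have "\<exists>h\<in>\<Gamma>. \<exists>i\<in>I. mobR h z \<in> V i" using cov[OF z]
      proof
        assume "\<exists>h\<in>\<Gamma>. hb (mobR h z) < C'"
        then obtain h where h: "h \<in> \<Gamma>" "hb (mobR h z) < C'" by blast
        then have "mobR h z \<in> V None" using Im_mobR_pos[OF sub[OF h(1)] z] by (simp add: V_def)
        then show ?thesis using h(1) unfolding I_def by blast
      next
        assume "\<exists>h\<in>\<Gamma>. \<exists>f\<in>FP. mobR h z \<in> thin_part f"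
        then obtain h f where "h \<in> \<Gamma>" "f \<in> FP" "mobR h z \<in> thin_part f" by blast
        then have "mobR h z \<in> V (Some f)" "Some f \<in> I" by (auto simp: V_def I_def)
        then show ?thesis using \<open>h \<in> \<Gamma>\<close> by blast
      qed
      then obtain h i where h: "h \<in> \<Gamma>" "i \<in> I" "mobR h z \<in> V i" by blast
      have hS: "h \<in> SL2R" using sub h by simp
      have "h ** \<gamma> ** adj2 h = \<gamma>" using cen[OF h(1)] adj2_right[OF hS] by (simp add: comm_def assoc2 flip: matrix_mul_assoc)
        (metis adj2_right[OF hS] assoc2 matrix_mul_rid)
      then have "Dsp \<gamma> (mobR h z) = Dsp \<gamma> z" using Dsp_equiv[OF hS z, of \<gamma>] by simp
      then show ?thesis using onV[OF h(2,3)] by simp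
    qed
    have l0: "\<bar>l f0\<bar> > 0" using lam_nonzero[OF g ne l[OF f0]] by simp
    obtain z where z: "Im z > 0" "eta (vv f0) z > B / \<bar>l f0\<bar>" using eta_unbounded[OF vv(1)[OF f0]] by blast
    have "Dsp \<gamma> z = \<bar>l f0\<bar> * eta (vv f0) z" using Dsp_tfr[OF l[OF f0]] vv(2)[OF f0] by simp
    also have "\<dots> > B" using z(2) l0 by (simp add: field_simps)
    finally show False using all[OF z(1)] by simp
  qed
  have "cusp_cover \<Gamma> I V p w S \<rho> c"
  proof
    fix \<gamma> assume "\<gamma> \<in> \<Gamma>" then show "\<gamma> \<in> SL2R" by (rule sub)
  next
    show "mat 1 \<in> \<Gamma>" by (rule one)
  next
    fix g h assume "g \<in> \<Gamma>" "h \<in> \<Gamma>" then show "g ** h \<in> \<Gamma>" by (rule mult)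
  next
    fix g assume "g \<in> \<Gamma>" then show "adj2 g \<in> \<Gamma>" by (rule adj)
  next
    fix C show "finite {\<gamma> \<in> \<Gamma>. \<exists>z. Im z > 0 \<and> hb z \<le> C \<and> hb (mobR \<gamma> z) \<le> C}" by (rule finite_hb)
  next
    fix \<gamma> assume "\<gamma> \<in> \<Gamma>" "\<And>h. h \<in> \<Gamma> \<Longrightarrow> comm \<gamma> h" then show "\<gamma> = mat 1" by (rule centre)
  next
    show "finite I" by (rule Ifin)
  next
    fix i assume "i \<in> I"
    show "open (V i)"
    proof (cases i)
      case None
      have "open (H_plane \<inter> hb -` {..<C'})" by (intro continuous_open_preimage[OF continuous_on_hb open_H_plane]) auto
      moreover have "V i = H_plane \<inter> hb -` {..<C'}" using None by (auto simp: V_def H_plane_def)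
      ultimately show ?thesis by simp
    qed (simp add: V_def thin_part_open)
  next
    fix i z assume "i \<in> I" "z \<in> V i" then show "Im z > 0" by (cases i) (auto simp: V_def thin_part_H)
  next
    fix i assume "i \<in> I" then show "p i \<in> \<Gamma>" using q one by (auto simp: I_def p_def)
  next
    have inv: "mobR h z \<in> thin_part f" if "f \<in> FP" "h \<in> \<Gamma>" "comm h f" "z \<in> thin_part f" for h f z
    proof -
      have "h ** f ** adj2 h = f" using that(3) adj2_right[OF sub[OF that(2)]] by (metis assoc2 comm_def matrix_mul_rid)
      then show ?thesis using thin_part_equiv[OF that(2,4)] by simp
    qed
    fix i z assume iz: "i \<in> I" "z \<in> V i"
    show "mobR (p i) z \<in> V i"
      using iz inv q by (cases i) (auto simp: I_def V_def p_def)
    show "mobR (adj2 (p i)) z \<in> V i"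
      using iz inv[OF _ adj comm_adj2] q by (cases i) (auto simp: I_def V_def p_def)
  next
    fix z assume z: "Im z > 0"
    from cov[OF z] show "\<exists>\<gamma>\<in>\<Gamma>. \<exists>i\<in>I. mobR \<gamma> z \<in> V i"
    proof
      assume "\<exists>h\<in>\<Gamma>. hb (mobR h z) < C'"
      then obtain h where h: "h \<in> \<Gamma>" "hb (mobR h z) < C'" by blast
      then have "mobR h z \<in> V None" using Im_mobR_pos[OF sub[OF h(1)] z] by (simp add: V_def)
      then show ?thesis using h(1) unfolding I_def by blast
    next
      assume "\<exists>h\<in>\<Gamma>. \<exists>f\<in>FP. mobR h z \<in> thin_part f"
      then obtain h f where "h \<in> \<Gamma>" "f \<in> FP" "mobR h z \<in> thin_part f" by blast
      then have "mobR h z \<in> V (Some f)" "Some f \<in> I" by (auto simp: V_def I_def)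
      then show ?thesis using \<open>h \<in> \<Gamma>\<close> by blast
    qed
  next
    show "finite S" unfolding S_def using T Ifin by auto
    show "S \<subseteq> \<Gamma>" unfolding S_def using T by blast
  next
    fix \<gamma> i j z assume "\<gamma> \<in> \<Gamma>" "i \<in> I" "j \<in> I" "z \<in> V j" "mobR \<gamma> z \<in> V i"
    then have "\<exists>m\<in>cyc (p i). \<exists>m'\<in>cyc (p j). \<exists>s\<in>T (i,j). \<gamma> = m ** s ** m'" using T[rule_format, of "(i,j)"] by auto
    then show "\<exists>m\<in>cyc (p i). \<exists>m'\<in>cyc (p j). \<exists>s\<in>S. \<gamma> = m ** s ** m'" unfolding S_def using \<open>i \<in> I\<close> \<open>j \<in> I\<close> by blast
  next
    fix i z assume "i \<in> I" "z \<in> V i" then show "eta (w i) z < \<rho>" by (rule wV)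
  next
    show "c > 0" by (rule c(1))
  next
    fix \<gamma> i assume "\<gamma> \<in> \<Gamma>" "i \<in> I" then show "c \<le> norm (\<gamma> *v w i)" by (rule cw)
  qed
  then show ?thesis by blast
qed

end

section \<open>Hermitian forms and discs\<close>

type_synonym hform = "real \<times> complex \<times> real"

text \<open>A generalised disc with parameters \<open>(a, b, c)\<close> corresponds to the cone where the Hermitian form \<open>Qf\<close> is nonpositive.\<close>
definition Bf :: "hform \<Rightarrow> complex^2 \<Rightarrow> complex^2 \<Rightarrow> complex" where
  "Bf P u v = (case P of (a, b, c) \<Rightarrow> of_real a * (u$1 * cnj (v$1)) + cnj b * (u$1 * cnj (v$2)) + b * (u$2 * cnj (v$1)) + of_real c * (u$2 * cnj (v$2)))"

definition Qf :: "hform \<Rightarrow> complex^2 \<Rightarrow> real" where "Qf P u = Re (Bf P u u)"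

definition dsc :: "hform \<Rightarrow> real" where "dsc P = (case P of (a, b, c) \<Rightarrow> (cmod b)\<^sup>2 - a * c)"

definition wd2 :: "complex^2 \<Rightarrow> complex^2 \<Rightarrow> complex" where "wd2 u v = u$1 * v$2 - u$2 * v$1"

definition pt :: "complex^2 \<Rightarrow> complex option" where
  "pt w = (if w$2 = 0 then None else Some (w$1 / w$2))"

lemma Bf_self: "Bf P u u = of_real (Qf P u)"
  by (cases P) (simp add: Qf_def Bf_def complex_eq_iff algebra_simps)

lemma Bf_swap: "Bf P v u = cnj (Bf P u v)"
  by (cases P) (simp add: Bf_def algebra_simps)

lemma Bf_add: "Bf P (u + v) x = Bf P u x + Bf P v x" "Bf P x (u + v) = Bf P x u + Bf P x v"
  by (cases P; simp add: Bf_def algebra_simps)+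

lemma Bf_scale: "Bf P (k *s u) v = k * Bf P u v" "Bf P u (k *s v) = cnj k * Bf P u v"
  by (cases P; simp add: Bf_def algebra_simps)+

lemma Qf_add: "Qf P (u + v) = Qf P u + 2 * Re (Bf P u v) + Qf P v"
  using Bf_swap[of P v u] by (simp add: Qf_def Bf_add)

lemma Qf_scale: "Qf P (k *s u) = (cmod k)\<^sup>2 * Qf P u"
proof -
  have "Bf P (k *s u) (k *s u) = of_real ((cmod k)\<^sup>2) * Bf P u u"
    by (simp only: Bf_scale complex_norm_square) (simp add: mult_ac)
  then show ?thesis by (simp add: Qf_def)
qed

lemma Qf_explicit: "Qf (a, b, c) w = a * (cmod (w$1))\<^sup>2 + 2 * Re (cnj b * (w$1 * cnj (w$2))) + c * (cmod (w$2))\<^sup>2"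
  unfolding cmod_power2 by (simp add: Qf_def Bf_def power2_eq_square algebra_simps)

text \<open>The determinant of the Gram matrix of \<open>u\<close> and \<open>v\<close> is
  \<open>|wd2 u v|^2\<close> times the determinant of the form, and \<open>dsc\<close> is minus the
  latter.\<close>

lemma gram: "(cmod (Bf P u v))\<^sup>2 = Qf P u * Qf P v + (cmod (wd2 u v))\<^sup>2 * dsc P"
proof -
  obtain a b c where P: "P = (a, b, c)" by (cases P)
  have "complex_of_real ((cmod (Bf P u v))\<^sup>2) = of_real (Qf P u * Qf P v + (cmod (wd2 u v))\<^sup>2 * dsc P)"
    unfolding of_real_add of_real_mult Bf_self[symmetric]
    by (simp only: complex_norm_square P dsc_def prod.case of_real_diff of_real_mult)
      (simp add: Bf_def wd2_def algebra_simps)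
  then show ?thesis by (simp only: of_real_eq_iff)
qed

text \<open>The explicit vector spans the orthogonal complement of \<open>u\<close>; for a form of
  signature (1,1) the sign there is opposite. The scaling is fixed by the value of
  \<open>wd2\<close>.\<close>

lemma Qf_orth: assumes "Qf P u \<noteq> 0"
  shows "\<exists>v. Bf P v u = 0 \<and> Qf P v = - dsc P * Qf P u \<and> wd2 u v = - of_real (Qf P u)"
proof -
  obtain a b c where P: "P = (a, b, c)" by (cases P)
  define v :: "complex^2" where "v = vector [b * cnj (u$1) + of_real c * cnj (u$2), - (of_real a * cnj (u$1) + cnj b * cnj (u$2))]"
  have 1: "Bf P v u = 0" by (simp add: Bf_def P v_def algebra_simps)
  have 2: "wd2 u v = - of_real (Qf P u)"
    unfolding Bf_self[symmetric] by (simp add: wd2_def Bf_def P v_def algebra_simps)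
  have "0 = Qf P v * Qf P u + (Qf P u)\<^sup>2 * dsc P"
  proof -
    have "wd2 v u = - wd2 u v" by (simp add: wd2_def)
    then have "cmod (wd2 v u) = \<bar>Qf P u\<bar>" using 2 by simp
    then show ?thesis using gram[of P v u] 1 by simp
  qed
  then have "Qf P u * (Qf P v + Qf P u * dsc P) = 0" by (simp add: power2_eq_square algebra_simps)
  then have "Qf P v + Qf P u * dsc P = 0" using assms by simp
  then have "Qf P v = - dsc P * Qf P u" by (simp add: eq_neg_iff_add_eq_0 mult.commute)
  then show ?thesis using 1 2 by blast
qed

lemma Qf_pos_exists: assumes "dsc P > 0" shows "\<exists>u. Qf P u > 0"
proof -
  obtain a b c where P: "P = (a, b, c)" by (cases P)
  have e1: "Qf P (vector [1, 0]) = a" and e2: "Qf P (vector [0, 1]) = c" by (simp_all add: P Qf_explicit)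
  consider "a > 0" | "a < 0" | "c > 0" | "c < 0" | "a = 0" "c = 0" by linarith
  then show ?thesis
  proof cases
    case 1 then show ?thesis using e1 by metis
  next
    case 2
    then obtain v where "Qf P v = - dsc P * a" using Qf_orth[of P "vector [1,0]"] e1 by auto
    then show ?thesis using assms 2 by (intro exI[of _ v]) (simp add: mult_less_0_iff)
  next
    case 3 then show ?thesis using e2 by metis
  next
    case 4
    then obtain v where "Qf P v = - dsc P * c" using Qf_orth[of P "vector [0,1]"] e2 by auto
    then show ?thesis using assms 4 by (intro exI[of _ v]) (simp add: mult_less_0_iff)
  next
    case 5
    have "Qf P (vector [b, 1]) = 2 * (cmod b)\<^sup>2" using 5
      unfolding cmod_power2 by (simp add: P Qf_explicit) (simp add: power2_eq_square)
    moreover have "(cmod b)\<^sup>2 > 0" using assms 5 by (simp add: P dsc_def)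
    ultimately show ?thesis by (intro exI[of _ "vector [b,1]"]) simp
  qed
qed

lemma Qf_zero [simp]: "Qf P 0 = 0" by (cases P) (simp add: Qf_explicit)

definition scP :: "real \<Rightarrow> hform \<Rightarrow> hform" where
  "scP s P = (case P of (a, b, c) \<Rightarrow> (s * a, of_real s * b, s * c))"

lemma Qf_scP: "Qf (scP s P) w = s * Qf P w"
  by (cases P) (simp add: scP_def Qf_explicit algebra_simps)

lemma dsc_scP: "dsc (scP s P) = s\<^sup>2 * dsc P"
  by (cases P) (simp add: scP_def dsc_def norm_mult power_mult_distrib power2_eq_square algebra_simps)

text \<open>The Hermitian form composed with \<open>A\<close>, written in the parameters of a disc:
  the diagonal entries are values on the columns of \<open>A\<close>.\<close>

definition pullb :: "hform \<Rightarrow> complex^2^2 \<Rightarrow> hform" where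
  "pullb P A = (Qf P (vector [A$1$1, A$2$1]), cnj (Bf P (vector [A$1$1, A$2$1]) (vector [A$1$2, A$2$2])), Qf P (vector [A$1$2, A$2$2]))"

lemma mulv_cols: "(A::complex^2^2) *v (w::complex^2) = (w$1) *s (vector [A$1$1, A$2$1] :: complex^2) + (w$2) *s (vector [A$1$2, A$2$2])"
  by (simp add: vec2_eq mulv2 mult.commute)

lemma Qf_pullb: "Qf (pullb P A) w = Qf P (A *v w)"
  unfolding mulv_cols Qf_add Qf_scale Bf_scale by (simp add: pullb_def Qf_explicit algebra_simps)

lemma dsc_pullb: "dsc (pullb P A) = (cmod (det A))\<^sup>2 * dsc P"
proof -
  have "dsc (pullb P A) = (cmod (wd2 (vector [A$1$1, A$2$1]) (vector [A$1$2, A$2$2])))\<^sup>2 * dsc P"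
    using gram[of P "vector [A$1$1, A$2$1]" "vector [A$1$2, A$2$2]"] by (simp add: pullb_def dsc_def)
  then show ?thesis by (simp add: wd2_def det_2 mult.commute)
qed

lemma continuous_on_Qf [continuous_intros]: "continuous_on S f \<Longrightarrow> continuous_on S (\<lambda>x. Qf P (f x))"
  by (cases P) (simp only: Qf_explicit, intro continuous_intros)

lemma scaleR_s: "r *\<^sub>R w = (of_real r :: complex) *s (w::complex^2)"
  unfolding vec2_eq by (simp add: scaleR_conv_of_real[of r "w$1"] scaleR_conv_of_real[of r "w$2"])

lemma phase_exists: "\<exists>k::complex. cmod k = 1 \<and> k * b = of_real (cmod b)"
proof (cases "b = 0")
  case True then show ?thesis by (intro exI[of _ 1]) simp
next
  case False
  then show ?thesis by (intro exI[of _ "of_real (cmod b) / b"]) (simp add: norm_divide)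
qed

text \<open>The positive cone of \<open>P\<close> is connected up to phases, and by
  \<open>zero\<close> the form \<open>R\<close> has no nontrivial zero in it, so \<open>R\<close>
  cannot change sign there.\<close>

lemma const_sign:
  assumes zero: "\<And>w. w \<noteq> 0 \<Longrightarrow> Qf R w = 0 \<Longrightarrow> Qf P w = 0"
    and u: "Qf P u > 0" and v: "Qf P v > 0" and Ru: "Qf R u > 0"
  shows "Qf R v > 0"
proof (rule ccontr)
  assume neg: "\<not> Qf R v > 0"
  \<comment> \<open>The phase makes the mixed term nonnegative, so the whole segment from
    \<open>u\<close> to the rotated \<open>v\<close> stays in the positive cone.\<close>
  obtain k where k: "cmod k = 1" "k * cnj (Bf P u v) = of_real (cmod (cnj (Bf P u v)))" using phase_exists by blast
  define v' where "v' = k *s v"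
  have v'P: "Qf P v' > 0" and v'R: "Qf R v' \<le> 0" using v neg k by (auto simp: v'_def Qf_scale)
  have "Bf P v' u = of_real (cmod (Bf P u v))" using k Bf_swap[of P v u] by (simp add: v'_def Bf_scale)
  then have B: "Re (Bf P u v') \<ge> 0" using Bf_swap[of P u v'] by simp
  define f where "f = (\<lambda>s::real. (1 - s) *\<^sub>R u + s *\<^sub>R v')"
  have pos: "Qf P (f s) > 0" if s: "0 \<le> s" "s \<le> 1" for s
  proof -
    have "Qf P (f s) = (1 - s)\<^sup>2 * Qf P u + 2 * ((1 - s) * s * Re (Bf P u v')) + s\<^sup>2 * Qf P v'"
      unfolding f_def scaleR_s Qf_add Qf_scale Bf_scale using s by (simp del: of_real_diff)
    moreover have "(1 - s) * s * Re (Bf P u v') \<ge> 0" using s B by simp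
    moreover have "(1 - s)\<^sup>2 * Qf P u \<ge> 0" "s\<^sup>2 * Qf P v' \<ge> 0" using u v'P by simp_all
    moreover have "(1 - s)\<^sup>2 * Qf P u > 0 \<or> s\<^sup>2 * Qf P v' > 0" using u v'P by (cases "s = 1") auto
    ultimately show ?thesis by linarith
  qed
  have "continuous_on {0..1} (\<lambda>s. Qf R (f s))" unfolding f_def by (intro continuous_intros)
  moreover have "Qf R (f 1) \<le> 0" "0 \<le> Qf R (f 0)" using v'R Ru by (simp_all add: f_def)
  ultimately obtain s where s: "0 \<le> s" "s \<le> 1" "Qf R (f s) = 0"
    using IVT2'[of "\<lambda>s. Qf R (f s)" 1 0 0] by auto
  have "f s \<noteq> 0" using pos[OF s(1,2)] by auto
  then show False using zero[OF _ s(3)] pos[OF s(1,2)] by simp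
qed

text \<open>The quantitative form of ping-pong: for forms normalised to discriminant 1, disjointness
  of closed discs is positivity of the sum. If the sum were nonpositive at \<open>u\<close>, a path
  inside the first disc from \<open>u\<close> to its boundary would contain a point of the second
  disc.\<close>

lemma disjoint_posdef:
  assumes d: "dsc P = 1" "dsc R = 1" and dj: "\<And>w. w \<noteq> 0 \<Longrightarrow> \<not> (Qf P w \<le> 0 \<and> Qf R w \<le> 0)" and u0: "u \<noteq> 0"
  shows "Qf P u + Qf R u > 0"
proof (rule ccontr)
  assume neg: "\<not> Qf P u + Qf R u > 0"
  have main: False if d: "dsc P = 1" "dsc R = 1" and dj: "\<And>w. w \<noteq> 0 \<Longrightarrow> \<not> (Qf P w \<le> 0 \<and> Qf R w \<le> 0)"
    and neg: "Qf P u + Qf R u \<le> 0" and Pu: "Qf P u < 0" for P R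
  proof -
    define s where "s = - Qf P u"
    define \<beta> where "\<beta> = Qf R u"
    have s: "s > 0" using Pu by (simp add: s_def)
    have b: "\<beta> > 0" "\<beta> \<le> s" using dj[OF u0] Pu neg by (auto simp: \<beta>_def s_def)
    obtain v where v: "Bf P v u = 0" "Qf P v = s" "wd2 u v = of_real s"
      using Qf_orth[of P u] Pu d by (auto simp: s_def)
    define r where "r = Qf R v"
    define N where "N = cmod (Bf R u v)"
    have bad2: "N\<^sup>2 = \<beta> * r + s\<^sup>2" using gram[of R u v] d v by (simp add: N_def \<beta>_def r_def)
    have N0: "N \<ge> 0" by (simp add: N_def)
    obtain k where k: "cmod k = 1" "k * Bf R v u = of_real (cmod (Bf R v u))" using phase_exists by blast
    have Nk: "k * Bf R v u = of_real N" using k Bf_swap[of R v u] by (simp add: N_def)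
    \<comment> \<open>The path is \<open>u\<close> minus \<tau> times the rotated orthogonal vector.
      The first form is nonpositive along it, so the quadratic polynomial in \<tau> given by the
      second form must be positive on the unit interval.\<close>
    have x: "\<not> (\<beta> - 2 * \<tau> * N + \<tau>\<^sup>2 * r \<le> 0)" if t: "0 \<le> \<tau>" "\<tau> \<le> 1" for \<tau>
    proof -
      define x where "x = u + (of_real (-\<tau>) * k) *s v"
      have "wd2 x v = wd2 u v" by (simp add: x_def wd2_def algebra_simps)
      then have x0: "x \<noteq> 0" using v s by (auto simp: wd2_def)
      have "Bf P u ((of_real (-\<tau>) * k) *s v) = 0" using v(1) Bf_swap[of P u v] by (simp only: Bf_scale) simp
      then have "Qf P x = - s + \<tau>\<^sup>2 * s" unfolding x_def Qf_add Qf_scale using k v t by (simp add: s_def norm_mult)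
      then have 1: "Qf P x \<le> 0" using t s by (simp add: power_le_one mult_le_cancel_right1)
      have "Bf R ((of_real (-\<tau>) * k) *s v) u = of_real (-\<tau> * N)" using Nk by (simp only: Bf_scale mult.assoc) simp
      then have "Re (Bf R u ((of_real (-\<tau>) * k) *s v)) = -\<tau> * N" using Bf_swap[of R u "(of_real (-\<tau>) * k) *s v"] by simp
      then have "Qf R x = \<beta> - 2 * \<tau> * N + \<tau>\<^sup>2 * r"
        unfolding x_def Qf_add Qf_scale using k t by (simp add: \<beta>_def r_def norm_mult)
      then show ?thesis using dj[OF x0] 1 by simp
    qed
    \<comment> \<open>The end point \<tau> = 1 gives the contradiction unless \<open>r\<close> is
      large; then the vertex \<open>N / r\<close> lies in the unit interval and the value there is
      \<open>- s^2 / r\<close>.\<close>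
    consider "\<bar>\<beta> - r\<bar> \<le> 2 * s" | "r > \<beta> + 2 * s" | "r < \<beta> - 2 * s" by linarith
    then show False
    proof cases
      case 1
      have "\<bar>\<beta> - r\<bar>\<^sup>2 \<le> (2 * s)\<^sup>2" using 1 by (intro power_mono) auto
      then have le: "(\<beta> - r)\<^sup>2 \<le> 4 * s\<^sup>2" by (simp only: power2_abs power_mult_distrib) simp
      have "(\<beta> + r)\<^sup>2 = (\<beta> - r)\<^sup>2 + 4 * (\<beta> * r)" by (simp add: power2_eq_square algebra_simps)
      also have "\<dots> \<le> 4 * s\<^sup>2 + 4 * (\<beta> * r)" using le by (rule add_right_mono)
      also have "\<dots> = (2 * N)\<^sup>2" unfolding power_mult_distrib bad2 by simp
      finally have "(\<beta> + r)\<^sup>2 \<le> (2 * N)\<^sup>2" .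
      then have "\<beta> + r \<le> 2 * N" by (rule power2_le_imp_le) (use N0 in simp)
      then show False using x[of 1] by simp
    next
      case 2
      then have r: "r > 2 * s" "r > 0" using b s by auto
      have "r * (r - \<beta>) \<ge> r * (2 * s)" using 2 r by (intro mult_left_mono) auto
      moreover have "r * (2 * s) \<ge> (2 * s) * (2 * s)" using r s by (intro mult_right_mono) auto
      moreover have "(2 * s) * (2 * s) \<ge> s * s" using s by (intro mult_mono) auto
      ultimately have "s * s \<le> r * (r - \<beta>)" by (meson order_trans)
      then have "N\<^sup>2 \<le> r\<^sup>2" unfolding bad2 by (simp add: power2_eq_square algebra_simps)
      then have "N \<le> r" by (rule power2_le_imp_le) (use r in simp)
      then have t: "0 \<le> N / r" "N / r \<le> 1" using N0 r by auto
      have "\<beta> - 2 * (N / r) * N + (N / r)\<^sup>2 * r = \<beta> - N\<^sup>2 / r" using r by (simp add: power2_eq_square field_simps)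
      also have "\<dots> = - (s\<^sup>2 / r)" unfolding bad2 using r by (simp add: field_simps)
      also have "\<dots> \<le> 0" using r by simp
      finally show False using x[OF t] by simp
    next
      case 3
      then have "\<beta> + r \<le> 0" using b by simp
      then show False using x[of 1] N0 by simp
    qed
  qed
  have "Qf P u < 0 \<or> Qf R u < 0" using neg dj[OF u0] by linarith
  then show False
  proof
    assume "Qf P u < 0" then show False using main[of P R] d dj neg by simp
  next
    assume "Qf R u < 0" then show False using main[of R P] d dj neg by (simp add: add.commute conj_commute)
  qed
qed

text \<open>By homogeneity it is enough to take the minimum over the compact intersection with the
  unit sphere. It makes the strict inclusions of ping-pong uniform.\<close>

lemma cone_lower:
  fixes K :: "(complex^2) set"
  assumes "closed K" "\<And>w r. w \<in> K \<Longrightarrow> r *\<^sub>R w \<in> K" "continuous_on UNIV F" "\<And>w r. F (r *\<^sub>R w) = r\<^sup>2 * F w"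
    "\<And>w. w \<in> K \<Longrightarrow> w \<noteq> 0 \<Longrightarrow> F w > (0::real)"
  shows "\<exists>c>0. \<forall>w\<in>K. c * (norm w)\<^sup>2 \<le> F w"
proof (cases "K \<inter> sphere 0 1 = {}")
  case True
  have "w = 0" if "w \<in> K" for w
  proof (rule ccontr)
    assume "w \<noteq> 0"
    then have "(1 / norm w) *\<^sub>R w \<in> K \<inter> sphere 0 1" using assms(2)[OF that] by simp
    then show False using True by blast
  qed
  moreover have "F 0 = 0" using assms(4)[of 0 0] by simp
  ultimately show ?thesis by (intro exI[of _ 1] conjI ballI) (simp, metis norm_zero order_refl mult_zero_right power_zero_numeral)
next
  case False
  have "compact (K \<inter> sphere 0 1)" using assms(1) by (intro closed_Int_compact) auto
  then obtain x where x: "x \<in> K \<inter> sphere 0 1" "\<And>y. y \<in> K \<inter> sphere 0 1 \<Longrightarrow> F x \<le> F y"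
    using continuous_attains_inf[of "K \<inter> sphere 0 1" F] False assms(3) continuous_on_subset by blast
  have "x \<noteq> 0" using x by auto
  then have Fx: "F x > 0" using assms(5) x by auto
  have "F x * (norm w)\<^sup>2 \<le> F w" if "w \<in> K" for w
  proof (cases "w = 0")
    case True
    moreover have "F 0 = 0" using assms(4)[of 0 0] by simp
    ultimately show ?thesis by simp
  next
    case w: False
    have "F x \<le> F ((1 / norm w) *\<^sub>R w)" using w assms(2)[OF that] by (intro x(2)) simp
    also have "\<dots> = F w / (norm w)\<^sup>2" by (simp add: assms(4) power_divide)
    finally show ?thesis using w by (simp add: field_simps)
  qed
  then show ?thesis using Fx by blast
qed

lemma Qf_upper: "\<exists>C>0. \<forall>w. \<bar>Qf P w\<bar> \<le> C * (norm w)\<^sup>2"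
proof -
  have "compact (Qf P ` sphere 0 1)" by (intro compact_continuous_image continuous_intros) auto
  then obtain C where C: "C > 0" "\<And>y. y \<in> Qf P ` sphere 0 1 \<Longrightarrow> \<bar>y\<bar> \<le> C"
    using compact_imp_bounded bounded_pos by (metis real_norm_def)
  have "\<bar>Qf P w\<bar> \<le> C * (norm w)\<^sup>2" for w
  proof (cases "w = 0")
    case False
    have "\<bar>Qf P ((1 / norm w) *\<^sub>R w)\<bar> \<le> C" using False by (intro C(2) imageI) simp
    also have "Qf P ((1 / norm w) *\<^sub>R w) = Qf P w / (norm w)\<^sup>2" unfolding scaleR_s Qf_scale by (simp add: power_divide norm_divide)
    finally show ?thesis using False by (simp add: field_simps)
  qed simp
  then show ?thesis using C by blast
qed

lemma pt_gdisc: assumes "w \<noteq> 0" shows "pt w \<in> gdisc P \<longleftrightarrow> Qf P w \<le> 0" "pt w \<in> gcircle P \<longleftrightarrow> Qf P w = 0"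
proof -
  obtain a b c where P: "P = (a, b, c)" by (cases P)
  have "(pt w \<in> gdisc P \<longleftrightarrow> Qf P w \<le> 0) \<and> (pt w \<in> gcircle P \<longleftrightarrow> Qf P w = 0)"
  proof (cases "w$2 = 0")
    case True
    then have "w$1 \<noteq> 0" using assms by (auto simp: vec2_eq)
    then have "(cmod (w$1))\<^sup>2 > 0" by simp
    moreover have "Qf P w = a * (cmod (w$1))\<^sup>2" using True by (simp add: P Qf_explicit)
    ultimately show ?thesis using True \<open>w$1 \<noteq> 0\<close> by (auto simp: pt_def gdisc_def gcircle_def P mult_le_0_iff)
  next
    case False
    define z where "z = w$1 / w$2"
    have w1: "w$1 = z * w$2" using False by (simp add: z_def)
    have pos: "(cmod (w$2))\<^sup>2 > 0" using False by simp
    have "cnj b * (w$1 * cnj (w$2)) = (cnj b * z) * of_real ((cmod (w$2))\<^sup>2)"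
      unfolding w1 complex_norm_square by (simp add: mult_ac)
    then have "Re (cnj b * (w$1 * cnj (w$2))) = Re (cnj b * z) * (cmod (w$2))\<^sup>2" by (simp only: Re_complex_of_real times_complex.sel Im_complex_of_real)
    then have "Qf P w = (a * (cmod z)\<^sup>2 + 2 * Re (cnj b * z) + c) * (cmod (w$2))\<^sup>2"
      unfolding P Qf_explicit by (simp add: w1 norm_mult power_mult_distrib algebra_simps)
    then have "(Qf P w \<le> 0 \<longleftrightarrow> a * (cmod z)\<^sup>2 + 2 * Re (cnj b * z) + c \<le> 0) \<and> (Qf P w = 0 \<longleftrightarrow> a * (cmod z)\<^sup>2 + 2 * Re (cnj b * z) + c = 0)"
      using pos by (simp add: mult_le_0_iff)
    moreover have "pt w = Some z" using False by (simp add: pt_def z_def)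
    ultimately show ?thesis by (auto simp: gdisc_def gcircle_def P)
  qed
  then show "pt w \<in> gdisc P \<longleftrightarrow> Qf P w \<le> 0" "pt w \<in> gcircle P \<longleftrightarrow> Qf P w = 0" by auto
qed

lemma pt_surj: "\<exists>w. w \<noteq> 0 \<and> pt w = x"
proof (cases x)
  case None then show ?thesis by (intro exI[of _ "vector [1, 0]"]) (simp add: pt_def vec2_eq)
next
  case (Some z) then show ?thesis by (intro exI[of _ "vector [z, 1]"]) (simp add: pt_def vec2_eq)
qed

lemma pt_eq: assumes "u \<noteq> 0" "v \<noteq> 0" "pt u = pt v" shows "\<exists>k. k \<noteq> 0 \<and> v = k *s u"
proof (cases "u$2 = 0")
  case True
  then have "v$2 = 0" using assms(3) by (auto simp: pt_def split: if_splits)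
  moreover have "u$1 \<noteq> 0" "v$1 \<noteq> 0" using True calculation assms by (auto simp: vec2_eq)
  ultimately show ?thesis using True by (intro exI[of _ "v$1 / u$1"]) (simp add: vec2_eq)
next
  case False
  then have "v$2 \<noteq> 0" "u$1 / u$2 = v$1 / v$2" using assms(3) by (auto simp: pt_def split: if_splits)
  then show ?thesis using False by (intro exI[of _ "v$2 / u$2"]) (simp add: vec2_eq field_simps)
qed

lemma mulv_nonzero: assumes "det (A::complex^2^2) \<noteq> 0" "w \<noteq> 0" shows "A *v w \<noteq> 0"
proof
  assume "A *v w = 0"
  then have "A *v w = A *v 0" by (simp only: matrix_vector_mult_0_right)
  moreover have "invertible A" using assms(1) by (subst invertible_det_nz)
  then have "inj ((*v) A)" by (rule inj_matrix_vector_mult)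
  ultimately have "w = 0" by (simp only: inj_eq)
  with assms(2) show False by contradiction
qed

lemma moebC_pt: assumes "det A \<noteq> 0" "w \<noteq> 0" shows "moebC A (pt w) = pt (A *v w)"
proof (cases "w$2 = 0")
  case True
  then have "w$1 \<noteq> 0" using assms by (auto simp: vec2_eq)
  then show ?thesis using True by (simp add: moebC_def pt_def mulv2)
next
  case False
  have "A$2$1 * (w$1 / w$2) + A$2$2 = (A$2$1 * w$1 + A$2$2 * w$2) / w$2"
    "A$1$1 * (w$1 / w$2) + A$1$2 = (A$1$1 * w$1 + A$1$2 * w$2) / w$2" using False by (simp_all add: field_simps)
  then show ?thesis using False by (simp add: moebC_def pt_def mulv2)
qed

section \<open>Ping-pong contraction\<close>

text \<open>The letters are the generators and their inverses; \<open>A a\<close> maps the outside of the disc of \<open>iv a\<close> onto the disc of \<open>a\<close>.\<close>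
locale sforms =
  fixes L :: "'l set" and iv :: "'l \<Rightarrow> 'l" and A :: "'l \<Rightarrow> complex^2^2" and H :: "'l \<Rightarrow> hform" and x0 :: "complex^2"
  assumes finL: "finite L" and ivL: "a \<in> L \<Longrightarrow> iv a \<in> L" and iviv: "a \<in> L \<Longrightarrow> iv (iv a) = a" and ivne: "a \<in> L \<Longrightarrow> iv a \<noteq> a"
    and Ainv: "a \<in> L \<Longrightarrow> A (iv a) ** A a = mat 1"
    and dscH: "a \<in> L \<Longrightarrow> dsc (H a) = 1"
    and HA: "a \<in> L \<Longrightarrow> Qf (H (iv a)) w * cmod (det (A a)) = - Qf (H a) (A a *v w)"
    and dj: "a \<in> L \<Longrightarrow> b \<in> L \<Longrightarrow> a \<noteq> b \<Longrightarrow> w \<noteq> 0 \<Longrightarrow> \<not> (Qf (H a) w \<le> 0 \<and> Qf (H b) w \<le> 0)"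
    and x0nz: "x0 \<noteq> 0" and x0: "a \<in> L \<Longrightarrow> Qf (H a) x0 > 0"

lemma wd2_mulv: "wd2 (M *v u) (M *v v) = det (M::complex^2^2) * wd2 u v"
  by (simp add: wd2_def mulv2 det_2 algebra_simps)

lemma wd2_add: "wd2 (u + v) x = wd2 u x + wd2 v x" by (simp add: wd2_def algebra_simps)
lemma wd2_self [simp]: "wd2 u u = 0" by (simp add: wd2_def mult.commute)

definition cinv :: "complex^2^2 \<Rightarrow> complex^2^2" where
  "cinv M = mk2 (M$2$2 / det M) (- (M$1$2) / det M) (- (M$2$1) / det M) (M$1$1 / det M)"

lemma cinv: assumes "det M \<noteq> 0" shows "cinv M ** M = mat 1" "M ** cinv M = mat 1" "cmod (det (cinv M)) = 1 / cmod (det M)" "det (cinv M) = 1 / det M"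
proof -
  define d where "d = det M"
  have d: "d \<noteq> 0" "M$1$1 * M$2$2 - M$1$2 * M$2$1 = d" using assms by (simp_all add: d_def det_2)
  have c: "cinv M = mk2 (M$2$2 / d) (- (M$1$2) / d) (- (M$2$1) / d) (M$1$1 / d)" by (simp add: cinv_def d_def)
  have e: "(M$1$1 * M$2$2 - M$1$2 * M$2$1) / d = 1" using d by simp
  show 1: "cinv M ** M = mat 1" "M ** cinv M = mat 1"
    using e unfolding mat2_eq c by (simp_all add: mult2 diff_divide_distrib mult.commute)
  have "det (cinv M) * det M = 1" using 1(1) by (metis det_I det_mul)
  then show "det (cinv M) = 1 / det M" using assms by (simp add: field_simps)
  then show "cmod (det (cinv M)) = 1 / cmod (det M)" by (simp add: norm_divide)
qed

text \<open>Adding orthogonal vectors with opposite values gives a null vector, that is a boundary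
  point; pushing along the positive one leaves the disc. It provides points of the exterior
  arbitrarily near the circle.\<close>

lemma ext_approx: assumes d: "dsc P = 1"
  shows "\<exists>q u. q \<noteq> 0 \<and> Qf P q = 0 \<and> (\<forall>e>0. Qf P (q + e *\<^sub>R u) > 0)"
proof -
  obtain u where u: "Qf P u > 0" using Qf_pos_exists[of P] d by auto
  obtain v where v: "Bf P v u = 0" "Qf P v = - Qf P u" "wd2 u v = - of_real (Qf P u)" using Qf_orth[of P u] u d by auto
  have uv: "Bf P u v = 0" using v(1) Bf_swap[of P u v] by simp
  define q where "q = u + v"
  have "wd2 q v = - of_real (Qf P u)" using v by (simp add: q_def wd2_add)
  then have "q \<noteq> 0" using u by (auto simp: wd2_def)
  moreover have "Qf P q = 0" using v uv by (simp add: q_def Qf_add)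
  moreover have "Qf P (q + e *\<^sub>R u) > 0" if "e > 0" for e
  proof -
    have "q + e *\<^sub>R u = (1 + e) *\<^sub>R u + v" by (simp add: q_def algebra_simps)
    then have "Qf P (q + e *\<^sub>R u) = (1 + e)\<^sup>2 * Qf P u - Qf P u"
      using that by (simp only: scaleR_s Qf_add Qf_scale Bf_scale uv v(2) norm_of_real) simp
    also have "\<dots> = ((1 + e)\<^sup>2 - 1) * Qf P u" by (simp add: algebra_simps)
    also have "\<dots> > 0" using that u by (intro mult_pos_pos) (simp_all add: power2_eq_square algebra_simps add_pos_pos)
    finally show ?thesis .
  qed
  ultimately show ?thesis by blast
qed

lemma eventually_Qf_pos: assumes "Qf R q > 0" shows "eventually (\<lambda>e. Qf R (q + e *\<^sub>R u) > 0) (at_right 0)"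
proof -
  have "continuous_on UNIV (\<lambda>e::real. Qf R (q + e *\<^sub>R u))" by (intro continuous_intros)
  then have "isCont (\<lambda>e::real. Qf R (q + e *\<^sub>R u)) 0" by (simp add: continuous_on_eq_continuous_at)
  then have "((\<lambda>e. Qf R (q + e *\<^sub>R u)) \<longlongrightarrow> Qf R (q + 0 *\<^sub>R u)) (at 0)" unfolding isCont_def .
  then have "((\<lambda>e. Qf R (q + e *\<^sub>R u)) \<longlongrightarrow> Qf R q) (at_right 0)" using tendsto_within_subset[of _ _ 0 UNIV] by simp
  then show ?thesis using assms by (rule order_tendstoD)
qed

lemma mulv_inj: assumes "det (M::complex^2^2) \<noteq> 0" "M *v u = M *v v" shows "u = v"
proof -
  have "cinv M *v (M *v u) = cinv M *v (M *v v)" using assms by simp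
  then show ?thesis by (simp add: matrix_vector_mul_assoc cinv[OF assms(1)])
qed

lemma mulv_s: "(M::complex^2^2) *v (k *s w) = k *s (M *v w)"
  by (simp add: vec2_eq mulv2 algebra_simps)

text \<open>The hypotheses only say that circles go to circles and that the common exterior
  \<open>D\<close> is moved off itself. What ping-pong needs is that each generator maps the
  exterior of one disc into the interior of the other; this has to be derived from the sign of the
  forms.\<close>

lemma schottky_extract:
  assumes "schottky G"
  shows "\<exists>m gs (A :: nat \<times> bool \<Rightarrow> complex^2^2) H x0. sforms ({..<m} \<times> UNIV) (\<lambda>(i, s). (i, \<not> s)) A H x0 \<and>
     (\<forall>i<m. A (i, True) = gs i \<and> gs i \<in> G) \<and> moebC ` G = gen_group ((\<lambda>i. moebC (gs i)) ` {..<m})"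
proof -
  from assms obtain m :: nat and gs :: "nat \<Rightarrow> complex^2^2" and P P' :: "nat \<Rightarrow> hform" where G: "\<forall>A\<in>G. invertible A"
    and gP0: "\<forall>i<m. gs i \<in> G \<and> gpar_ok (P i) \<and> gpar_ok (P' i)"
    and dd0: "\<forall>i<m. \<forall>j<m. gdisc (P i) \<inter> gdisc (P' j) = {} \<and>
          (i \<noteq> j \<longrightarrow> gdisc (P i) \<inter> gdisc (P j) = {} \<and> gdisc (P' i) \<inter> gdisc (P' j) = {})"
    and gD0: "\<forall>i<m. moebC (gs i) ` gcircle (P' i) = gcircle (P i) \<and>
       moebC (gs i) ` (UNIV - (\<Union>i<m. gdisc (P i) \<union> gdisc (P' i))) \<inter> (UNIV - (\<Union>i<m. gdisc (P i) \<union> gdisc (P' i))) = {}"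
    and gen: "moebC ` G = gen_group ((\<lambda>i. moebC (gs i)) ` {..<m})"
    unfolding schottky_def Let_def by (elim conjE exE)
  have gP: "gs i \<in> G \<and> gpar_ok (P i) \<and> gpar_ok (P' i)" if "i < m" for i using gP0 that by blast
  have dd: "gdisc (P i) \<inter> gdisc (P' j) = {} \<and>
          (i \<noteq> j \<longrightarrow> gdisc (P i) \<inter> gdisc (P j) = {} \<and> gdisc (P' i) \<inter> gdisc (P' j) = {})" if "i < m" "j < m" for i j
    using dd0 that by blast
  have gD: "moebC (gs i) ` gcircle (P' i) = gcircle (P i) \<and>
       moebC (gs i) ` (UNIV - (\<Union>i<m. gdisc (P i) \<union> gdisc (P' i))) \<inter> (UNIV - (\<Union>i<m. gdisc (P i) \<union> gdisc (P' i))) = {}"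
    if "i < m" for i using gD0[THEN spec, of i] that by (rule mp)
  have det: "det (gs i) \<noteq> 0" if "i < m" for i using G gP[OF that] invertible_det_nz by blast
  have dpos: "dsc (P i) > 0" "dsc (P' i) > 0" if "i < m" for i
    using gP[OF that] by (auto simp: gpar_ok_def dsc_def split: prod.splits)
  define nrm where "nrm = (\<lambda>P. scP (1 / sqrt (dsc P)) P)"
  define N where "N = (\<lambda>i. nrm (P i))"
  define N' where "N' = (\<lambda>i. nrm (P' i))"
  have nq: "Qf (nrm P) w > 0 \<longleftrightarrow> Qf P w > 0" "Qf (nrm P) w = 0 \<longleftrightarrow> Qf P w = 0" "dsc (nrm P) = 1" if "dsc P > 0" for P w
    using that by (auto simp: nrm_def Qf_scP dsc_scP zero_less_divide_iff power_divide)
  have dN: "dsc (N i) = 1" "dsc (N' i) = 1" if "i < m" for i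
    using nq(3) dpos[OF that] by (auto simp: N_def N'_def)
  have disc: "pt w \<in> gdisc (P i) \<longleftrightarrow> Qf (N i) w \<le> 0" "pt w \<in> gdisc (P' i) \<longleftrightarrow> Qf (N' i) w \<le> 0"
    "pt w \<in> gcircle (P i) \<longleftrightarrow> Qf (N i) w = 0" "pt w \<in> gcircle (P' i) \<longleftrightarrow> Qf (N' i) w = 0" if "i < m" "w \<noteq> 0" for i w
    using pt_gdisc[OF that(2)] nq(1,2)[OF dpos(1)[OF that(1)], of w] nq(1,2)[OF dpos(2)[OF that(1)], of w]
    unfolding N_def N'_def by (auto simp: not_less[symmetric])
  define D where "D = UNIV - (\<Union>i<m. gdisc (P i) \<union> gdisc (P' i))"
  have inD: "pt w \<in> D \<longleftrightarrow> (\<forall>i<m. Qf (N i) w > 0 \<and> Qf (N' i) w > 0)" if "w \<noteq> 0" for w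
    using disc(1,2)[OF _ that] unfolding D_def by (auto simp: not_le)
  have dj1: "\<not> (Qf (N i) w \<le> 0 \<and> Qf (N' j) w \<le> 0)" "i \<noteq> j \<Longrightarrow> \<not> (Qf (N i) w \<le> 0 \<and> Qf (N j) w \<le> 0)"
    "i \<noteq> j \<Longrightarrow> \<not> (Qf (N' i) w \<le> 0 \<and> Qf (N' j) w \<le> 0)" if "i < m" "j < m" "w \<noteq> 0" for i j w
    using dd[OF that(1,2)] disc(1,2)[OF that(1,3)] disc(1,2)[OF that(2,3)] by blast+
  have zero: "Qf (N i) (gs i *v w) = 0 \<longleftrightarrow> Qf (N' i) w = 0" if i: "i < m" and w: "w \<noteq> 0" for i w
  proof
    assume "Qf (N' i) w = 0"
    then have "pt w \<in> gcircle (P' i)" using disc(4)[OF i w] by simp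
    then have "pt (gs i *v w) \<in> gcircle (P i)" using gD[OF i] moebC_pt[OF det[OF i] w] by (metis image_eqI)
    then show "Qf (N i) (gs i *v w) = 0" using disc(3)[OF i mulv_nonzero[OF det[OF i] w]] by simp
  next
    assume "Qf (N i) (gs i *v w) = 0"
    then have "pt (gs i *v w) \<in> moebC (gs i) ` gcircle (P' i)"
      using disc(3)[OF i mulv_nonzero[OF det[OF i] w]] gD[OF i] by simp
    then obtain x where x: "x \<in> gcircle (P' i)" "moebC (gs i) x = pt (gs i *v w)" by (metis imageE)
    obtain w' where w': "w' \<noteq> 0" "pt w' = x" using pt_surj by blast
    have "pt (gs i *v w') = pt (gs i *v w)" using x w' moebC_pt[OF det[OF i] w'(1)] by simp
    then obtain k where k: "gs i *v w = k *s (gs i *v w')"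
      using pt_eq[OF mulv_nonzero[OF det[OF i] w'(1)] mulv_nonzero[OF det[OF i] w]] by blast
    then have "w = k *s w'" using mulv_inj[OF det[OF i]] by (metis mulv_s)
    moreover have "Qf (N' i) w' = 0" using disc(4)[OF i w'(1)] x w' by simp
    ultimately show "Qf (N' i) w = 0" by (simp add: Qf_scale)
  qed
  have approx: "\<exists>q u. q \<noteq> 0 \<and> Qf (N' i) q = 0 \<and> (\<forall>e>0. Qf (N' i) (q + e *\<^sub>R u) > 0)
      \<and> eventually (\<lambda>e. (\<forall>j<m. Qf (N j) (q + e *\<^sub>R u) > 0 \<and> Qf (N' j) (q + e *\<^sub>R u) > 0)) (at_right 0)" if i: "i < m" for i
  proof -
    obtain q u where q: "q \<noteq> 0" "Qf (N' i) q = 0" "\<And>e. e > 0 \<Longrightarrow> Qf (N' i) (q + e *\<^sub>R u) > 0" using ext_approx[OF dN(2)[OF i]] by blast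
    have "eventually (\<lambda>e. Qf (N j) (q + e *\<^sub>R u) > 0 \<and> Qf (N' j) (q + e *\<^sub>R u) > 0) (at_right 0)" if j: "j < m" for j
    proof (rule eventually_conj)
      have "Qf (N j) q > 0" using dj1(1)[OF j i q(1)] q(2) by auto
      then show "eventually (\<lambda>e. Qf (N j) (q + e *\<^sub>R u) > 0) (at_right 0)" by (rule eventually_Qf_pos)
      show "eventually (\<lambda>e. Qf (N' j) (q + e *\<^sub>R u) > 0) (at_right 0)"
      proof (cases "j = i")
        case True
        show ?thesis unfolding True using eventually_at_right_less[of "0::real"] by eventually_elim (rule q(3))
      next
        case False
        then have "Qf (N' j) q > 0" using dj1(3)[OF j i q(1)] q(2) by auto
        then show ?thesis by (rule eventually_Qf_pos)
      qed
    qed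
    then have "eventually (\<lambda>e. \<forall>j\<in>{..<m}. Qf (N j) (q + e *\<^sub>R u) > 0 \<and> Qf (N' j) (q + e *\<^sub>R u) > 0) (at_right 0)"
      by (intro eventually_ball_finite) auto
    then have "eventually (\<lambda>e. \<forall>j<m. Qf (N j) (q + e *\<^sub>R u) > 0 \<and> Qf (N' j) (q + e *\<^sub>R u) > 0) (at_right 0)"
      by (rule eventually_mono) simp
    then show ?thesis using q by (rule_tac exI[of _ q], rule_tac exI[of _ u]) simp
  qed
  \<comment> \<open>Otherwise \<open>const_sign\<close> would send the whole exterior to the
    exterior. Points just outside the circle lie in \<open>D\<close>, and their images would be just
    outside the image circle and again in \<open>D\<close>.\<close>
  have ext: "Qf (N i) (gs i *v w) < 0" if i: "i < m" and w: "Qf (N' i) w > 0" for i w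
  proof (rule ccontr)
    assume nn: "\<not> Qf (N i) (gs i *v w) < 0"
    have w0: "w \<noteq> 0" using w by auto
    then have gw: "Qf (pullb (N i) (gs i)) w > 0" using zero[OF i w0] w nn unfolding Qf_pullb by linarith
    have all: "Qf (N i) (gs i *v v) > 0" if "Qf (N' i) v > 0" for v
      using const_sign[of "pullb (N i) (gs i)" "N' i", OF _ w that gw] zero[OF i] unfolding Qf_pullb by blast
    obtain q u where q: "q \<noteq> 0" "Qf (N' i) q = 0" "\<And>e. e > 0 \<Longrightarrow> Qf (N' i) (q + e *\<^sub>R u) > 0"
      and eval: "eventually (\<lambda>e. (\<forall>j<m. Qf (N j) (q + e *\<^sub>R u) > 0 \<and> Qf (N' j) (q + e *\<^sub>R u) > 0)) (at_right 0)" using approx[OF i] by blast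
    have gq0: "gs i *v q \<noteq> 0" using mulv_nonzero[OF det[OF i] q(1)] .
    have gq: "Qf (N i) (gs i *v q) = 0" using zero[OF i q(1)] q(2) by simp
    have "eventually (\<lambda>e. Qf (N j) (gs i *v (q + e *\<^sub>R u)) > 0 \<and> Qf (N' j) (gs i *v (q + e *\<^sub>R u)) > 0) (at_right 0)" if j: "j < m" for j
    proof (rule eventually_conj)
      have "Qf (N' j) (gs i *v q) > 0" using dj1(1)[OF i j gq0] gq by auto
      then show "eventually (\<lambda>e. Qf (N' j) (gs i *v (q + e *\<^sub>R u)) > 0) (at_right 0)"
        unfolding Qf_pullb[symmetric] by (rule eventually_Qf_pos)
      show "eventually (\<lambda>e. Qf (N j) (gs i *v (q + e *\<^sub>R u)) > 0) (at_right 0)"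
      proof (cases "j = i")
        case True
        show ?thesis unfolding True using eventually_at_right_less[of "0::real"] by eventually_elim (rule all[OF q(3)])
      next
        case False
        then have "Qf (N j) (gs i *v q) > 0" using dj1(2)[OF j i gq0] gq by auto
        then show ?thesis unfolding Qf_pullb[symmetric] by (rule eventually_Qf_pos)
      qed
    qed
    then have "eventually (\<lambda>e. \<forall>j\<in>{..<m}. Qf (N j) (gs i *v (q + e *\<^sub>R u)) > 0 \<and> Qf (N' j) (gs i *v (q + e *\<^sub>R u)) > 0) (at_right 0)"
      by (intro eventually_ball_finite) auto
    from eventually_conj[OF eventually_conj[OF this eval] eventually_at_right_less[of "0::real"]]
    obtain e where e: "\<forall>j\<in>{..<m}. Qf (N j) (gs i *v (q + e *\<^sub>R u)) > 0 \<and> Qf (N' j) (gs i *v (q + e *\<^sub>R u)) > 0"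
      "\<forall>j<m. Qf (N j) (q + e *\<^sub>R u) > 0 \<and> Qf (N' j) (q + e *\<^sub>R u) > 0" "e > 0"
      by (auto dest!: eventually_happens)
    let ?x = "q + e *\<^sub>R u"
    have x0: "?x \<noteq> 0" using q(3)[OF e(3)] by (metis Qf_zero less_irrefl)
    have "pt ?x \<in> D" using inD[OF x0] e by simp
    moreover have "pt (gs i *v ?x) \<in> D" using inD[OF mulv_nonzero[OF det[OF i] x0]] e by simp
    moreover have "moebC (gs i) (pt ?x) = pt (gs i *v ?x)" by (rule moebC_pt[OF det[OF i] x0])
    ultimately have "pt (gs i *v ?x) \<in> moebC (gs i) ` D \<inter> D" by (metis IntI image_eqI)
    then show False using gD[OF i] unfolding D_def[symmetric] by simp
  qed
  \<comment> \<open>Otherwise interior and exterior would both be mapped into the same disc, and the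
    matrix would not be surjective.\<close>
  have int: "Qf (N i) (gs i *v w) > 0" if i: "i < m" and w: "Qf (N' i) w < 0" for i w
  proof (rule ccontr)
    assume n: "\<not> Qf (N i) (gs i *v w) > 0"
    have w0: "w \<noteq> 0" using w by auto
    let ?R = "scP (-1) (pullb (N i) (gs i))"
    have gw: "Qf ?R w > 0" using zero[OF i w0] w n unfolding Qf_scP Qf_pullb by linarith
    have wP: "Qf (scP (-1) (N' i)) w > 0" using w by (simp add: Qf_scP)
    have all: "Qf (N i) (gs i *v v) < 0" if v: "Qf (N' i) v < 0" for v
    proof -
      have "Qf (scP (-1) (N' i)) v > 0" using v by (simp add: Qf_scP)
      from const_sign[of ?R "scP (-1) (N' i)", OF _ wP this gw] show ?thesis
        using zero[OF i] unfolding Qf_pullb Qf_scP by simp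
    qed
    obtain u where u: "Qf (N i) u > 0" using Qf_pos_exists[of "N i"] dN[OF i] by auto
    define v where "v = cinv (gs i) *v u"
    have gv: "gs i *v v = u" by (simp add: v_def matrix_vector_mul_assoc cinv[OF det[OF i]])
    have v0: "v \<noteq> 0" using gv u by (metis Qf_zero less_irrefl matrix_vector_mult_0_right)
    have "Qf (N' i) v \<noteq> 0" using zero[OF i v0] gv u by simp
    then show False using all[of v] ext[OF i, of v] gv u by (cases "Qf (N' i) v > 0") auto
  qed
  have iff: "Qf (N i) (gs i *v w) \<ge> 0 \<longleftrightarrow> Qf (N' i) w \<le> 0" if i: "i < m" and w: "w \<noteq> 0" for i w
    using ext[OF i, of w] int[OF i, of w] zero[OF i w] by linarith
  have "\<exists>x0. x0 \<noteq> 0 \<and> (\<forall>i<m. Qf (N i) x0 > 0 \<and> Qf (N' i) x0 > 0)"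
  proof (cases "m = 0")
    case True then show ?thesis by (intro exI[of _ "vector [1, 0]"]) (simp add: vec2_eq)
  next
    case False
    then have m: "0 < m" by simp
    obtain q u where eval: "eventually (\<lambda>e::real. (\<forall>j<m. Qf (N j) (q + e *\<^sub>R u) > 0 \<and> Qf (N' j) (q + e *\<^sub>R u) > 0)) (at_right 0)" using approx[OF m] by blast
    then obtain e :: real where e: "\<forall>j<m. Qf (N j) (q + e *\<^sub>R u) > 0 \<and> Qf (N' j) (q + e *\<^sub>R u) > 0" by (auto dest!: eventually_happens)
    moreover have "q + e *\<^sub>R u \<noteq> 0" using e m by (metis Qf_zero less_irrefl)
    ultimately show ?thesis by blast
  qed
  then obtain x0 where x0: "x0 \<noteq> 0" "\<And>i. i < m \<Longrightarrow> Qf (N i) x0 > 0 \<and> Qf (N' i) x0 > 0" by blast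
  define A where "A = (\<lambda>(i, s). if s then gs i else cinv (gs i))"
  \<comment> \<open>For an inverse letter the pulled back form replaces \<open>N' i\<close>. Both
    describe the same disc by \<open>Hle\<close>, but with the pulled back form the transformation
    rule \<open>HA\<close> is an exact equality.\<close>
  define H where "H = (\<lambda>(i, s). if s then N i else scP (- 1 / cmod (det (gs i))) (pullb (N i) (gs i)))"
  have H': "Qf (H (i, False)) w = - Qf (N i) (gs i *v w) / cmod (det (gs i))" for i w
    by (simp add: H_def Qf_scP Qf_pullb)
  have Hle: "Qf (H (i, False)) w \<le> 0 \<longleftrightarrow> Qf (N' i) w \<le> 0" if i: "i < m" and w: "w \<noteq> 0" for i w
  proof -
    have "cmod (det (gs i)) > 0" using det[OF i] by simp
    then have "Qf (H (i, False)) w \<le> 0 \<longleftrightarrow> Qf (N i) (gs i *v w) \<ge> 0" unfolding H' by (auto simp: zero_le_divide_iff)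
    then show ?thesis using iff[OF i w] by simp
  qed
  have "sforms ({..<m} \<times> UNIV) (\<lambda>(i, s). (i, \<not> s)) A H x0"
  proof
    show "finite ({..<m} \<times> (UNIV :: bool set))" by simp
  next
    fix a :: "nat \<times> bool" assume a: "a \<in> {..<m} \<times> UNIV"
    obtain i s where ais: "a = (i, s)" "i < m" using a by auto
    note d = det[OF ais(2)]
    show "(case a of (i, s) \<Rightarrow> (i, \<not> s)) \<in> {..<m} \<times> UNIV" using a by auto
    show "(case case a of (i, s) \<Rightarrow> (i, \<not> s) of (i, s) \<Rightarrow> (i, \<not> s)) = a" by (simp add: ais)
    show "(case a of (i, s) \<Rightarrow> (i, \<not> s)) \<noteq> a" by (simp add: ais)
    show "A (case a of (i, s) \<Rightarrow> (i, \<not> s)) ** A a = mat 1" by (simp add: ais A_def cinv[OF d])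
    show "dsc (H a) = 1" using d by (simp add: ais H_def dN[OF ais(2)] dsc_scP dsc_pullb power_divide)
    show "Qf (H a) x0 > 0"
    proof (cases s)
      case True then show ?thesis using x0(2)[OF ais(2)] by (simp add: ais H_def)
    next
      case False
      then show ?thesis using x0(2)[OF ais(2)] Hle[OF ais(2) x0(1)] ais by (simp add: not_le[symmetric])
    qed
    fix w
    show "Qf (H (case a of (i, s) \<Rightarrow> (i, \<not> s))) w * cmod (det (A a)) = - Qf (H a) (A a *v w)"
    proof (cases s)
      case True
      then show ?thesis using d by (simp add: ais H' A_def) (simp add: H_def)
    next
      case False
      have "gs i *v (cinv (gs i) *v w) = w" by (simp add: matrix_vector_mul_assoc cinv[OF d])
      then show ?thesis using d False by (simp add: ais H' A_def cinv(3)[OF d]) (simp add: H_def)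
    qed
  next
    fix a b :: "nat \<times> bool" and w :: "complex^2"
    assume ab: "a \<in> {..<m} \<times> UNIV" "b \<in> {..<m} \<times> UNIV" "a \<noteq> b" "w \<noteq> 0"
    obtain i s where ais: "a = (i, s)" "i < m" using ab by auto
    obtain j t where jt: "b = (j, t)" "j < m" using ab by auto
    have HN: "Qf (H (k, True)) w = Qf (N k) w" for k by (simp add: H_def)
    show "\<not> (Qf (H a) w \<le> 0 \<and> Qf (H b) w \<le> 0)"
    proof (cases s; cases t)
      assume st: "s" "t"
      then have "i \<noteq> j" using ab(3) ais jt by simp
      then show ?thesis using dj1(2)[OF ais(2) jt(2) ab(4)] st by (simp add: ais jt HN)
    next
      assume st: "s" "\<not> t"
      show ?thesis using dj1(1)[OF ais(2) jt(2) ab(4)] Hle[OF jt(2) ab(4)] st by (simp add: ais jt HN)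
    next
      assume st: "\<not> s" "t"
      show ?thesis using dj1(1)[OF jt(2) ais(2) ab(4)] Hle[OF ais(2) ab(4)] st by (simp add: ais jt HN conj_commute)
    next
      assume st: "\<not> s" "\<not> t"
      then have "i \<noteq> j" using ab(3) ais jt by simp
      then show ?thesis using dj1(3)[OF ais(2) jt(2) ab(4)] Hle[OF jt(2) ab(4)] Hle[OF ais(2) ab(4)] st by (simp add: ais jt)
    qed
  next
    show "x0 \<noteq> 0" by (rule x0(1))
  qed
  then show ?thesis using gP gen by (rule_tac exI[of _ m], rule_tac exI[of _ gs], rule_tac exI[of _ A], rule_tac exI[of _ H], rule_tac exI[of _ x0]) (auto simp: A_def)
qed

lemma finite_uniform_lower:
  assumes "finite X" "\<And>x. x \<in> X \<Longrightarrow> \<exists>c>0. \<forall>y. P x y \<longrightarrow> c * f y \<le> (F x y :: real)" "\<And>y. f y \<ge> (0::real)"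
  shows "\<exists>c>0. \<forall>x\<in>X. \<forall>y. P x y \<longrightarrow> c * f y \<le> F x y"
  using assms(1,2)
proof (induction X rule: finite_induct)
  case empty show ?case by (intro exI[of _ 1]) auto
next
  case (insert x X)
  obtain c where c: "c > 0" "\<forall>x\<in>X. \<forall>y. P x y \<longrightarrow> c * f y \<le> F x y" using insert by auto
  obtain d where d: "d > 0" "\<forall>y. P x y \<longrightarrow> d * f y \<le> F x y" using insert.prems[of x] by auto
  have "min c d * f y \<le> c * f y" "min c d * f y \<le> d * f y" for y using assms(3) by (auto intro!: mult_right_mono)
  then have "min c d * f y \<le> F x' y" if "x' \<in> insert x X" "P x' y" for x' y
    using c(2) d(2) that by (metis insertE order_trans)
  then show ?case using c(1) d(1) by (intro exI[of _ "min c d"]) simp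
qed

lemma wd2_le: "cmod (wd2 u v) \<le> norm u * norm v"
proof (rule power2_le_imp_le)
  have n: "(norm w)\<^sup>2 = (cmod (w$1))\<^sup>2 + (cmod (w$2))\<^sup>2" for w :: "complex^2" by (simp add: norm_vec_def L2_set_def sum_2)
  have "cmod (wd2 u v) \<le> cmod (u$1) * cmod (v$2) + cmod (u$2) * cmod (v$1)"
    unfolding wd2_def using norm_triangle_ineq4[of "u$1 * v$2" "u$2 * v$1"] by (simp add: norm_mult)
  then have "(cmod (wd2 u v))\<^sup>2 \<le> (cmod (u$1) * cmod (v$2) + cmod (u$2) * cmod (v$1))\<^sup>2" by (intro power_mono) auto
  also have "\<dots> \<le> ((cmod (u$1))\<^sup>2 + (cmod (u$2))\<^sup>2) * ((cmod (v$2))\<^sup>2 + (cmod (v$1))\<^sup>2)" by (rule cauchy2)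
  also have "\<dots> = (norm u * norm v)\<^sup>2" by (simp add: n power_mult_distrib add.commute)
  finally show "(cmod (wd2 u v))\<^sup>2 \<le> (norm u * norm v)\<^sup>2" .
qed simp

section \<open>Uniform contraction along reduced words\<close>

context sforms begin

lemma detA: "a \<in> L \<Longrightarrow> det (A a) \<noteq> 0"
  using Ainv[of a] by (metis det_I det_mul mult_zero_right zero_neq_one)

lemma A_iv_right: "a \<in> L \<Longrightarrow> A a ** A (iv a) = mat 1"
  using Ainv[OF ivL] iviv by metis

lemma A_cancel: "a \<in> L \<Longrightarrow> A a *v (A (iv a) *v w) = w" "a \<in> L \<Longrightarrow> A (iv a) *v (A a *v w) = w"
  by (simp_all add: matrix_vector_mul_assoc Ainv A_iv_right)

lemma ping: assumes "a \<in> L" "b \<in> L" "b \<noteq> iv a" "w \<noteq> 0" "Qf (H b) w \<le> 0" shows "Qf (H a) (A a *v w) < 0"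
proof -
  have "Qf (H (iv a)) w > 0" using dj[OF ivL[OF assms(1)] assms(2) _ assms(4)] assms(3,5) by auto
  moreover have "cmod (det (A a)) > 0" using detA[OF assms(1)] by simp
  ultimately have "Qf (H (iv a)) w * cmod (det (A a)) > 0" by simp
  then show ?thesis using HA[OF assms(1), of w] by simp
qed

text \<open>By \<open>disjoint_posdef\<close> the sum of the two forms is at least
  \<open>c |u|^2\<close>, while the second form is at most \<open>D |u|^2\<close>. Hence a share
  \<open>c / D\<close> of it can be given away.\<close>

lemma contraction: "\<exists>\<theta>. 0 \<le> \<theta> \<and> \<theta> < 1 \<and> (\<forall>b\<in>L. \<forall>e\<in>L. b \<noteq> e \<longrightarrow> (\<forall>u. Qf (H b) u \<le> 0 \<longrightarrow> - Qf (H b) u \<le> \<theta> * Qf (H e) u))"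
proof -
  have "\<exists>c>0. \<forall>x\<in>{(b, e). b \<in> L \<and> e \<in> L \<and> b \<noteq> e}. \<forall>u. True \<longrightarrow> c * (norm u)\<^sup>2 \<le> Qf (H (fst x)) u + Qf (H (snd x)) u"
  proof (rule finite_uniform_lower)
    show "finite {(b, e). b \<in> L \<and> e \<in> L \<and> b \<noteq> e}" by (rule finite_subset[of _ "L \<times> L"]) (auto simp: finL)
    fix x assume "x \<in> {(b, e). b \<in> L \<and> e \<in> L \<and> b \<noteq> e}"
    then obtain b e where be: "x = (b, e)" "b \<in> L" "e \<in> L" "b \<noteq> e" by auto
    have "\<exists>c>0. \<forall>w\<in>UNIV. c * (norm w)\<^sup>2 \<le> Qf (H b) w + Qf (H e) w"
    proof (rule cone_lower)
      show "continuous_on UNIV (\<lambda>w. Qf (H b) w + Qf (H e) w)" by (intro continuous_intros)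
      show "Qf (H b) (r *\<^sub>R w) + Qf (H e) (r *\<^sub>R w) = r\<^sup>2 * (Qf (H b) w + Qf (H e) w)" for w r
        unfolding scaleR_s Qf_scale by (simp add: algebra_simps)
      show "Qf (H b) w + Qf (H e) w > 0" if "w \<noteq> 0" for w
        by (rule disjoint_posdef[OF dscH[OF be(2)] dscH[OF be(3)] dj[OF be(2-4)] that])
    qed auto
    then show "\<exists>c>0. \<forall>u. True \<longrightarrow> c * (norm u)\<^sup>2 \<le> Qf (H (fst x)) u + Qf (H (snd x)) u" by (simp add: be)
  qed simp
  then obtain c where c: "c > 0" "\<And>b e u. b \<in> L \<Longrightarrow> e \<in> L \<Longrightarrow> b \<noteq> e \<Longrightarrow> c * (norm u)\<^sup>2 \<le> Qf (H b) u + Qf (H e) u" by force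
  have "\<exists>C>0. \<forall>e\<in>L. \<forall>u. Qf (H e) u \<le> C * (norm u)\<^sup>2"
  proof -
    have "\<forall>e\<in>L. \<exists>C>0. \<forall>u. \<bar>Qf (H e) u\<bar> \<le> C * (norm u)\<^sup>2" using Qf_upper by blast
    then obtain Cf where Cf: "\<And>e. e \<in> L \<Longrightarrow> Cf e > 0" "\<And>e u. e \<in> L \<Longrightarrow> \<bar>Qf (H e) u\<bar> \<le> Cf e * (norm u)\<^sup>2" by metis
    have "Qf (H e) u \<le> (1 + (\<Sum>e\<in>L. Cf e)) * (norm u)\<^sup>2" if "e \<in> L" for e u
    proof -
      have "Cf e \<le> (\<Sum>e\<in>L. Cf e)" using that finL Cf(1) by (intro member_le_sum) (auto intro: less_imp_le)
      then have "Cf e * (norm u)\<^sup>2 \<le> (1 + (\<Sum>e\<in>L. Cf e)) * (norm u)\<^sup>2" by (intro mult_right_mono) auto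
      then show ?thesis using Cf(2)[OF that, of u] by linarith
    qed
    moreover have "1 + (\<Sum>e\<in>L. Cf e) > 0" using Cf(1) by (intro add_pos_nonneg sum_nonneg) (auto intro: less_imp_le)
    ultimately show ?thesis by blast
  qed
  then obtain C where C: "C > 0" "\<And>e u. e \<in> L \<Longrightarrow> Qf (H e) u \<le> C * (norm u)\<^sup>2" by blast
  \<comment> \<open>Taking the maximum with \<open>c\<close> keeps \<open>1 - c / D\<close>
    nonnegative.\<close>
  define D where "D = max C c"
  have D: "D > 0" "D \<ge> c" "D \<ge> C" using C c by (auto simp: D_def)
  have CD: "Qf (H e) u \<le> D * (norm u)\<^sup>2" if "e \<in> L" for e u
    using C(2)[OF that, of u] mult_right_mono[OF D(3), of "(norm u)\<^sup>2"] by simp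
  show ?thesis
  proof (intro exI[of _ "1 - c / D"] conjI ballI impI allI)
    show "0 \<le> 1 - c / D" "1 - c / D < 1" using D c by (auto simp: field_simps)
    fix b e u assume be: "b \<in> L" "e \<in> L" "b \<noteq> e" "Qf (H b) u \<le> 0"
    have "c / D * Qf (H e) u \<le> c / D * (D * (norm u)\<^sup>2)" using CD[OF be(2), of u] D c by (intro mult_left_mono) auto
    also have "\<dots> = c * (norm u)\<^sup>2" using D by simp
    also have "\<dots> \<le> Qf (H b) u + Qf (H e) u" by (rule c(2)[OF be(1-3)])
    finally show "- Qf (H b) u \<le> (1 - c / D) * Qf (H e) u" by (simp add: algebra_simps)
  qed
qed

text \<open>A vector whose next step stays in an admissible disc lies in a closed cone inside the
  open disc of \<open>a\<close>. There the form is comparable with the squared norm, which lets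
  \<open>limit_line_decay\<close> pass from forms to norms.\<close>

lemma interior_bound: "\<exists>c>0. \<forall>a\<in>L. \<forall>b\<in>L. b \<noteq> iv a \<longrightarrow> (\<forall>u. Qf (H b) (A (iv a) *v u) \<le> 0 \<longrightarrow> c * (norm u)\<^sup>2 \<le> - Qf (H a) u)"
proof -
  have "\<exists>c>0. \<forall>x\<in>{(a, b). a \<in> L \<and> b \<in> L \<and> b \<noteq> iv a}. \<forall>u. Qf (H (snd x)) (A (iv (fst x)) *v u) \<le> 0 \<longrightarrow> c * (norm u)\<^sup>2 \<le> - Qf (H (fst x)) u"
  proof (rule finite_uniform_lower)
    show "finite {(a, b). a \<in> L \<and> b \<in> L \<and> b \<noteq> iv a}" by (rule finite_subset[of _ "L \<times> L"]) (auto simp: finL)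
    fix x assume "x \<in> {(a, b). a \<in> L \<and> b \<in> L \<and> b \<noteq> iv a}"
    then obtain a b where ab: "x = (a, b)" "a \<in> L" "b \<in> L" "b \<noteq> iv a" by auto
    have "\<exists>c>0. \<forall>w\<in>{u. Qf (pullb (H b) (A (iv a))) u \<le> 0}. c * (norm w)\<^sup>2 \<le> - Qf (H a) w"
    proof (rule cone_lower)
      show "closed {u. Qf (pullb (H b) (A (iv a))) u \<le> 0}" by (intro closed_Collect_le continuous_intros)
      show "r *\<^sub>R w \<in> {u. Qf (pullb (H b) (A (iv a))) u \<le> 0}" if "w \<in> {u. Qf (pullb (H b) (A (iv a))) u \<le> 0}" for w r
        using that unfolding scaleR_s mem_Collect_eq Qf_scale by (simp add: mult_nonneg_nonpos)
      show "continuous_on UNIV (\<lambda>w. - Qf (H a) w)" by (intro continuous_intros)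
      show "- Qf (H a) (r *\<^sub>R w) = r\<^sup>2 * - Qf (H a) w" for w r unfolding scaleR_s Qf_scale by simp
      show "- Qf (H a) w > 0" if "w \<in> {u. Qf (pullb (H b) (A (iv a))) u \<le> 0}" "w \<noteq> 0" for w
      proof -
        have "A (iv a) *v w \<noteq> 0" using mulv_nonzero[OF detA[OF ivL[OF ab(2)]] that(2)] .
        then have "Qf (H a) (A a *v (A (iv a) *v w)) < 0" using ping[OF ab(2-4)] that(1) unfolding Qf_pullb by blast
        then show ?thesis using A_cancel(1)[OF ab(2)] by simp
      qed
    qed
    then show "\<exists>c>0. \<forall>u. Qf (H (snd x)) (A (iv (fst x)) *v u) \<le> 0 \<longrightarrow> c * (norm u)\<^sup>2 \<le> - Qf (H (fst x)) u"
      unfolding Qf_pullb ab by auto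
  qed simp
  then show ?thesis by fastforce
qed

definition iword :: "(nat \<Rightarrow> 'l) \<Rightarrow> bool" where
  "iword a \<longleftrightarrow> (\<forall>k. a k \<in> L \<and> a (Suc k) \<noteq> iv (a k))"

primrec Mk :: "(nat \<Rightarrow> 'l) \<Rightarrow> nat \<Rightarrow> complex^2^2" where
  "Mk a 0 = mat 1"
| "Mk a (Suc k) = A (iv (a k)) ** Mk a k"

text \<open>The line in all nested cones determined by the infinite word \<open>a\<close>; note that \<open>Mk a k\<close> is the inverse of the
  product of the first \<open>k\<close> letters.\<close>
definition limit_line :: "(nat \<Rightarrow> 'l) \<Rightarrow> (complex^2) set" where
  "limit_line a = {w. \<forall>k. Qf (H (a k)) (Mk a k *v w) \<le> 0}"

lemma det_Mk: "iword a \<Longrightarrow> det (Mk a k) \<noteq> 0"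
  by (induction k) (auto simp: det_mul iword_def detA ivL)

lemma limit_line_nested: assumes a: "iword a" and w: "w \<noteq> 0" "Qf (H (a (Suc k))) (Mk a (Suc k) *v w) \<le> 0"
  shows "Qf (H (a k)) (Mk a k *v w) < 0"
proof -
  have L: "a k \<in> L" "a (Suc k) \<in> L" "a (Suc k) \<noteq> iv (a k)" using a by (auto simp: iword_def)
  have "Qf (H (a k)) (A (a k) *v (Mk a (Suc k) *v w)) < 0"
    by (rule ping[OF L mulv_nonzero[OF det_Mk[OF a] w(1)] w(2)])
  then show ?thesis by (simp add: matrix_vector_mul_assoc[symmetric] A_cancel(1)[OF L(1)])
qed

text \<open>The values \<open>- Qf (H (a j))\<close> along the orbit shrink by \<theta> at each
  step, apart from the determinant that enters through \<open>HA\<close>. The forms are compared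
  with the norm only at the two ends, so the constant does not depend on the word.\<close>

lemma limit_line_decay:
  "\<exists>C \<theta>. 0 \<le> \<theta> \<and> \<theta> < 1 \<and> (\<forall>a w k. iword a \<longrightarrow> w \<in> limit_line a \<longrightarrow> (norm (Mk a k *v w))\<^sup>2 \<le> C * \<theta>^k * (norm w)\<^sup>2 * cmod (det (Mk a k)))"
proof -
  obtain \<theta> where th: "0 \<le> \<theta>" "\<theta> < 1" "\<And>b e u. b \<in> L \<Longrightarrow> e \<in> L \<Longrightarrow> b \<noteq> e \<Longrightarrow> Qf (H b) u \<le> 0 \<Longrightarrow> - Qf (H b) u \<le> \<theta> * Qf (H e) u"
    using contraction by blast
  obtain c where c: "c > 0" "\<And>a b u. a \<in> L \<Longrightarrow> b \<in> L \<Longrightarrow> b \<noteq> iv a \<Longrightarrow> Qf (H b) (A (iv a) *v u) \<le> 0 \<Longrightarrow> c * (norm u)\<^sup>2 \<le> - Qf (H a) u"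
    using interior_bound by blast
  have "\<forall>e\<in>L. \<exists>C>0. \<forall>u. \<bar>Qf (H e) u\<bar> \<le> C * (norm u)\<^sup>2" using Qf_upper by blast
  then obtain Cf where Cf: "\<And>e. e \<in> L \<Longrightarrow> Cf e > 0" "\<And>e u. e \<in> L \<Longrightarrow> \<bar>Qf (H e) u\<bar> \<le> Cf e * (norm u)\<^sup>2" by metis
  define C where "C = (\<Sum>e\<in>L. Cf e)"
  have CfC: "Cf e \<le> C" if "e \<in> L" for e unfolding C_def using that finL Cf(1) by (intro member_le_sum) (auto intro: less_imp_le)
  have "(norm (Mk a k *v w))\<^sup>2 \<le> C / c * \<theta>^k * (norm w)\<^sup>2 * cmod (det (Mk a k))" if a: "iword a" and w: "w \<in> limit_line a" for a w k
  proof -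
    have aL: "a j \<in> L" "a (Suc j) \<noteq> iv (a j)" for j using a by (auto simp: iword_def)
    have wk: "Qf (H (a j)) (Mk a j *v w) \<le> 0" for j using w by (simp add: limit_line_def)
    define q where "q = (\<lambda>j. - Qf (H (a j)) (Mk a j *v w))"
    define d where "d = (\<lambda>j. cmod (det (Mk a j)))"
    have q: "q k \<le> \<theta>^k * q 0 * d k"
    proof (induction k)
      case 0 then show ?case by (simp add: d_def)
    next
      case (Suc k)
      let ?u = "Mk a (Suc k) *v w"
      have u: "A (a k) *v ?u = Mk a k *v w" using A_cancel(1)[OF aL(1)] by (simp add: matrix_vector_mul_assoc[symmetric])
      have dk: "cmod (det (A (a k))) > 0" using detA[OF aL(1)] by simp
      have "Qf (H (iv (a k))) ?u * cmod (det (A (a k))) = q k" using HA[OF aL(1), of k ?u] u by (simp add: q_def)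
      then have 1: "Qf (H (iv (a k))) ?u = q k / cmod (det (A (a k)))" using dk by (simp add: field_simps)
      have "det (A (iv (a k))) * det (A (a k)) = 1" using Ainv[OF aL(1)] by (metis det_I det_mul)
      then have "cmod (det (A (iv (a k)))) * cmod (det (A (a k))) = 1" by (metis norm_mult norm_one)
      then have 2: "d (Suc k) = d k / cmod (det (A (a k)))" using dk by (simp add: d_def det_mul norm_mult field_simps)
      have "q (Suc k) \<le> \<theta> * Qf (H (iv (a k))) ?u" unfolding q_def using th(3)[OF aL(1) ivL[OF aL(1)] aL(2) wk] .
      also have "\<dots> = \<theta> * (q k / cmod (det (A (a k))))" by (simp only: 1)
      also have "\<dots> \<le> \<theta> * (\<theta>^k * q 0 * d k / cmod (det (A (a k))))" using Suc dk th(1) by (intro mult_left_mono divide_right_mono) auto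
      also have "\<dots> = \<theta>^Suc k * q 0 * d (Suc k)" unfolding 2 by simp
      finally show ?case .
    qed
    have "Qf (H (a (Suc k))) (A (iv (a k)) *v (Mk a k *v w)) \<le> 0" using wk[of "Suc k"] by (simp add: matrix_vector_mul_assoc)
    then have "c * (norm (Mk a k *v w))\<^sup>2 \<le> q k" unfolding q_def by (rule c(2)[OF aL(1) aL(1) aL(2)])
    also have "\<dots> \<le> \<theta>^k * q 0 * d k" by (rule q)
    also have "\<dots> \<le> \<theta>^k * (C * (norm w)\<^sup>2) * d k"
    proof (intro mult_right_mono mult_left_mono)
      have "q 0 \<le> Cf (a 0) * (norm w)\<^sup>2" using Cf(2)[OF aL(1), of 0 w] by (simp add: q_def abs_le_iff)
      also have "\<dots> \<le> C * (norm w)\<^sup>2" using CfC[OF aL(1)] by (intro mult_right_mono) auto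
      finally show "q 0 \<le> C * (norm w)\<^sup>2" .
    qed (use th in \<open>auto simp: d_def\<close>)
    finally show ?thesis using c(1) by (simp add: d_def field_simps)
  qed
  then show ?thesis using th(1,2) by blast
qed

end

section \<open>Infinite words and their limit lines\<close>

lemma cline_iff: "x \<in> cline w \<longleftrightarrow> (\<exists>c. x = c *s w)" by (auto simp: cline_def)

lemma wd2_zero_parallel: assumes "w \<noteq> 0" "wd2 w v = 0" shows "v \<in> cline w"
proof -
  have e: "w$1 * v$2 = w$2 * v$1" using assms(2) by (simp add: wd2_def)
  have "w$1 \<noteq> 0 \<or> w$2 \<noteq> 0" using assms(1) by (auto simp: vec2_eq)
  then show ?thesis
  proof
    assume "w$1 \<noteq> 0"
    then have "v = (v$1 / w$1) *s w" using e by (simp add: vec2_eq field_simps)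
    then show ?thesis unfolding cline_iff by blast
  next
    assume "w$2 \<noteq> 0"
    then have "v = (v$2 / w$2) *s w" using e by (simp add: vec2_eq field_simps)
    then show ?thesis unfolding cline_iff by blast
  qed
qed

lemma continuous_mulv [continuous_intros]: "continuous_on S f \<Longrightarrow> continuous_on S (\<lambda>x. (M::complex^2^2) *v f x)"
  by (rule continuous_on_compose2[OF linear_continuous_on[OF matrix_vector_mul_bounded_linear[of M]]]) auto

lemma wd2_cline: "x \<in> cline w \<Longrightarrow> wd2 x w = 0"
  by (auto simp: cline_iff wd2_def)

context sforms begin

definition unit_cone :: "(nat \<Rightarrow> 'l) \<Rightarrow> nat \<Rightarrow> (complex^2) set" where
  "unit_cone a k = {w. norm w = 1 \<and> Qf (H (a k)) (Mk a k *v w) \<le> 0}"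

lemma unit_cone_compact: "compact (unit_cone a k)"
proof -
  have "closed {w. Qf (H (a k)) (Mk a k *v w) \<le> 0}" by (intro closed_Collect_le continuous_intros)
  then have "compact (sphere 0 1 \<inter> {w. Qf (H (a k)) (Mk a k *v w) \<le> 0})" by (intro compact_Int_closed) auto
  moreover have "unit_cone a k = sphere 0 1 \<inter> {w. Qf (H (a k)) (Mk a k *v w) \<le> 0}" by (auto simp: unit_cone_def)
  ultimately show ?thesis by simp
qed

lemma unit_cone_anti: assumes "iword a" "m \<le> n" shows "unit_cone a n \<subseteq> unit_cone a m"
  using assms(2)
proof (induction n rule: dec_induct)
  case (step n)
  have "unit_cone a (Suc n) \<subseteq> unit_cone a n"
  proof
    fix w assume w: "w \<in> unit_cone a (Suc n)"
    then have "w \<noteq> 0" by (auto simp: unit_cone_def)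
    then show "w \<in> unit_cone a n" using limit_line_nested[OF assms(1), of w n] w by (auto simp: unit_cone_def)
  qed
  then show ?case using step by blast
qed simp

lemma unit_cone_nonempty: assumes a: "iword a" shows "unit_cone a k \<noteq> {}"
proof -
  have L: "a k \<in> L" using a by (simp add: iword_def)
  define x where "x = A (a k) *v x0"
  have "Qf (H (iv (a k))) x0 * cmod (det (A (a k))) > 0" using x0[OF ivL[OF L]] detA[OF L] by simp
  then have x: "Qf (H (a k)) x < 0" using HA[OF L, of x0] by (simp add: x_def)
  define w where "w = cinv (Mk a k) *v x"
  have Mw: "Mk a k *v w = x" by (simp add: w_def matrix_vector_mul_assoc cinv[OF det_Mk[OF a]])
  have w0: "w \<noteq> 0" using Mw x by (metis Qf_zero less_irrefl matrix_vector_mult_0_right)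
  define v where "v = of_real (1 / norm w) *s w"
  have "norm v = 1" using w0 unfolding v_def scaleR_s[symmetric] by simp
  moreover have "Qf (H (a k)) (Mk a k *v v) \<le> 0" using x by (simp add: v_def mulv_s Qf_scale Mw mult_nonneg_nonpos)
  ultimately show ?thesis by (auto simp: unit_cone_def)
qed

lemma limit_line_unit_cone: assumes "w \<in> limit_line a" "w \<noteq> 0" shows "of_real (1 / norm w) *s w \<in> unit_cone a k"
proof -
  have "norm (of_real (1 / norm w) *s w) = 1" using assms(2) unfolding scaleR_s[symmetric] by simp
  moreover have "Qf (H (a k)) (Mk a k *v (of_real (1 / norm w) *s w)) \<le> 0"
    using assms by (simp add: limit_line_def mulv_s Qf_scale mult_nonneg_nonpos)
  ultimately show ?thesis by (simp add: unit_cone_def)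
qed

lemma limit_line_scale: "w \<in> limit_line a \<Longrightarrow> c *s w \<in> limit_line a"
  by (simp add: limit_line_def mulv_s Qf_scale mult_nonneg_nonpos)

text \<open>The wedge of two vectors is scaled exactly by the determinant, whereas both vectors
  shrink faster than its square root; so the wedge is zero.\<close>

lemma limit_line_unique: assumes a: "iword a" and u: "u \<in> limit_line a" and v: "v \<in> limit_line a" shows "wd2 u v = 0"
proof -
  obtain C \<theta> where C: "0 \<le> \<theta>" "\<theta> < 1" "\<And>a w k. iword a \<Longrightarrow> w \<in> limit_line a \<Longrightarrow> (norm (Mk a k *v w))\<^sup>2 \<le> C * \<theta>^k * (norm w)\<^sup>2 * cmod (det (Mk a k))"
    using limit_line_decay by blast
  define N where "N = (norm u)\<^sup>2 + (norm v)\<^sup>2"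
  have b: "cmod (wd2 u v) \<le> \<theta>^k * (C * N)" for k
  proof -
    let ?M = "Mk a k"
    have d: "cmod (det ?M) > 0" using det_Mk[OF a] by simp
    have "cmod (det ?M) * cmod (wd2 u v) = cmod (wd2 (?M *v u) (?M *v v))" by (simp add: wd2_mulv norm_mult)
    also have "\<dots> \<le> norm (?M *v u) * norm (?M *v v)" by (rule wd2_le)
    also have "\<dots> \<le> (norm (?M *v u))\<^sup>2 + (norm (?M *v v))\<^sup>2"
    proof -
      have "2 * (norm (?M *v u) * norm (?M *v v)) \<le> (norm (?M *v u))\<^sup>2 + (norm (?M *v v))\<^sup>2"
        using sum_squares_bound[of "norm (?M *v u)" "norm (?M *v v)"] by simp
      moreover have "norm (?M *v u) * norm (?M *v v) \<ge> 0" by simp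
      ultimately show ?thesis by linarith
    qed
    also have "\<dots> \<le> C * \<theta>^k * (norm u)\<^sup>2 * cmod (det ?M) + C * \<theta>^k * (norm v)\<^sup>2 * cmod (det ?M)"
      by (intro add_mono C(3) a u v)
    also have "\<dots> = cmod (det ?M) * (\<theta>^k * (C * N))" by (simp add: N_def algebra_simps)
    finally show ?thesis using d by (simp add: mult_le_cancel_left)
  qed
  have "(\<lambda>k. \<theta>^k * (C * N)) \<longlonglongrightarrow> 0" using C by (intro tendsto_mult_left_zero LIMSEQ_power_zero) auto
  then have "cmod (wd2 u v) \<le> 0" using b by (intro LIMSEQ_le_const[of _ 0]) auto
  then show ?thesis by simp
qed

text \<open>Nested nonempty compact sets of unit vectors have a common point. It is unique up to
  scalars by \<open>limit_line_unique\<close>.\<close>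

lemma limit_line_line: assumes a: "iword a" shows "\<exists>w. w \<noteq> 0 \<and> limit_line a = cline w"
proof -
  have "\<Inter>(range (unit_cone a)) \<noteq> {}" by (rule compact_nest[OF unit_cone_compact unit_cone_nonempty[OF a] unit_cone_anti[OF a]])
  then obtain w where "\<And>k. w \<in> unit_cone a k" by auto
  then have w: "w \<in> limit_line a" "norm w = 1" by (auto simp: limit_line_def unit_cone_def)
  have w0: "w \<noteq> 0" using w by auto
  have "limit_line a = cline w"
  proof (intro set_eqI iffI)
    fix v assume "v \<in> limit_line a"
    then show "v \<in> cline w" using wd2_zero_parallel[OF w0 limit_line_unique[OF a w(1)]] by blast
  next
    fix v assume "v \<in> cline w"
    then show "v \<in> limit_line a" using limit_line_scale[OF w(1)] unfolding cline_iff by blast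
  qed
  then show ?thesis using w0 by blast
qed

lemma Mk_cong: "(\<And>j. j < k \<Longrightarrow> a j = b j) \<Longrightarrow> Mk a k = Mk b k"
  by (induction k) auto

text \<open>The parts of the nested compact sets that stay away from the line have empty
  intersection, so one of them is already empty. Hence finitely many letters fix the line up to a
  given error, the source of continuity of the sections.\<close>

lemma limit_line_near: assumes a: "iword a" and w0: "limit_line a = cline w0" and e: "e > 0"
  shows "\<exists>k. \<forall>b. iword b \<longrightarrow> (\<forall>j\<le>k. b j = a j) \<longrightarrow> (\<forall>w\<in>limit_line b. w \<noteq> 0 \<longrightarrow> cmod (wd2 w w0) < e * norm w)"
proof -
  define F where "F = (\<lambda>k. unit_cone a k \<inter> {w. e \<le> cmod (wd2 w w0)})"
  have "\<exists>k. F k = {}"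
  proof (rule ccontr)
    assume ne: "\<not> (\<exists>k. F k = {})"
    have "closed {w. e \<le> cmod (wd2 w w0)}" unfolding wd2_def by (intro closed_Collect_le continuous_intros)
    then have "compact (F k)" for k unfolding F_def by (intro compact_Int_closed unit_cone_compact)
    moreover have "F n \<subseteq> F m" if "m \<le> n" for m n using unit_cone_anti[OF a that] by (auto simp: F_def)
    ultimately have "\<Inter>(range F) \<noteq> {}" using ne by (intro compact_nest) auto
    then obtain w where w: "\<And>k. w \<in> F k" by auto
    then have "w \<in> limit_line a" "e \<le> cmod (wd2 w w0)" by (auto simp: limit_line_def F_def unit_cone_def)
    then show False using wd2_cline[of w w0] w0 e by simp
  qed
  then obtain k where k: "F k = {}" by blast
  show ?thesis
  proof (intro exI[of _ k] allI impI ballI)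
    fix b w assume b: "iword b" "\<forall>j\<le>k. b j = a j" and w: "w \<in> limit_line b" "w \<noteq> 0"
    let ?v = "of_real (1 / norm w) *s w"
    have "?v \<in> unit_cone b k" by (rule limit_line_unit_cone[OF w])
    moreover have "Mk b k = Mk a k" "b k = a k" using b(2) by (auto intro: Mk_cong)
    ultimately have "?v \<in> unit_cone a k" by (simp add: unit_cone_def)
    then have "cmod (wd2 ?v w0) < e" using k by (auto simp: F_def)
    moreover have "wd2 ?v w0 = of_real (1 / norm w) * wd2 w w0" by (simp add: wd2_def algebra_simps)
    ultimately have "cmod (wd2 w w0) / norm w < e" by (simp add: norm_mult norm_divide)
    then show "cmod (wd2 w w0) < e * norm w" using w(2) by (simp add: field_simps)
  qed
qed

lemma Mk_shift: "Mk (case_nat b a) (Suc k) = Mk a k ** A (iv b)"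
  by (induction k) (simp_all add: matrix_mul_assoc)

lemma limit_line_shift: assumes a: "iword a" "b \<in> L" "a 0 \<noteq> iv b"
  shows "limit_line (case_nat b a) = (*v) (A b) ` limit_line a"
proof -
  have aL: "a 0 \<in> L" using a by (simp add: iword_def)
  have 1: "w \<in> limit_line (case_nat b a) \<longleftrightarrow> A (iv b) *v w \<in> limit_line a" for w
  proof
    assume "w \<in> limit_line (case_nat b a)"
    then have "Qf (H (case_nat b a (Suc k))) (Mk (case_nat b a) (Suc k) *v w) \<le> 0" for k
      unfolding limit_line_def mem_Collect_eq by (rule spec[of "\<lambda>k. Qf (H (case_nat b a k)) (Mk (case_nat b a) k *v w) \<le> 0"])
    then show "A (iv b) *v w \<in> limit_line a" unfolding Mk_shift by (simp add: limit_line_def matrix_vector_mul_assoc)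
  next
    assume v: "A (iv b) *v w \<in> limit_line a"
    have "Qf (H (case_nat b a k)) (Mk (case_nat b a) k *v w) \<le> 0" for k
    proof (cases k)
      \<comment> \<open>The condition at the new first letter is the one not inherited from the
        shifted word; \<open>ping\<close> supplies it.\<close>
      case 0
      have "Qf (H b) w \<le> 0"
      proof (cases "w = 0")
        case False
        have "A (iv b) *v w \<noteq> 0" using mulv_nonzero[OF detA[OF ivL[OF a(2)]] False] .
        moreover have "Qf (H (a 0)) (A (iv b) *v w) \<le> 0" using v unfolding limit_line_def by (auto dest: spec[of _ 0])
        ultimately have "Qf (H b) (A b *v (A (iv b) *v w)) < 0" by (intro ping[OF a(2) aL a(3)])
        then show ?thesis using A_cancel(1)[OF a(2)] by simp
      qed simp
      then show ?thesis using 0 by simp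
    next
      case (Suc j)
      then show ?thesis using v unfolding Suc Mk_shift by (simp add: limit_line_def matrix_vector_mul_assoc)
    qed
    then show "w \<in> limit_line (case_nat b a)" by (simp add: limit_line_def)
  qed
  show ?thesis
  proof (intro set_eqI iffI)
    fix w assume "w \<in> limit_line (case_nat b a)"
    then have "A (iv b) *v w \<in> limit_line a" using 1 by simp
    moreover have "w = A b *v (A (iv b) *v w)" using A_cancel(1)[OF a(2)] by simp
    ultimately show "w \<in> (*v) (A b) ` limit_line a" by blast
  next
    fix w assume "w \<in> (*v) (A b) ` limit_line a"
    then obtain v where "v \<in> limit_line a" "w = A b *v v" by blast
    then show "w \<in> limit_line (case_nat b a)" using 1 A_cancel(2)[OF a(2)] by simp
  qed
qed

section \<open>Reduced words and the free group\<close>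

fun reduced :: "'l list \<Rightarrow> bool" where
  "reduced [] = True"
| "reduced [a] = True"
| "reduced (a # b # w) = (b \<noteq> iv a \<and> reduced (b # w))"

lemma reduced_Cons: "reduced (a # w) \<longleftrightarrow> reduced w \<and> (w = [] \<or> hd w \<noteq> iv a)"
  by (cases w) auto

lemma reduced_append: "reduced (u @ w) \<longleftrightarrow> reduced u \<and> reduced w \<and> (u = [] \<or> w = [] \<or> hd w \<noteq> iv (last u))"
proof (induction u)
  case (Cons a u) then show ?case by (cases u; cases w) (auto simp: reduced_Cons)
qed simp

lemma reduced_take: "reduced w \<Longrightarrow> reduced (take k w)"
  by (metis append_take_drop_id reduced_append)

definition inv_word :: "'l list \<Rightarrow> 'l list" where "inv_word w = rev (map iv w)"

lemma inv_word_Cons: "inv_word (a # w) = inv_word w @ [iv a]" by (simp add: inv_word_def)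

lemma last_inv_word: "w \<noteq> [] \<Longrightarrow> last (inv_word w) = iv (hd w)" by (simp add: inv_word_def last_rev hd_map)
lemma hd_inv_word: "w \<noteq> [] \<Longrightarrow> hd (inv_word w) = iv (last w)" by (simp add: inv_word_def hd_rev last_map)

lemma reduced_inv_word: "set w \<subseteq> L \<Longrightarrow> reduced w \<Longrightarrow> reduced (inv_word w)"
proof (induction w)
  case (Cons a w)
  then have r: "reduced w" "w = [] \<or> hd w \<noteq> iv a" "set w \<subseteq> L" "a \<in> L" by (auto simp: reduced_Cons)
  show ?case
  proof (cases "w = []")
    case False
    have "iv a \<noteq> iv (last (inv_word w))"
    proof
      assume "iv a = iv (last (inv_word w))"
      then have "iv a = iv (iv (hd w))" using last_inv_word[OF False] by simp
      moreover have "hd w \<in> L" using False r by auto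
      ultimately show False using r(2) False iviv by metis
    qed
    then show ?thesis using Cons.IH[OF r(3,1)] by (simp add: inv_word_Cons reduced_append)
  qed (simp add: inv_word_def)
qed (simp add: inv_word_def)

lemma set_inv_word: "set w \<subseteq> L \<Longrightarrow> set (inv_word w) \<subseteq> L" using ivL by (auto simp: inv_word_def)

end

text \<open>The discs live on the side of \<open>R\<close>, the words on the side of \<Gamma>. The
  assumption \<open>gen\<close> asks for words in \<Gamma> itself, which is more than generation of
  the induced Moebius group; \<open>srep_exists\<close> bridges the gap.\<close>

locale srep = sforms L iv A H x0
  for L :: "'l set" and iv A H x0 +
  fixes \<Gamma> :: "(real^2^2) set" and g :: "'l \<Rightarrow> real^2^2" and R :: "real^2^2 \<Rightarrow> complex^2^2"
  assumes sub: "\<gamma> \<in> \<Gamma> \<Longrightarrow> \<gamma> \<in> SL2R"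
    and one: "mat 1 \<in> \<Gamma>"
    and mult: "h \<in> \<Gamma> \<Longrightarrow> k \<in> \<Gamma> \<Longrightarrow> h ** k \<in> \<Gamma>"
    and adj: "h \<in> \<Gamma> \<Longrightarrow> adj2 h \<in> \<Gamma>"
    and gG: "a \<in> L \<Longrightarrow> g a \<in> \<Gamma>" and giv: "a \<in> L \<Longrightarrow> g (iv a) = adj2 (g a)"
    and Rg: "a \<in> L \<Longrightarrow> R (g a) = A a" and R1: "R (mat 1) = mat 1"
    and Rmult: "h \<in> \<Gamma> \<Longrightarrow> k \<in> \<Gamma> \<Longrightarrow> R (h ** k) = R h ** R k"
    and gen: "\<gamma> \<in> \<Gamma> \<Longrightarrow> \<exists>w. set w \<subseteq> L \<and> foldr (\<lambda>a M. g a ** M) w (mat 1) = \<gamma>"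
begin

definition eval :: "'l list \<Rightarrow> real^2^2" where "eval w = foldr (\<lambda>a M. g a ** M) w (mat 1)"

lemma eval_simps [simp]: "eval [] = mat 1" "eval (a # w) = g a ** eval w" by (simp_all add: eval_def)

lemma eval_append: "eval (u @ w) = eval u ** eval w" by (induction u) (simp_all add: matrix_mul_assoc)

lemma eval_in: "set w \<subseteq> L \<Longrightarrow> eval w \<in> \<Gamma>" by (induction w) (auto simp: one gG mult)

lemma eval_inv_word: "set w \<subseteq> L \<Longrightarrow> eval (inv_word w) = adj2 (eval w)"
  by (induction w) (auto simp: inv_word_Cons eval_append giv adj2_mult, simp add: inv_word_def)

lemma g_cancel: "a \<in> L \<Longrightarrow> g a ** (g (iv a) ** M) = (M::real^2^2)" "a \<in> L \<Longrightarrow> g (iv a) ** (g a ** M) = (M::real^2^2)"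
  using giv conj_cancel[OF sub[OF gG]] by auto

text \<open>Ping-pong started at \<open>x0\<close>, which lies outside all discs: the disc reached
  shows the first letter. Freeness follows in \<open>eval_inj\<close>.\<close>

lemma reduced_ping: "set w \<subseteq> L \<Longrightarrow> reduced w \<Longrightarrow> w \<noteq> [] \<Longrightarrow> R (eval w) *v x0 \<noteq> 0 \<and> Qf (H (hd w)) (R (eval w) *v x0) < 0"
proof (induction w)
  case (Cons a w)
  then have a: "a \<in> L" "set w \<subseteq> L" "reduced w" "w = [] \<or> hd w \<noteq> iv a" by (auto simp: reduced_Cons)
  have e: "R (eval (a # w)) *v x0 = A a *v (R (eval w) *v x0)"
    using Rmult[OF gG[OF a(1)] eval_in[OF a(2)]] by (simp add: Rg[OF a(1)] matrix_vector_mul_assoc)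
  have "Qf (H (iv a)) (R (eval w) *v x0) > 0"
  proof (cases "w = []")
    case True then show ?thesis using x0[OF ivL[OF a(1)]] by (simp add: R1)
  next
    case False
    then have w: "R (eval w) *v x0 \<noteq> 0" "Qf (H (hd w)) (R (eval w) *v x0) < 0" "hd w \<in> L" using Cons.IH a by auto
    show ?thesis using dj[OF w(3) ivL[OF a(1)] _ w(1)] w(2) a(4) False by auto
  qed
  moreover have "cmod (det (A a)) > 0" using detA[OF a(1)] by simp
  ultimately have "Qf (H (iv a)) (R (eval w) *v x0) * cmod (det (A a)) > 0" by simp
  then have "Qf (H a) (R (eval (a # w)) *v x0) < 0" using HA[OF a(1), of "R (eval w) *v x0"] e by simp
  then show ?case by (metis Qf_zero less_irrefl list.sel(1))
qed simp

lemma eval_inj: "set w \<subseteq> L \<Longrightarrow> reduced w \<Longrightarrow> set v \<subseteq> L \<Longrightarrow> reduced v \<Longrightarrow> eval w = eval v \<Longrightarrow> w = v"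
proof (induction w arbitrary: v)
  case Nil
  show ?case
  proof (rule ccontr)
    assume "[] \<noteq> v"
    then have "Qf (H (hd v)) (R (eval v) *v x0) < 0" "hd v \<in> L" using reduced_ping Nil by auto
    moreover have "R (eval v) = mat 1" using Nil R1 by (metis eval_simps(1))
    ultimately show False using x0[of "hd v"] by simp
  qed
next
  case (Cons a w)
  have p: "R (eval (a # w)) *v x0 \<noteq> 0" "Qf (H a) (R (eval (a # w)) *v x0) < 0" using reduced_ping[of "a # w"] Cons.prems by auto
  have a: "a \<in> L" using Cons.prems by simp
  have "v \<noteq> []"
  proof
    assume "v = []"
    then have "R (eval (a # w)) = mat 1" using Cons.prems(5) R1 by (metis eval_simps(1))
    then show False using p(2) x0[OF a] by simp
  qed
  then obtain b v' where v: "v = b # v'" by (cases v) auto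
  have q: "Qf (H b) (R (eval (a # w)) *v x0) < 0" "b \<in> L" using reduced_ping[of v] Cons.prems v by auto
  have ab: "a = b" using dj[OF a q(2) _ p(1)] p(2) q(1) by auto
  have "g (iv a) ** eval (a # w) = g (iv a) ** eval v" using Cons.prems by simp
  then have "eval w = eval v'" using g_cancel(2)[OF a] v ab by simp
  then have "w = v'" using Cons.IH[of v'] Cons.prems v by (auto simp: reduced_Cons)
  then show ?case using v ab by simp
qed

lemma reduced_exists: assumes "\<gamma> \<in> \<Gamma>" shows "\<exists>w. set w \<subseteq> L \<and> reduced w \<and> eval w = \<gamma>"
proof -
  obtain w where w: "set w \<subseteq> L" "eval w = \<gamma>" using gen[OF assms] by (auto simp: eval_def)
  have "set w \<subseteq> L \<Longrightarrow> \<exists>v. set v \<subseteq> L \<and> reduced v \<and> eval v = eval w" for w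
  proof (induction w)
    case Nil show ?case by (intro exI[of _ "[]"]) simp
  next
    case (Cons a w)
    then obtain v where v: "set v \<subseteq> L" "reduced v" "eval v = eval w" "a \<in> L" by auto
    show ?case
    proof (cases "v \<noteq> [] \<and> hd v = iv a")
      case True
      then obtain v' where v': "v = iv a # v'" by (cases v) auto
      then have "eval v' = eval (a # w)" using g_cancel(1)[OF v(4)] v(3) by (metis eval_simps(2))
      then show ?thesis using v v' by (intro exI[of _ v']) (auto simp: reduced_Cons)
    next
      case False
      then show ?thesis using v by (intro exI[of _ "a # v"]) (auto simp: reduced_Cons)
    qed
  qed
  then show ?thesis using w by metis
qed

definition nform :: "real^2^2 \<Rightarrow> 'l list" where "nform \<gamma> = (THE w. set w \<subseteq> L \<and> reduced w \<and> eval w = \<gamma>)"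

lemma nform: assumes "\<gamma> \<in> \<Gamma>" shows "set (nform \<gamma>) \<subseteq> L" "reduced (nform \<gamma>)" "eval (nform \<gamma>) = \<gamma>"
proof -
  have "\<exists>!w. set w \<subseteq> L \<and> reduced w \<and> eval w = \<gamma>" using reduced_exists[OF assms] eval_inj by blast
  from theI'[OF this] show "set (nform \<gamma>) \<subseteq> L" "reduced (nform \<gamma>)" "eval (nform \<gamma>) = \<gamma>" by (auto simp: nform_def)
qed

lemma nform_eval: assumes "set w \<subseteq> L" "reduced w" shows "nform (eval w) = w"
  using eval_inj[OF _ _ assms] nform[OF eval_in[OF assms(1)]] by blast

lemma finite_nform: "finite {\<gamma> \<in> \<Gamma>. length (nform \<gamma>) \<le> n}"
proof (rule finite_subset)
  show "{\<gamma> \<in> \<Gamma>. length (nform \<gamma>) \<le> n} \<subseteq> eval ` {w. set w \<subseteq> L \<and> length w \<le> n}"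
    using nform by (smt (verit, best) imageI mem_Collect_eq subsetI)
  show "finite (eval ` {w. set w \<subseteq> L \<and> length w \<le> n})" using finite_lists_length_le[OF finL] by simp
qed

lemma nform_snoc: assumes \<gamma>: "\<gamma> \<in> \<Gamma>" and a: "a \<in> L"
  shows "nform (\<gamma> ** g a) = (if nform \<gamma> \<noteq> [] \<and> last (nform \<gamma>) = iv a then butlast (nform \<gamma>) else nform \<gamma> @ [a])"
proof (cases "nform \<gamma> \<noteq> [] \<and> last (nform \<gamma>) = iv a")
  case True
  then have w: "nform \<gamma> = butlast (nform \<gamma>) @ [iv a]" by (metis append_butlast_last_id)
  let ?b = "butlast (nform \<gamma>)"
  have b: "set ?b \<subseteq> L" "reduced ?b" using nform(1,2)[OF \<gamma>] w reduced_append by (metis Un_subset_iff set_append)+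
  have "\<gamma> = eval ?b ** g (iv a)" using nform(3)[OF \<gamma>] w eval_append[of ?b "[iv a]"] by simp
  then have "\<gamma> ** g a = eval ?b ** (g (iv a) ** (g a ** mat 1))" by (simp add: matrix_mul_assoc)
  then have "\<gamma> ** g a = eval ?b" unfolding g_cancel(2)[OF a] by simp
  then show ?thesis using nform_eval[OF b] True by simp
next
  case False
  have w: "set (nform \<gamma> @ [a]) \<subseteq> L" "reduced (nform \<gamma> @ [a])"
  proof -
    show "set (nform \<gamma> @ [a]) \<subseteq> L" using nform(1)[OF \<gamma>] a by simp
    have "nform \<gamma> = [] \<or> a \<noteq> iv (last (nform \<gamma>))"
    proof (cases "nform \<gamma> = []")
      case ne: False
      have "last (nform \<gamma>) \<in> L" using nform(1)[OF \<gamma>] ne by auto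
      then show ?thesis using False iviv by metis
    qed simp
    then show "reduced (nform \<gamma> @ [a])" using nform(2)[OF \<gamma>] by (auto simp: reduced_append)
  qed
  have "eval (nform \<gamma> @ [a]) = \<gamma> ** g a" using nform(3)[OF \<gamma>] by (simp add: eval_append)
  then show ?thesis using nform_eval[OF w] False by auto
qed

text \<open>Right multiplication by a letter adds or removes one letter at the end, so the beginning
  of a long word survives a short factor.\<close>

lemma take_stable_word: "set s \<subseteq> L \<Longrightarrow> \<gamma> \<in> \<Gamma> \<Longrightarrow> k + length s \<le> length (nform \<gamma>) \<Longrightarrow>
   take k (nform (\<gamma> ** eval s)) = take k (nform \<gamma>) \<and> length (nform \<gamma>) \<le> length (nform (\<gamma> ** eval s)) + length s"
proof (induction s arbitrary: \<gamma>)
  case (Cons a s)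
  let ?d = "\<gamma> ** g a"
  have a: "a \<in> L" using Cons by simp
  have d: "?d \<in> \<Gamma>" using mult gG a Cons by blast
  have l: "length (nform \<gamma>) \<le> length (nform ?d) + 1" "take k (nform ?d) = take k (nform \<gamma>)"
    unfolding nform_snoc[OF Cons.prems(2) a] using Cons.prems(3) by (auto simp: take_butlast)
  have "take k (nform (?d ** eval s)) = take k (nform ?d) \<and> length (nform ?d) \<le> length (nform (?d ** eval s)) + length s"
    using Cons.prems l by (intro Cons.IH d) auto
  then show ?case using l by (auto simp: matrix_mul_assoc)
qed simp

lemma take_stable: assumes "\<gamma> \<in> \<Gamma>" "s \<in> \<Gamma>" "k + length (nform s) \<le> length (nform \<gamma>)"
  shows "take k (nform (\<gamma> ** s)) = take k (nform \<gamma>)"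
  using take_stable_word[of "nform s" \<gamma> k] nform[OF assms(2)] assms by auto

definition has_prefix :: "'l list \<Rightarrow> real^2^2 \<Rightarrow> bool" where "has_prefix u \<gamma> \<longleftrightarrow> take (length u) (nform \<gamma>) = u"

text \<open>After the common prefix is stripped, any unmatched rest of \<open>u\<close> leaves its
  inverse uncancelled in front. A question about a long prefix becomes one about a single letter of
  a translated element, so the exceptions are always translates of the one finite set
  \<open>short_set 1\<close>.\<close>

lemma has_prefix_first: assumes u: "set u \<subseteq> L" "reduced u" "u \<noteq> []" and \<gamma>: "\<gamma> \<in> \<Gamma>"
  shows "has_prefix u \<gamma> \<longleftrightarrow> take 1 (nform (adj2 (eval u) ** \<gamma>)) \<noteq> [iv (last u)]"
proof -
  define w where "w = nform \<gamma>"
  have w: "set w \<subseteq> L" "reduced w" "eval w = \<gamma>" using nform[OF \<gamma>] by (auto simp: w_def)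
  obtain c u2 w2 where c: "u = c @ u2" "w = c @ w2" "u2 = [] \<or> w2 = [] \<or> hd u2 \<noteq> hd w2"
    using longest_common_prefix[of u w] by (metis list.sel(1) list.exhaust)
  have r: "reduced u2" "reduced w2" "set u2 \<subseteq> L" "set w2 \<subseteq> L" using u w c by (auto simp: reduced_append)
  have cS: "eval c \<in> SL2R" using c(1) u(1) eval_in sub by auto
  have e: "adj2 (eval u) ** \<gamma> = adj2 (eval u2) ** eval w2"
    unfolding w(3)[symmetric] c(1,2) eval_append adj2_mult using conj_cancel(1)[OF cS] by (simp add: assoc2)
  show ?thesis
  proof (cases "u2 = []")
    case True
    then have "has_prefix u \<gamma>" using c by (simp add: has_prefix_def w_def[symmetric])
    moreover have "nform (adj2 (eval u) ** \<gamma>) = w2" using e True nform_eval[OF r(4,2)] by simp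
    moreover have "w2 = [] \<or> hd w2 \<noteq> iv (last u)" using w(2) c True u(3) by (auto simp: reduced_append)
    then have "take 1 w2 \<noteq> [iv (last u)]" by (cases w2) auto
    ultimately show ?thesis by simp
  next
    case False
    have np: "\<not> has_prefix u \<gamma>"
    proof
      assume "has_prefix u \<gamma>"
      then have "take (length u) (c @ w2) = c @ u2" using c by (simp add: has_prefix_def w_def[symmetric])
      then have t: "take (length u2) w2 = u2" using c(1) by simp
      then have "w2 \<noteq> []" using False by auto
      moreover have "hd w2 = hd u2" using t False by (metis hd_take length_greater_0_conv)
      ultimately show False using c(3) False by simp
    qed
    have "reduced (inv_word u2 @ w2)"
    proof -
      have "w2 = [] \<or> hd w2 \<noteq> iv (last (inv_word u2))"
      proof (cases "w2 = []")
        case ne: False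
        have "hd u2 \<in> L" using False r by auto
        then have "iv (last (inv_word u2)) = hd u2" using last_inv_word[OF False] iviv by simp
        then show ?thesis using c(3) False ne by auto
      qed simp
      then show ?thesis using reduced_inv_word[OF r(3,1)] r(2) by (auto simp: reduced_append)
    qed
    moreover have "set (inv_word u2 @ w2) \<subseteq> L" using set_inv_word[OF r(3)] r(4) by simp
    moreover have "eval (inv_word u2 @ w2) = adj2 (eval u) ** \<gamma>" using e eval_inv_word[OF r(3)] by (simp add: eval_append)
    ultimately have "nform (adj2 (eval u) ** \<gamma>) = inv_word u2 @ w2" using nform_eval by metis
    moreover have "inv_word u2 \<noteq> []" "hd (inv_word u2) = iv (last u)" using False hd_inv_word[OF False] c by (auto simp: inv_word_def)
    then have "take 1 (inv_word u2 @ w2) = [iv (last u)]" by (cases "inv_word u2") auto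
    ultimately show ?thesis using np by simp
  qed
qed

end

section \<open>Words of geodesic ends\<close>

text \<open>The set is the image of a convex half disc under \<open>- 1 / z\<close>.\<close>

lemma connected_far: assumes "r > 0" shows "connected {y. Im y > 0 \<and> r < cmod y}"
proof -
  let ?B = "{y. Im y > 0} \<inter> ball 0 (1/r)"
  have "convex ?B" by (intro convex_Int convex_halfspace_Im_gt convex_ball)
  then have "connected ?B" by (rule convex_connected)
  moreover have "continuous_on ?B (\<lambda>z. - 1 / z)" by (intro continuous_intros) auto
  ultimately have c: "connected ((\<lambda>z. - 1 / z) ` ?B)" by (rule connected_continuous_image[rotated])
  have i: "Im (- 1 / z) = Im z / (cmod z)\<^sup>2" for z
    by (simp add: Im_divide cmod_power2)
  have "(\<lambda>z. - 1 / z) ` ?B = {y. Im y > 0 \<and> r < cmod y}"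
  proof (intro set_eqI iffI)
    fix y assume "y \<in> (\<lambda>z. - 1 / z) ` ?B"
    then obtain z where z: "y = - 1 / z" "Im z > 0" "cmod z < 1/r" by auto
    then have "z \<noteq> 0" by auto
    then show "y \<in> {y. Im y > 0 \<and> r < cmod y}" using z assms unfolding z(1) mem_Collect_eq i
      by (simp add: norm_divide field_simps)
  next
    fix y assume y: "y \<in> {y. Im y > 0 \<and> r < cmod y}"
    then have "y \<noteq> 0" by auto
    then have "- 1 / y \<in> ?B" using y assms unfolding Int_iff mem_Collect_eq i by (simp add: norm_divide field_simps)
    moreover have "y = - 1 / (- 1 / y)" by simp
    ultimately show "y \<in> (\<lambda>z. - 1 / z) ` ?B" by (rule rev_image_eqI)
  qed
  then show ?thesis using c by simp
qed

text \<open>A horoball not based at infinity is bounded in the plane: far out \<open>eta\<close>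
  grows like \<open>u$2\<close> squared times the modulus.\<close>

lemma eta_far: assumes "Im y > 0" "eta u y < R" "u$2 \<noteq> 0" shows "cmod y \<le> (R + 2 * \<bar>u$1 * u$2\<bar>) / (u$2)\<^sup>2"
proof -
  have y0: "cmod y > 0" using assms(1) by auto
  have "\<bar>u$2\<bar> * cmod y - \<bar>u$1\<bar> \<le> cmod (of_real (u$1) - of_real (u$2) * y)"
    using norm_triangle_ineq2[of "of_real (u$2) * y" "of_real (u$1) :: complex"] by (simp add: norm_mult norm_minus_commute)
  then have a: "\<bar>\<bar>u$2\<bar> * cmod y - \<bar>u$1\<bar>\<bar> \<le> cmod (of_real (u$1) - of_real (u$2) * y)"
    using norm_triangle_ineq2[of "of_real (u$1) :: complex" "of_real (u$2) * y"] by (simp add: norm_mult)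
  have "(\<bar>u$2\<bar> * cmod y - \<bar>u$1\<bar>)\<^sup>2 \<le> (cmod (of_real (u$1) - of_real (u$2) * y))\<^sup>2"
    using power_mono[OF a, of 2] by simp
  also have "\<dots> \<le> R * Im y" using assms by (simp add: eta_def field_simps)
  also have "\<dots> \<le> R * cmod y"
  proof (rule mult_left_mono)
    show "Im y \<le> cmod y" using abs_Im_le_cmod[of y] by linarith
    show "0 \<le> R" using eta_nonneg[OF assms(1), of u] assms(2) by simp
  qed
  finally have "(u$2)\<^sup>2 * (cmod y)\<^sup>2 - 2 * \<bar>u$1 * u$2\<bar> * cmod y + (u$1)\<^sup>2 \<le> R * cmod y"
    by (simp add: power2_eq_square algebra_simps abs_mult)
  then have "(u$2)\<^sup>2 * (cmod y)\<^sup>2 \<le> (R + 2 * \<bar>u$1 * u$2\<bar>) * cmod y" using zero_le_power2[of "u$1"]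
    unfolding distrib_right by linarith
  then have "((u$2)\<^sup>2 * cmod y) * cmod y \<le> (R + 2 * \<bar>u$1 * u$2\<bar>) * cmod y" by (simp add: power2_eq_square mult.assoc)
  then have "(u$2)\<^sup>2 * cmod y \<le> R + 2 * \<bar>u$1 * u$2\<bar>" using y0 by (simp add: mult_le_cancel_right)
  then show ?thesis using assms(3) by (simp add: pos_le_divide_eq mult.commute)
qed

locale geo = cc: cusp_cover \<Gamma> I V p om S rr c0 + srep L iv A H x0 \<Gamma> gl R
  for \<Gamma> :: "(real^2^2) set" and I :: "'i set" and V p om S rr c0 and L :: "'l set" and iv A H x0 gl R
begin

text \<open>The point \<open>z\<close> lies in the translate of \<open>V i\<close> by \<open>\<gamma>\<close>.\<close>
definition touch :: "real^2^2 \<Rightarrow> 'i \<Rightarrow> complex \<Rightarrow> bool" where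
  "touch \<gamma> i z \<longleftrightarrow> mobR (adj2 \<gamma>) z \<in> V i"

lemma touch_exists: "Im z > 0 \<Longrightarrow> \<exists>\<gamma>\<in>\<Gamma>. \<exists>i\<in>I. touch \<gamma> i z"
  using cc.cover[of z] adj unfolding touch_def by (metis adj2_adj2)

lemma touch_mult: "h \<in> SL2R \<Longrightarrow> Im z > 0 \<Longrightarrow> touch (h ** \<gamma>) i (mobR h z) \<longleftrightarrow> touch \<gamma> i z"
  unfolding touch_def adj2_mult using mobR_mult[OF SL2R_adj Im_mobR_pos, of h h z "adj2 \<gamma>"] mobR_adj_cancel(1) by simp

lemma touch_eta: assumes "touch \<gamma> i z" "\<gamma> \<in> \<Gamma>" "i \<in> I" "Im z > 0" shows "eta (\<gamma> *v om i) z < rr"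
proof -
  have "eta (om i) (mobR (adj2 \<gamma>) z) < rr" using assms cc.wV unfolding touch_def by blast
  moreover have "eta (\<gamma> *v om i) (mobR \<gamma> (mobR (adj2 \<gamma>) z)) = eta (om i) (mobR (adj2 \<gamma>) z)"
    using assms sub by (intro eta_equiv Im_mobR_pos SL2R_adj) auto
  ultimately show ?thesis using mobR_adj_cancel(2) sub assms by simp
qed

lemma touch_open: assumes "\<gamma> \<in> \<Gamma>" "i \<in> I" shows "open {z. Im z > 0 \<and> touch \<gamma> i z}"
proof -
  have "open (H_plane \<inter> mobR (adj2 \<gamma>) -` V i)"
    using assms sub by (intro continuous_open_preimage continuous_on_mobR SL2R_adj open_H_plane cc.Vopen) auto
  moreover have "H_plane \<inter> mobR (adj2 \<gamma>) -` V i = {z. Im z > 0 \<and> touch \<gamma> i z}" by (auto simp: H_plane_def touch_def)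
  ultimately show ?thesis by simp
qed

lemma cyc_in: "i \<in> I \<Longrightarrow> m \<in> cyc (p i) \<Longrightarrow> m \<in> \<Gamma>"
  by (rotate_tac, induction rule: cyc.induct) (auto intro: one mult adj cc.pG)

lemma touch_cusp: assumes "touch \<gamma> i z" "\<gamma> \<in> \<Gamma>" "i \<in> I" "Im z > 0" shows "touch (\<gamma> ** p i) i z" "touch (\<gamma> ** adj2 (p i)) i z"
  using assms cc.pV cc.pV' mobR_mult[OF SL2R_adj[OF sub[OF assms(2)]] assms(4)]
  unfolding touch_def adj2_mult by simp_all

text \<open>Overlaps of touching pieces factor into these elements, so invariance under each of them
  is what \<open>conn_const\<close> has to assume.\<close>

definition steps where "steps = S \<union> p ` I \<union> (\<lambda>i. adj2 (p i)) ` I"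

lemma steps_in: "s \<in> steps \<Longrightarrow> s \<in> \<Gamma>" using cc.SG cc.pG adj by (auto simp: steps_def)

text \<open>A function of \<open>\<gamma>\<close> that is unchanged by the steps between overlapping sets is constant along a connected set,
  provided the set avoids the finitely many translates where the function may change.\<close>
lemma conn_const:
  assumes N: "connected N" "\<And>z. z \<in> N \<Longrightarrow> Im z > 0" and h: "h \<in> \<Gamma>"
    and F: "\<And>\<delta> s. \<delta> \<in> \<Gamma> \<Longrightarrow> s \<in> steps \<Longrightarrow> \<delta> \<notin> B \<Longrightarrow> F (\<delta> ** s) = F \<delta>"
    and miss: "\<And>z f i. z \<in> N \<Longrightarrow> f \<in> B \<Longrightarrow> i \<in> I \<Longrightarrow> \<not> touch (h ** f) i z"
    and t: "\<gamma> \<in> \<Gamma>" "i \<in> I" "z \<in> N" "touch \<gamma> i z" and t': "\<gamma>' \<in> \<Gamma>" "i' \<in> I" "z' \<in> N" "touch \<gamma>' i' z'"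
  shows "F (adj2 h ** \<gamma>) = F (adj2 h ** \<gamma>')"
proof -
  define G where "G \<gamma> = F (adj2 h ** \<gamma>)" for \<gamma>
  have G: "G (\<gamma> ** s) = G \<gamma>" if "\<gamma> \<in> \<Gamma>" "i \<in> I" "z \<in> N" "touch \<gamma> i z" "s \<in> steps" for \<gamma> i z s
  proof -
    have "h ** (adj2 h ** \<gamma>) = \<gamma>" using conj_cancel[OF sub[OF h]] by simp
    then have "adj2 h ** \<gamma> \<notin> B" using miss[OF that(3) _ that(2), of "adj2 h ** \<gamma>"] that(4) by auto
    then show ?thesis unfolding G_def using F[of "adj2 h ** \<gamma>" s] mult[OF adj[OF h] that(1)] that(5) by (simp add: matrix_mul_assoc)
  qed
  have cyc: "touch (\<gamma> ** m) i z \<and> G (\<gamma> ** m) = G \<gamma>" if gg: "\<gamma> \<in> \<Gamma>" "i \<in> I" "z \<in> N" "touch \<gamma> i z" and m: "m \<in> cyc (p i)" for \<gamma> i z m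
    using m
  proof (induction rule: cyc.induct)
    case c1 show ?case using gg by simp
  next
    case (cp x)
    have x: "\<gamma> ** x \<in> \<Gamma>" using mult gg(1) cyc_in[OF gg(2) cp(1)] by blast
    have "G (\<gamma> ** x ** p i) = G (\<gamma> ** x)" using cp.IH gg by (intro G[OF x gg(2,3)]) (auto simp: steps_def)
    then show ?case using touch_cusp(1)[OF _ x gg(2) N(2)[OF gg(3)]] cp.IH by (simp add: matrix_mul_assoc)
  next
    case (cm x)
    have x: "\<gamma> ** x \<in> \<Gamma>" using mult gg(1) cyc_in[OF gg(2) cm(1)] by blast
    have "G (\<gamma> ** x ** adj2 (p i)) = G (\<gamma> ** x)" using cm.IH gg by (intro G[OF x gg(2,3)]) (auto simp: steps_def)
    then show ?case using touch_cusp(2)[OF _ x gg(2) N(2)[OF gg(3)]] cm.IH by (simp add: matrix_mul_assoc)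
  qed
  have same: "G \<gamma>' = G \<gamma>" if gg: "\<gamma> \<in> \<Gamma>" "i \<in> I" "z \<in> N" "touch \<gamma> i z" and g': "\<gamma>' \<in> \<Gamma>" "i' \<in> I" "touch \<gamma>' i' z" for \<gamma> i z \<gamma>' i'
  proof -
    have z: "Im z > 0" using N gg by auto
    have sg: "\<gamma> \<in> SL2R" "\<gamma>' \<in> SL2R" using gg g' sub by auto
    have e: "mobR (adj2 \<gamma> ** \<gamma>') (mobR (adj2 \<gamma>') z) = mobR (adj2 \<gamma>) z"
      using mobR_mult[OF sg(2) Im_mobR_pos[OF SL2R_adj[OF sg(2)] z]] mobR_adj_cancel(2)[OF sg(2) z] by simp
    obtain m m' s where ms: "m \<in> cyc (p i)" "m' \<in> cyc (p i')" "s \<in> S" "adj2 \<gamma> ** \<gamma>' = m ** s ** m'"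
      using cc.overlap[of "adj2 \<gamma> ** \<gamma>'" i i' "mobR (adj2 \<gamma>') z"] mult[OF adj[OF gg(1)] g'(1)] gg g' e unfolding touch_def by auto
    have eq: "\<gamma>' = \<gamma> ** m ** s ** m'" using ms(4) conj_cancel(2)[OF sg(1), of \<gamma>'] by (simp add: matrix_mul_assoc)
    have mG: "m \<in> \<Gamma>" "m' \<in> \<Gamma>" "s \<in> \<Gamma>" using cyc_in ms gg g' cc.SG by auto
    \<comment> \<open>The last factor is undone from the right: walking back from \<gamma>' along
      the stabiliser shows that the intermediate element \<gamma> \<open>m s\<close> still touches
      \<open>z\<close>.\<close>
    have mc: "adj2 m' \<in> \<Gamma> \<and> (touch (\<gamma>'') i' z \<longrightarrow> touch (\<gamma>'' ** adj2 m') i' z)" if "\<gamma>'' \<in> \<Gamma>" for \<gamma>''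
      using ms(2) that
    proof (induction arbitrary: \<gamma>'' rule: cyc.induct)
      case c1 then show ?case using one by simp
    next
      case (cp x)
      have "\<gamma>'' ** adj2 (p i') \<in> \<Gamma>" using cp mult adj cc.pG g' by blast
      moreover have "adj2 (p i') ** adj2 x \<in> \<Gamma>" using cp mult adj cc.pG g' by blast
      ultimately show ?case using cp.IH[of "\<gamma>'' ** adj2 (p i')"] touch_cusp(2)[OF _ cp.prems g'(2) z] by (auto simp: adj2_mult matrix_mul_assoc)
    next
      case (cm x)
      have "\<gamma>'' ** p i' \<in> \<Gamma>" using cm mult adj cc.pG g' by blast
      moreover have "p i' ** adj2 x \<in> \<Gamma>" using cm mult adj cc.pG g' by blast
      ultimately show ?case using cm.IH[of "\<gamma>'' ** p i'"] touch_cusp(1)[OF _ cm.prems g'(2) z] by (auto simp: adj2_mult matrix_mul_assoc)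
    qed
    have t2: "touch (\<gamma> ** m ** s) i' z"
    proof -
      have "\<gamma>' ** adj2 m' = \<gamma> ** m ** s" unfolding eq assoc2 using adj2_right[OF sub[OF mG(2)]] by simp
      then show ?thesis using mc[OF g'(1)] g'(3) by simp
    qed
    have a: "\<gamma> ** m \<in> \<Gamma>" "\<gamma> ** m ** s \<in> \<Gamma>" using mult gg mG by auto
    have "G \<gamma>' = G (\<gamma> ** m ** s)" using cyc[OF a(2) g'(2) gg(3) t2 ms(2)] by (simp add: eq)
    also have "\<dots> = G (\<gamma> ** m)" using cyc[OF gg ms(1)] ms(3) by (intro G[OF a(1) gg(2,3)]) (auto simp: steps_def)
    also have "\<dots> = G \<gamma>" using cyc[OF gg ms(1)] by simp
    finally show ?thesis .
  qed
  \<comment> \<open>The points seen with a prescribed kind of value form an open set. Two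
    complementary kinds are disjoint on \<open>N\<close> by \<open>same\<close>, so connectedness
    leaves only one.\<close>
  define U where "U P = (\<Union>\<gamma>\<in>{\<gamma>\<in>\<Gamma>. P (G \<gamma>)}. \<Union>i\<in>I. {z. Im z > 0 \<and> touch \<gamma> i z})" for P
  have op: "open (U P)" for P unfolding U_def using touch_open by auto
  let ?P = "\<lambda>x. x = G \<gamma>" and ?Q = "\<lambda>x. x \<noteq> G \<gamma>"
  have cov: "N \<subseteq> U ?P \<union> U ?Q"
  proof
    fix y assume y: "y \<in> N"
    then obtain \<delta> j where "\<delta> \<in> \<Gamma>" "j \<in> I" "touch \<delta> j y" using touch_exists N(2) by blast
    then show "y \<in> U ?P \<union> U ?Q" using N(2)[OF y] unfolding U_def by blast
  qed
  have dis: "U ?P \<inter> U ?Q \<inter> N = {}"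
  proof (rule ccontr)
    assume "U ?P \<inter> U ?Q \<inter> N \<noteq> {}"
    then obtain y where y: "y \<in> U ?P" "y \<in> U ?Q" "y \<in> N" by blast
    obtain \<delta> j where d: "\<delta> \<in> \<Gamma>" "G \<delta> = G \<gamma>" "j \<in> I" "touch \<delta> j y" using y(1) unfolding U_def by blast
    obtain \<delta>' j' where d': "\<delta>' \<in> \<Gamma>" "G \<delta>' \<noteq> G \<gamma>" "j' \<in> I" "touch \<delta>' j' y" using y(2) unfolding U_def by blast
    show False using same[OF d(1,3) y(3) d(4) d'(1,3,4)] d(2) d'(2) by simp
  qed
  have "U ?P \<inter> N \<noteq> {}" using t N(2) unfolding U_def by blast
  then have "U ?Q \<inter> N = {}" using connectedD[OF N(1) op op dis cov] by blast
  then have "G \<gamma>' = G \<gamma>" using t' N(2) unfolding U_def by blast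
  then show ?thesis by (simp add: G_def)
qed

definition step_len where "step_len = (\<Sum>s\<in>steps. length (nform s))"

lemma step_len: "s \<in> steps \<Longrightarrow> length (nform s) \<le> step_len"
  using cc.finI cc.finS unfolding step_len_def steps_def by (intro member_le_sum) auto

text \<open>Only for these elements can a single step reach back into the first \<open>k\<close>
  letters.\<close>

definition short_set where "short_set k = {f \<in> \<Gamma>. length (nform f) < k + step_len}"

lemma finite_short_set: "finite (short_set k)"
  by (rule finite_subset[OF _ finite_nform[of "k + step_len"]]) (auto simp: short_set_def)

lemma take_steps: "\<delta> \<in> \<Gamma> \<Longrightarrow> s \<in> steps \<Longrightarrow> \<delta> \<notin> short_set k \<Longrightarrow> take k (nform (\<delta> ** s)) = take k (nform \<delta>)"
  using step_len[of s] steps_in[of s] by (intro take_stable) (auto simp: short_set_def)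

text \<open>By \<open>has_prefix_first\<close> the prefix \<open>u\<close> shows in the first letter
  after translation by the inverse of \<open>eval u\<close>. Along a connected set that letter
  changes only where a piece of a translated short element is met.\<close>

lemma crossing:
  assumes N: "connected N" "\<And>z. z \<in> N \<Longrightarrow> Im z > 0" and u: "set u \<subseteq> L" "reduced u" "u \<noteq> []"
    and t: "\<gamma> \<in> \<Gamma>" "i \<in> I" "z \<in> N" "touch \<gamma> i z" "has_prefix u \<gamma>"
    and t': "\<gamma>' \<in> \<Gamma>" "i' \<in> I" "z' \<in> N" "touch \<gamma>' i' z'" "\<not> has_prefix u \<gamma>'"
  shows "\<exists>z\<in>N. \<exists>f\<in>short_set 1. \<exists>i\<in>I. touch (eval u ** f) i z"
proof (rule ccontr)
  assume n: "\<not> ?thesis"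
  have "take 1 (nform (adj2 (eval u) ** \<gamma>)) = take 1 (nform (adj2 (eval u) ** \<gamma>'))"
    using n by (intro conn_const[OF N eval_in[OF u(1)] take_steps _ t(1-4) t'(1-4), where B="short_set 1"]) auto
  then show False using has_prefix_first[OF u t(1)] has_prefix_first[OF u t'(1)] t(5) t'(5) by simp
qed

section \<open>Words read off near the end of a geodesic\<close>

text \<open>The geodesic \<open>t \<mapsto> g (e\<^sup>t i)\<close> does not end in a cusp.\<close>
definition good :: "real^2^2 \<Rightarrow> bool" where
  "good g \<longleftrightarrow> g \<in> SL2R \<and> (\<forall>\<gamma>\<in>\<Gamma>. \<forall>i\<in>I. (adj2 g *v (\<gamma> *v om i))$2 \<noteq> 0)"

text \<open>All translates met by the half plane \<open>g {\<bar>y\<bar> > r}\<close> have a reduced word that starts with \<open>l\<close>.\<close>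
definition far :: "real^2^2 \<Rightarrow> real \<Rightarrow> nat \<Rightarrow> 'l list \<Rightarrow> bool" where
  "far g r k l \<longleftrightarrow> (\<forall>\<gamma>\<in>\<Gamma>. \<forall>i\<in>I. \<forall>y. Im y > 0 \<and> r < cmod y \<and> touch \<gamma> i (mobR g y) \<longrightarrow>
     take k (nform \<gamma>) = l \<and> k + step_len \<le> length (nform \<gamma>))"

definition label where "label g k l \<longleftrightarrow> (\<exists>r\<ge>1. far g r k l)"

text \<open>The end point is not a cusp, so each single horoball avoids a neighbourhood of it.\<close>
lemma good_far: assumes g: "good g" shows "\<forall>\<^sub>F r in at_top. \<forall>f\<in>short_set k. \<forall>i\<in>I. \<forall>y. Im y > 0 \<and> r < cmod y \<longrightarrow> \<not> touch f i (mobR g y)"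
proof (intro eventually_ball_finite finite_short_set cc.finI ballI)
  fix f i assume f: "f \<in> short_set k" and i: "i \<in> I"
  have gS: "g \<in> SL2R" using g by (simp add: good_def)
  have fG: "f \<in> \<Gamma>" using f by (simp add: short_set_def)
  define u where "u = adj2 g *v (f *v om i)"
  have u: "u$2 \<noteq> 0" using g fG i by (auto simp: good_def u_def)
  have gu: "g *v u = f *v om i" by (simp add: u_def matrix_vector_mul_assoc matrix_mul_assoc adj2_right[OF gS])
  show "\<forall>\<^sub>F r in at_top. \<forall>y. Im y > 0 \<and> r < cmod y \<longrightarrow> \<not> touch f i (mobR g y)"
    using eventually_ge_at_top[of "(rr + 2 * \<bar>u$1 * u$2\<bar>) / (u$2)\<^sup>2"]
  proof (rule eventually_mono, intro allI impI notI)
    fix r y assume r: "r \<ge> (rr + 2 * \<bar>u$1 * u$2\<bar>) / (u$2)\<^sup>2" and y: "Im y > 0 \<and> r < cmod y" and t: "touch f i (mobR g y)"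
    have "eta (f *v om i) (mobR g y) < rr" using touch_eta[OF t fG i] Im_mobR_pos[OF gS] y by simp
    then have "eta u y < rr" using eta_equiv[OF gS, of y u] y gu by simp
    then show False using eta_far[of y u rr] y r u by auto
  qed
qed

text \<open>A sufficiently small half plane at the end avoids all pieces of short words, and
  \<open>conn_const\<close> makes the first \<open>k\<close> letters constant on it.\<close>

lemma label_exists: assumes g: "good g" shows "\<exists>l. label g k l"
proof -
  have gS: "g \<in> SL2R" using g by (simp add: good_def)
  obtain r0 where r0: "\<forall>r\<ge>r0. \<forall>f\<in>short_set k. \<forall>i\<in>I. \<forall>y. Im y > 0 \<and> r < cmod y \<longrightarrow> \<not> touch f i (mobR g y)"
    using good_far[OF g] unfolding eventually_at_top_linorder by blast
  define r where "r = max 1 r0"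
  have r: "r \<ge> 1" "\<And>f i y. f \<in> short_set k \<Longrightarrow> i \<in> I \<Longrightarrow> Im y > 0 \<Longrightarrow> r < cmod y \<Longrightarrow> \<not> touch f i (mobR g y)"
    using r0 by (auto simp: r_def)
  define N where "N = mobR g ` {y. Im y > 0 \<and> r < cmod y}"
  have "connected N" unfolding N_def
    using r(1) by (intro connected_continuous_image connected_far continuous_on_subset[OF continuous_on_mobR[OF gS]]) (auto simp: H_plane_def)
  moreover have NI: "Im z > 0" if "z \<in> N" for z using that Im_mobR_pos[OF gS] by (auto simp: N_def)
  moreover have miss: "\<not> touch (mat 1 ** f) i z" if "z \<in> N" "f \<in> short_set k" "i \<in> I" for z f i
    using that r(2) by (auto simp: N_def)
  ultimately have c: "take k (nform \<gamma>) = take k (nform \<gamma>')" if "\<gamma> \<in> \<Gamma>" "i \<in> I" "z \<in> N" "touch \<gamma> i z" "\<gamma>' \<in> \<Gamma>" "i' \<in> I" "z' \<in> N" "touch \<gamma>' i' z'" for \<gamma> i z \<gamma>' i' z'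
    using conn_const[of N "mat 1" "short_set k" "\<lambda>x. take k (nform x)" \<gamma> i z \<gamma>' i' z'] that one take_steps by simp
  have "Im (of_real (r+1) * \<i>) > 0" "r < cmod (of_real (r+1) * \<i>)" using r(1) by (auto simp: norm_mult)
  then have n: "mobR g (of_real (r+1) * \<i>) \<in> N" unfolding N_def by blast
  then obtain \<gamma> i where t: "\<gamma> \<in> \<Gamma>" "i \<in> I" "touch \<gamma> i (mobR g (of_real (r+1) * \<i>))" using touch_exists NI by blast
  have "far g r k (take k (nform \<gamma>))" unfolding far_def
  proof (intro ballI allI impI conjI)
    fix \<gamma>' i' y assume a: "\<gamma>' \<in> \<Gamma>" "i' \<in> I" "0 < Im y \<and> r < cmod y \<and> touch \<gamma>' i' (mobR g y)"
    then have y: "mobR g y \<in> N" unfolding N_def by blast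
    show "take k (nform \<gamma>') = take k (nform \<gamma>)" by (rule c[OF a(1,2) y _ t(1,2) n t(3)]) (use a in simp)
    have "\<gamma>' \<notin> short_set k" using r(2)[of \<gamma>' i' y] a by auto
    then show "k + step_len \<le> length (nform \<gamma>')" using a(1) by (simp add: short_set_def)
  qed
  then show ?thesis unfolding label_def using r(1) by blast
qed

text \<open>The last letter of a label of length \<open>Suc n\<close>. Labels of different lengths
  agree because any two are prefixes of a common word by \<open>label_common\<close>.\<close>

definition letter :: "real^2^2 \<Rightarrow> nat \<Rightarrow> 'l" where "letter g n = (SOME l. label g (Suc n) l) ! n"

text \<open>High points of the imaginary axis lie in both half planes, and an element touching there
  carries both labels.\<close>

lemma label_common: assumes g: "g \<in> SL2R" and l: "label g k l" and l': "label g k' l'"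
  shows "\<exists>\<gamma>\<in>\<Gamma>. take k (nform \<gamma>) = l \<and> take k' (nform \<gamma>) = l' \<and> k \<le> length (nform \<gamma>) \<and> k' \<le> length (nform \<gamma>)"
proof -
  obtain r r' where r: "r \<ge> 1" "far g r k l" "r' \<ge> 1" "far g r' k' l'" using l l' unfolding label_def by blast
  define y where "y = of_real (max r r' + 1) * \<i>"
  have y: "Im y > 0" "r < cmod y" "r' < cmod y" using r by (auto simp: y_def norm_mult)
  obtain \<gamma> i where t: "\<gamma> \<in> \<Gamma>" "i \<in> I" "touch \<gamma> i (mobR g y)" using touch_exists Im_mobR_pos[OF g y(1)] by blast
  show ?thesis using t y r(2,4) unfolding far_def by (intro bexI[of _ \<gamma>]) auto
qed

lemma letter: assumes g: "good g" shows "label g k (map (letter g) [0..<k])"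
proof -
  have gS: "g \<in> SL2R" using g by (simp add: good_def)
  obtain l where l: "label g k l" using label_exists[OF g] by blast
  have len: "length l = k" using label_common[OF gS l l] by auto
  have "l ! j = letter g j" if j: "j < k" for j
  proof -
    define m where "m = (SOME l. label g (Suc j) l)"
    have "label g (Suc j) m" unfolding m_def using label_exists[OF g] by (rule someI_ex)
    from label_common[OF gS l this] obtain \<gamma> where gm: "take k (nform \<gamma>) = l" "take (Suc j) (nform \<gamma>) = m" by blast
    have "l ! j = nform \<gamma> ! j" using j unfolding gm(1)[symmetric] by simp
    moreover have "m ! j = nform \<gamma> ! j" unfolding gm(2)[symmetric] by simp
    ultimately show ?thesis by (simp add: letter_def m_def)
  qed
  then have "l = map (letter g) [0..<k]" using len by (auto intro: nth_equalityI)
  then show ?thesis using l by simp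
qed

lemma letter_unique: assumes "good g" "label g k l" shows "l = map (letter g) [0..<k]"
  using label_common[OF _ assms(2) letter[OF assms(1)]] assms(1) by (auto simp: good_def)

lemma iword_letter: assumes g: "good g" shows "iword (letter g)"
  unfolding iword_def
proof (intro allI)
  fix k
  have gS: "g \<in> SL2R" using g by (simp add: good_def)
  let ?l = "map (letter g) [0..<k+2]"
  obtain \<gamma> where gm: "\<gamma> \<in> \<Gamma>" "take (k+2) (nform \<gamma>) = ?l" using label_common[OF gS letter[OF g] letter[OF g]] by blast
  have r: "reduced ?l" "set ?l \<subseteq> L" using reduced_take[OF nform(2)[OF gm(1)], of "k+2"] nform(1)[OF gm(1)] set_take_subset[of "k+2" "nform \<gamma>"] unfolding gm(2) by auto
  have "?l = map (letter g) [0..<k] @ [letter g k] @ [letter g (Suc k)]" by simp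
  then show "letter g k \<in> L \<and> letter g (Suc k) \<noteq> iv (letter g k)" using r by (auto simp: reduced_append)
qed

lemma reduced_letter: assumes "good g" shows "reduced (map (letter g) [0..<k])" "set (map (letter g) [0..<k]) \<subseteq> L"
proof -
  show "set (map (letter g) [0..<k]) \<subseteq> L" using iword_letter[OF assms] by (auto simp: iword_def)
  show "reduced (map (letter g) [0..<k])"
  proof (induction k)
    case (Suc k)
    then show ?case using iword_letter[OF assms] by (cases k) (auto simp: iword_def reduced_append)
  qed simp
qed

text \<open>A dilation permutes the half planes at infinity. The case \<open>c = 1\<close> handles
  the sign of the matrix, \<open>c = exp t\<close> the flow.\<close>

lemma letter_cong_mobR: assumes "good g" "good h" "\<And>y. Im y > 0 \<Longrightarrow> mobR h y = mobR g (of_real c * y)" "c > 0"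
  shows "letter h = letter g"
proof
  fix n
  obtain r where r: "r \<ge> 1" "far g r (Suc n) (map (letter g) [0..<Suc n])" using letter[OF assms(1)] unfolding label_def by blast
  have "far h (max 1 (r / c)) (Suc n) (map (letter g) [0..<Suc n])" unfolding far_def
  proof (intro ballI allI impI)
    fix \<gamma> i y assume a: "\<gamma> \<in> \<Gamma>" "i \<in> I" "0 < Im y \<and> max 1 (r / c) < cmod y \<and> touch \<gamma> i (mobR h y)"
    have "Im (of_real c * y) > 0" "r < cmod (of_real c * y)" "touch \<gamma> i (mobR g (of_real c * y))"
      using a assms(3,4) by (auto simp: norm_mult field_simps)
    then show "take (Suc n) (nform \<gamma>) = map (letter g) [0..<Suc n] \<and> Suc n + step_len \<le> length (nform \<gamma>)"
      using r(2) a(1,2) unfolding far_def by blast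
  qed
  then have "label h (Suc n) (map (letter g) [0..<Suc n])" unfolding label_def by (intro exI[of _ "max 1 (r/c)"]) simp
  from letter_unique[OF assms(2) this] show "letter h n = letter g n" by simp
qed

section \<open>Equivariance and stability of the words\<close>

lemma good_left: assumes "good g" "h \<in> \<Gamma>" shows "good (h ** g)"
  unfolding good_def
proof (intro conjI ballI)
  show "h ** g \<in> SL2R" using assms sub by (auto simp: good_def SL2R_mult)
  fix \<gamma> i assume a: "\<gamma> \<in> \<Gamma>" "i \<in> I"
  have "adj2 (h ** g) *v (\<gamma> *v om i) = adj2 g *v ((adj2 h ** \<gamma>) *v om i)" by (simp add: adj2_mult matrix_vector_mul_assoc matrix_mul_assoc)
  moreover have "adj2 h ** \<gamma> \<in> \<Gamma>" using a assms mult adj by blast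
  ultimately show "(adj2 (h ** g) *v (\<gamma> *v om i)) $ 2 \<noteq> 0" using assms(1) a(2) by (auto simp: good_def)
qed

lemma far_left: assumes g: "g \<in> SL2R" "h \<in> \<Gamma>" and far: "far g r k l"
    and l: "\<And>\<gamma>. \<gamma> \<in> \<Gamma> \<Longrightarrow> take k (nform \<gamma>) = l \<Longrightarrow> k + step_len \<le> length (nform \<gamma>) \<Longrightarrow> take k' (nform (h ** \<gamma>)) = l' \<and> k' + step_len \<le> length (nform (h ** \<gamma>))"
  shows "far (h ** g) r k' l'" unfolding far_def
proof (intro ballI allI impI)
  fix \<gamma> i y assume a: "\<gamma> \<in> \<Gamma>" "i \<in> I" "0 < Im y \<and> r < cmod y \<and> touch \<gamma> i (mobR (h ** g) y)"
  have G: "adj2 h ** \<gamma> \<in> \<Gamma>" using a g mult adj by blast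
  have "touch (h ** (adj2 h ** \<gamma>)) i (mobR h (mobR g y))" using a mobR_mult[OF g(1), of y h] conj_cancel(2)[OF sub[OF g(2)]] by auto
  then have "touch (adj2 h ** \<gamma>) i (mobR g y)" using touch_mult[OF sub[OF g(2)] Im_mobR_pos[OF g(1)]] a by blast
  then have "take k (nform (adj2 h ** \<gamma>)) = l \<and> k + step_len \<le> length (nform (adj2 h ** \<gamma>))" using far G a unfolding far_def by blast
  then show "take k' (nform \<gamma>) = l' \<and> k' + step_len \<le> length (nform \<gamma>)" using l[OF G] conj_cancel(2)[OF sub[OF g(2)]] by simp
qed

lemma nform_Cons: assumes "\<gamma> \<in> \<Gamma>" "a \<in> L" "nform \<gamma> \<noteq> []" "hd (nform \<gamma>) \<noteq> iv a" shows "nform (gl a ** \<gamma>) = a # nform \<gamma>"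
  using nform_eval[of "a # nform \<gamma>"] nform[OF assms(1)] assms by (simp add: reduced_Cons)

lemma letter_Cons: assumes g: "good g" and a: "a \<in> L" "letter g 0 \<noteq> iv a" shows "letter (gl a ** g) = case_nat a (letter g)"
proof
  fix n
  have gS: "g \<in> SL2R" using g by (simp add: good_def)
  obtain r where r: "r \<ge> 1" "far g r (Suc n) (map (letter g) [0..<Suc n])" using letter[OF g] unfolding label_def by blast
  have "far (gl a ** g) r (Suc (Suc n)) (a # map (letter g) [0..<Suc n])"
  proof (rule far_left[OF gS gG[OF a(1)] r(2)])
    fix \<gamma> assume w: "\<gamma> \<in> \<Gamma>" "take (Suc n) (nform \<gamma>) = map (letter g) [0..<Suc n]" "Suc n + step_len \<le> length (nform \<gamma>)"
    then have ne: "nform \<gamma> \<noteq> []" by auto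
    have "hd (nform \<gamma>) = hd (take (Suc n) (nform \<gamma>))" by simp
    also have "\<dots> = letter g 0" unfolding w(2) by (simp add: hd_map upt_conv_Cons del: upt_Suc)
    finally have "nform (gl a ** \<gamma>) = a # nform \<gamma>" using nform_Cons[OF w(1) a(1) ne] a(2) by simp
    then show "take (Suc (Suc n)) (nform (gl a ** \<gamma>)) = a # map (letter g) [0..<Suc n] \<and> Suc (Suc n) + step_len \<le> length (nform (gl a ** \<gamma>))"
      using w by (simp del: upt_Suc)
  qed
  then have "label (gl a ** g) (Suc (Suc n)) (a # map (letter g) [0..<Suc n])" unfolding label_def using r(1) by blast
  then have e: "a # map (letter g) [0..<Suc n] = map (letter (gl a ** g)) [0..<Suc (Suc n)]" by (rule letter_unique[OF good_left[OF g gG[OF a(1)]]])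
  have "letter (gl a ** g) n = (a # map (letter g) [0..<Suc n]) ! n" unfolding e by (simp del: upt_Suc)
  also have "\<dots> = case_nat a (letter g) n" by (cases n) (simp_all del: upt_Suc)
  finally show "letter (gl a ** g) n = case_nat a (letter g) n" .
qed

text \<open>A label of length two is needed here, because the first letter is cancelled and the new
  first letter has to be read from the second.\<close>

lemma letter_cancel: assumes g: "good g" and a: "a \<in> L" "letter g 0 = iv a" shows "letter (gl a ** g) 0 \<noteq> a"
proof -
  have gS: "g \<in> SL2R" using g by (simp add: good_def)
  have lt2: "map (letter g) [0..<Suc (Suc 0)] = [iv a, letter g 1]" using a(2) by simp
  obtain r where r: "r \<ge> 1" "far g r (Suc (Suc 0)) [iv a, letter g 1]" using letter[OF g, of "Suc (Suc 0)"] unfolding label_def lt2 by blast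
  have "far (gl a ** g) r 1 [letter g 1]"
  proof (rule far_left[OF gS gG[OF a(1)] r(2)])
    fix \<gamma> assume w: "\<gamma> \<in> \<Gamma>" "take (Suc (Suc 0)) (nform \<gamma>) = [iv a, letter g 1]" "Suc (Suc 0) + step_len \<le> length (nform \<gamma>)"
    then obtain v where v: "nform \<gamma> = iv a # letter g 1 # v" by (cases "nform \<gamma>"; cases "tl (nform \<gamma>)") auto
    have "set (letter g 1 # v) \<subseteq> L" "reduced (letter g 1 # v)" using nform(1,2)[OF w(1)] unfolding v by (auto simp: reduced_Cons)
    moreover have "gl a ** \<gamma> = eval (letter g 1 # v)" using nform(3)[OF w(1)] g_cancel(1)[OF a(1)] unfolding v by (metis eval_simps(2))
    ultimately have "nform (gl a ** \<gamma>) = letter g 1 # v" using nform_eval by metis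
    then show "take 1 (nform (gl a ** \<gamma>)) = [letter g 1] \<and> 1 + step_len \<le> length (nform (gl a ** \<gamma>))" using w(3) v by simp
  qed
  then have "label (gl a ** g) 1 [letter g 1]" unfolding label_def using r(1) by blast
  then have "[letter g 1] = map (letter (gl a ** g)) [0..<1]" by (rule letter_unique[OF good_left[OF g gG[OF a(1)]]])
  then have "letter (gl a ** g) 0 = letter g 1" by simp
  moreover have "letter g 1 \<noteq> iv (letter g 0)" using iword_letter[OF g] by (simp add: iword_def)
  ultimately show ?thesis using a iviv by simp
qed

text \<open>If the new letter does not cancel, this is the shift. If it cancels, the translated word
  does not cancel with the inverse letter, and the shift is applied backwards.\<close>

lemma limit_line_letter: assumes g: "good g" and a: "a \<in> L" shows "limit_line (letter (gl a ** g)) = (*v) (A a) ` limit_line (letter g)"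
proof (cases "letter g 0 = iv a")
  case False
  then show ?thesis using letter_Cons[OF g a] limit_line_shift[OF iword_letter[OF g] a False] by simp
next
  case True
  let ?h = "gl a ** g"
  have h: "good ?h" by (rule good_left[OF g gG[OF a]])
  have ia: "iv a \<in> L" "iv (iv a) = a" using ivL iviv a by auto
  have h0: "letter ?h 0 \<noteq> iv (iv a)" using letter_cancel[OF g a True] ia by simp
  have "gl (iv a) ** ?h = g" using g_cancel(2)[OF a] .
  then have "limit_line (letter g) = (*v) (A (iv a)) ` limit_line (letter ?h)"
    using letter_Cons[OF h ia(1) h0] limit_line_shift[OF iword_letter[OF h] ia(1) h0] by simp
  then have "(*v) (A a) ` limit_line (letter g) = (\<lambda>x. A a *v (A (iv a) *v x)) ` limit_line (letter ?h)" by (simp add: image_image)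
  then show ?thesis using A_cancel(1)[OF a] by simp
qed

lemma limit_line_equiv: assumes g: "good g" and h: "h \<in> \<Gamma>" shows "limit_line (letter (h ** g)) = (*v) (R h) ` limit_line (letter g)"
proof -
  have "set u \<subseteq> L \<Longrightarrow> limit_line (letter (eval u ** g)) = (*v) (R (eval u)) ` limit_line (letter g)" for u
  proof (induction u)
    case Nil show ?case by (simp add: R1 image_def)
  next
    case (Cons a u)
    then have u: "a \<in> L" "set u \<subseteq> L" by auto
    have "limit_line (letter (gl a ** (eval u ** g))) = (*v) (A a) ` (*v) (R (eval u)) ` limit_line (letter g)"
      using limit_line_letter[OF good_left[OF g eval_in[OF u(2)]] u(1)] Cons.IH[OF u(2)] by simp
    then show ?case using Rmult[OF gG[OF u(1)] eval_in[OF u(2)]] Rg[OF u(1)] by (simp add: image_image matrix_vector_mul_assoc matrix_mul_assoc)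
  qed
  from this[of "nform h"] show ?thesis using nform[OF h] by simp
qed

text \<open>A matrix near the identity maps points of modulus above \<open>2 r\<close> to points of
  modulus above \<open>r\<close>. With \<open>e < 1 / (6 r)\<close> both \<open>e r\<close> and
  \<open>e\<close> are below 1/6, so all error terms together stay below the modulus of
  \<open>y\<close>.\<close>

lemma far_perturb: assumes far: "far g r k l" "r \<ge> 1" and g: "g \<in> SL2R"
    and q: "q \<in> SL2R" "\<bar>q$1$1 - 1\<bar> \<le> e" "\<bar>q$1$2\<bar> \<le> e" "\<bar>q$2$1\<bar> \<le> e" "\<bar>q$2$2 - 1\<bar> \<le> e" "e < 1 / (6 * r)"
  shows "far (g ** q) (2 * r) k l"
  unfolding far_def
proof (intro ballI allI impI)
  fix \<gamma> i y assume a: "\<gamma> \<in> \<Gamma>" "i \<in> I" "0 < Im y \<and> 2 * r < cmod y \<and> touch \<gamma> i (mobR (g ** q) y)"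
  have e0: "e \<ge> 0" using q(3) by linarith
  define Y where "Y = cmod y"
  have Y: "Y > 2 * r" using a by (simp add: Y_def)
  have er: "e * r < 1/6" using q(6) far(2) by (simp add: field_simps)
  have e6: "e < 1/6" using er far(2) e0 by (metis mult_left_mono mult_1_right order_le_less_trans)
  have n: "cmod (num q y) \<ge> (1 - e) * Y - e"
  proof -
    have "num q y = y + (of_real (q$1$1 - 1) * y + of_real (q$1$2))" by (simp add: num_def algebra_simps)
    then have "cmod (num q y) \<ge> Y - cmod (of_real (q$1$1 - 1) * y + of_real (q$1$2))" unfolding Y_def by (metis norm_diff_ineq)
    moreover have "cmod (of_real (q$1$1 - 1) * y + of_real (q$1$2)) \<le> \<bar>q$1$1 - 1\<bar> * Y + \<bar>q$1$2\<bar>"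
      unfolding Y_def by (rule order_trans[OF norm_triangle_ineq]) (simp add: norm_mult del: of_real_diff)
    moreover have "\<bar>q$1$1 - 1\<bar> * Y \<le> e * Y" using q(2) Y far(2) by (intro mult_right_mono) auto
    ultimately show ?thesis using q(3) by (simp add: algebra_simps)
  qed
  have d: "cmod (den q y) \<le> e * Y + 1 + e"
  proof -
    have "cmod (den q y) \<le> \<bar>q$2$1\<bar> * Y + \<bar>q$2$2\<bar>"
      unfolding Y_def den_def by (rule order_trans[OF norm_triangle_ineq]) (simp add: norm_mult)
    moreover have "\<bar>q$2$1\<bar> * Y \<le> e * Y" using q(4) Y far(2) by (intro mult_right_mono) auto
    ultimately show ?thesis using q(5) by linarith
  qed
  have "r * (e * Y + 1 + e) < (1 - e) * Y - e"
  proof -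
    have "(e * r) * Y \<le> 1/6 * Y" "e * Y \<le> 1/6 * Y" using er e6 Y far(2) by (auto intro!: mult_right_mono)
    then have "r * (e * Y + 1 + e) + e * Y + e \<le> 1/6 * Y + r + 1/6 + 1/6 * Y + 1/6" using er e6 by (simp add: algebra_simps)
    also have "\<dots> < Y" using Y far(2) by simp
    finally show ?thesis by (simp add: algebra_simps)
  qed
  then have "r * cmod (den q y) < cmod (num q y)" using n d far(2) mult_left_mono[OF d, of r] by linarith
  moreover have "cmod (den q y) > 0" using den_nonzero[OF q(1)] a by simp
  ultimately have "r < cmod (mobR q y)" by (simp add: mobR_nd norm_divide pos_less_divide_eq)
  then show "take k (nform \<gamma>) = l \<and> k + step_len \<le> length (nform \<gamma>)"
    using far(1) a Im_mobR_pos[OF q(1)] mobR_mult[OF q(1)] unfolding far_def by (metis (no_types, lifting))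
qed

end

section \<open>Excursions into translated cusps\<close>

definition geo_pt :: "real^2^2 \<Rightarrow> real \<Rightarrow> complex" where
  "geo_pt g t = mobR g (of_real (exp t) * \<i>)"

lemma Im_geo_pt: "g \<in> SL2R \<Longrightarrow> Im (geo_pt g t) > 0" by (simp add: geo_pt_def Im_mobR_pos)

lemma geo_pt_0: "geo_pt g 0 = mobR g \<i>" by (simp add: geo_pt_def)

lemma geo_pt_mult: "g \<in> SL2R \<Longrightarrow> geo_pt (h ** g) t = mobR h (geo_pt g t)"
  by (simp add: geo_pt_def mobR_mult)

lemma eta_geo_pt: assumes "g \<in> SL2R"
  shows "eta v (geo_pt g t) = exp (-t) * ((adj2 g *v v)$1)\<^sup>2 + exp t * ((adj2 g *v v)$2)\<^sup>2"
proof -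
  have "eta (g *v (adj2 g *v v)) (geo_pt g t) = eta (adj2 g *v v) (of_real (exp t) * \<i>)"
    unfolding geo_pt_def using assms by (intro eta_equiv) auto
  then show ?thesis using assms by (simp add: eta_geo matrix_vector_mul_assoc adj2_right)
qed

lemma hb_geo_pt: assumes "g \<in> SL2R" "hb (mobR g \<i>) \<le> C" "\<bar>t\<bar> \<le> T" shows "hb (geo_pt g t) \<le> C * (2 * exp T)"
proof -
  have "hb (geo_pt g t) \<le> (norm g)\<^sup>2 * hb (of_real (exp t) * \<i>)" unfolding geo_pt_def using assms by (intro hb_mob) auto
  also have "hb (of_real (exp t) * \<i>) = exp (-t) + exp t"
    by (simp add: hb_def norm_mult power2_eq_square exp_minus field_simps)
  also have "(norm g)\<^sup>2 * (exp (-t) + exp t) \<le> C * (2 * exp T)"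
  proof (rule mult_mono)
    show "(norm g)\<^sup>2 \<le> C" using assms by (simp add: norm_sq_hb)
    have "exp (-t) \<le> exp T" "exp t \<le> exp T" using assms(3) by auto
    then show "exp (- t) + exp t \<le> 2 * exp T" by linarith
    show "0 \<le> C" using assms(1,2) hb_pos[of "mobR g \<i>"] Im_mobR_pos[of g \<i>] by simp
  qed (simp add: add_nonneg_nonneg)
  finally show ?thesis .
qed

lemma exp_pair_le: assumes "exp (-t) * A + exp t * B \<le> (r::real)" "A \<ge> 0" "B \<ge> 0"
  shows "A \<le> r * exp t" "B \<le> r * exp (-t)"
proof -
  have "exp (-t) * A \<ge> 0" "exp t * B \<ge> 0" using assms by simp_all
  then have "exp (-t) * A \<le> r" "exp t * B \<le> r" using assms(1) by linarith+
  then show "A \<le> r * exp t" "B \<le> r * exp (-t)" by (simp_all add: exp_minus field_simps)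
qed

lemma norm_mulv2: "norm ((A::real^2^2) *v v) \<le> norm A * norm v"
proof (rule power2_le_imp_le)
  have "(norm (A *v v))\<^sup>2 \<le> ((A$1$1)\<^sup>2 + (A$1$2)\<^sup>2) * ((v$1)\<^sup>2 + (v$2)\<^sup>2) + ((A$2$1)\<^sup>2 + (A$2$2)\<^sup>2) * ((v$1)\<^sup>2 + (v$2)\<^sup>2)"
    unfolding normv2_sq mulv2 by (intro add_mono cauchy2)
  then show "(norm (A *v v))\<^sup>2 \<le> (norm A * norm v)\<^sup>2" by (simp add: power_mult_distrib norm_2x2_sq normv2_sq algebra_simps)
qed simp

text \<open>Two cusps that are visited at times at least \<open>T\<close> before and after time 0 can
  both be seen from a point at bounded distance from the base point.\<close>
lemma meet_time:
  fixes a b a' b' r K t s T l :: real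
  assumes t: "exp (-t) * a\<^sup>2 + exp t * b\<^sup>2 \<le> r" "t \<ge> T" and s: "exp (-s) * a'\<^sup>2 + exp s * b'\<^sup>2 \<le> r" "s \<le> -T"
    and T: "T \<ge> 0" and K: "\<bar>a * b' - b * a'\<bar> \<le> K" "r > 0"
    and l: "l \<le> a\<^sup>2 + b\<^sup>2" "l \<le> a'\<^sup>2 + b'\<^sup>2" "2 * (2 * r + K) * exp (-T) < l"
  shows "\<exists>x. \<bar>x\<bar> \<le> T \<and> exp (-x) * a\<^sup>2 + exp x * b\<^sup>2 \<le> 2 * r + K \<and> exp (-x) * a'\<^sup>2 + exp x * b'\<^sup>2 \<le> 2 * r + K"
proof -
  have K0: "K \<ge> 0" using K(1) by linarith
  have pos: "exp (-t) * a\<^sup>2 \<ge> 0" "exp t * b\<^sup>2 \<ge> 0" "exp (-s) * a'\<^sup>2 \<ge> 0" "exp s * b'\<^sup>2 \<ge> 0" by simp_all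
  have a: "a\<^sup>2 \<le> r * exp t" by (rule exp_pair_le(1)[OF t(1)]) auto
  have b: "exp t * b\<^sup>2 \<le> r" using t(1) pos by linarith
  have a': "exp (-s) * a'\<^sup>2 \<le> r" using s(1) pos by linarith
  have b': "exp s * b'\<^sup>2 \<le> r" using s(1) pos by linarith
  have st: "s \<le> t" using t s T by linarith
  have b2: "b\<^sup>2 \<le> r * exp (-t)" using b by (simp add: exp_minus field_simps)
  have a2': "a'\<^sup>2 \<le> r * exp s" using a' by (simp add: exp_minus field_simps)
  \<comment> \<open>The order of the times makes this cross term at most \<open>r\<close>; the bound
    on the wedge then controls the other cross term.\<close>
  have "(b * a')\<^sup>2 \<le> (r * exp (-t)) * (r * exp s)" unfolding power_mult_distrib using b2 a2' K(2) by (intro mult_mono) auto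
  also have "\<dots> = r\<^sup>2 * exp (s - t)" by (simp add: exp_diff exp_minus power2_eq_square field_simps)
  also have "\<dots> \<le> r\<^sup>2 * 1" using st by (intro mult_left_mono) auto
  finally have "\<bar>b * a'\<bar> \<le> r" using K(2) by (simp add: abs_le_square_iff[of "b * a'" r, symmetric])
  then have "\<bar>a * b'\<bar> \<le> r + K" using K(1) by linarith
  then have ab: "(a * b')\<^sup>2 \<le> (r + K)\<^sup>2" using K0 K(2) by (simp add: abs_le_square_iff[symmetric])
  \<comment> \<open>The time \<open>x\<close> is the first one from \<open>s\<close> on at which the
    term of \<open>a\<close> is at most \<open>r + K\<close>.\<close>
  define E where "E = max (exp s) (a\<^sup>2 / (r + K))"
  define x where "x = ln E"
  have E0: "E > 0" by (simp add: E_def less_max_iff_disj)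
  have ex: "exp x = E" using E0 by (simp add: x_def)
  have rK: "r + K > 0" using K0 K(2) by linarith
  have Et: "E \<le> exp t"
  proof -
    have "a\<^sup>2 \<le> exp t * (r + K)" using a K0 by (simp add: algebra_simps) (smt (verit) exp_gt_zero mult_nonneg_nonneg)
    then show ?thesis using st rK by (simp add: E_def pos_divide_le_eq)
  qed
  have xs: "s \<le> x" using ex by (metis E_def exp_le_cancel_iff max.cobounded1)
  have xt: "x \<le> t" using ex Et by (metis exp_le_cancel_iff)
  have 1: "exp (-x) * a\<^sup>2 \<le> r + K"
  proof -
    have "a\<^sup>2 \<le> E * (r + K)" using rK by (simp add: E_def pos_divide_le_eq[symmetric])
    then show ?thesis using E0 by (simp add: exp_minus ex field_simps)
  qed
  have 2: "exp x * b\<^sup>2 \<le> r" using b xt by (smt (verit) exp_le_cancel_iff mult_right_mono zero_le_power2)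
  have 3: "exp (-x) * a'\<^sup>2 \<le> r" using a' xs by (smt (verit) exp_le_cancel_iff mult_right_mono zero_le_power2)
  have 4: "exp x * b'\<^sup>2 \<le> r + K"
  proof (cases "E = exp s")
    case True then show ?thesis using b' K0 ex by simp
  next
    case False
    then have "E = a\<^sup>2 / (r + K)" by (auto simp: E_def max_def split: if_splits)
    then have "E * b'\<^sup>2 * (r + K) = (a * b')\<^sup>2" using rK by (simp add: power_mult_distrib)
    then have "(E * b'\<^sup>2) * (r + K) \<le> (r + K) * (r + K)" using ab by (metis power2_eq_square)
    then show ?thesis using rK ex by (simp add: mult_le_cancel_right)
  qed
  let ?C = "2 * r + K"
  have C: "exp (-x) * a\<^sup>2 + exp x * b\<^sup>2 \<le> ?C" "exp (-x) * a'\<^sup>2 + exp x * b'\<^sup>2 \<le> ?C" using 1 2 3 4 by linarith+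
  have bd: "A\<^sup>2 + B\<^sup>2 \<le> 2 * ?C * exp (-T)" if "exp (-u) * A\<^sup>2 \<le> ?C" "exp v * B\<^sup>2 \<le> ?C" "u \<le> -T" "v \<ge> T" for A B u v :: real
  proof -
    have "A\<^sup>2 \<le> ?C * exp u" "B\<^sup>2 \<le> ?C * exp (-v)" using that(1,2) by (simp_all add: exp_minus field_simps)
    moreover have "?C * exp u \<le> ?C * exp (-T)" "?C * exp (-v) \<le> ?C * exp (-T)" using that(3,4) K0 K(2) by (auto intro!: mult_left_mono)
    ultimately show ?thesis by linarith
  qed
  \<comment> \<open>Outside the interval from \<open>-T\<close> to \<open>T\<close> both components
    of one of the two vectors would be tiny, against the lower bound \<open>l\<close>.\<close>
  have "x < T"
  proof (rule ccontr)
    assume "\<not> x < T"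
    then have "a'\<^sup>2 + b'\<^sup>2 \<le> 2 * ?C * exp (-T)" using 3 4 a' K0 K(2) s(2) by (intro bd[of s _ x]) auto
    then show False using l by linarith
  qed
  moreover have "- T < x"
  proof (rule ccontr)
    assume "\<not> - T < x"
    then have "a\<^sup>2 + b\<^sup>2 \<le> 2 * ?C * exp (-T)" using 1 2 b K0 K(2) t(2) by (intro bd[of x _ t]) auto
    then show False using l by linarith
  qed
  ultimately show ?thesis using C by (intro exI[of _ x]) auto
qed

section \<open>Finiteness of two-sided excursions\<close>

context geo begin

definition crossed_pair_set :: "real \<Rightarrow> real \<Rightarrow> real^2 \<Rightarrow> real^2 \<Rightarrow> (real^2^2) set" where
  "crossed_pair_set C T v v' = {h\<in>\<Gamma>. \<exists>g\<in>SL2R. hb (mobR g \<i>) \<le> C \<and> (\<exists>t\<ge>T. eta (h *v v) (geo_pt g t) < rr) \<and> (\<exists>s\<le>-T. eta (h *v v') (geo_pt g s) < rr)}"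

text \<open>For independent vectors \<open>meet_time\<close> gives a point near the base point
  inside bounded horoballs of both translated cusps. The inverse of \<open>h\<close> carries it to a
  bounded region by \<open>hb_le_of_eta\<close>, and proper discontinuity leaves finitely many
  \<open>h\<close>. For parallel vectors the set is empty for large \<open>T\<close>.\<close>

lemma crossed_pair_set_finite:
  assumes v: "\<And>h. h \<in> \<Gamma> \<Longrightarrow> c0 \<le> norm (h *v v)" "\<And>h. h \<in> \<Gamma> \<Longrightarrow> c0 \<le> norm (h *v v')" and C: "C > 0"
  shows "\<forall>\<^sub>F T in at_top. finite (crossed_pair_set C T v v')"
proof (cases "rr > 0")
  case False
  have "crossed_pair_set C T v v' = {}" for T unfolding crossed_pair_set_def using False eta_nonneg[OF Im_geo_pt] by (smt (verit) Collect_empty_eq)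
  then show ?thesis by simp
next
  case rr: True
  define K where "K = \<bar>wdg v v'\<bar>"
  \<comment> \<open>In the frame \<open>g\<close> a vector loses at most the factor
    \<open>norm g\<close>, whose square is at most \<open>C\<close>.\<close>
  define l where "l = c0\<^sup>2 / C"
  have l0: "l > 0" using C cc.cpos by (simp add: l_def)
  have low: "l \<le> ((adj2 g *v (h *v x))$1)\<^sup>2 + ((adj2 g *v (h *v x))$2)\<^sup>2"
    if h: "h \<in> \<Gamma>" and g: "g \<in> SL2R" "hb (mobR g \<i>) \<le> C" and x: "c0 \<le> norm (h *v x)" for g h x
  proof -
    have "g *v (adj2 g *v (h *v x)) = h *v x" using g by (simp add: matrix_vector_mul_assoc matrix_mul_assoc adj2_right)
    then have "c0 \<le> norm g * norm (adj2 g *v (h *v x))" using x norm_mulv2[of g "adj2 g *v (h *v x)"] by simp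
    then have "c0\<^sup>2 \<le> (norm g * norm (adj2 g *v (h *v x)))\<^sup>2" using cc.cpos by (intro power_mono) auto
    also have "\<dots> = (norm g)\<^sup>2 * (norm (adj2 g *v (h *v x)))\<^sup>2" by (simp add: power_mult_distrib)
    also have "\<dots> \<le> C * (norm (adj2 g *v (h *v x)))\<^sup>2" using g by (intro mult_right_mono) (simp_all add: norm_sq_hb)
    finally show ?thesis using C by (simp add: l_def pos_divide_le_eq normv2_sq mult.commute)
  qed
  have lim: "\<forall>\<^sub>F T in at_top. D * exp (-T) < l" for D :: real
  proof -
    have "((\<lambda>T. D * exp (-T)) \<longlongrightarrow> D * 0) at_top" by (intro tendsto_intros filterlim_compose[OF exp_at_bot] filterlim_uminus_at_bot_at_top)
    then show ?thesis using l0 by (intro order_tendstoD(2)) auto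
  qed
  show ?thesis
  proof (cases "wdg v v' = 0")
    case False
    have "\<forall>\<^sub>F T in at_top. 0 \<le> T \<and> 2 * (2 * rr + K) * exp (-T) < l" by (intro eventually_conj eventually_ge_at_top lim)
    then show ?thesis
    proof (rule eventually_mono)
      fix T assume T: "0 \<le> T \<and> 2 * (2 * rr + K) * exp (-T) < l"
      define M where "M = max (C * (2 * exp T)) (2 * (2 * rr + K) * ((norm v)\<^sup>2 + (norm v')\<^sup>2) / (wdg v v')\<^sup>2)"
      have "adj2 h \<in> {\<gamma> \<in> \<Gamma>. \<exists>z. Im z > 0 \<and> hb z \<le> M \<and> hb (mobR \<gamma> z) \<le> M}" if "h \<in> crossed_pair_set C T v v'" for h
      proof -
        obtain g t s where g: "h \<in> \<Gamma>" "g \<in> SL2R" "hb (mobR g \<i>) \<le> C" "t \<ge> T" "eta (h *v v) (geo_pt g t) < rr" "s \<le> -T" "eta (h *v v') (geo_pt g s) < rr"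
          using \<open>h \<in> crossed_pair_set C T v v'\<close> unfolding crossed_pair_set_def by blast
        let ?u = "adj2 g *v (h *v v)" and ?u' = "adj2 g *v (h *v v')"
        have "wdg ?u ?u' = wdg v v'" using g(1,2) sub by (simp add: wdg_SL2R SL2R_adj)
        then have K: "\<bar>?u$1 * ?u'$2 - ?u$2 * ?u'$1\<bar> \<le> K" by (simp add: K_def wdg_def)
        obtain x where x: "\<bar>x\<bar> \<le> T" "exp (-x) * (?u$1)\<^sup>2 + exp x * (?u$2)\<^sup>2 \<le> 2 * rr + K" "exp (-x) * (?u'$1)\<^sup>2 + exp x * (?u'$2)\<^sup>2 \<le> 2 * rr + K"
          using meet_time[OF _ g(4) _ g(6) _ K rr low[OF g(1-3) v(1)[OF g(1)]] low[OF g(1-3) v(2)[OF g(1)]]] T g(5,7)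
          unfolding eta_geo_pt[OF g(2)] by (metis less_imp_le)
        define z where "z = geo_pt g x"
        have z: "Im z > 0" "hb z \<le> M" "eta (h *v v) z \<le> 2 * rr + K" "eta (h *v v') z \<le> 2 * rr + K"
          using Im_geo_pt[OF g(2)] hb_geo_pt[OF g(2,3) x(1)] x(2,3) unfolding z_def eta_geo_pt[OF g(2)] by (auto simp: M_def)
        have hS: "adj2 h \<in> SL2R" "h \<in> SL2R" using sub[OF g(1)] SL2R_adj by auto
        have e: "eta y (mobR (adj2 h) z) = eta (h *v y) z" for y
          using eta_equiv[OF hS(1) z(1), of "h *v y"] by (simp add: matrix_vector_mul_assoc adj2_left[OF hS(2)])
        have "hb (mobR (adj2 h) z) \<le> 2 * (2 * rr + K) * ((norm v)\<^sup>2 + (norm v')\<^sup>2) / (wdg v v')\<^sup>2"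
          using z e by (intro hb_le_of_eta[OF Im_mobR_pos[OF hS(1) z(1)] _ _ False]) auto
        then have "hb (mobR (adj2 h) z) \<le> M" by (simp add: M_def)
        then show ?thesis using z(1,2) adj[OF g(1)] by blast
      qed
      then have "crossed_pair_set C T v v' \<subseteq> adj2 ` {\<gamma> \<in> \<Gamma>. \<exists>z. Im z > 0 \<and> hb z \<le> M \<and> hb (mobR \<gamma> z) \<le> M}"
        by (metis (no_types, lifting) adj2_adj2 image_iff subsetI)
      then show "finite (crossed_pair_set C T v v')" using cc.finite_hb by (rule finite_surj[rotated])
    qed
  next
    case True
    have v'0: "v' \<noteq> 0" using v(2)[OF one] cc.cpos by auto
    then have "\<exists>m. v = m *\<^sub>R v'"
    proof -
      have "v'$1 \<noteq> 0 \<or> v'$2 \<noteq> 0" using v'0 by (auto simp: vec2_eq)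
      then show ?thesis
      proof
        assume "v'$1 \<noteq> 0"
        then have "v = (v$1 / v'$1) *\<^sub>R v'" using True by (simp add: vec2_eq wdg_def field_simps)
        then show ?thesis by blast
      next
        assume "v'$2 \<noteq> 0"
        then have "v = (v$2 / v'$2) *\<^sub>R v'" using True by (simp add: vec2_eq wdg_def field_simps)
        then show ?thesis by blast
      qed
    qed
    then obtain m where m: "v = m *\<^sub>R v'" by blast
    \<comment> \<open>One and the same cusp cannot be visited late at both ends: the late visit
      makes one component small and the early visit the other.\<close>
    from lim[of "rr + m\<^sup>2 * rr"] show ?thesis
    proof (rule eventually_mono)
      fix T assume T: "(rr + m\<^sup>2 * rr) * exp (-T) < l"
      have "h \<notin> crossed_pair_set C T v v'" for h
      proof
        assume "h \<in> crossed_pair_set C T v v'"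
        then obtain g t s where g: "h \<in> \<Gamma>" "g \<in> SL2R" "hb (mobR g \<i>) \<le> C" "t \<ge> T" "eta (h *v v) (geo_pt g t) < rr" "s \<le> -T" "eta (h *v v') (geo_pt g s) < rr"
          unfolding crossed_pair_set_def by blast
        let ?u = "adj2 g *v (h *v v)" and ?u' = "adj2 g *v (h *v v')"
        have um: "?u = m *\<^sub>R ?u'" unfolding m by (simp add: matrix_vector_mult_scaleR)
        have 1: "exp (-t) * (?u$1)\<^sup>2 + exp t * (?u$2)\<^sup>2 < rr" "exp (-s) * (?u'$1)\<^sup>2 + exp s * (?u'$2)\<^sup>2 < rr"
          using g(5,7) unfolding eta_geo_pt[OF g(2)] by auto
        have "(?u$2)\<^sup>2 \<le> rr * exp (-t)" using exp_pair_le(2)[OF less_imp_le[OF 1(1)]] by simp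
        also have "\<dots> \<le> rr * exp (-T)" using g(4) rr by (intro mult_left_mono) auto
        finally have b: "(?u$2)\<^sup>2 \<le> rr * exp (-T)" .
        have "(?u'$1)\<^sup>2 \<le> rr * exp s" using exp_pair_le(1)[OF less_imp_le[OF 1(2)]] by simp
        also have "\<dots> \<le> rr * exp (-T)" using g(6) rr by (intro mult_left_mono) auto
        finally have "(?u$1)\<^sup>2 \<le> m\<^sup>2 * (rr * exp (-T))" unfolding um by (simp add: power_mult_distrib mult_left_mono)
        then have "l \<le> (rr + m\<^sup>2 * rr) * exp (-T)" using b low[OF g(1-3) v(1)[OF g(1)]] by (simp add: algebra_simps)
        then show False using T by simp
      qed
      then have "crossed_pair_set C T v v' = {}" by blast
      then show "finite (crossed_pair_set C T v v')" by simp
    qed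
  qed
qed

text \<open>Elements whose cusps are visited by a geodesic through a compact set both before time \<open>-T\<close> and after time \<open>T\<close>.\<close>
definition crossed_set :: "real \<Rightarrow> real \<Rightarrow> (real^2^2) set" where
  "crossed_set C T = {h\<in>\<Gamma>. \<exists>g\<in>SL2R. hb (mobR g \<i>) \<le> C \<and> (\<exists>t\<ge>T. \<exists>f\<in>short_set 1. \<exists>i\<in>I. touch (h ** f) i (geo_pt g t)) \<and> (\<exists>s\<le>-T. \<exists>f\<in>short_set 1. \<exists>i\<in>I. touch (h ** f) i (geo_pt g s))}"

lemma crossed_set_finite: assumes C: "C > 0" shows "\<exists>T\<ge>0. finite (crossed_set C T)"
proof -
  have BG: "f \<in> short_set 1 \<Longrightarrow> f \<in> \<Gamma>" for f by (simp add: short_set_def)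
  have "\<forall>\<^sub>F T in at_top. \<forall>x \<in> short_set 1 \<times> I. \<forall>y \<in> short_set 1 \<times> I. finite (crossed_pair_set C T (fst x *v om (snd x)) (fst y *v om (snd y)))"
  proof (intro eventually_ball_finite finite_cartesian_product finite_short_set cc.finI ballI)
    fix x y assume x: "x \<in> short_set 1 \<times> I" "y \<in> short_set 1 \<times> I"
    have lw: "c0 \<le> norm (h *v (fst x *v om (snd x)))" if "h \<in> \<Gamma>" "x \<in> short_set 1 \<times> I" for h x
      using that cc.cw[of "h ** fst x" "snd x"] mult BG by (auto simp: matrix_vector_mul_assoc)
    show "\<forall>\<^sub>F T in at_top. finite (crossed_pair_set C T (fst x *v om (snd x)) (fst y *v om (snd y)))"
      using lw x C by (intro crossed_pair_set_finite) auto
  qed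
  then have "\<forall>\<^sub>F T in at_top. T \<ge> 0 \<and> (\<forall>x \<in> short_set 1 \<times> I. \<forall>y \<in> short_set 1 \<times> I. finite (crossed_pair_set C T (fst x *v om (snd x)) (fst y *v om (snd y))))"
    by (intro eventually_conj eventually_ge_at_top)
  then obtain T where T: "T \<ge> 0" "\<And>x y. x \<in> short_set 1 \<times> I \<Longrightarrow> y \<in> short_set 1 \<times> I \<Longrightarrow> finite (crossed_pair_set C T (fst x *v om (snd x)) (fst y *v om (snd y)))"
    using eventually_happens[of _ "at_top :: real filter"] by fastforce
  have "crossed_set C T \<subseteq> (\<Union>x\<in>short_set 1 \<times> I. \<Union>y\<in>short_set 1 \<times> I. crossed_pair_set C T (fst x *v om (snd x)) (fst y *v om (snd y)))"
  proof
    fix h assume "h \<in> crossed_set C T"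
    then obtain g t f i s f' i' where h: "h \<in> \<Gamma>" "g \<in> SL2R" "hb (mobR g \<i>) \<le> C" "t \<ge> T" "f \<in> short_set 1" "i \<in> I" "touch (h ** f) i (geo_pt g t)"
      "s \<le> -T" "f' \<in> short_set 1" "i' \<in> I" "touch (h ** f') i' (geo_pt g s)" unfolding crossed_set_def by blast
    have "eta (h *v (f *v om i)) (geo_pt g t) < rr" "eta (h *v (f' *v om i')) (geo_pt g s) < rr"
      using touch_eta[OF h(7) mult[OF h(1) BG[OF h(5)]] h(6) Im_geo_pt[OF h(2)]] touch_eta[OF h(11) mult[OF h(1) BG[OF h(9)]] h(10) Im_geo_pt[OF h(2)]]
      by (simp_all add: matrix_vector_mul_assoc)
    then have "h \<in> crossed_pair_set C T (fst (f, i) *v om (snd (f, i))) (fst (f', i') *v om (snd (f', i')))"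
      unfolding crossed_pair_set_def using h(1-4,8) by auto
    then show "h \<in> (\<Union>x\<in>short_set 1 \<times> I. \<Union>y\<in>short_set 1 \<times> I. crossed_pair_set C T (fst x *v om (snd x)) (fst y *v om (snd y)))"
      using h(5,6,9,10) by blast
  qed
  then have "finite (crossed_set C T)" by (rule finite_subset) (use T(2) finite_short_set cc.finI in auto)
  then show ?thesis using T(1) by blast
qed

end

section \<open>Expansion along a geodesic\<close>

text \<open>The half turn at \<open>i\<close>. Multiplication by it from the right reverses a
  geodesic, and its square is minus the identity.\<close>

definition flip_mat :: "real^2^2" where "flip_mat = mk2 0 (-1) 1 0"
definition diag_flow :: "real \<Rightarrow> real^2^2" where "diag_flow t = mk2 (exp (t/2)) 0 0 (exp (-t/2))"

lemma flip_mat_SL2R: "flip_mat \<in> SL2R" by (simp add: SL2R_iff flip_mat_def)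
lemma diag_flow_SL2R: "diag_flow t \<in> SL2R" by (simp add: SL2R_iff diag_flow_def flip: exp_add)

lemma mobR_diag_flow: "mobR (diag_flow t) y = of_real (exp t) * y"
proof -
  have "exp (t/2) = exp t * exp (-t/2)" by (simp flip: exp_add)
  then have "complex_of_real (exp (t/2)) = of_real (exp t) * of_real (exp (-t/2))" by (metis of_real_mult)
  then show ?thesis by (simp add: mobR_def diag_flow_def)
qed

lemma mobR_flip_mat: "mobR flip_mat y = - 1 / y" by (simp add: mobR_def flip_mat_def)

lemma geo_pt_diag_flow: "geo_pt (g ** diag_flow t) x = geo_pt g (t + x)"
  unfolding geo_pt_def by (subst mobR_mult[OF diag_flow_SL2R]) (simp_all add: mobR_diag_flow exp_add mult.assoc)

lemma geo_pt_flip_mat: "geo_pt (g ** flip_mat) t = geo_pt g (- t)"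
proof -
  have "- 1 / (complex_of_real (exp t) * \<i>) = of_real (exp (-t)) * \<i>" by (simp add: exp_minus of_real_inverse field_simps)
  then show ?thesis unfolding geo_pt_def by (subst mobR_mult[OF flip_mat_SL2R]) (simp_all add: mobR_flip_mat)
qed

lemma continuous_geo_pt: "g \<in> SL2R \<Longrightarrow> continuous_on X (geo_pt g)"
  unfolding geo_pt_def
  by (rule continuous_on_compose2[OF continuous_on_mobR]) (auto intro!: continuous_intros simp: H_plane_def)

lemma vec_norm_bound: "\<exists>K. \<forall>v. norm ((B::complex^2^2) *v v) \<le> K * norm v"
  using linear_bounded[OF matrix_vector_mul_linear, of B] by blast

section \<open>Crossings and expansion along the flow\<close>

context geo begin

definition bigood :: "real^2^2 \<Rightarrow> bool" where "bigood g \<longleftrightarrow> good g \<and> good (g ** flip_mat)"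

text \<open>The ray is connected, and far out the words are those of the end. If the element at time
  \<open>T\<close> disagrees with the end about the prefix \<open>u\<close>, \<open>crossing\<close>
  finds a visit in between.\<close>

lemma crossing_forward: assumes g: "good g" and u: "set u \<subseteq> L" "reduced u" "u \<noteq> []" and t: "\<gamma> \<in> \<Gamma>" "i \<in> I" "touch \<gamma> i (geo_pt g T)"
    and ne: "has_prefix u \<gamma> \<noteq> (map (letter g) [0..<length u] = u)"
  shows "\<exists>t\<ge>T. \<exists>f\<in>short_set 1. \<exists>i\<in>I. touch (eval u ** f) i (geo_pt g t)"
proof -
  have gS: "g \<in> SL2R" using g by (simp add: good_def)
  obtain r where r: "r \<ge> 1" "far g r (length u) (map (letter g) [0..<length u])" using letter[OF g] unfolding label_def by blast
  \<comment> \<open>Late enough for the geodesic to be inside the half plane of radius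
    \<open>r\<close>.\<close>
  define T' where "T' = max T (ln r + 1)"
  have "exp T' \<ge> exp (ln r + 1)" by (simp add: T'_def)
  then have T': "T' \<ge> T" "r < exp T'" using r(1) exp_gt_one[of 1] by (auto simp: T'_def exp_add mult_less_cancel_left1 intro: less_le_trans[of _ "r * exp 1"])
  obtain \<tau> j where ta: "\<tau> \<in> \<Gamma>" "j \<in> I" "touch \<tau> j (geo_pt g T')" using touch_exists Im_geo_pt[OF gS] by blast
  have "take (length u) (nform \<tau>) = map (letter g) [0..<length u]"
    using r(2) ta T'(2) unfolding far_def geo_pt_def by (auto simp: norm_mult)
  then have pt: "has_prefix u \<tau> \<longleftrightarrow> map (letter g) [0..<length u] = u" by (simp add: has_prefix_def)
  define N where "N = geo_pt g ` {T..}"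
  have N: "connected N" "\<And>z. z \<in> N \<Longrightarrow> Im z > 0" unfolding N_def
    using Im_geo_pt[OF gS] by (auto intro!: connected_continuous_image continuous_geo_pt gS)
  have m: "geo_pt g T \<in> N" "geo_pt g T' \<in> N" using T' by (auto simp: N_def)
  have "\<exists>z\<in>N. \<exists>f\<in>short_set 1. \<exists>i\<in>I. touch (eval u ** f) i z"
  proof (cases "has_prefix u \<gamma>")
    case True
    then have np: "\<not> has_prefix u \<tau>" using ne pt by simp
    show ?thesis by (rule crossing[OF N u t(1,2) m(1) t(3) True ta(1,2) m(2) ta(3) np])
  next
    case False
    then have p: "has_prefix u \<tau>" using ne pt by simp
    show ?thesis by (rule crossing[OF N u ta(1,2) m(2) ta(3) p t(1,2) m(1) t(3) False])
  qed
  then show ?thesis unfolding N_def by auto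
qed

lemma crossing_backward: assumes g: "good (g ** flip_mat)" and u: "set u \<subseteq> L" "reduced u" "u \<noteq> []" and t: "\<gamma> \<in> \<Gamma>" "i \<in> I" "touch \<gamma> i (geo_pt g T)"
    and ne: "has_prefix u \<gamma> \<noteq> (map (letter (g ** flip_mat)) [0..<length u] = u)"
  shows "\<exists>t\<le>T. \<exists>f\<in>short_set 1. \<exists>i\<in>I. touch (eval u ** f) i (geo_pt g t)"
proof -
  have "touch \<gamma> i (geo_pt (g ** flip_mat) (- T))" using t(3) by (simp add: geo_pt_flip_mat)
  from crossing_forward[OF g u t(1,2) this ne] obtain t where "t \<ge> -T" "\<exists>f\<in>short_set 1. \<exists>i\<in>I. touch (eval u ** f) i (geo_pt g (- t))"
    unfolding geo_pt_flip_mat by blast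
  then show ?thesis by (intro exI[of _ "-t"]) auto
qed

text \<open>If both ends had the same word, the geodesic would visit the cusps of every long prefix on both sides.\<close>
lemma letters_distinct: assumes g: "bigood g" shows "letter g \<noteq> letter (g ** flip_mat)"
proof
  assume eq: "letter g = letter (g ** flip_mat)"
  have gg: "good g" "good (g ** flip_mat)" "g \<in> SL2R" using g by (auto simp: bigood_def good_def)
  define C where "C = hb (mobR g \<i>)"
  have "C > 0" unfolding C_def using gg by (intro hb_pos Im_mobR_pos) auto
  then obtain T where T: "T \<ge> 0" "finite (crossed_set C T)" using crossed_set_finite by blast
  obtain \<gamma> i where t: "\<gamma> \<in> \<Gamma>" "i \<in> I" "touch \<gamma> i (geo_pt g T)" using touch_exists Im_geo_pt[OF gg(3)] by blast
  obtain \<gamma>' i' where t': "\<gamma>' \<in> \<Gamma>" "i' \<in> I" "touch \<gamma>' i' (geo_pt g (-T))" using touch_exists Im_geo_pt[OF gg(3)] by blast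
  \<comment> \<open>Longer than the two words seen at times \<open>T\<close> and \<open>-T\<close>,
    so that neither has the prefix while both ends do.\<close>
  define k0 where "k0 = Suc (max (length (nform \<gamma>)) (length (nform \<gamma>')))"
  let ?u = "\<lambda>k. map (letter g) [0..<k]"
  have "eval (?u k) \<in> crossed_set C T" if k: "k \<ge> k0" for k
  proof -
    have u: "set (?u k) \<subseteq> L" "reduced (?u k)" "?u k \<noteq> []" using reduced_letter[OF gg(1)] k by (auto simp: k0_def)
    have np: "\<not> has_prefix (?u k) \<gamma>" "\<not> has_prefix (?u k) \<gamma>'" using k by (auto simp: has_prefix_def k0_def dest: arg_cong[of _ _ length])
    obtain a where a: "a \<ge> T" "\<exists>f\<in>short_set 1. \<exists>i\<in>I. touch (eval (?u k) ** f) i (geo_pt g a)" using crossing_forward[OF gg(1) u t] np by auto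
    obtain b where b: "b \<le> -T" "\<exists>f\<in>short_set 1. \<exists>i\<in>I. touch (eval (?u k) ** f) i (geo_pt g b)" using crossing_backward[OF gg(2) u t'] np eq by auto
    show ?thesis unfolding crossed_set_def using a b eval_in[OF u(1)] gg(3) by (auto simp: C_def)
  qed
  then have "(\<lambda>k. eval (?u k)) ` {k0..} \<subseteq> crossed_set C T" by auto
  then have "finite ((\<lambda>k. eval (?u k)) ` {k0..})" using T(2) finite_subset by blast
  moreover have "inj_on (\<lambda>k. eval (?u k)) {k0..}"
  proof (rule inj_onI)
    fix k m assume "eval (?u k) = eval (?u m)"
    then have "?u k = ?u m" using nform_eval[OF reduced_letter(2,1)[OF gg(1)]] by metis
    then show "k = m" by (auto dest: arg_cong[of _ _ length])
  qed
  ultimately have "finite {k0..}" using finite_imageD by blast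
  then show False using infinite_Ici by blast
qed

lemma cover_hb: "\<exists>E. finite E \<and> E \<subseteq> \<Gamma> \<and> (\<forall>z. Im z > 0 \<and> hb z \<le> C \<longrightarrow> (\<exists>f\<in>E. \<exists>i\<in>I. touch f i z))"
proof -
  obtain X where X: "X \<subseteq> \<Gamma> \<times> I" "finite X" "{z. Im z > 0 \<and> hb z \<le> C} \<subseteq> (\<Union>x\<in>X. {z. Im z > 0 \<and> touch (fst x) (snd x) z})"
  proof (rule compactE_image[OF compact_hb[of C], of "\<Gamma> \<times> I" "\<lambda>x. {z. Im z > 0 \<and> touch (fst x) (snd x) z}"])
    show "open {z. Im z > 0 \<and> touch (fst x) (snd x) z}" if "x \<in> \<Gamma> \<times> I" for x using that by (intro touch_open) auto
    show "{z. Im z > 0 \<and> hb z \<le> C} \<subseteq> (\<Union>x\<in>\<Gamma> \<times> I. {z. Im z > 0 \<and> touch (fst x) (snd x) z})"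
      using touch_exists by fastforce
  qed
  show ?thesis
  proof (intro exI[of _ "fst ` X"] conjI allI impI)
    show "finite (fst ` X)" using X(2) by simp
    show "fst ` X \<subseteq> \<Gamma>" using X(1) by auto
    fix z assume "Im z > 0 \<and> hb z \<le> C"
    then obtain x where x: "x \<in> X" "touch (fst x) (snd x) z" using X(3) by blast
    then show "\<exists>f\<in>fst ` X. \<exists>i\<in>I. touch f i z" using X(1) by (intro bexI[of _ "fst x"] bexI[of _ "snd x"]) auto
  qed
qed

text \<open>At a return time the word of \<open>adj2 \<gamma>\<close> follows the word of the forward end except for a tail of bounded length:
  a longer tail would make the geodesic enter its cusps on both sides of the return time.\<close>
lemma word_split: assumes g: "bigood g" and C: "C > 0"
  shows "\<exists>M. \<forall>k. \<exists>T1. \<forall>t\<ge>T1. \<forall>\<gamma>\<in>\<Gamma>. hb (mobR \<gamma> (geo_pt g t)) \<le> C \<longrightarrow>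
    (\<exists>j b. k \<le> j \<and> set b \<subseteq> L \<and> length b \<le> M \<and> adj2 \<gamma> = eval (map (letter g) [0..<j] @ b))"
proof -
  have gg: "good g" "good (g ** flip_mat)" "g \<in> SL2R" using g by (auto simp: bigood_def good_def)
  obtain T where T: "T \<ge> 0" "finite (crossed_set C T)" using crossed_set_finite[OF C] by blast
  obtain E where E: "finite E" "E \<subseteq> \<Gamma>" "\<And>z. Im z > 0 \<Longrightarrow> hb z \<le> C * (2 * exp T) \<Longrightarrow> \<exists>f\<in>E. \<exists>i\<in>I. touch f i z"
    using cover_hb[of "C * (2 * exp T)"] by blast
  define LE where "LE = (\<Sum>f\<in>E. length (nform f) + length (nform (adj2 f)))"
  have LE: "length (nform f) + length (nform (adj2 f)) \<le> LE" if "f \<in> E" for f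
    unfolding LE_def using member_le_sum[OF that _ E(1), of "\<lambda>f. length (nform f) + length (nform (adj2 f))"] by simp
  define MR where "MR = (\<Sum>h\<in>crossed_set C T. length (nform (adj2 h)))"
  have MR: "length (nform (adj2 h)) \<le> MR" if "h \<in> crossed_set C T" for h
    unfolding MR_def using member_le_sum[OF that _ T(2), of "\<lambda>f. length (nform (adj2 f))"] by simp
  define M where "M = LE + MR + 2"
  obtain n where n: "letter g n \<noteq> letter (g ** flip_mat) n" using letters_distinct[OF g] by (meson ext)
  have "\<exists>T1. \<forall>t\<ge>T1. \<forall>\<gamma>\<in>\<Gamma>. hb (mobR \<gamma> (geo_pt g t)) \<le> C \<longrightarrow>
    (\<exists>j b. k \<le> j \<and> set b \<subseteq> L \<and> length b \<le> M \<and> adj2 \<gamma> = eval (map (letter g) [0..<j] @ b))" for k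
  proof -
    \<comment> \<open>Passing index \<open>n\<close> guarantees that a common prefix of this length
      already separates the forward end from the backward end.\<close>
    define k' where "k' = max k (Suc n)"
    obtain r where r: "r \<ge> 1" "far g r (k' + LE) (map (letter g) [0..<k' + LE])" using letter[OF gg(1)] unfolding label_def by blast
    show ?thesis
    proof (intro exI[of _ "ln r + 1"] allI impI ballI)
      fix t \<gamma> assume t: "ln r + 1 \<le> t" and gm: "\<gamma> \<in> \<Gamma>" and hb: "hb (mobR \<gamma> (geo_pt g t)) \<le> C"
      define d where "d = adj2 \<gamma>"
      have d: "d \<in> \<Gamma>" using adj gm by (simp add: d_def)
      have gmS: "\<gamma> \<in> SL2R" using sub[OF gm] .
      define g' where "g' = \<gamma> ** (g ** diag_flow t)"
      have g': "g' \<in> SL2R" unfolding g'_def using gmS gg(3) diag_flow_SL2R by (intro SL2R_mult)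
      have gp: "geo_pt g' x = mobR \<gamma> (geo_pt g (t + x))" for x
        unfolding g'_def using geo_pt_mult[OF SL2R_mult[OF gg(3) diag_flow_SL2R]] geo_pt_diag_flow by simp
      have hb': "hb (mobR g' \<i>) \<le> C" using gp[of 0] hb by (simp add: geo_pt_0)
      have tc: "touch (d ** f) i (geo_pt g (t + x)) \<longleftrightarrow> touch f i (geo_pt g' x)" for f i x
        using touch_mult[OF SL2R_adj[OF gmS] Im_geo_pt[OF g'], of f i x] mobR_adj_cancel(1)[OF gmS Im_geo_pt[OF gg(3)]]
        unfolding gp d_def by simp
      have near: "\<exists>f\<in>E. \<exists>i\<in>I. touch (d ** f) i (geo_pt g (t + x))" if "\<bar>x\<bar> \<le> T" for x
        unfolding tc using E(3)[OF Im_geo_pt[OF g'] hb_geo_pt[OF g' hb' that]] .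
      obtain f i where f: "f \<in> E" "i \<in> I" "touch (d ** f) i (geo_pt g t)" using near[of 0] T(1) by auto
      have fG: "f \<in> \<Gamma>" "adj2 f \<in> \<Gamma>" using f(1) E(2) adj by auto
      have df: "d ** f \<in> \<Gamma>" by (rule mult[OF d fG(1)])
      have "exp t \<ge> exp (ln r + 1)" using t by simp
      then have "r < exp t" using r(1) exp_gt_one[of 1] by (auto simp: exp_add mult_less_cancel_left1 intro: less_le_trans[of _ "r * exp 1"])
      then have tk: "take (k' + LE) (nform (d ** f)) = map (letter g) [0..<k' + LE]" "k' + LE + step_len \<le> length (nform (d ** f))"
        using r(2) f df unfolding far_def geo_pt_def by (auto simp: norm_mult)
      have "take k' (nform (d ** f ** adj2 f)) = take k' (nform (d ** f))"
        using LE[OF f(1)] tk(2) by (intro take_stable df fG) auto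
      moreover have "d ** f ** adj2 f = d" unfolding assoc2 using adj2_right[OF sub[OF fG(1)]] by simp
      ultimately have "take k' (nform d) = take k' (take (k' + LE) (nform (d ** f)))" by simp
      also have "\<dots> = map (letter g) [0..<k']" unfolding tk(1) by (simp add: take_map)
      finally have tkd: "take k' (nform d) = map (letter g) [0..<k']" .
      \<comment> \<open>The lengths up to which the word of \<open>d\<close> follows the forward
        end. It is a bounded set, and its maximum \<open>j\<close> is the point of
        departure.\<close>
      define X where "X = {j. take j (nform d) = map (letter g) [0..<j]}"
      have Xb: "j \<le> length (nform d)" if "j \<in> X" for j using arg_cong[of _ _ length, OF that[unfolded X_def mem_Collect_eq]] by simp
      have Xf: "finite X" using Xb by (intro finite_subset[of X "{..length (nform d)}"]) auto
      define j where "j = Max X"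
      have k'X: "k' \<in> X" using tkd by (simp add: X_def)
      have jX: "j \<in> X" unfolding j_def using Max_in[OF Xf] k'X by blast
      have jk: "k' \<le> j" unfolding j_def using Max_ge[OF Xf k'X] .
      define b where "b = drop j (nform d)"
      have wdd: "nform d = map (letter g) [0..<j] @ b" using jX append_take_drop_id[of j "nform d"] by (simp add: X_def b_def)
      have bL: "set b \<subseteq> L" using nform(1)[OF d] wdd by simp
      have "length b \<le> M"
      proof (rule ccontr)
        assume bM: "\<not> length b \<le> M"
        then obtain b0 b' where b0: "b = b0 # b'" by (cases b) auto
        \<comment> \<open>The agreed prefix with the first deviating letter. It is a prefix of the
          word of \<open>d\<close> but of neither end, so it must be crossed on both sides of the
          return.\<close>
        define u where "u = map (letter g) [0..<j] @ [b0]"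
        have wu: "nform d = u @ b'" using wdd b0 by (simp add: u_def)
        have lu: "length u = Suc j" by (simp add: u_def)
        have u: "set u \<subseteq> L" "reduced u" "u \<noteq> []" "set b' \<subseteq> L" "reduced b'" using nform(1,2)[OF d] unfolding wu by (auto simp: reduced_append) (auto simp: u_def)
        have b0n: "b0 \<noteq> letter g j"
        proof
          assume "b0 = letter g j"
          then have "Suc j \<in> X" unfolding X_def using wu by (simp add: u_def)
          then show False using Max_ge[OF Xf, of "Suc j"] by (simp add: j_def)
        qed
        have nu: "map (letter g) [0..<length u] \<noteq> u" unfolding lu using b0n by (simp add: u_def)
        have nu': "map (letter (g ** flip_mat)) [0..<length u] \<noteq> u"
        proof
          assume e: "map (letter (g ** flip_mat)) [0..<length u] = u"
          have nj: "n < j" using jk by (simp add: k'_def)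
          have "letter (g ** flip_mat) n = map (letter (g ** flip_mat)) [0..<length u] ! n" using nj lu by (simp del: upt_Suc)
          also have "\<dots> = letter g n" unfolding e using nj by (simp add: u_def nth_append)
          finally show False using n by simp
        qed
        \<comment> \<open>The tail is longer than \<open>LE\<close>, so multiplication by an element
          of \<open>E\<close> does not reach back into \<open>u\<close>.\<close>
        have pr: "has_prefix u (d ** f)" if "f \<in> E" for f
        proof -
          have "take (length u) (nform (d ** f)) = take (length u) (nform d)"
            using LE[OF that] bM wdd lu E(2) that by (intro take_stable d) (auto simp: M_def)
          then show ?thesis unfolding has_prefix_def wu by simp
        qed
        obtain f1 i1 where f1: "f1 \<in> E" "i1 \<in> I" "touch (d ** f1) i1 (geo_pt g (t + T))" using near[of T] T(1) by auto
        obtain f2 i2 where f2: "f2 \<in> E" "i2 \<in> I" "touch (d ** f2) i2 (geo_pt g (t + - T))" using near[of "-T"] T(1) by auto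
        have G12: "d ** f1 \<in> \<Gamma>" "d ** f2 \<in> \<Gamma>" using mult[OF d] f1 f2 E(2) by auto
        obtain a where a: "a \<ge> t + T" "\<exists>f\<in>short_set 1. \<exists>i\<in>I. touch (eval u ** f) i (geo_pt g a)"
          using crossing_forward[OF gg(1) u(1-3) G12(1) f1(2,3)] pr[OF f1(1)] nu by auto
        obtain c where c: "c \<le> t + - T" "\<exists>f\<in>short_set 1. \<exists>i\<in>I. touch (eval u ** f) i (geo_pt g c)"
          using crossing_backward[OF gg(2) u(1-3) G12(2) f2(2,3)] pr[OF f2(1)] nu' by auto
        \<comment> \<open>Moved by \<gamma> to the compact region, both crossings put
          \<open>h\<close> into the finite set \<open>crossed_set C T\<close>. Its inverse is the
          value of the rest of the tail, which is thus no longer than \<open>MR\<close>.\<close>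
        define h where "h = \<gamma> ** eval u"
        have mv: "touch (h ** f) i (geo_pt g' (x - t)) \<longleftrightarrow> touch (eval u ** f) i (geo_pt g x)" for f i x
          unfolding h_def using touch_mult[OF gmS Im_geo_pt[OF gg(3)], of "eval u ** f" i x] gp[of "x - t"] by (simp add: assoc2)
        have "h \<in> crossed_set C T" unfolding crossed_set_def mem_Collect_eq
        proof (intro conjI bexI[of _ g'] g' hb')
          show "h \<in> \<Gamma>" unfolding h_def using mult[OF gm eval_in[OF u(1)]] .
          show "\<exists>t\<ge>T. \<exists>f\<in>short_set 1. \<exists>i\<in>I. touch (h ** f) i (geo_pt g' t)" using a mv by (intro exI[of _ "a - t"]) auto
          show "\<exists>s\<le>-T. \<exists>f\<in>short_set 1. \<exists>i\<in>I. touch (h ** f) i (geo_pt g' s)" using c mv by (intro exI[of _ "c - t"]) auto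
        qed
        then have "length (nform (adj2 h)) \<le> MR" by (rule MR)
        moreover have "adj2 h = eval b'"
        proof -
          have "d = eval u ** eval b'" using nform(3)[OF d] wu eval_append by metis
          then show ?thesis unfolding h_def adj2_mult d_def[symmetric] using conj_cancel(1)[OF sub[OF eval_in[OF u(1)]]] by simp
        qed
        ultimately show False using nform_eval[OF u(4,5)] b0 bM by (simp add: M_def)
      qed
      moreover have "adj2 \<gamma> = eval (map (letter g) [0..<j] @ b)" using nform(3)[OF d] wdd by (simp add: d_def)
      moreover have "k \<le> j" using jk by (simp add: k'_def)
      ultimately show "\<exists>j b. k \<le> j \<and> set b \<subseteq> L \<and> length b \<le> M \<and> adj2 \<gamma> = eval (map (letter g) [0..<j] @ b)"
        using bL by blast
    qed
  qed
  then show ?thesis by blast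
qed

lemma rep_inv_word: assumes a: "\<And>j. a j \<in> L" shows "R (eval (inv_word (map a [0..<k]))) = Mk a k"
proof (induction k)
  case 0 show ?case by (simp add: inv_word_def R1)
next
  case (Suc k)
  have s: "set (inv_word (map a [0..<k])) \<subseteq> L" using a by (intro set_inv_word) auto
  have "inv_word (map a [0..<Suc k]) = iv (a k) # inv_word (map a [0..<k])" by (simp add: inv_word_def)
  then show ?case using Rmult[OF gG[OF ivL[OF a]] eval_in[OF s], of k] Rg[OF ivL[OF a]] Suc by simp
qed

lemma words_bound: "\<exists>P>0. \<forall>b v. set b \<subseteq> L \<and> length b \<le> M \<longrightarrow> norm (R (eval b) *v v) \<le> P * norm v"
proof -
  have "\<forall>\<^sub>F P in at_top. \<forall>b\<in>{b. set b \<subseteq> L \<and> length b \<le> M}. \<forall>v. norm (R (eval b) *v v) \<le> P * norm v"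
  proof (intro eventually_ball_finite ballI)
    show "finite {b. set b \<subseteq> L \<and> length b \<le> M}" by (rule finite_lists_length_le[OF finL])
    fix b
    obtain K where K: "\<And>v. norm (R (eval b) *v v) \<le> K * norm v" using vec_norm_bound by blast
    show "\<forall>\<^sub>F P in at_top. \<forall>v. norm (R (eval b) *v v) \<le> P * norm v"
      using eventually_ge_at_top[of K] by (rule eventually_mono) (meson K mult_right_mono norm_ge_zero order_trans)
  qed
  then have "\<forall>\<^sub>F P in at_top. P > 0 \<and> (\<forall>b\<in>{b. set b \<subseteq> L \<and> length b \<le> M}. \<forall>v. norm (R (eval b) *v v) \<le> P * norm v)"
    by (intro eventually_conj eventually_gt_at_top)
  then show ?thesis using eventually_happens[of _ "at_top :: real filter"] by fastforce
qed

text \<open>By \<open>word_split\<close> the matrix of \<gamma> is a bounded factor times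
  \<open>Mk a j\<close> with \<open>j\<close> large. The latter contracts \<open>w2\<close> faster
  than the root of its determinant, while it scales the wedge of \<open>w1\<close> and
  \<open>w2\<close> by exactly the determinant; so the quotient of the norms grows.\<close>

lemma expansion: assumes g: "bigood g" and C: "C > 0" and w2: "w2 \<in> limit_line (letter g)" "w2 \<noteq> 0" and w1: "w1 \<notin> limit_line (letter g)" and Z: "Z > 0"
  shows "\<exists>T1. \<forall>t\<ge>T1. \<forall>\<gamma>\<in>\<Gamma>. hb (mobR \<gamma> (geo_pt g t)) \<le> C \<longrightarrow> Z * norm (R \<gamma> *v w2) \<le> norm (R \<gamma> *v w1)"
proof -
  define a where "a = letter g"
  have a: "iword a" using g iword_letter by (simp add: a_def bigood_def)
  have aL: "\<And>j. a j \<in> L" using a by (simp add: iword_def)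
  obtain M where M: "\<And>k. \<exists>T1. \<forall>t\<ge>T1. \<forall>\<gamma>\<in>\<Gamma>. hb (mobR \<gamma> (geo_pt g t)) \<le> C \<longrightarrow>
    (\<exists>j b. k \<le> j \<and> set b \<subseteq> L \<and> length b \<le> M \<and> adj2 \<gamma> = eval (map a [0..<j] @ b))"
    using word_split[OF g C] unfolding a_def by blast
  obtain P where P: "P > 0" "\<And>b v. set b \<subseteq> L \<Longrightarrow> length b \<le> M \<Longrightarrow> norm (R (eval b) *v v) \<le> P * norm v" using words_bound by blast
  obtain D \<theta> where D: "0 \<le> \<theta>" "\<theta> < 1" "\<And>a w k. iword a \<Longrightarrow> w \<in> limit_line a \<Longrightarrow> (norm (Mk a k *v w))\<^sup>2 \<le> D * \<theta>^k * (norm w)\<^sup>2 * cmod (det (Mk a k))"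
    using limit_line_decay by blast
  have wn: "wd2 w2 w1 \<noteq> 0"
  proof
    assume "wd2 w2 w1 = 0"
    then have "w1 \<in> cline w2" using wd2_zero_parallel[OF w2(2)] by blast
    then show False using w1 limit_line_scale[OF w2(1)] by (auto simp: cline_iff)
  qed
  have "(\<lambda>j. \<theta>^j * (Z * P\<^sup>2 * D * (norm w2)\<^sup>2)) \<longlonglongrightarrow> 0" using D by (intro tendsto_mult_left_zero LIMSEQ_power_zero) auto
  then have "\<forall>\<^sub>F j in sequentially. \<theta>^j * (Z * P\<^sup>2 * D * (norm w2)\<^sup>2) < cmod (wd2 w2 w1)" using wn by (intro order_tendstoD(2)) auto
  then obtain k where k: "\<And>j. j \<ge> k \<Longrightarrow> \<theta>^j * (Z * P\<^sup>2 * D * (norm w2)\<^sup>2) < cmod (wd2 w2 w1)" unfolding eventually_sequentially by blast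
  obtain T1 where T1: "\<And>t \<gamma>. t \<ge> T1 \<Longrightarrow> \<gamma> \<in> \<Gamma> \<Longrightarrow> hb (mobR \<gamma> (geo_pt g t)) \<le> C \<Longrightarrow>
    (\<exists>j b. k \<le> j \<and> set b \<subseteq> L \<and> length b \<le> M \<and> adj2 \<gamma> = eval (map a [0..<j] @ b))" using M[of k] by blast
  show ?thesis
  proof (intro exI[of _ T1] allI impI ballI)
    fix t \<gamma> assume t: "T1 \<le> t" "\<gamma> \<in> \<Gamma>" "hb (mobR \<gamma> (geo_pt g t)) \<le> C"
    obtain j b where jb: "k \<le> j" "set b \<subseteq> L" "length b \<le> M" "adj2 \<gamma> = eval (map a [0..<j] @ b)" using T1[OF t] by blast
    have uL: "set (map a [0..<j]) \<subseteq> L" using aL by auto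
    have ib: "set (inv_word b) \<subseteq> L" "length (inv_word b) \<le> M" using set_inv_word[OF jb(2)] jb(3) by (auto simp: inv_word_def)
    have "\<gamma> = adj2 (eval (map a [0..<j] @ b))" using jb(4) by (metis adj2_adj2)
    then have "\<gamma> = eval (inv_word b) ** eval (inv_word (map a [0..<j]))" using eval_inv_word[OF uL] eval_inv_word[OF jb(2)] by (simp add: eval_append adj2_mult)
    then have Rg: "R \<gamma> = R (eval (inv_word b)) ** Mk a j" using Rmult[OF eval_in[OF ib(1)] eval_in[OF set_inv_word[OF uL]]] rep_inv_word[of a j, OF aL] by simp
    let ?m = "Mk a j"
    have inv: "R (eval b) *v (R (eval (inv_word b)) *v v) = v" for v
    proof -
      have "R (eval b) ** R (eval (inv_word b)) = R (eval b ** adj2 (eval b))" using Rmult[OF eval_in[OF jb(2)] eval_in[OF ib(1)]] eval_inv_word[OF jb(2)] by simp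
      also have "\<dots> = mat 1" using adj2_right[OF sub[OF eval_in[OF jb(2)]]] R1 by simp
      finally show ?thesis by (simp add: matrix_vector_mul_assoc)
    qed
    have 1: "norm (R \<gamma> *v w2) \<le> P * norm (?m *v w2)" using P(2)[OF ib, of "?m *v w2"] by (simp add: Rg matrix_vector_mul_assoc)
    have 2: "norm (?m *v w1) \<le> P * norm (R \<gamma> *v w1)" using P(2)[OF jb(2,3), of "R \<gamma> *v w1"] inv by (simp add: Rg matrix_vector_mul_assoc[symmetric])
    have d: "cmod (det ?m) > 0" using det_Mk[OF a] by simp
    have m2: "norm (?m *v w2) > 0" using mulv_nonzero[OF det_Mk[OF a] w2(2)] by simp
    have "(Z * P\<^sup>2 * norm (?m *v w2)) * norm (?m *v w2) = Z * P\<^sup>2 * (norm (?m *v w2))\<^sup>2" by (simp add: power2_eq_square)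
    also have "\<dots> \<le> Z * P\<^sup>2 * (D * \<theta>^j * (norm w2)\<^sup>2 * cmod (det ?m))"
      using Z P(1) D(3)[OF a, of w2 j] w2(1) by (intro mult_left_mono) (auto simp: a_def)
    also have "\<dots> = cmod (det ?m) * (\<theta>^j * (Z * P\<^sup>2 * D * (norm w2)\<^sup>2))" by (simp add: algebra_simps)
    also have "\<dots> \<le> cmod (det ?m) * cmod (wd2 w2 w1)" using k[OF jb(1)] d by (intro mult_left_mono) auto
    also have "\<dots> = cmod (wd2 (?m *v w2) (?m *v w1))" by (simp add: wd2_mulv norm_mult)
    also have "\<dots> \<le> norm (?m *v w1) * norm (?m *v w2)" using wd2_le[of "?m *v w2" "?m *v w1"] by (simp add: mult.commute)
    finally have "Z * P\<^sup>2 * norm (?m *v w2) \<le> norm (?m *v w1)" using m2 by (simp add: mult_le_cancel_right)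
    then have "P * (Z * (P * norm (?m *v w2))) \<le> P * norm (R \<gamma> *v w1)" using 2 by (simp add: power2_eq_square algebra_simps)
    then have "Z * (P * norm (?m *v w2)) \<le> norm (R \<gamma> *v w1)" using P(1) by (simp add: mult_le_cancel_left)
    then show "Z * norm (R \<gamma> *v w2) \<le> norm (R \<gamma> *v w1)" using mult_left_mono[OF 1 less_imp_le[OF Z]] by linarith
  qed
qed

lemma bigood_flip_mat: assumes "bigood g" shows "bigood (g ** flip_mat)"
proof -
  have "good (- g) \<longleftrightarrow> good g" for g
  proof -
    have "- g \<in> SL2R \<longleftrightarrow> g \<in> SL2R" by (simp add: SL2R_iff)
    moreover have "(adj2 (- g) *v v)$2 = - (adj2 g *v v)$2" for v by (simp add: mulv2)
    ultimately show ?thesis by (simp add: good_def)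
  qed
  moreover have "g ** flip_mat ** flip_mat = - g" by (simp add: mat2_eq mult2 flip_mat_def)
  ultimately show ?thesis using assms by (simp add: bigood_def)
qed

end

section \<open>Frames and the geodesic flow\<close>

lemma moebC_mult: assumes "det A \<noteq> 0" "det B \<noteq> 0" shows "moebC (A ** B) = moebC A \<circ> moebC B"
proof
  fix x
  obtain w where w: "w \<noteq> 0" "pt w = x" using pt_surj by blast
  have "moebC (A ** B) (pt w) = pt ((A ** B) *v w)" using assms w by (intro moebC_pt) (simp_all add: det_mul)
  moreover have "moebC A (moebC B (pt w)) = pt (A *v (B *v w))"
    using moebC_pt[OF assms(2) w(1)] moebC_pt[OF assms(1) mulv_nonzero[OF assms(2) w(1)]] by simp
  ultimately show "moebC (A ** B) x = (moebC A \<circ> moebC B) x" using w by (simp add: matrix_vector_mul_assoc)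
qed

lemma moebC_one: "moebC (mat 1) = id"
  by (rule ext) (auto simp: moebC_def split: option.splits)

lemma moebC_id: assumes "moebC B = id" "det B \<noteq> 0" shows "B ** M = M ** (B :: complex^2^2)"
proof -
  have 1: "B$2$1 = 0" using fun_cong[OF assms(1), of None] by (auto simp: moebC_def split: if_splits)
  then have d: "B$1$1 \<noteq> 0" "B$2$2 \<noteq> 0" using assms(2) by (auto simp: det_2)
  have 2: "B$1$2 = 0" using fun_cong[OF assms(1), of "Some 0"] d 1 by (auto simp: moebC_def)
  have 3: "B$1$1 = B$2$2" using fun_cong[OF assms(1), of "Some 1"] d 1 2 by (auto simp: moebC_def)
  show ?thesis by (simp add: mat2_eq mult2 1 2 3)
qed

text \<open>The Schottky condition determines elements only up to matrices that act trivially. Such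
  a matrix is scalar, its preimage under the injective \<rho> is central in \<Gamma>, and
  \<open>centre\<close> makes it trivial.\<close>

lemma srep_exists:
  assumes cc: "cusp_cover \<Gamma> I V p om S rr c0" and rep: "representation \<Gamma> \<rho>" and inj: "inj_on \<rho> \<Gamma>" and sch: "schottky (\<rho> ` \<Gamma>)"
  shows "\<exists>(L :: (nat \<times> bool) set) iv A H x0 g. srep L iv A H x0 \<Gamma> g \<rho>"
proof -
  interpret cc: cusp_cover \<Gamma> I V p om S rr c0 by (rule cc)
  obtain m gs and A :: "nat \<times> bool \<Rightarrow> complex^2^2" and H x0 where
    sf: "sforms ({..<m} \<times> UNIV) (\<lambda>(i, s). (i, \<not> s)) A H x0" and gs: "\<forall>i<m. A (i, True) = gs i \<and> gs i \<in> \<rho> ` \<Gamma>"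
    and gen: "moebC ` (\<rho> ` \<Gamma>) = gen_group ((\<lambda>i. moebC (gs i)) ` {..<m})"
    using schottky_extract[OF sch] by (elim exE conjE)
  interpret sf: sforms "{..<m} \<times> (UNIV::bool set)" "\<lambda>(i, s). (i, \<not> s)" A H x0 by (rule sf)
  have inv: "det (\<rho> \<gamma>) \<noteq> 0" if "\<gamma> \<in> \<Gamma>" for \<gamma> using rep that by (simp add: representation_def invertible_det_nz)
  have mu: "\<rho> (g ** h) = \<rho> g ** \<rho> h" if "g \<in> \<Gamma>" "h \<in> \<Gamma>" for g h using rep that by (simp add: representation_def)
  have r1: "\<rho> (mat 1) = mat 1"
  proof -
    have "invertible (\<rho> (mat 1))" using rep cc.one by (simp add: representation_def)
    then obtain B where B: "B ** \<rho> (mat 1) = mat 1" unfolding invertible_def by blast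
    have "\<rho> (mat 1) ** \<rho> (mat 1) = \<rho> (mat 1)" using mu[OF cc.one cc.one] by simp
    then have "B ** \<rho> (mat 1) ** \<rho> (mat 1) = B ** \<rho> (mat 1)" by (simp add: matrix_mul_assoc[symmetric])
    then show ?thesis by (simp add: B)
  qed
  define gi where "gi i = the_inv_into \<Gamma> \<rho> (gs i)" for i
  have gi: "gi i \<in> \<Gamma>" "\<rho> (gi i) = gs i" if "i < m" for i
    using gs that the_inv_into_into[OF inj, of "gs i" \<Gamma>] f_the_inv_into_f[OF inj, of "gs i"] by (auto simp: gi_def)
  define g where "g = (\<lambda>(i, s). if s then gi i else adj2 (gi i))"
  have gG: "g a \<in> \<Gamma>" if "a \<in> {..<m} \<times> UNIV" for a using that gi cc.adj by (auto simp: g_def)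
  have ra: "\<rho> (adj2 (gi i)) ** gs i = mat 1" "gs i ** \<rho> (adj2 (gi i)) = mat 1" if i: "i < m" for i
    using mu[OF cc.adj[OF gi(1)[OF i]] gi(1)[OF i]] mu[OF gi(1)[OF i] cc.adj[OF gi(1)[OF i]]] gi(2)[OF i] r1
      adj2_left[OF cc.sub[OF gi(1)[OF i]]] adj2_right[OF cc.sub[OF gi(1)[OF i]]] by auto
  have Rg: "\<rho> (g a) = A a" if a: "a \<in> {..<m} \<times> UNIV" for a
  proof (cases a)
    case (Pair i s)
    then have i: "i < m" using a by simp
    show ?thesis
    proof (cases s)
      case True then show ?thesis using Pair gi(2)[OF i] gs i by (simp add: g_def)
    next
      case False
      have "A (i, False) ** gs i = mat 1" using sf.Ainv[of "(i, True)"] gs i by simp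
      then have "A (i, False) ** gs i ** \<rho> (adj2 (gi i)) = \<rho> (adj2 (gi i))" by simp
      then have "A (i, False) = \<rho> (adj2 (gi i))" using ra(2)[OF i] by (simp add: matrix_mul_assoc[symmetric])
      then show ?thesis using Pair False by (simp add: g_def)
    qed
  qed
  define e where "e w = foldr (\<lambda>a M. g a ** M) w (mat 1)" for w
  have e: "e [] = mat 1" "e (a # w) = g a ** e w" for a w by (simp_all add: e_def)
  have eG: "set w \<subseteq> {..<m} \<times> UNIV \<Longrightarrow> e w \<in> \<Gamma>" for w by (induction w) (auto simp: e cc.one intro!: cc.mult gG)
  have wg: "\<exists>w. set w \<subseteq> {..<m} \<times> UNIV \<and> f = moebC (\<rho> (e w))" if "f \<in> gen_group ((\<lambda>i. moebC (gs i)) ` {..<m})" for f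
    using that
  proof (induction rule: gen_group.induct)
    case gen_id
    show ?case by (intro exI[of _ "[]"]) (simp add: e r1 moebC_one)
  next
    case (gen_l f h)
    then obtain w i where w: "set w \<subseteq> {..<m} \<times> UNIV" "h = moebC (\<rho> (e w))" "i < m" "f = moebC (gs i)" by auto
    have "f \<circ> h = moebC (\<rho> (e ((i, True) # w)))"
      using w mu[OF gi(1)[OF w(3)] eG[OF w(1)]] gi(2)[OF w(3)] moebC_mult[OF inv[OF gi(1)[OF w(3)]] inv[OF eG[OF w(1)]]] by (simp add: e g_def)
    then show ?case using w by (intro exI[of _ "(i, True) # w"]) auto
  next
    case (gen_linv f h)
    then obtain w i where w: "set w \<subseteq> {..<m} \<times> UNIV" "h = moebC (\<rho> (e w))" "i < m" "f = moebC (gs i)" by auto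
    have aG: "adj2 (gi i) \<in> \<Gamma>" using cc.adj gi w(3) by blast
    have "inv f = moebC (\<rho> (adj2 (gi i)))"
      using moebC_mult[OF inv[OF gi(1)[OF w(3)]] inv[OF aG]] moebC_mult[OF inv[OF aG] inv[OF gi(1)[OF w(3)]]] ra[OF w(3)] gi(2)[OF w(3)]
      unfolding w(4) by (intro inv_unique_comp) (simp_all add: moebC_one)
    then have "inv f \<circ> h = moebC (\<rho> (e ((i, False) # w)))"
      using w mu[OF aG eG[OF w(1)]] moebC_mult[OF inv[OF aG] inv[OF eG[OF w(1)]]] by (simp add: e g_def)
    then show ?case using w by (intro exI[of _ "(i, False) # w"]) auto
  qed
  have gen': "\<exists>w. set w \<subseteq> {..<m} \<times> UNIV \<and> e w = \<gamma>" if \<gamma>: "\<gamma> \<in> \<Gamma>" for \<gamma>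
  proof -
    have "moebC (\<rho> \<gamma>) \<in> gen_group ((\<lambda>i. moebC (gs i)) ` {..<m})" using gen \<gamma> by blast
    then obtain w where w: "set w \<subseteq> {..<m} \<times> UNIV" "moebC (\<rho> \<gamma>) = moebC (\<rho> (e w))" using wg by blast
    let ?e = "e w" and ?h = "\<gamma> ** adj2 (e w)"
    have G: "?e \<in> \<Gamma>" "adj2 ?e \<in> \<Gamma>" "?h \<in> \<Gamma>" using eG[OF w(1)] cc.adj cc.mult \<gamma> by auto
    have "moebC (\<rho> ?h) = moebC (\<rho> ?e) \<circ> moebC (\<rho> (adj2 ?e))"
      using mu[OF \<gamma> G(2)] moebC_mult[OF inv[OF \<gamma>] inv[OF G(2)]] w(2) by simp
    also have "\<dots> = moebC (\<rho> (?e ** adj2 ?e))" using mu[OF G(1,2)] moebC_mult[OF inv[OF G(1)] inv[OF G(2)]] by simp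
    also have "\<dots> = id" using adj2_right[OF cc.sub[OF G(1)]] r1 moebC_one by simp
    finally have id: "moebC (\<rho> ?h) = id" .
    \<comment> \<open>\<open>moebC_id\<close> gives commutation of the matrices, and injectivity of
      \<rho> carries it back to \<Gamma>.\<close>
    have "?h = mat 1"
    proof (rule cc.centre[OF G(3)])
      fix x assume x: "x \<in> \<Gamma>"
      have "\<rho> (?h ** x) = \<rho> (x ** ?h)" using mu[OF G(3) x] mu[OF x G(3)] moebC_id[OF id inv[OF G(3)], of "\<rho> x"] by simp
      then show "comm ?h x" unfolding comm_def using inj_onD[OF inj] cc.mult[OF G(3) x] cc.mult[OF x G(3)] by blast
    qed
    then have "?h ** ?e = ?e" by simp
    then have "\<gamma> = ?e" by (simp add: assoc2 adj2_left[OF cc.sub[OF G(1)]])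
    then show ?thesis using w(1) by blast
  qed
  have "srep ({..<m} \<times> UNIV) (\<lambda>(i, s). (i, \<not> s)) A H x0 \<Gamma> g \<rho>"
  proof (intro srep.intro srep_axioms.intro)
    show "sforms ({..<m} \<times> UNIV) (\<lambda>(i, s). (i, \<not> s)) A H x0" by (rule sf)
    show "g ((\<lambda>(i, s). (i, \<not> s)) a) = adj2 (g a)" if "a \<in> {..<m} \<times> UNIV" for a using that by (auto simp: g_def)
    show "\<exists>w. set w \<subseteq> {..<m} \<times> UNIV \<and> foldr (\<lambda>a M. g a ** M) w (mat 1) = \<gamma>" if "\<gamma> \<in> \<Gamma>" for \<gamma>
      using gen'[OF that] by (simp add: e_def)
  qed (use cc.sub cc.one cc.mult cc.adj gG Rg r1 mu in auto)
  then show ?thesis by blast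
qed

text \<open>Identifies \<open>T1H\<close> with \<open>SL2R\<close> up to sign, by
  \<open>frame_surj\<close> and \<open>frame_inj\<close>. The deck group acts from the left, the
  flow and the reversal from the right.\<close>

definition frame :: "real^2^2 \<Rightarrow> complex \<times> complex" where "frame g = actT g (\<i>, \<i>)"

lemma actT_eq: "actT g v = (mobR g (fst v), snd v / (den g (fst v))\<^sup>2)" by (simp add: actT_def den_def)

lemma actT_mult: "h \<in> SL2R \<Longrightarrow> Im (fst v) > 0 \<Longrightarrow> actT (g ** h) v = actT g (actT h v)"
  by (simp add: actT_eq mobR_mult den_mult power_mult_distrib field_simps)

lemma frame_mult: "h \<in> SL2R \<Longrightarrow> frame (g ** h) = actT g (frame h)"
  by (simp add: frame_def actT_mult)

lemma fst_frame: "fst (frame g) = mobR g \<i>" by (simp add: frame_def actT_def)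

lemma actT_T1H: assumes "g \<in> SL2R" "v \<in> T1H" shows "actT g v \<in> T1H"
  using assms Im_mobR_pos[OF assms(1)] Im_mobR[OF assms(1)]
  by (auto simp: T1H_def actT_eq norm_divide norm_power)

lemma frame_T1H: "g \<in> SL2R \<Longrightarrow> frame g \<in> T1H"
  unfolding frame_def by (intro actT_T1H) (auto simp: T1H_def)

lemma actT_uminus: "actT (- g) v = actT g v"
proof -
  have "den (- g) z = - den g z" "num (- g) z = - num g z" for z by (simp_all add: den_def num_def)
  then show ?thesis by (simp add: actT_eq mobR_nd)
qed

text \<open>Here \<open>j\<close> is the automorphy factor at \<open>i\<close>. The frame then has
  base point \<open>z\<close> and vector \<open>i / j^2\<close>, so \<open>j\<close> has to be a
  square root of \<open>i / u\<close>.\<close>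

definition frame_mat :: "complex \<Rightarrow> complex \<Rightarrow> real^2^2" where
  "frame_mat z j = mk2 (Im (z * j)) (Re (z * j)) (Im j) (Re j)"

lemma frame_mat: assumes "(z, u) \<in> T1H" "j\<^sup>2 = \<i> / u" shows "frame_mat z j \<in> SL2R" "frame (frame_mat z j) = (z, u)"
proof -
  have u: "cmod u = Im z" "Im z > 0" "u \<noteq> 0" using assms by (auto simp: T1H_def)
  have "(cmod j)\<^sup>2 = 1 / Im z" using arg_cong[OF assms(2), of cmod] u by (simp add: norm_power norm_divide)
  then have j2: "((Re j)\<^sup>2 + (Im j)\<^sup>2) * Im z = 1" using u by (simp add: cmod_power2)
  then show "frame_mat z j \<in> SL2R" by (simp add: SL2R_iff frame_mat_def power2_eq_square algebra_simps)
  have d: "den (frame_mat z j) \<i> = j" "num (frame_mat z j) \<i> = z * j" by (simp_all add: den_def num_def frame_mat_def complex_eq_iff)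
  have "j \<noteq> 0" using assms(2) u by auto
  then show "frame (frame_mat z j) = (z, u)" using assms(2) u by (simp add: frame_def actT_eq mobR_nd d)
qed

lemma frame_surj: assumes "v \<in> T1H" shows "\<exists>g\<in>SL2R. frame g = v"
proof -
  obtain z u where v: "v = (z, u)" by (cases v)
  show ?thesis using frame_mat[of z u "csqrt (\<i> / u)"] assms v by auto
qed

lemma frame_inj: assumes "g \<in> SL2R" "h \<in> SL2R" "frame g = frame h" shows "g = h \<or> g = - h"
proof -
  have nz: "den g \<i> \<noteq> 0" "den h \<i> \<noteq> 0" using den_nonzero assms by auto
  have e: "num g \<i> / den g \<i> = num h \<i> / den h \<i>" "(den g \<i>)\<^sup>2 = (den h \<i>)\<^sup>2"
    using assms(3) nz by (auto simp: frame_def actT_eq mobR_nd frac_eq_eq)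
  then have d: "den g \<i> = den h \<i> \<or> den g \<i> = - den h \<i>" by (simp add: power2_eq_iff)
  then show ?thesis
  proof
    assume a: "den g \<i> = den h \<i>"
    then have "num g \<i> = num h \<i>" using e nz by simp
    then show ?thesis using a by (simp add: num_def den_def complex_eq_iff mat2_eq)
  next
    assume a: "den g \<i> = - den h \<i>"
    then have "- num g \<i> = num h \<i>" using e nz by (simp add: field_simps)
    then have "num g \<i> = - num h \<i>" by (metis minus_minus)
    then show ?thesis using a by (simp add: num_def den_def complex_eq_iff mat2_eq)
  qed
qed

lemma frame_diag_flow: "frame (diag_flow t) = (of_real (exp t) * \<i>, of_real (exp t) * \<i>)"
proof -
  have "(complex_of_real (exp (-t/2)))\<^sup>2 = of_real (exp (-t))" by (simp flip: of_real_power exp_double)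
  then show ?thesis by (simp add: frame_def actT_eq mobR_diag_flow) (simp add: den_def diag_flow_def exp_minus of_real_inverse field_simps)
qed

text \<open>The matrix picked by \<open>SOME\<close> is determined up to sign, and the sign acts
  trivially.\<close>

lemma geoflow_frame: assumes g: "g \<in> SL2R" shows "geoflow (frame g) t = frame (g ** diag_flow t)"
proof -
  define h where "h = (SOME h. h \<in> SL2R \<and> actT h (\<i>, \<i>) = frame g)"
  have "h \<in> SL2R \<and> actT h (\<i>, \<i>) = frame g" unfolding h_def by (rule someI[of _ g]) (use g in \<open>simp add: frame_def\<close>)
  then have "h = g \<or> h = - g" using frame_inj[of h g] g by (simp add: frame_def)
  then have "actT h (frame (diag_flow t)) = actT g (frame (diag_flow t))" by (elim disjE) (simp_all only: actT_uminus)
  then show ?thesis unfolding geoflow_def h_def[symmetric] frame_mult[OF diag_flow_SL2R] by (simp add: frame_diag_flow)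
qed

definition flip :: "complex \<times> complex \<Rightarrow> complex \<times> complex" where "flip v = (fst v, - snd v)"

lemma frame_flip_mat: "frame (g ** flip_mat) = flip (frame g)"
proof -
  have "frame flip_mat = (\<i>, - \<i>)" by (simp add: frame_def actT_eq mobR_flip_mat) (simp add: den_def flip_mat_def)
  then show ?thesis unfolding frame_mult[OF flip_mat_SL2R] by (simp add: flip_def frame_def actT_eq)
qed

text \<open>A continuous local inverse of \<open>frame\<close> at the identity, from the continuity
  of the square root at 1. Other points are reached by left translation.\<close>

lemma near_frame: assumes e: "e > 0"
  shows "\<forall>\<^sub>F v in nhds (\<i>, \<i>). v \<in> T1H \<longrightarrow> (\<exists>q\<in>SL2R. frame q = v \<and> \<bar>q$1$1 - 1\<bar> \<le> e \<and> \<bar>q$1$2\<bar> \<le> e \<and> \<bar>q$2$1\<bar> \<le> e \<and> \<bar>q$2$2 - 1\<bar> \<le> e)"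
proof -
  let ?q = "\<lambda>v. frame_mat (fst v) (csqrt (\<i> / snd v))"
  let ?F = "nhds (\<i>, \<i>) :: (complex \<times> complex) filter"
  have f: "(fst \<longlongrightarrow> \<i>) ?F" "(snd \<longlongrightarrow> \<i>) ?F"
    using tendsto_fst[of "\<lambda>x. x" "(\<i>,\<i>)" ?F] tendsto_snd[of "\<lambda>x. x" "(\<i>,\<i>)" ?F] by (simp_all add: tendsto_ident_at filterlim_ident)
  have "((\<lambda>v. \<i> / snd v) \<longlongrightarrow> 1) ?F" using tendsto_divide[OF tendsto_const[of \<i>] f(2)] by simp
  then have j: "((\<lambda>v. csqrt (\<i> / snd v)) \<longlongrightarrow> 1) ?F"
    using isCont_tendsto_compose[OF continuous_at_csqrt, of 1] by (simp add: complex_nonpos_Reals_iff)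
  have zj: "((\<lambda>v. fst v * csqrt (\<i> / snd v)) \<longlongrightarrow> \<i>) ?F" using tendsto_mult[OF f(1) j] by simp
  have t: "((\<lambda>v. ?q v $1$1) \<longlongrightarrow> 1) ?F" "((\<lambda>v. ?q v $1$2) \<longlongrightarrow> 0) ?F" "((\<lambda>v. ?q v $2$1) \<longlongrightarrow> 0) ?F" "((\<lambda>v. ?q v $2$2) \<longlongrightarrow> 1) ?F"
    using tendsto_Im[OF zj] tendsto_Re[OF zj] tendsto_Im[OF j] tendsto_Re[OF j] by (simp_all add: frame_mat_def)
  have "\<forall>\<^sub>F v in ?F. \<bar>?q v$1$1 - 1\<bar> < e \<and> \<bar>?q v$1$2 - 0\<bar> < e \<and> \<bar>?q v$2$1 - 0\<bar> < e \<and> \<bar>?q v$2$2 - 1\<bar> < e"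
    using t[THEN tendstoD, OF e] unfolding dist_real_def by (intro eventually_conj)
  then show ?thesis
  proof (rule eventually_mono, intro impI)
    fix v assume q: "\<bar>?q v$1$1 - 1\<bar> < e \<and> \<bar>?q v$1$2 - 0\<bar> < e \<and> \<bar>?q v$2$1 - 0\<bar> < e \<and> \<bar>?q v$2$2 - 1\<bar> < e" and v: "v \<in> T1H"
    then show "\<exists>q\<in>SL2R. frame q = v \<and> \<bar>q$1$1 - 1\<bar> \<le> e \<and> \<bar>q$1$2\<bar> \<le> e \<and> \<bar>q$2$1\<bar> \<le> e \<and> \<bar>q$2$2 - 1\<bar> \<le> e"
      using frame_mat[of "fst v" "snd v" "csqrt (\<i> / snd v)"] by (intro bexI[of _ "?q v"]) auto
  qed
qed

lemma actT_tendsto: assumes g: "g \<in> SL2R" and v: "Im (fst v) > 0" shows "(actT g \<longlongrightarrow> actT g v) (nhds v)"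
proof -
  have f: "(fst \<longlongrightarrow> fst v) (nhds v)" "(snd \<longlongrightarrow> snd v) (nhds v)"
    using tendsto_fst[of "\<lambda>x. x" v "nhds v"] tendsto_snd[of "\<lambda>x. x" v "nhds v"] by (simp_all add: filterlim_ident)
  have nz: "den g (fst v) \<noteq> 0" by (rule den_nonzero[OF g v])
  show ?thesis unfolding actT_eq[abs_def] mobR_nd num_def den_def
    using nz unfolding den_def by (intro tendsto_Pair tendsto_divide tendsto_add tendsto_mult tendsto_power tendsto_const f) auto
qed

lemma hnorm_bounds: assumes Hf: "hermitian_metric \<Gamma> \<rho> Hf"
  shows "\<exists>c d. c > 0 \<and> d > 0 \<and> (\<forall>z w. Im z > 0 \<and> hb z \<le> C \<longrightarrow> c * norm w \<le> hnorm (Hf z) w \<and> hnorm (Hf z) w \<le> d * norm w)"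
proof -
  define Q where "Q = (\<lambda>(z, w). Re (\<Sum>i\<in>UNIV. \<Sum>j\<in>UNIV. cnj ((w::complex^2)$i) * Hf z$i$j * w$j))"
  define X where "X = {z. Im z > 0 \<and> hb z \<le> C} \<times> sphere (0::complex^2) 1"
  have X: "compact X" unfolding X_def by (intro compact_Times compact_hb compact_sphere)
  have "continuous_on H_plane Hf" using Hf by (simp add: hermitian_metric_def)
  then have "continuous_on X (\<lambda>x. Hf (fst x))" by (rule continuous_on_compose2) (auto intro!: continuous_intros simp: X_def H_plane_def)
  then have cQ: "continuous_on X Q" unfolding Q_def case_prod_beta by (intro continuous_intros)
  have hq: "hnorm (Hf z) w = sqrt (Q (z, w))" for z w by (simp add: hnorm_def Q_def)
  have Qs: "Q (z, of_real r *s w) = r\<^sup>2 * Q (z, w)" for z w r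
    by (simp add: Q_def sum_2 power2_eq_square algebra_simps)
  have pos: "Q x > 0" if xX: "x \<in> X" for x
  proof -
    obtain z w where x: "x = (z, w)" "Im z > 0" "norm w = 1" using xX by (cases x) (auto simp: X_def)
    then have "w \<noteq> 0" by auto
    moreover have "\<forall>z\<in>H_plane. \<forall>w. w \<noteq> 0 \<longrightarrow> Re (\<Sum>i\<in>UNIV. \<Sum>j\<in>UNIV. cnj (w$i) * Hf z $i$j * w$j) > 0"
      using Hf unfolding hermitian_metric_def by blast
    ultimately show ?thesis using x unfolding Q_def H_plane_def by simp
  qed
  show ?thesis
  proof (cases "X = {}")
    case True
    have "(axis 1 1 :: complex^2) \<in> sphere 0 1" by (simp add: norm_axis_1)
    then have "{z. Im z > 0 \<and> hb z \<le> C} = {}" using True unfolding X_def by blast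
    then show ?thesis by (intro exI[of _ 1]) auto
  next
    case False
    obtain a where a: "a \<in> X" "\<And>x. x \<in> X \<Longrightarrow> Q a \<le> Q x" using continuous_attains_inf[OF X False cQ] by blast
    obtain b where b: "b \<in> X" "\<And>x. x \<in> X \<Longrightarrow> Q x \<le> Q b" using continuous_attains_sup[OF X False cQ] by blast
    show ?thesis
    proof (rule exI[of _ "sqrt (Q a)"], rule exI[of _ "sqrt (Q b)"], intro conjI allI impI)
      show "sqrt (Q a) > 0" "sqrt (Q b) > 0" using pos a b by auto
      fix z w assume z: "Im z > 0 \<and> hb z \<le> C"
      have "Q a * (norm w)\<^sup>2 \<le> Q (z, w) \<and> Q (z, w) \<le> Q b * (norm w)\<^sup>2"
      proof (cases "w = 0")
        case True then show ?thesis by (simp add: Q_def)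
      next
        case w: False
        let ?w = "of_real (1 / norm w) *s w"
        have "norm ?w = 1" using w unfolding scaleR_s[symmetric] by simp
        then have x: "(z, ?w) \<in> X" using z by (simp add: X_def)
        have "Q (z, ?w) = Q (z, w) / (norm w)\<^sup>2" unfolding Qs by (simp add: power_divide)
        then have "Q (z, w) = Q (z, ?w) * (norm w)\<^sup>2" using w by (simp add: field_simps)
        then show ?thesis using mult_right_mono[OF a(2)[OF x], of "(norm w)\<^sup>2"] mult_right_mono[OF b(2)[OF x], of "(norm w)\<^sup>2"] by simp
      qed
      then have "sqrt (Q a * (norm w)\<^sup>2) \<le> sqrt (Q (z, w)) \<and> sqrt (Q (z, w)) \<le> sqrt (Q b * (norm w)\<^sup>2)" by simp
      then show "sqrt (Q a) * norm w \<le> hnorm (Hf z) w" "hnorm (Hf z) w \<le> sqrt (Q b) * norm w" by (simp_all add: hq real_sqrt_mult)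
    qed
  qed
qed

section \<open>Null sets, measurability and continuity\<close>

text \<open>For fixed remaining coordinates at most one value of the first one is left, so Fubini
  gives measure 0.\<close>

lemma null_graph: fixes a b :: "real \<times> real \<Rightarrow> real"
  assumes [measurable]: "a \<in> borel_measurable borel" "b \<in> borel_measurable borel"
  shows "{p. a (snd p) * fst p = b (snd p) \<and> a (snd p) \<noteq> 0} \<in> null_sets (lborel :: (real \<times> real \<times> real) measure)"
proof (rule null_setsI)
  let ?A = "{p. a (snd p) * fst p = b (snd p) \<and> a (snd p) \<noteq> 0} :: (real \<times> real \<times> real) set"
  have m: "(\<lambda>p. a (snd p)) \<in> borel_measurable (borel \<Otimes>\<^sub>M borel)" "(\<lambda>p. b (snd p)) \<in> borel_measurable (borel \<Otimes>\<^sub>M borel)"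
    by (rule measurable_compose[OF measurable_snd assms(1)], rule measurable_compose[OF measurable_snd assms(2)])
  have "{p \<in> space ((borel :: real measure) \<Otimes>\<^sub>M (borel :: (real \<times> real) measure)). a (snd p) * fst p = b (snd p) \<and> a (snd p) \<noteq> 0}
    \<in> sets (borel \<Otimes>\<^sub>M borel)" using m by measurable
  then have b: "?A \<in> sets (borel :: (real \<times> real \<times> real) measure)" 
    unfolding borel_prod[symmetric, where 'a=real and 'b="real \<times> real"] by (simp add: space_pair_measure)
  then show "?A \<in> sets lborel" by simp
  have A: "?A \<in> sets ((lborel::real measure) \<Otimes>\<^sub>M (lborel::(real\<times>real) measure))" unfolding lborel_prod using b by simp
  have "emeasure lborel ?A = emeasure ((lborel::real measure) \<Otimes>\<^sub>M (lborel::(real\<times>real) measure)) ?A" unfolding lborel_prod ..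
  also have "\<dots> = (\<integral>\<^sup>+y. emeasure lborel ((\<lambda>x. (x, y)) -` ?A) \<partial>lborel)"
    by (rule pair_sigma_finite.emeasure_pair_measure_alt2[OF _ A]) (intro pair_sigma_finite.intro sigma_finite_lborel)
  also have "\<dots> = (\<integral>\<^sup>+y. 0 \<partial>(lborel::(real\<times>real) measure))"
  proof (rule nn_integral_cong)
    fix y :: "real \<times> real"
    have "(\<lambda>x. (x, y)) -` ?A \<subseteq> {b y / a y}" by (auto simp: field_simps)
    then have "finite ((\<lambda>x. (x, y)) -` ?A)" by (rule finite_subset) simp
    then show "emeasure lborel ((\<lambda>x. (x, y)) -` ?A) = 0" using finite_imp_null_set_lborel by blast
  qed
  finally show "emeasure lborel ?A = 0" by simp
qed

lemma null_angle: assumes "countable Z" shows "UNIV \<times> UNIV \<times> Z \<in> null_sets (lborel :: (real \<times> real \<times> real) measure)"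
proof -
  have Z: "Z \<in> null_sets (lborel :: real measure)" using assms by (rule countable_imp_null_set_lborel)
  have "UNIV \<times> Z \<in> null_sets ((lborel :: real measure) \<Otimes>\<^sub>M (lborel :: real measure))"
    by (rule sigma_finite_measure.times_in_null_sets2[OF sigma_finite_lborel _ Z]) simp
  then have 2: "UNIV \<times> Z \<in> null_sets (lborel :: (real \<times> real) measure)" unfolding lborel_prod .
  have "UNIV \<times> (UNIV \<times> Z) \<in> null_sets ((lborel :: real measure) \<Otimes>\<^sub>M (lborel :: (real \<times> real) measure))"
    by (rule sigma_finite_measure.times_in_null_sets2[OF sigma_finite_lborel _ 2]) simp
  then show ?thesis unfolding lborel_prod .
qed

text \<open>The argument of the square root of \<open>i / u\<close> for a vector \<open>u\<close> of
  angle \<theta>.\<close>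

definition half_angle where "half_angle \<theta> = pi / 4 - \<theta> / 2"

lemma countable_zeros: "countable {\<theta>. sin (half_angle \<theta>) = 0}" "countable {\<theta>. cos (half_angle \<theta>) = 0}"
proof -
  have e: "\<theta> = pi / 2 - 2 * half_angle \<theta>" for \<theta> by (simp add: half_angle_def)
  have "{\<theta>. sin (half_angle \<theta>) = 0} \<subseteq> range (\<lambda>i::int. pi / 2 - 2 * (of_int i * pi))"
  proof
    fix \<theta> assume "\<theta> \<in> {\<theta>. sin (half_angle \<theta>) = 0}"
    then obtain i :: int where "half_angle \<theta> = of_int i * pi" by (auto simp: sin_zero_iff_int2)
    then have "\<theta> = pi / 2 - 2 * (of_int i * pi)" using e[of \<theta>] by argo
    then show "\<theta> \<in> range (\<lambda>i::int. pi / 2 - 2 * (of_int i * pi))" by (rule range_eqI)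
  qed
  then show "countable {\<theta>. sin (half_angle \<theta>) = 0}" by (rule countable_subset) simp
  have "{\<theta>. cos (half_angle \<theta>) = 0} \<subseteq> range (\<lambda>i::int. pi / 2 - 2 * (of_int i * pi + pi / 2))"
  proof
    fix \<theta> assume "\<theta> \<in> {\<theta>. cos (half_angle \<theta>) = 0}"
    then obtain i :: int where "half_angle \<theta> = of_int i * pi + pi / 2" by (auto simp: cos_zero_iff_int2)
    then have "\<theta> = pi / 2 - 2 * (of_int i * pi + pi / 2)" using e[of \<theta>] by argo
    then show "\<theta> \<in> range (\<lambda>i::int. pi / 2 - 2 * (of_int i * pi + pi / 2))" by (rule range_eqI)
  qed
  then show "countable {\<theta>. cos (half_angle \<theta>) = 0}" by (rule countable_subset) simp
qed

text \<open>In the coordinates of \<open>coordT\<close> the two entries of \<open>adj2 g *v v\<close> vanish on these sets.\<close>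
definition bad1 :: "real^2 \<Rightarrow> (real \<times> real \<times> real) set" where
  "bad1 v = {(x, y, \<theta>). (cos (half_angle \<theta>) * v$2) * x = cos (half_angle \<theta>) * v$1 + y * sin (half_angle \<theta>) * v$2}"
definition bad2 :: "real^2 \<Rightarrow> (real \<times> real \<times> real) set" where
  "bad2 v = {(x, y, \<theta>). (sin (half_angle \<theta>) * v$2) * x = sin (half_angle \<theta>) * v$1 - y * cos (half_angle \<theta>) * v$2}"

text \<open>Both equations are linear in \<open>x\<close>. Where the coefficient of \<open>x\<close>
  is nonzero the solutions form a graph; where it vanishes, \<open>v \<noteq> 0\<close> leaves only
  countably many angles.\<close>

lemma bad_null: assumes "v \<noteq> 0" shows "\<exists>N\<in>null_sets lborel. bad1 v \<union> bad2 v \<subseteq> N"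
proof -
  define X1 where "X1 = {p. (\<lambda>q. cos (half_angle (snd q)) * v$2) (snd p) * fst p = (\<lambda>q. cos (half_angle (snd q)) * v$1 + fst q * sin (half_angle (snd q)) * v$2) (snd p)
    \<and> (\<lambda>q :: real \<times> real. cos (half_angle (snd q)) * v$2) (snd p) \<noteq> 0}"
  define X2 where "X2 = {p. (\<lambda>q. sin (half_angle (snd q)) * v$2) (snd p) * fst p = (\<lambda>q. sin (half_angle (snd q)) * v$1 - fst q * cos (half_angle (snd q)) * v$2) (snd p)
    \<and> (\<lambda>q :: real \<times> real. sin (half_angle (snd q)) * v$2) (snd p) \<noteq> 0}"
  have "X1 \<in> null_sets lborel" unfolding X1_def half_angle_def by (rule null_graph) (auto intro!: borel_measurable_continuous_onI continuous_intros)
  moreover have "X2 \<in> null_sets lborel" unfolding X2_def half_angle_def by (rule null_graph) (auto intro!: borel_measurable_continuous_onI continuous_intros)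
  ultimately have n: "X1 \<union> X2 \<union> UNIV \<times> UNIV \<times> {\<theta>. sin (half_angle \<theta>) = 0} \<union> UNIV \<times> UNIV \<times> {\<theta>. cos (half_angle \<theta>) = 0} \<in> null_sets lborel"
    by (intro null_sets.Un null_angle countable_zeros)
  have v: "v$1 \<noteq> 0 \<or> v$2 \<noteq> 0" using assms by (auto simp: vec2_eq)
  have "bad1 v \<union> bad2 v \<subseteq> X1 \<union> X2 \<union> UNIV \<times> UNIV \<times> {\<theta>. sin (half_angle \<theta>) = 0} \<union> UNIV \<times> UNIV \<times> {\<theta>. cos (half_angle \<theta>) = 0}"
    using v by (auto simp: bad1_def bad2_def X1_def X2_def)
  then show ?thesis using n by blast
qed

lemma coordT_frame: assumes y: "y > 0" and g: "g \<in> SL2R" "frame g = coordT (x, y, \<theta>)"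
  shows "(adj2 g *v v)$1 = 0 \<Longrightarrow> (x, y, \<theta>) \<in> bad1 v" "(adj2 g *v v)$2 = 0 \<Longrightarrow> (x, y, \<theta>) \<in> bad2 v"
proof -
  let ?k = "cos (half_angle \<theta>)" and ?s = "sin (half_angle \<theta>)"
  define j where "j = cis (half_angle \<theta>) / of_real (sqrt y)"
  have "(cis (half_angle \<theta>))\<^sup>2 * cis \<theta> = \<i>" by (simp add: power2_eq_square cis_mult half_angle_def)
  moreover have "(complex_of_real (sqrt y))\<^sup>2 = of_real y" using y by (simp flip: of_real_power)
  ultimately have j2: "j\<^sup>2 = \<i> / (of_real y * cis \<theta>)"
    by (metis (no_types, lifting) cis_neq_zero divide_divide_eq_left mult.commute nonzero_eq_divide_eq j_def power_divide)
  have zu: "(Complex x y, of_real y * cis \<theta>) \<in> T1H" using y by (simp add: T1H_def norm_mult)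
  define q where "q = frame_mat (Complex x y) j"
  have q: "q \<in> SL2R" "frame q = frame g" using frame_mat[OF zu j2] g by (auto simp: q_def coordT_def)
  have gq: "g = q \<or> g = - q" by (rule frame_inj) (use g q in auto)
  have sy: "sqrt y > 0" using y by simp
  have j: "Re j = ?k / sqrt y" "Im j = ?s / sqrt y" by (simp_all add: j_def)
  have e: "q$1$1 = (x * ?s + y * ?k) / sqrt y" "q$1$2 = (x * ?k - y * ?s) / sqrt y" "q$2$1 = ?s / sqrt y" "q$2$2 = ?k / sqrt y"
    by (simp_all add: q_def frame_mat_def j add_divide_distrib diff_divide_distrib)
  have "(adj2 g *v v)$1 = 0 \<longleftrightarrow> (adj2 q *v v)$1 = 0" "(adj2 g *v v)$2 = 0 \<longleftrightarrow> (adj2 q *v v)$2 = 0"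
    using gq by (auto simp: mulv2)
  moreover have "(adj2 q *v v)$1 = (?k * v$1 - (x * ?k - y * ?s) * v$2) / sqrt y" "(adj2 q *v v)$2 = ((x * ?s + y * ?k) * v$2 - ?s * v$1) / sqrt y"
    by (simp_all add: mulv2 e add_divide_distrib diff_divide_distrib algebra_simps)
  ultimately show "(adj2 g *v v)$1 = 0 \<Longrightarrow> (x, y, \<theta>) \<in> bad1 v" "(adj2 g *v v)$2 = 0 \<Longrightarrow> (x, y, \<theta>) \<in> bad2 v"
    using sy by (auto simp: bad1_def bad2_def algebra_simps)
qed

lemma full_measurable: assumes A: "A \<subseteq> T1H" "liouville_full A" shows "{p. coordT p \<in> A} \<in> sets lebesgue"
proof -
  obtain N where N: "N \<in> null_sets lborel" "{p. fst (snd p) > 0 \<and> coordT p \<notin> A} \<subseteq> N" using A(2) unfolding liouville_full_def by blast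
  have "{p. fst (snd p) > 0 \<and> coordT p \<notin> A} \<in> null_sets lebesgue" by (rule null_sets_completion_subset[OF N(2) null_sets_completionI[OF N(1)]])
  then have s: "{p. fst (snd p) > 0 \<and> coordT p \<notin> A} \<in> sets lebesgue" by blast
  have "open {p :: real \<times> real \<times> real. fst (snd p) > 0}" by (intro open_Collect_less continuous_intros)
  then have o: "{p :: real \<times> real \<times> real. fst (snd p) > 0} \<in> sets lebesgue" by simp
  have "{p. coordT p \<in> A} = {p. fst (snd p) > 0} - {p. fst (snd p) > 0 \<and> coordT p \<notin> A}"
    using A(1) by (auto simp: coordT_def T1H_def)
  then show ?thesis using sets.Diff[OF o s] by simp
qed

lemma continuous_coordT: "continuous_on X coordT"
  unfolding coordT_def case_prod_beta cis_conv_exp Complex_eq by (intro continuous_intros)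

text \<open>An affine chart of the projective line: coordinate \<open>n\<close> is normalised to 1,
  and the wedge estimate in \<open>loc\<close> becomes an estimate for the other coordinate.\<close>

lemma line_normal_form:
  fixes X :: "complex \<times> complex \<Rightarrow> (complex^2) set"
  assumes X: "\<And>v. v \<in> A \<Longrightarrow> \<exists>w. w \<noteq> 0 \<and> X v = cline w"
    and loc: "\<And>v w \<epsilon>. v \<in> A \<Longrightarrow> X v = cline w \<Longrightarrow> w \<noteq> 0 \<Longrightarrow> \<epsilon> > 0 \<Longrightarrow>
      \<forall>\<^sub>F u in nhds v. u \<in> A \<longrightarrow> (\<forall>x\<in>X u. x \<noteq> 0 \<longrightarrow> cmod (wd2 x w) < \<epsilon> * norm x)"
    and nm: "n \<noteq> (m :: 2)"
  shows "\<exists>U f. open U \<and> (\<forall>v\<in>A. v \<in> U \<longleftrightarrow> (\<exists>x\<in>X v. x$n \<noteq> 0)) \<and> continuous_on (A \<inter> U) f \<and> (\<forall>v\<in>A \<inter> U. f v \<noteq> 0 \<and> cline (f v) = X v)"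
proof -
  have norm2: "norm x \<le> cmod (x$n) + cmod (x$m)" for x :: "complex^2"
  proof -
    have "norm x \<le> (\<Sum>i\<in>UNIV. norm (x$i))" unfolding norm_vec_def by (rule L2_set_le_sum) simp
    then show ?thesis using nm exhaust_2[of n] exhaust_2[of m] by (auto simp: sum_2)
  qed
  have wd2: "cmod (wd2 x w) = cmod (x$m * w$n - x$n * w$m)" for x w
    using nm exhaust_2[of n] exhaust_2[of m] by (auto simp: wd2_def norm_minus_commute mult.commute)
  define f where "f v = (SOME x. x \<in> X v \<and> x$n = 1)" for v
  have ex: "\<exists>x. x \<in> X v \<and> x$n = 1" if vx: "v \<in> A" "x \<in> X v" "x$n \<noteq> 0" for v x
  proof -
    obtain w where w: "X v = cline w" using X[OF vx(1)] by blast
    then obtain c where c: "x = c *s w" using vx(2) by (auto simp: cline_iff)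
    then have "(1 / w$n) *s w \<in> X v \<and> ((1 / w$n) *s w)$n = 1" using w vx(3) by (auto simp: cline_iff)
    then show ?thesis by blast
  qed
  have f: "f v \<in> X v" "f v $ n = 1" "f v \<noteq> 0" "cline (f v) = X v" if v: "v \<in> A" "x \<in> X v" "x$n \<noteq> 0" for v x
  proof -
    have "f v \<in> X v \<and> f v $ n = 1" unfolding f_def by (rule someI_ex[OF ex[OF v]])
    then show f: "f v \<in> X v" "f v $ n = 1" by auto
    then show "f v \<noteq> 0" by auto
    obtain w where w: "X v = cline w" using X v(1) by blast
    then obtain c where c: "f v = c *s w" using f(1) by (auto simp: cline_iff)
    then have "c \<noteq> 0" using f(2) by auto
    then have "w = (1 / c) *s f v" using c by (simp add: vec2_eq)
    then have "cline w = cline (f v)" unfolding set_eq_iff cline_iff using c by (metis vector_smult_assoc)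
    then show "cline (f v) = X v" using w by simp
  qed
  have close: "\<forall>\<^sub>F u in nhds v. u \<in> A \<longrightarrow> (\<exists>x\<in>X u. x$n \<noteq> 0) \<and> dist (f u) (f v) < d"
    if v: "v \<in> A" "x \<in> X v" "x$n \<noteq> 0" and d: "d > 0" for v x d
  proof -
    define \<zeta> where "\<zeta> = cmod (f v $ m)"
    \<comment> \<open>The bound 1/2 absorbs the unknown \<open>t\<close> on the right hand side
      below; the other bound makes the remainder smaller than \<open>d\<close>.\<close>
    define \<epsilon> where "\<epsilon> = min (1/2) (d / (2 * (\<zeta> + 1) + 1))"
    have z0: "\<zeta> \<ge> 0" by (simp add: \<zeta>_def)
    have e: "\<epsilon> > 0" "\<epsilon> \<le> 1/2" "\<epsilon> * (2 * (\<zeta> + 1)) < d"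
    proof -
      show "\<epsilon> \<le> 1/2" unfolding \<epsilon>_def by (rule min.cobounded1)
      have "d / (2 * (\<zeta> + 1) + 1) > 0" using d z0 by (intro divide_pos_pos) auto
      then show "\<epsilon> > 0" by (simp add: \<epsilon>_def)
      have "\<epsilon> * (2 * (\<zeta> + 1)) \<le> d / (2 * (\<zeta> + 1) + 1) * (2 * (\<zeta> + 1))" using z0 by (intro mult_right_mono) (auto simp: \<epsilon>_def)
      also have "\<dots> < d" using d z0 by (simp add: field_simps)
      finally show "\<epsilon> * (2 * (\<zeta> + 1)) < d" .
    qed
    have nf: "f v $ n = 1" by (rule f(2)[OF v])
    from loc[OF v(1) f(4)[OF v, symmetric] f(3)[OF v] e(1)] show ?thesis
    proof (rule eventually_mono, intro impI conjI)
      fix u assume u: "u \<in> A \<longrightarrow> (\<forall>x\<in>X u. x \<noteq> 0 \<longrightarrow> cmod (wd2 x (f v)) < \<epsilon> * norm x)" and uA: "u \<in> A"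
      then have letter: "cmod (wd2 x (f v)) < \<epsilon> * norm x" if "x \<in> X u" "x \<noteq> 0" for x using that by blast
      show nz: "\<exists>x\<in>X u. x$n \<noteq> 0"
      proof (rule ccontr)
        assume z: "\<not> ?thesis"
        obtain w where w: "w \<noteq> 0" "X u = cline w" using X uA by blast
        have wX: "w \<in> X u" unfolding w(2) cline_iff by (intro exI[of _ 1]) simp
        then have "w$n = 0" using z by blast
        then have "cmod (w$m) < \<epsilon> * norm w" "norm w \<le> cmod (w$m)" using letter[OF wX w(1)] norm2[of w] by (simp_all add: wd2 nf)
        moreover have "\<epsilon> * norm w \<le> 1 * norm w" using e by (intro mult_right_mono) auto
        ultimately show False by linarith
      qed
      then obtain x where x: "x \<in> X u" "x$n \<noteq> 0" by blast
      have fu: "f u \<in> X u" "f u $ n = 1" "f u \<noteq> 0" using f[OF uA x] by auto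
      define t where "t = cmod (f u $ m - f v $ m)"
      have "t < \<epsilon> * norm (f u)" using letter[OF fu(1,3)] by (simp add: wd2 nf fu(2) t_def)
      also have "\<dots> \<le> \<epsilon> * (1 + (t + \<zeta>))"
      proof (rule mult_left_mono)
        have "cmod (f u $ m) \<le> t + \<zeta>" using norm_triangle_ineq[of "f u $ m - f v $ m" "f v $ m"] by (simp add: t_def \<zeta>_def)
        then show "norm (f u) \<le> 1 + (t + \<zeta>)" using norm2[of "f u"] fu(2) by simp
      qed (use e in simp)
      finally have "t < \<epsilon> * t + \<epsilon> * (\<zeta> + 1)" by (simp add: algebra_simps)
      moreover have "\<epsilon> * t \<le> 1/2 * t" using e by (intro mult_right_mono) (auto simp: t_def)
      ultimately have "t < d" using e(3) by (simp add: algebra_simps)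
      moreover have "dist (f u) (f v) \<le> t" using norm2[of "f u - f v"] nf fu(2) by (simp add: dist_norm t_def)
      ultimately show "dist (f u) (f v) < d" by simp
    qed
  qed
  define P where "P v = (\<exists>x\<in>X v. x$n \<noteq> 0)" for v
  \<comment> \<open>The chart domain is only meaningful on \<open>A\<close>. Requiring the condition
    eventually near \<open>v\<close> yields a set that is open in the whole space and has the right
    trace on \<open>A\<close>.\<close>
  define U where "U = {v. \<forall>\<^sub>F u in nhds v. u \<in> A \<longrightarrow> P u}"
  have oU: "open U" unfolding U_def
  proof (subst open_subopen, intro ballI)
    fix v assume "v \<in> {v. \<forall>\<^sub>F u in nhds v. u \<in> A \<longrightarrow> P u}"
    then have "\<forall>\<^sub>F x in nhds v. \<forall>\<^sub>F u in nhds x. u \<in> A \<longrightarrow> P u" by (simp add: eventually_eventually)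
    then show "\<exists>T. open T \<and> v \<in> T \<and> T \<subseteq> {v. \<forall>\<^sub>F u in nhds v. u \<in> A \<longrightarrow> P u}" unfolding eventually_nhds[of _ v] by auto
  qed
  have U: "v \<in> U \<longleftrightarrow> P v" if v: "v \<in> A" for v
  proof
    assume "v \<in> U" then show "P v" using eventually_nhds_x_imp_x[of _ v] v unfolding U_def by blast
  next
    assume "P v"
    then obtain x where "x \<in> X v" "x$n \<noteq> 0" by (auto simp: P_def)
    from close[OF v this zero_less_one] show "v \<in> U" unfolding U_def mem_Collect_eq by (rule eventually_mono) (auto simp: P_def)
  qed
  have "continuous_on (A \<inter> U) f"
    unfolding continuous_on_def
  proof (intro ballI tendstoI)
    fix v and d :: real assume v: "v \<in> A \<inter> U" and d: "d > 0"
    have vA: "v \<in> A" "P v" using v U[of v] by auto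
    then obtain x where x: "x \<in> X v" "x$n \<noteq> 0" unfolding P_def by blast
    have "\<forall>\<^sub>F u in nhds v. u \<in> A \<longrightarrow> (\<exists>x\<in>X u. x$n \<noteq> 0) \<and> dist (f u) (f v) < d" by (rule close[OF vA(1) x d])
    then show "\<forall>\<^sub>F u in at v within A \<inter> U. dist (f u) (f v) < d"
      unfolding eventually_at_filter by (rule eventually_mono) auto
  qed
  moreover have "f v \<noteq> 0 \<and> cline (f v) = X v" if v: "v \<in> A \<inter> U" for v
  proof -
    have vA: "v \<in> A" "P v" using v U[of v] by auto
    then obtain x where x: "x \<in> X v" "x$n \<noteq> 0" unfolding P_def by blast
    show ?thesis using f(3,4)[OF vA(1) x] by simp
  qed
  ultimately show ?thesis using oU U unfolding P_def by (intro exI[of _ U] exI[of _ f] conjI ballI) auto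
qed

text \<open>Two affine charts cover \<open>A\<close>. Each local section is continuous on a
  measurable set, so choosing the first chart wherever possible gives a measurable global choice,
  although the glued vector field itself may jump.\<close>

lemma line_section:
  fixes X :: "complex \<times> complex \<Rightarrow> (complex^2) set"
  assumes A: "A \<subseteq> T1H" "liouville_full A"
    and X: "\<And>v. v \<in> A \<Longrightarrow> \<exists>w. w \<noteq> 0 \<and> X v = cline w"
    and loc: "\<And>v w \<epsilon>. v \<in> A \<Longrightarrow> X v = cline w \<Longrightarrow> w \<noteq> 0 \<Longrightarrow> \<epsilon> > 0 \<Longrightarrow>
      \<forall>\<^sub>F u in nhds v. u \<in> A \<longrightarrow> (\<forall>x\<in>X u. x \<noteq> 0 \<longrightarrow> cmod (wd2 x w) < \<epsilon> * norm x)"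
  shows "\<exists>f. (\<forall>v\<in>A. f v \<noteq> 0 \<and> cline (f v) = X v) \<and> (\<lambda>p. f (coordT p)) \<in> borel_measurable (lebesgue :: (real \<times> real \<times> real) measure) \<and> section_continuous A f"
proof -
  have ne: "(2::2) \<noteq> 1" "(1::2) \<noteq> 2" by simp_all
  have nf: "\<exists>U f. open U \<and> (\<forall>v\<in>A. v \<in> U \<longleftrightarrow> (\<exists>x\<in>X v. x$n \<noteq> 0)) \<and> continuous_on (A \<inter> U) f \<and> (\<forall>v\<in>A \<inter> U. f v \<noteq> 0 \<and> cline (f v) = X v)"
    if nm: "n \<noteq> (m :: 2)" for n m by (rule line_normal_form[OF _ _ nm]) (fact X, fact loc)
  obtain U h where U0: "open U" "\<forall>v\<in>A. v \<in> U \<longleftrightarrow> (\<exists>x\<in>X v. x$2 \<noteq> 0)" "continuous_on (A \<inter> U) h" "\<forall>v\<in>A \<inter> U. h v \<noteq> 0 \<and> cline (h v) = X v"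
    using nf[OF ne(1)] by (elim exE conjE)
  note U = U0(1) U0(2)[rule_format] U0(3) U0(4)[rule_format]
  obtain U' h' where U1: "open U'" "\<forall>v\<in>A. v \<in> U' \<longleftrightarrow> (\<exists>x\<in>X v. x$1 \<noteq> 0)" "continuous_on (A \<inter> U') h'" "\<forall>v\<in>A \<inter> U'. h' v \<noteq> 0 \<and> cline (h' v) = X v"
    using nf[OF ne(2)] by (elim exE conjE)
  note U' = U1(1) U1(2)[rule_format] U1(3) U1(4)[rule_format]
  have UU: "v \<in> U \<or> v \<in> U'" if v: "v \<in> A" for v
  proof -
    obtain w where w: "w \<noteq> 0" "X v = cline w" using X v by blast
    have "w \<in> X v" unfolding w(2) cline_iff by (intro exI[of _ 1]) simp
    then show ?thesis using U(2)[OF v] U'(2)[OF v] w(1) by (auto simp: vec2_eq)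
  qed
  define f where "f v = (if v \<in> A \<inter> U then h v else 0) + (if v \<in> A - U then h' v else 0)" for v
  have f: "f v \<noteq> 0 \<and> cline (f v) = X v" if "v \<in> A" for v
    using U(4)[of v] U'(4)[of v] UU[OF that] that by (auto simp: f_def)
  have mA: "{p. coordT p \<in> A} \<in> sets lebesgue" by (rule full_measurable[OF A])
  have "open (coordT -` U)" by (rule open_vimage[OF U(1) continuous_coordT])
  then have mU: "coordT -` U \<in> sets lebesgue" by simp
  have m1: "{p. coordT p \<in> A \<inter> U} \<in> sets lebesgue" using sets.Int[OF mA mU] by (simp add: Int_def vimage_def)
  have m2: "{p. coordT p \<in> A - U} \<in> sets lebesgue" using sets.Diff[OF mA mU] by (simp add: set_diff_eq vimage_def)
  have "continuous_on {p. coordT p \<in> A \<inter> U} (\<lambda>p. h (coordT p))" by (rule continuous_on_compose2[OF U(3) continuous_coordT]) auto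
  from borel_measurable_if_I[OF continuous_imp_measurable_on_sets_lebesgue[OF this m1] m1]
  have 1: "(\<lambda>p. if coordT p \<in> A \<inter> U then h (coordT p) else 0) \<in> borel_measurable lebesgue" by simp
  have "continuous_on {p. coordT p \<in> A - U} (\<lambda>p. h' (coordT p))" by (rule continuous_on_compose2[OF U'(3) continuous_coordT]) (use UU in blast)
  from borel_measurable_if_I[OF continuous_imp_measurable_on_sets_lebesgue[OF this m2] m2]
  have 2: "(\<lambda>p. if coordT p \<in> A - U then h' (coordT p) else 0) \<in> borel_measurable lebesgue" by simp
  have "(\<lambda>p. f (coordT p)) \<in> borel_measurable lebesgue" unfolding f_def by (rule borel_measurable_add[OF 1 2])
  moreover have "section_continuous A f" unfolding section_continuous_def
  proof
    fix v assume v: "v \<in> A"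
    from UU[OF v] show "\<exists>U. open U \<and> v \<in> U \<and> (\<exists>h. continuous_on (A \<inter> U) h \<and> (\<forall>v\<in>A \<inter> U. h v \<noteq> 0 \<and> cline (h v) = cline (f v)))"
    proof
      assume "v \<in> U" then show ?thesis using U(1,3,4) f by (intro exI[of _ U] conjI exI[of _ h] ballI) simp_all
    next
      assume "v \<in> U'" then show ?thesis using U'(1,3,4) f by (intro exI[of _ U'] conjI exI[of _ h'] ballI) simp_all
    qed
  qed
  ultimately show ?thesis using f by blast
qed

section \<open>The two sections\<close>

text \<open>At the first index where the words differ, the moved vector would lie in two disjoint
  discs.\<close>

lemma (in sforms) limit_line_disjoint: assumes a: "iword a" and b: "iword b" and ab: "a \<noteq> b" and w: "w \<in> limit_line a" "w \<in> limit_line b" shows "w = 0"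
proof (rule ccontr)
  assume w0: "w \<noteq> 0"
  define n where "n = (LEAST n. a n \<noteq> b n)"
  obtain m where "a m \<noteq> b m" using ab by blast
  then have n: "a n \<noteq> b n" unfolding n_def by (rule LeastI)
  have "a j = b j" if "j < n" for j using not_less_Least that unfolding n_def by blast
  then have M: "Mk a n = Mk b n" by (rule Mk_cong)
  have "Mk a n *v w \<noteq> 0" using mulv_nonzero[OF det_Mk[OF a] w0] .
  moreover have "Qf (H (a n)) (Mk a n *v w) \<le> 0" using w(1) unfolding limit_line_def by blast
  moreover have "Qf (H (b n)) (Mk b n *v w) \<le> 0" using w(2) unfolding limit_line_def by blast
  ultimately show False using dj[of "a n" "b n"] a b n by (auto simp: iword_def M)
qed

lemma frame_one: "frame (mat 1) = (\<i>, \<i>)" by (simp add: frame_def actT_def)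

lemma hb_bounded: assumes K: "compact K" "K \<subseteq> T1H" shows "\<exists>C>0. \<forall>v\<in>K. hb (fst v) \<le> C"
proof -
  have "continuous_on K (\<lambda>v. hb (fst v))" unfolding hb_def using K(2) by (intro continuous_intros) (auto simp: T1H_def)
  then have "bounded ((\<lambda>v. hb (fst v)) ` K)" using compact_continuous_image[OF _ K(1)] compact_imp_bounded by blast
  then obtain C where C: "\<And>v. v \<in> K \<Longrightarrow> \<bar>hb (fst v)\<bar> \<le> C" unfolding bounded_iff by auto
  have "hb (fst v) \<le> max C 1" if "v \<in> K" for v using C[OF that] by linarith
  then show ?thesis by (intro exI[of _ "max C 1"]) auto
qed

section \<open>Geodesics with two non-cuspidal ends and their lines\<close>

context geo begin

definition bigood_set :: "(complex \<times> complex) set" where "bigood_set = {frame g |g. bigood g}"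

lemma bigood_SL2R: "bigood g \<Longrightarrow> g \<in> SL2R" by (simp add: bigood_def good_def)

lemma good_uminus: "good (- g) \<longleftrightarrow> good g"
proof -
  have "- g \<in> SL2R \<longleftrightarrow> g \<in> SL2R" by (simp add: SL2R_iff)
  moreover have "(adj2 (- g) *v v)$2 = - (adj2 g *v v)$2" for v by (simp add: mulv2)
  ultimately show ?thesis by (simp add: good_def)
qed

lemma bigood_uminus: "bigood (- g) \<longleftrightarrow> bigood g"
proof -
  have "- g ** flip_mat = - (g ** flip_mat)" by (simp add: mat2_eq mult2)
  then show ?thesis by (simp add: bigood_def good_uminus)
qed

lemma mobR_uminus: "mobR (- g) z = mobR g z"
  using arg_cong[OF actT_uminus[of g "(z, 0)"], of fst] by (simp add: actT_def)

lemma letter_uminus: assumes "bigood g" shows "letter (- g) = letter g"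
  by (rule letter_cong_mobR[where c = 1]) (use assms in \<open>simp_all add: bigood_def good_uminus mobR_uminus\<close>)

lemma bigood_set_iff: assumes g: "g \<in> SL2R" shows "frame g \<in> bigood_set \<longleftrightarrow> bigood g"
proof
  assume "frame g \<in> bigood_set"
  then obtain h where h: "bigood h" "frame h = frame g" by (auto simp: bigood_set_def)
  then show "bigood g" using frame_inj[OF bigood_SL2R[OF h(1)] g] bigood_uminus by auto
qed (auto simp: bigood_set_def)

definition fwd :: "complex \<times> complex \<Rightarrow> (complex^2) set" where "fwd v = limit_line (letter (SOME g. bigood g \<and> frame g = v))"
definition bwd :: "complex \<times> complex \<Rightarrow> (complex^2) set" where "bwd v = fwd (flip v)"

lemma fwd: assumes g: "bigood g" shows "fwd (frame g) = limit_line (letter g)"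
proof -
  define h where "h = (SOME h. bigood h \<and> frame h = frame g)"
  have h: "bigood h" "frame h = frame g" using someI[of "\<lambda>h. bigood h \<and> frame h = frame g" g] g by (auto simp: h_def)
  have "h = g \<or> h = - g" using frame_inj[OF bigood_SL2R[OF h(1)] bigood_SL2R[OF g] h(2)] .
  then have "letter h = letter g" using letter_uminus[OF g] by auto
  then show ?thesis by (simp add: fwd_def h_def)
qed

lemma bwd: "bigood g \<Longrightarrow> bwd (frame g) = limit_line (letter (g ** flip_mat))"
  using fwd[OF bigood_flip_mat] by (simp add: bwd_def frame_flip_mat)

lemma bigood_set_flip: assumes "v \<in> bigood_set" shows "flip v \<in> bigood_set"
proof -
  obtain g where g: "bigood g" "v = frame g" using assms by (auto simp: bigood_set_def)
  have "flip v = frame (g ** flip_mat)" by (simp add: g frame_flip_mat)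
  then show ?thesis unfolding bigood_set_def using bigood_flip_mat[OF g(1)] by blast
qed

lemma bigood_set_T1H: "bigood_set \<subseteq> T1H" unfolding bigood_set_def using frame_T1H bigood_SL2R by auto

text \<open>The excluded frames point to a translated cusp vector forwards or backwards. There are
  countably many such vectors, and each contributes a null set by \<open>bad_null\<close>.\<close>

lemma bigood_set_full: assumes "countable \<Gamma>" shows "liouville_full bigood_set"
proof -
  have nz: "\<gamma> *v om i \<noteq> 0" if "\<gamma> \<in> \<Gamma>" "i \<in> I" for \<gamma> i using cc.cw[OF that] cc.cpos by auto
  have "\<forall>x\<in>\<Gamma> \<times> I. \<exists>N. N \<in> null_sets lborel \<and> bad1 (fst x *v om (snd x)) \<union> bad2 (fst x *v om (snd x)) \<subseteq> N"
  proof
    fix x assume "x \<in> \<Gamma> \<times> I"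
    then have "fst x *v om (snd x) \<noteq> 0" using nz by auto
    from bad_null[OF this] show "\<exists>N. N \<in> null_sets lborel \<and> bad1 (fst x *v om (snd x)) \<union> bad2 (fst x *v om (snd x)) \<subseteq> N" by blast
  qed
  from bchoice[OF this] obtain NN where NN0: "\<forall>x\<in>\<Gamma> \<times> I. NN x \<in> null_sets lborel \<and> bad1 (fst x *v om (snd x)) \<union> bad2 (fst x *v om (snd x)) \<subseteq> NN x" by (elim exE)
  have NN: "NN x \<in> null_sets lborel" "bad1 (fst x *v om (snd x)) \<union> bad2 (fst x *v om (snd x)) \<subseteq> NN x" if "x \<in> \<Gamma> \<times> I" for x
    using NN0[rule_format, OF that] by simp_all
  have n: "(\<Union>x\<in>\<Gamma> \<times> I. NN x) \<in> null_sets lborel"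
    using assms cc.finI NN(1) by (intro null_sets_UN') (auto intro: countable_finite)
  have "{p. fst (snd p) > 0 \<and> coordT p \<notin> bigood_set} \<subseteq> (\<Union>x\<in>\<Gamma> \<times> I. NN x)"
  proof
    fix p :: "real \<times> real \<times> real" assume p: "p \<in> {p. fst (snd p) > 0 \<and> coordT p \<notin> bigood_set}"
    obtain x y \<theta> where xy: "p = (x, y, \<theta>)" by (cases p)
    have y: "y > 0" using p xy by simp
    have "coordT p \<in> T1H" using y by (simp add: xy coordT_def T1H_def norm_mult)
    then obtain g where g: "g \<in> SL2R" "frame g = coordT (x, y, \<theta>)" using frame_surj xy by blast
    have J: "(adj2 (g ** flip_mat) *v v)$2 = - (adj2 g *v v)$1" for v by (simp add: mulv2 mult2 flip_mat_def)
    have "\<not> bigood g" using p xy g bigood_set_iff[OF g(1)] by simp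
    then have "\<not> good g \<or> \<not> good (g ** flip_mat)" by (simp add: bigood_def)
    then obtain \<gamma> i where gi: "\<gamma> \<in> \<Gamma>" "i \<in> I" "(adj2 g *v (\<gamma> *v om i))$2 = 0 \<or> (adj2 g *v (\<gamma> *v om i))$1 = 0"
      using g(1) flip_mat_SL2R J unfolding good_def by (auto simp: SL2R_mult)
    then have "p \<in> bad1 (\<gamma> *v om i) \<union> bad2 (\<gamma> *v om i)" using coordT_frame[OF y g] xy by auto
    then show "p \<in> (\<Union>x\<in>\<Gamma> \<times> I. NN x)" using NN(2)[of "(\<gamma>, i)"] gi by auto
  qed
  then show ?thesis unfolding liouville_full_def using n by blast
qed

lemma good_diag_flow: assumes "good g" shows "good (g ** diag_flow t)"
proof -
  have "(adj2 (g ** diag_flow t) *v v)$2 = exp (t/2) * (adj2 g *v v)$2" for v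
    by (simp add: mulv2 mult2 diag_flow_def algebra_simps)
  then show ?thesis using assms diag_flow_SL2R[of t] by (simp add: good_def SL2R_mult)
qed

lemma diag_flow_flip_mat: "(g::real^2^2) ** diag_flow t ** flip_mat = g ** flip_mat ** diag_flow (- t)"
  unfolding mat2_eq mult2 diag_flow_def flip_mat_def by simp

lemma bigood_diag_flow: "bigood g \<Longrightarrow> bigood (g ** diag_flow t)"
  by (simp add: bigood_def good_diag_flow diag_flow_flip_mat)

lemma letter_diag_flow: assumes g: "good g" shows "letter (g ** diag_flow t) = letter g"
  by (rule letter_cong_mobR[OF g good_diag_flow[OF g], where c = "exp t"]) (simp_all add: mobR_mult[OF diag_flow_SL2R] mobR_diag_flow)

lemma lines_flow: assumes "bigood g" shows "fwd (geoflow (frame g) t) = fwd (frame g)" "bwd (geoflow (frame g) t) = bwd (frame g)"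
  using fwd[OF bigood_diag_flow[OF assms], of t] bwd[OF bigood_diag_flow[OF assms], of t] fwd[OF assms] bwd[OF assms] letter_diag_flow[of g t] letter_diag_flow[of "g ** flip_mat" "-t"] assms
  unfolding geoflow_frame[OF bigood_SL2R[OF assms]] by (simp_all add: bigood_def diag_flow_flip_mat)

lemma bigood_left: "bigood g \<Longrightarrow> h \<in> \<Gamma> \<Longrightarrow> bigood (h ** g)"
  using good_left[of g h] good_left[of "g ** flip_mat" h] by (simp add: bigood_def matrix_mul_assoc)

lemma bigood_set_left: assumes h: "h \<in> \<Gamma>" and v: "v \<in> T1H" shows "actT h v \<in> bigood_set \<longleftrightarrow> v \<in> bigood_set"
proof -
  obtain g where g: "g \<in> SL2R" "frame g = v" using frame_surj[OF v] by blast
  have hg: "h ** g \<in> SL2R" using sub[OF h] g by (simp add: SL2R_mult)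
  have "bigood (h ** g) \<longleftrightarrow> bigood g" using bigood_left[OF _ h] bigood_left[OF _ adj[OF h], of "h ** g"] conj_cancel(1)[OF sub[OF h]] by auto
  then show ?thesis using bigood_set_iff[OF hg] bigood_set_iff[OF g(1)] g frame_mult[OF g(1), of h] by simp
qed

lemma lines_equivariant: assumes g: "bigood g" and h: "h \<in> \<Gamma>"
  shows "fwd (actT h (frame g)) = (*v) (R h) ` fwd (frame g)" "bwd (actT h (frame g)) = (*v) (R h) ` bwd (frame g)"
proof -
  have e: "actT h (frame g) = frame (h ** g)" using frame_mult[OF bigood_SL2R[OF g]] by simp
  have a: "h ** g ** flip_mat = h ** (g ** flip_mat)" by (simp add: matrix_mul_assoc)
  show "fwd (actT h (frame g)) = (*v) (R h) ` fwd (frame g)" unfolding e fwd[OF bigood_left[OF g h]] fwd[OF g] by (rule limit_line_equiv) (use g h in \<open>auto simp: bigood_def\<close>)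
  show "bwd (actT h (frame g)) = (*v) (R h) ` bwd (frame g)" unfolding e bwd[OF bigood_left[OF g h]] bwd[OF g] a by (rule limit_line_equiv) (use g h in \<open>auto simp: bigood_def\<close>)
qed

lemma bigood_setE: assumes "v \<in> bigood_set" obtains g where "bigood g" "v = frame g" using assms by (auto simp: bigood_set_def)

lemma lines_disjoint: assumes "v \<in> bigood_set" "x \<in> fwd v" "x \<in> bwd v" shows "x = 0"
proof -
  obtain g where g: "bigood g" "v = frame g" using assms(1) by (rule bigood_setE)
  then show ?thesis using assms(2,3) fwd[OF g(1)] bwd[OF g(1)] limit_line_disjoint[OF _ _ letters_distinct[OF g(1)]] iword_letter by (auto simp: bigood_def)
qed

lemma fwd_line: assumes "v \<in> bigood_set" shows "\<exists>w. w \<noteq> 0 \<and> fwd v = cline w"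
proof -
  obtain g where g: "bigood g" "v = frame g" using assms by (rule bigood_setE)
  then show ?thesis using limit_line_line[OF iword_letter, of g] fwd by (auto simp: bigood_def)
qed

text \<open>By \<open>limit_line_near\<close> only the first \<open>Suc k\<close> letters matter;
  they are read off from one half plane, and \<open>far_perturb\<close> keeps that reading for all
  nearby frames.\<close>

lemma fwd_local: assumes v: "v \<in> bigood_set" "fwd v = cline w" and e: "\<epsilon> > 0"
  shows "\<forall>\<^sub>F u in nhds v. u \<in> bigood_set \<longrightarrow> (\<forall>x\<in>fwd u. x \<noteq> 0 \<longrightarrow> cmod (wd2 x w) < \<epsilon> * norm x)"
proof -
  obtain g where g: "bigood g" "v = frame g" using v(1) by (rule bigood_setE)
  have gg: "good g" "g \<in> SL2R" using g by (auto simp: bigood_def good_def)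
  have X: "limit_line (letter g) = cline w" using v(2) fwd[OF g(1)] g(2) by simp
  obtain k where k: "\<And>b x. iword b \<Longrightarrow> \<forall>j\<le>k. b j = letter g j \<Longrightarrow> x \<in> limit_line b \<Longrightarrow> x \<noteq> 0 \<Longrightarrow> cmod (wd2 x w) < \<epsilon> * norm x"
    using limit_line_near[OF iword_letter[OF gg(1)] X e] by blast
  obtain r where r: "r \<ge> 1" "far g r (Suc k) (map (letter g) [0..<Suc k])" using letter[OF gg(1)] unfolding label_def by blast
  \<comment> \<open>Any positive value below \<open>1 / (6 * r)\<close>, the tolerance of
    \<open>far_perturb\<close>, would do.\<close>
  define \<delta> where "\<delta> = 1 / (7 * r)"
  have d: "\<delta> > 0" "\<delta> < 1 / (6 * r)" using r(1) by (simp_all add: \<delta>_def field_simps)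
  have gi: "adj2 g \<in> SL2R" by (rule SL2R_adj[OF gg(2)])
  have vT: "v \<in> T1H" using v(1) bigood_set_T1H by blast
  then have "Im (fst v) > 0" by (auto simp: T1H_def)
  then have t: "(actT (adj2 g) \<longlongrightarrow> actT (adj2 g) v) (nhds v)" by (rule actT_tendsto[OF gi])
  have "actT (adj2 g) v = (\<i>, \<i>)" unfolding g(2) using frame_mult[OF gg(2), of "adj2 g"] adj2_left[OF gg(2)] frame_one by simp
  then have "\<forall>\<^sub>F u in nhds v. actT (adj2 g) u \<in> T1H \<longrightarrow> (\<exists>q\<in>SL2R. frame q = actT (adj2 g) u \<and> \<bar>q$1$1 - 1\<bar> \<le> \<delta> \<and> \<bar>q$1$2\<bar> \<le> \<delta> \<and> \<bar>q$2$1\<bar> \<le> \<delta> \<and> \<bar>q$2$2 - 1\<bar> \<le> \<delta>)"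
    using eventually_compose_filterlim[OF near_frame[OF d(1)]] t by simp
  then show ?thesis
  proof (rule eventually_mono, intro impI ballI)
    fix u x assume q: "actT (adj2 g) u \<in> T1H \<longrightarrow> (\<exists>q\<in>SL2R. frame q = actT (adj2 g) u \<and> \<bar>q$1$1 - 1\<bar> \<le> \<delta> \<and> \<bar>q$1$2\<bar> \<le> \<delta> \<and> \<bar>q$2$1\<bar> \<le> \<delta> \<and> \<bar>q$2$2 - 1\<bar> \<le> \<delta>)"
      and u: "u \<in> bigood_set" and x: "x \<in> fwd u" "x \<noteq> 0"
    have uT: "u \<in> T1H" using u bigood_set_T1H by blast
    then have iu: "Im (fst u) > 0" by (auto simp: T1H_def)
    obtain q where q: "q \<in> SL2R" "frame q = actT (adj2 g) u" "\<bar>q$1$1 - 1\<bar> \<le> \<delta>" "\<bar>q$1$2\<bar> \<le> \<delta>" "\<bar>q$2$1\<bar> \<le> \<delta>" "\<bar>q$2$2 - 1\<bar> \<le> \<delta>"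
      using q actT_T1H[OF gi uT] by blast
    have "frame (g ** q) = u" unfolding frame_mult[OF q(1)] q(2) actT_mult[OF gi iu, symmetric] adj2_right[OF gg(2)] by (simp add: actT_def)
    then have b: "bigood (g ** q)" "fwd u = limit_line (letter (g ** q))" using bigood_set_iff[OF SL2R_mult[OF gg(2) q(1)]] u fwd by auto
    have "far (g ** q) (2 * r) (Suc k) (map (letter g) [0..<Suc k])" by (rule far_perturb[OF r(2,1) gg(2) q(1,3-6) d(2)])
    then have "label (g ** q) (Suc k) (map (letter g) [0..<Suc k])" unfolding label_def using r(1) by (intro exI[of _ "2 * r"]) auto
    then have m: "map (letter g) [0..<Suc k] = map (letter (g ** q)) [0..<Suc k]" using b(1) by (intro letter_unique) (simp add: bigood_def)
    have "\<forall>j\<le>k. letter (g ** q) j = letter g j"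
    proof (intro allI impI)
      fix j assume "j \<le> k"
      then show "letter (g ** q) j = letter g j" using arg_cong[OF m, of "\<lambda>l. l ! j"] by (simp del: upt_Suc)
    qed
    then show "cmod (wd2 x w) < \<epsilon> * norm x" using k[of "letter (g ** q)" x] iword_letter[of "g ** q"] b x by (auto simp: bigood_def)
  qed
qed

lemma bwd_local: assumes v: "v \<in> bigood_set" "bwd v = cline w" and e: "\<epsilon> > 0"
  shows "\<forall>\<^sub>F u in nhds v. u \<in> bigood_set \<longrightarrow> (\<forall>x\<in>bwd u. x \<noteq> 0 \<longrightarrow> cmod (wd2 x w) < \<epsilon> * norm x)"
proof -
  have "isCont flip v" unfolding flip_def by (intro continuous_intros)
  then have "(flip \<longlongrightarrow> flip v) (nhds v)" by (simp add: continuous_at tendsto_nhds_iff)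
  from eventually_compose_filterlim[OF fwd_local[OF bigood_set_flip[OF v(1)] v(2)[unfolded bwd_def] e] this]
  show ?thesis unfolding bwd_def by (rule eventually_mono) (auto intro: bigood_set_flip)
qed

text \<open>Equivariance of the metric moves each point into the compact region, where the metric is
  comparable with the Euclidean norm. There \<open>expansion\<close> applies to the moved
  vectors.\<close>

lemma ratio_at_top:
  assumes Hf: "hermitian_metric \<Gamma> R Hf" and g: "bigood g" and w2: "w2 \<in> limit_line (letter g)" "w2 \<noteq> 0" and w1: "w1 \<notin> limit_line (letter g)"
    and t: "filterlim t at_top sequentially" and C: "C > 0" "\<And>n. \<exists>\<gamma>\<in>\<Gamma>. hb (mobR \<gamma> (geo_pt g (t n))) \<le> C"
  shows "filterlim (\<lambda>n. hnorm (Hf (geo_pt g (t n))) w1 / hnorm (Hf (geo_pt g (t n))) w2) at_top sequentially"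
  unfolding filterlim_at_top_gt[where c = 0]
proof (intro allI impI)
  fix Z :: real assume Z: "Z > 0"
  obtain c d where cd: "c > 0" "d > 0" "\<And>z w. Im z > 0 \<Longrightarrow> hb z \<le> C \<Longrightarrow> c * norm w \<le> hnorm (Hf z) w \<and> hnorm (Hf z) w \<le> d * norm w"
    using hnorm_bounds[OF Hf, of C] by blast
  \<comment> \<open>The factor \<open>d / c\<close> pays for the comparison of the metric with the
    norm, once for each vector.\<close>
  have "Z * d / c > 0" using Z cd by simp
  then obtain T where T: "\<And>s \<gamma>. s \<ge> T \<Longrightarrow> \<gamma> \<in> \<Gamma> \<Longrightarrow> hb (mobR \<gamma> (geo_pt g s)) \<le> C \<Longrightarrow> Z * d / c * norm (R \<gamma> *v w2) \<le> norm (R \<gamma> *v w1)"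
    using expansion[OF g C(1) w2 w1] by blast
  have "\<forall>\<^sub>F n in sequentially. t n \<ge> T" using t by (simp add: filterlim_at_top)
  then show "\<forall>\<^sub>F n in sequentially. Z \<le> hnorm (Hf (geo_pt g (t n))) w1 / hnorm (Hf (geo_pt g (t n))) w2"
  proof (rule eventually_mono)
    fix n assume n: "T \<le> t n"
    let ?p = "geo_pt g (t n)"
    have p: "Im ?p > 0" using Im_geo_pt bigood_SL2R[OF g] by blast
    obtain \<gamma> where gm: "\<gamma> \<in> \<Gamma>" "hb (mobR \<gamma> ?p) \<le> C" using C(2) by blast
    have eq: "hnorm (Hf (mobR \<gamma> ?p)) (R \<gamma> *v w) = hnorm (Hf ?p) w" for w
      using Hf gm(1) p unfolding hermitian_metric_def H_plane_def by blast
    have b: "c * norm w \<le> hnorm (Hf (mobR \<gamma> ?p)) w" "hnorm (Hf (mobR \<gamma> ?p)) w \<le> d * norm w" for w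
      using cd(3)[OF Im_mobR_pos[OF sub[OF gm(1)] p] gm(2)] by auto
    have "\<forall>z\<in>H_plane. \<forall>w. w \<noteq> 0 \<longrightarrow> Re (\<Sum>i\<in>UNIV. \<Sum>j\<in>UNIV. cnj (w$i) * Hf z $i$j * w$j) > 0"
      using Hf unfolding hermitian_metric_def by blast
    then have "hnorm (Hf ?p) w2 > 0" using w2(2) p unfolding H_plane_def hnorm_def by simp
    moreover have "Z * hnorm (Hf ?p) w2 \<le> hnorm (Hf ?p) w1"
    proof -
      have "Z * hnorm (Hf ?p) w2 \<le> Z * (d * norm (R \<gamma> *v w2))" using b(2)[of "R \<gamma> *v w2"] eq[of w2] Z by simp
      also have "\<dots> = c * (Z * d / c * norm (R \<gamma> *v w2))" using cd by simp
      also have "\<dots> \<le> c * norm (R \<gamma> *v w1)" using T[OF n gm] cd by (intro mult_left_mono) auto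
      also have "\<dots> \<le> hnorm (Hf ?p) w1" using b(1)[of "R \<gamma> *v w1"] eq[of w1] by simp
      finally show ?thesis .
    qed
    ultimately show "Z \<le> hnorm (Hf ?p) w1 / hnorm (Hf ?p) w2" by (simp add: pos_le_divide_eq)
  qed
qed

lemma fst_geoflow: "g \<in> SL2R \<Longrightarrow> fst (geoflow (frame g) t) = geo_pt g t"
  using geo_pt_diag_flow[of g t 0] by (simp add: geoflow_frame fst_frame geo_pt_0)

lemma recurrent_hb:
  assumes g: "bigood g" and K: "compact K" "K \<subseteq> T1H" and r: "\<forall>n. \<exists>\<gamma>\<in>\<Gamma>. actT \<gamma> (geoflow (frame g) (t n)) \<in> K"
  shows "\<exists>C>0. \<forall>n. \<exists>\<gamma>\<in>\<Gamma>. hb (mobR \<gamma> (geo_pt g (t n))) \<le> C"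
proof -
  obtain C where C: "C > 0" "\<And>v. v \<in> K \<Longrightarrow> hb (fst v) \<le> C" using hb_bounded[OF K] by blast
  have "\<exists>\<gamma>\<in>\<Gamma>. hb (mobR \<gamma> (geo_pt g (t n))) \<le> C" for n
  proof -
    obtain \<gamma> where gm: "\<gamma> \<in> \<Gamma>" "actT \<gamma> (geoflow (frame g) (t n)) \<in> K" using r by blast
    have "fst (actT \<gamma> (geoflow (frame g) (t n))) = mobR \<gamma> (geo_pt g (t n))" using fst_geoflow[OF bigood_SL2R[OF g]] by (simp add: actT_def)
    then show ?thesis using C(2)[OF gm(2)] gm(1) by auto
  qed
  then show ?thesis using C(1) by blast
qed

lemma largest_sectionI:
  assumes cnt: "countable \<Gamma>"
    and f: "\<And>v. v \<in> bigood_set \<Longrightarrow> f v \<noteq> 0 \<and> cline (f v) = X v" "(\<lambda>p. f (coordT p)) \<in> borel_measurable (lebesgue :: (real \<times> real \<times> real) measure)"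
    and g: "\<And>v. v \<in> bigood_set \<Longrightarrow> g v \<noteq> 0 \<and> cline (g v) = Y v" "(\<lambda>p. g (coordT p)) \<in> borel_measurable (lebesgue :: (real \<times> real \<times> real) measure)"
    and XY: "X = bwd \<and> Y = fwd \<or> X = fwd \<and> Y = bwd"
    and E: "\<And>h t K w1 w2. bigood h \<Longrightarrow> filterlim t F sequentially \<Longrightarrow> compact K \<Longrightarrow> K \<subseteq> T1H \<Longrightarrow>
      \<forall>n. \<exists>\<gamma>\<in>\<Gamma>. actT \<gamma> (geoflow (frame h) (t n)) \<in> K \<Longrightarrow> w1 \<in> X (frame h) - {0} \<Longrightarrow> w2 \<in> Y (frame h) - {0} \<Longrightarrow>
      filterlim (\<lambda>n. hnorm (Hf (geo_pt h (t n))) w1 / hnorm (Hf (geo_pt h (t n))) w2) at_top sequentially"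
  shows "largest_section \<Gamma> R Hf bigood_set f g F"
proof -
  have flow: "geoflow v t \<in> bigood_set" if "v \<in> bigood_set" for v t
    using that bigood_diag_flow bigood_SL2R geoflow_frame unfolding bigood_set_def by fastforce
  have act: "actT \<gamma> v \<in> bigood_set" if "v \<in> bigood_set" "\<gamma> \<in> \<Gamma>" for v \<gamma> using that bigood_set_left bigood_set_T1H by blast
  have Xf: "X (geoflow v t) = X v" "Y (geoflow v t) = Y v" if "v \<in> bigood_set" for v t
    using that XY lines_flow by (auto elim!: bigood_setE)
  have Xa: "X (actT \<gamma> v) = (*v) (R \<gamma>) ` X v" "Y (actT \<gamma> v) = (*v) (R \<gamma>) ` Y v" if "v \<in> bigood_set" "\<gamma> \<in> \<Gamma>" for v \<gamma>
    using that XY lines_equivariant by (auto elim!: bigood_setE)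
  have dis: "cline (f v) \<inter> cline (g v) = {0}" if v: "v \<in> bigood_set" for v
  proof -
    have "0 \<in> cline x" for x unfolding cline_iff by (intro exI[of _ 0]) simp
    moreover have "x = 0" if "x \<in> X v" "x \<in> Y v" for x using that XY lines_disjoint[OF v] by auto
    ultimately show ?thesis using f(1)[OF v] g(1)[OF v] by auto
  qed
  have rat: "filterlim (\<lambda>n. hnorm (Hf (fst (geoflow v (t n)))) w1 / hnorm (Hf (fst (geoflow v (t n)))) w2) at_top sequentially"
    if h: "v \<in> bigood_set" "compact K \<and> K \<subseteq> T1H" "filterlim t F sequentially \<and> (\<forall>n. \<exists>\<gamma>\<in>\<Gamma>. actT \<gamma> (geoflow v (t n)) \<in> K)"
      "w1 \<in> cline (f v) - {0}" "w2 \<in> cline (g v) - {0}" for v K t w1 w2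
  proof -
    obtain h where hh: "bigood h" "v = frame h" using h(1) by (rule bigood_setE)
    show ?thesis unfolding hh(2) fst_geoflow[OF bigood_SL2R[OF hh(1)]]
      by (rule E[OF hh(1)]) (use h hh f(1)[OF h(1)] g(1)[OF h(1)] in auto)
  qed
  show ?thesis unfolding largest_section_def
  proof (intro conjI ballI allI impI)
    show "bigood_set \<subseteq> T1H" by (rule bigood_set_T1H)
    show "liouville_full bigood_set" by (rule bigood_set_full[OF cnt])
    show "cline (f (actT \<gamma> v)) = (\<lambda>w. R \<gamma> *v w) ` cline (f v)" "cline (g (actT \<gamma> v)) = (\<lambda>w. R \<gamma> *v w) ` cline (g v)"
      if "\<gamma> \<in> \<Gamma>" "v \<in> bigood_set" for \<gamma> v
      using Xa[OF that(2,1)] f(1)[OF that(2)] g(1)[OF that(2)] f(1)[OF act[OF that(2,1)]] g(1)[OF act[OF that(2,1)]] by auto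
    show "cline (f (geoflow v t)) = cline (f v)" "cline (g (geoflow v t)) = cline (g v)" if "v \<in> bigood_set" for v t
      using Xf[OF that] f(1)[OF that] g(1)[OF that] f(1)[OF flow[OF that]] g(1)[OF flow[OF that]] by auto
  qed (use flow bigood_set_left f g dis rat in auto)
qed

lemma sections_exist:
  assumes cnt: "countable \<Gamma>" and Hf: "hermitian_metric \<Gamma> R Hf"
  shows "\<exists>A fp gp fm gm. largest_section \<Gamma> R Hf A fp gp at_top \<and> section_continuous A fp \<and>
           largest_section \<Gamma> R Hf A fm gm at_bot \<and> section_continuous A fm"
proof -
  note full = bigood_set_full[OF cnt]
  have "\<exists>f. (\<forall>v\<in>bigood_set. f v \<noteq> 0 \<and> cline (f v) = fwd v) \<and> (\<lambda>p. f (coordT p)) \<in> borel_measurable (lebesgue :: (real \<times> real \<times> real) measure) \<and> section_continuous bigood_set f"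
    by (rule line_section[OF bigood_set_T1H full fwd_line fwd_local])
  then obtain p where p0: "\<forall>v\<in>bigood_set. p v \<noteq> 0 \<and> cline (p v) = fwd v" "(\<lambda>q. p (coordT q)) \<in> borel_measurable (lebesgue :: (real \<times> real \<times> real) measure)" "section_continuous bigood_set p"
    by (elim exE conjE)
  note p = p0(1)[rule_format] p0(2,3)
  have Xm_line: "\<exists>w. w \<noteq> 0 \<and> bwd v = cline w" if "v \<in> bigood_set" for v unfolding bwd_def by (rule fwd_line[OF bigood_set_flip[OF that]])
  have "\<exists>f. (\<forall>v\<in>bigood_set. f v \<noteq> 0 \<and> cline (f v) = bwd v) \<and> (\<lambda>p. f (coordT p)) \<in> borel_measurable (lebesgue :: (real \<times> real \<times> real) measure) \<and> section_continuous bigood_set f"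
    by (rule line_section[OF bigood_set_T1H full Xm_line bwd_local])
  then obtain m where m0: "\<forall>v\<in>bigood_set. m v \<noteq> 0 \<and> cline (m v) = bwd v" "(\<lambda>q. m (coordT q)) \<in> borel_measurable (lebesgue :: (real \<times> real \<times> real) measure)" "section_continuous bigood_set m"
    by (elim exE conjE)
  note m = m0(1)[rule_format] m0(2,3)
  \<comment> \<open>The line of the forward end is contracted in forward time, so the line of
    largest expansion is that of the backward end. The roles are exchanged for
    \<open>at_bot\<close>.\<close>
  have top: "largest_section \<Gamma> R Hf bigood_set m p at_top"
  proof (rule largest_sectionI[OF cnt m(1,2) p(1,2)])
    fix h K w1 w2 and t :: "nat \<Rightarrow> real"
    assume a: "bigood h" "filterlim t at_top sequentially" "compact K" "K \<subseteq> T1H" "\<forall>n. \<exists>\<gamma>\<in>\<Gamma>. actT \<gamma> (geoflow (frame h) (t n)) \<in> K"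
      and w: "w1 \<in> bwd (frame h) - {0}" "w2 \<in> fwd (frame h) - {0}"
    obtain C where C: "C > 0" "\<And>n. \<exists>\<gamma>\<in>\<Gamma>. hb (mobR \<gamma> (geo_pt h (t n))) \<le> C" using recurrent_hb[OF a(1,3-5)] by blast
    have hA: "frame h \<in> bigood_set" using a(1) by (auto simp: bigood_set_def)
    have "w1 \<notin> limit_line (letter h)" using lines_disjoint[OF hA] w(1) fwd[OF a(1)] by auto
    then show "filterlim (\<lambda>n. hnorm (Hf (geo_pt h (t n))) w1 / hnorm (Hf (geo_pt h (t n))) w2) at_top sequentially"
      using w(2) fwd[OF a(1)] by (intro ratio_at_top[OF Hf a(1) _ _ _ a(2) C]) auto
  qed simp_all
  have bot: "largest_section \<Gamma> R Hf bigood_set p m at_bot"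
  proof (rule largest_sectionI[OF cnt p(1,2) m(1,2)])
    fix h K w1 w2 and t :: "nat \<Rightarrow> real"
    assume a: "bigood h" "filterlim t at_bot sequentially" "compact K" "K \<subseteq> T1H" "\<forall>n. \<exists>\<gamma>\<in>\<Gamma>. actT \<gamma> (geoflow (frame h) (t n)) \<in> K"
      and w: "w1 \<in> fwd (frame h) - {0}" "w2 \<in> bwd (frame h) - {0}"
    obtain C where C: "C > 0" "\<And>n. \<exists>\<gamma>\<in>\<Gamma>. hb (mobR \<gamma> (geo_pt h (t n))) \<le> C" using recurrent_hb[OF a(1,3-5)] by blast
    have hA: "frame h \<in> bigood_set" using a(1) by (auto simp: bigood_set_def)
    have gp: "geo_pt h (t n) = geo_pt (h ** flip_mat) (- t n)" for n by (simp add: geo_pt_flip_mat)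
    have t: "filterlim (\<lambda>n. - t n) at_top sequentially" using filterlim_compose[OF filterlim_uminus_at_top_at_bot a(2)] .
    have "w1 \<notin> limit_line (letter (h ** flip_mat))" using lines_disjoint[OF hA] w(1) bwd[OF a(1)] by auto
    then show "filterlim (\<lambda>n. hnorm (Hf (geo_pt h (t n))) w1 / hnorm (Hf (geo_pt h (t n))) w2) at_top sequentially"
      using w(2) bwd[OF a(1)] C(2) unfolding gp by (intro ratio_at_top[OF Hf bigood_flip_mat[OF a(1)] _ _ _ t C(1)]) auto
  qed simp_all
  show ?thesis using top bot p(3) m(3) by blast
qed

end

theorem theorem5:
  fixes \<Gamma> :: "(real^2^2) set"
    and \<rho> :: "real^2^2 \<Rightarrow> complex^2^2"
    and Hf :: "complex \<Rightarrow> complex^2^2"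
  assumes "finite_hyperbolic_group \<Gamma>"
    and "\<not> cocompact \<Gamma>"
    and "representation \<Gamma> \<rho>"
    and "inj_on \<rho> \<Gamma>"
    and "schottky (\<rho> ` \<Gamma>)"
    and "hermitian_metric \<Gamma> \<rho> Hf"
  shows "\<exists>A fp gp fm gm.
           largest_section \<Gamma> \<rho> Hf A fp gp at_top \<and> section_continuous A fp \<and>
           largest_section \<Gamma> \<rho> Hf A fm gm at_bot \<and> section_continuous A fm"
proof -
  interpret fuchsian \<Gamma> by (rule fuchsian.intro) (rule assms(1))
  obtain I and V :: "(real^2^2) option \<Rightarrow> complex set" and p om S rr c0 where cc: "cusp_cover \<Gamma> I V p om S rr c0"
    using cusp_cover_exists[OF assms(2)] by (elim exE)
  obtain L :: "(nat \<times> bool) set" and iv A H x0 g where sr: "srep L iv A H x0 \<Gamma> g \<rho>"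
    using srep_exists[OF cc assms(3-5)] by (elim exE)
  show ?thesis by (rule geo.sections_exist[OF geo.intro[OF cc sr] countable_Gamma assms(6)])
qed

end
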